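(* Let $1<p<\infty$, let $\Omega$ be a measure space and let $\pi\colon G\to\mathcal{B}(L^p(\Omega))$ be a bounded continuous representation of an amenable locally compact group $G$. Then there exist a measure space $\Omega'$, a continuous isometric representation $\pi'\colon G\to\mathcal{B}(L^p(\Omega'))$ such that $\pi'(t)$ is positive for any $t\in G$, and two bounded operators $J\colon L^p(\Omega)\to L^p(\Omega')$ and $Q\colon L^p(\Omega')\to L^p(\Omega)$ such that $\|J\|\|Q\|\leq\|\pi\|^2$ and $$\pi(t)=Q\pi'(t)J\qquad\text{for all } t\in G.$$
   Context: Banach spaces are complex. A representation $\pi\colon G\to\mathcal{B}(X)$ is a map with $\pi(st)=\pi(s)\pi(t)$ for all $s,t$ and $\pi(e)=\mathrm{Id}_X$. It is continuous if $t\mapsto\pi(t)x$ is continuous for every $x\in X$; bounded if $\|\pi\|:=\sup_{t\in G}\|\pi(t)\|<\infty$; isometric if each $\pi(t)$ is an isometry. *)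

theory Defs
  imports "HOL-Analysis.Analysis"
begin

section \<open>Complex normed spaces given by a carrier set\<close>

text \<open>
  The spaces \<open>L\<^sup>p(\<Omega>)\<close> depend on \<open>p\<close> and \<open>\<Omega>\<close>, so they cannot be types; they are records with an
  explicit carrier. Operators are functions, and their values outside the carrier are irrelevant.
\<close>

record 'x cnormed =
  vecs :: "'x set"
  vadd :: "'x \<Rightarrow> 'x \<Rightarrow> 'x"
  vscale :: "complex \<Rightarrow> 'x \<Rightarrow> 'x"
  nrm :: "'x \<Rightarrow> real"

definition vdiff :: "'x cnormed \<Rightarrow> 'x \<Rightarrow> 'x \<Rightarrow> 'x" where
  "vdiff X x y = vadd X x (vscale X (-1) y)"

definition linear_op :: "'x cnormed \<Rightarrow> 'y cnormed \<Rightarrow> ('x \<Rightarrow> 'y) \<Rightarrow> bool" where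
  "linear_op X Y T \<longleftrightarrow>
     (\<forall>x\<in>vecs X. T x \<in> vecs Y) \<and>
     (\<forall>x\<in>vecs X. \<forall>y\<in>vecs X. T (vadd X x y) = vadd Y (T x) (T y)) \<and>
     (\<forall>c. \<forall>x\<in>vecs X. T (vscale X c x) = vscale Y c (T x))"

definition bounded_op :: "'x cnormed \<Rightarrow> 'y cnormed \<Rightarrow> ('x \<Rightarrow> 'y) \<Rightarrow> bool" where
  "bounded_op X Y T \<longleftrightarrow>
     linear_op X Y T \<and> (\<exists>C. \<forall>x\<in>vecs X. nrm Y (T x) \<le> C * nrm X x)"

definition op_norm :: "'x cnormed \<Rightarrow> 'y cnormed \<Rightarrow> ('x \<Rightarrow> 'y) \<Rightarrow> real" where
  "op_norm X Y T = (SUP x\<in>{x \<in> vecs X. nrm X x \<le> 1}. nrm Y (T x))"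

section \<open>Representations on a normed space\<close>

text \<open>
  Groups are written additively, as in the library's classes; \<open>group_add\<close> does not assume
  commutativity.
\<close>

definition is_representation :: "'x cnormed \<Rightarrow> ('g::group_add \<Rightarrow> 'x \<Rightarrow> 'x) \<Rightarrow> bool" where
  "is_representation X \<pi> \<longleftrightarrow>
     (\<forall>t. bounded_op X X (\<pi> t)) \<and>
     (\<forall>s t. \<forall>x\<in>vecs X. \<pi> (s + t) x = \<pi> s (\<pi> t x)) \<and>
     (\<forall>x\<in>vecs X. \<pi> 0 x = x)"

definition continuous_rep ::
    "'x cnormed \<Rightarrow> ('g::topological_space \<Rightarrow> 'x \<Rightarrow> 'x) \<Rightarrow> bool" where
  "continuous_rep X \<pi> \<longleftrightarrow>
     (\<forall>x\<in>vecs X. \<forall>t. ((\<lambda>s. nrm X (vdiff X (\<pi> s x) (\<pi> t x))) \<longlongrightarrow> 0) (at t))"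

definition bounded_rep :: "'x cnormed \<Rightarrow> ('g \<Rightarrow> 'x \<Rightarrow> 'x) \<Rightarrow> bool" where
  "bounded_rep X \<pi> \<longleftrightarrow> bdd_above (range (\<lambda>t. op_norm X X (\<pi> t)))"

definition rep_norm :: "'x cnormed \<Rightarrow> ('g \<Rightarrow> 'x \<Rightarrow> 'x) \<Rightarrow> real" where
  "rep_norm X \<pi> = (SUP t. op_norm X X (\<pi> t))"

definition isometric_rep :: "'x cnormed \<Rightarrow> ('g \<Rightarrow> 'x \<Rightarrow> 'x) \<Rightarrow> bool" where
  "isometric_rep X \<pi> \<longleftrightarrow> (\<forall>t. \<forall>x\<in>vecs X. nrm X (\<pi> t x) = nrm X x)"

section \<open>Complex \<open>L\<^sup>p\<close> spaces\<close>

definition Lp_fun :: "real \<Rightarrow> 'a measure \<Rightarrow> ('a \<Rightarrow> complex) set" where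
  "Lp_fun p M = {f \<in> borel_measurable M. integrable M (\<lambda>x. norm (f x) powr p)}"

definition ae_rel :: "real \<Rightarrow> 'a measure \<Rightarrow> (('a \<Rightarrow> complex) \<times> ('a \<Rightarrow> complex)) set" where
  "ae_rel p M = {(f, g). f \<in> Lp_fun p M \<and> g \<in> Lp_fun p M \<and> (AE x in M. f x = g x)}"

text \<open>
  The elements are almost-everywhere classes. The operations are given through representatives,
  on which they do not depend; in particular the image in the norm below is a singleton.
\<close>

definition Lp :: "real \<Rightarrow> 'a measure \<Rightarrow> ('a \<Rightarrow> complex) set cnormed" where
  "Lp p M = \<lparr>
     vecs = Lp_fun p M // ae_rel p M,
     vadd = (\<lambda>F G. {h \<in> Lp_fun p M. \<exists>f\<in>F. \<exists>g\<in>G. AE x in M. h x = f x + g x}),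
     vscale = (\<lambda>c F. {h \<in> Lp_fun p M. \<exists>f\<in>F. AE x in M. h x = c * f x}),
     nrm = (\<lambda>F. the_elem ((\<lambda>f. (\<integral>x. norm (f x) powr p \<partial>M) powr (1 / p)) ` F))\<rparr>"

definition Lp_nonneg :: "'a measure \<Rightarrow> ('a \<Rightarrow> complex) set \<Rightarrow> bool" where
  "Lp_nonneg M F \<longleftrightarrow> (\<exists>f\<in>F. AE x in M. f x \<in> \<real>\<^sub>\<ge>\<^sub>0)"

definition positive_op ::
    "real \<Rightarrow> 'a measure \<Rightarrow> 'b measure \<Rightarrow> (('a \<Rightarrow> complex) set \<Rightarrow> ('b \<Rightarrow> complex) set) \<Rightarrow> bool" where
  "positive_op p M N T \<longleftrightarrow> (\<forall>F\<in>vecs (Lp p M). Lp_nonneg M F \<longrightarrow> Lp_nonneg N (T F))"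

section \<open>Amenability\<close>

text \<open>A left Haar measure is a nonzero left-invariant Radon measure on the Borel sets.\<close>

definition left_haar_measure :: "'g::topological_group_add measure \<Rightarrow> bool" where
  "left_haar_measure \<mu> \<longleftrightarrow>
     sets \<mu> = sets borel \<and>
     emeasure \<mu> UNIV \<noteq> 0 \<and>
     (\<forall>K. compact K \<longrightarrow> emeasure \<mu> K < \<infinity>) \<and>
     (\<forall>A\<in>sets borel. emeasure \<mu> A = (INF U\<in>{U. open U \<and> A \<subseteq> U}. emeasure \<mu> U)) \<and>
     (\<forall>U. open U \<longrightarrow> emeasure \<mu> U = (SUP K\<in>{K. compact K \<and> K \<subseteq> U}. emeasure \<mu> K)) \<and>
     (\<forall>t. \<forall>A\<in>sets borel. emeasure \<mu> ((+) t ` A) = emeasure \<mu> A)"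

text \<open>
  If \<open>G\<close> is not \<open>\<sigma>\<close>-compact, \<open>L\<^sup>\<infinity>(G)\<close> is formed modulo locally null sets. Every class has a Borel
  representative.
\<close>

definition locally_AE :: "'g::topological_space measure \<Rightarrow> ('g \<Rightarrow> bool) \<Rightarrow> bool" where
  "locally_AE \<mu> P \<longleftrightarrow> (\<forall>K. compact K \<longrightarrow> (AE s in \<mu>. s \<in> K \<longrightarrow> P s))"

definition Linf_fun :: "'g::topological_space measure \<Rightarrow> ('g \<Rightarrow> real) set" where
  "Linf_fun \<mu> = {f \<in> borel_measurable borel. \<exists>C. locally_AE \<mu> (\<lambda>s. \<bar>f s\<bar> \<le> C)}"

text \<open>
  A mean is a positive linear functional on the real space \<open>L\<^sup>\<infinity>(G)\<close> with value \<open>1\<close> at the constant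
  function \<open>1\<close>. It is given on representatives: positivity with respect to locally
  almost-everywhere inequality makes its value depend only on the class, and makes its norm \<open>1\<close>.
\<close>

definition left_invariant_mean ::
    "'g::topological_group_add measure \<Rightarrow> (('g \<Rightarrow> real) \<Rightarrow> real) \<Rightarrow> bool" where
  "left_invariant_mean \<mu> m \<longleftrightarrow>
     (\<forall>f\<in>Linf_fun \<mu>. \<forall>g\<in>Linf_fun \<mu>. m (\<lambda>s. f s + g s) = m f + m g) \<and>
     (\<forall>c. \<forall>f\<in>Linf_fun \<mu>. m (\<lambda>s. c * f s) = c * m f) \<and>
     (\<forall>f\<in>Linf_fun \<mu>. locally_AE \<mu> (\<lambda>s. 0 \<le> f s) \<longrightarrow> 0 \<le> m f) \<and>
     m (\<lambda>_. 1) = 1 \<and>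
     (\<forall>t. \<forall>f\<in>Linf_fun \<mu>. m (\<lambda>s. f (t + s)) = m f)"

definition amenable :: "'g::topological_group_add itself \<Rightarrow> bool" where
  "amenable _ \<longleftrightarrow>
     (\<exists>\<mu> :: 'g measure. left_haar_measure \<mu> \<and> (\<exists>m. left_invariant_mean \<mu> m))"

section \<open>A carrier for the dilation space\<close>

text \<open>
  HOL cannot quantify existentially over types, so the points of \<open>\<Omega>'\<close> have to come from a type
  fixed in advance. The one below has cardinality \<open>2\<^sup>\<kappa>\<close>, where \<open>\<kappa>\<close> is the (infinite) number of
  functions from \<open>G\<close> to complex functions on \<open>\<Omega>\<close>. This is large enough: a dilation can be found on
  an abstract \<open>L\<^sup>p\<close> lattice with at most \<open>\<kappa>\<close> elements (a completion of a space of functions from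
  \<open>G\<close> to \<open>L\<^sup>p(\<Omega>)\<close>), and Kakutani's theorem represents it over a disjoint union of at most \<open>\<kappa>\<close> Stone
  spaces of Boolean algebras with at most \<open>\<kappa>\<close> elements.
\<close>

type_synonym ('g, 'a) dilation_point = "('g \<Rightarrow> 'a \<Rightarrow> complex) set"

end

theory Submission
  imports Defs
begin

text \<open>
  Let \<open>V\<close> be the space of bounded right uniformly continuous functions \<open>u\<close> from \<open>G\<close> to \<open>L\<^sup>p(\<Omega>)\<close>, with the
  \<open>p\<close>-th power seminorm \<open>\<Phi>(u) = m(s \<mapsto> \<parallel>u(s)\<parallel>\<^sup>p)\<close> given by an invariant mean \<open>m\<close>. Left translations
  act on \<open>V\<close> as positive isometries. The orbit map \<open>J x = (s \<mapsto> \<pi>(s\<^sup>-\<^sup>1) x)\<close> intertwines \<open>\<pi>\<close> with them,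
  and the weak mean \<open>Q u = m(s \<mapsto> \<pi>(s) u(s))\<close>, which exists in \<open>L\<^sup>p(\<Omega>)\<close> by reflexivity, is a left
  inverse of \<open>J\<close>; both have norm at most \<open>\<parallel>\<pi>\<parallel>\<close>. The seminorm is \<open>p\<close>-additive on disjoint functions,
  so by Kakutani's theorem the completion of \<open>V\<close> is an \<open>L\<^sup>p\<close> space, and the translations become a
  representation on it.

  The representation is built from functions rather than classes. For a maximal disjoint family of
  weights \<open>e\<close>, the content \<open>A \<mapsto> \<Phi>(1\<^sub>A e)\<close> on the sets with \<open>1\<^sub>A e \<in> V\<close> extends to a measure on the
  ultrafilters by Caratheodory's theorem.
\<close>

section \<open>Lattice seminorms on complex functions\<close>

text \<open>\<open>V\<close> has no weak unit in general, so no single finite measure can carry the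
  completion: hence the disjoint family of weights, and measures that may fail to be
  \<sigma>-finite. An indicator times a weight lies in \<open>V\<close> only for special sets. These
  are level sets \<open>{u > c e}\<close> for levels \<open>c\<close> outside a countable set, and
  membership rests on the completed \<open>V\<close> being closed under domination by functions of
  small seminorm. The completion is therefore again made of functions, on pairs of a point and an
  index in \<open>nat\<close>: lattice operations stay pointwise, ultrafilters of sets of points can
  be formed, and the new points can be coded in the prescribed type. The price is that many
  identities hold only up to null functions. Uniform continuity serves twice: it makes the
  translations strongly continuous in the seminorm, and it makes
  \<open>s \<mapsto> \<pi>(s) u(s)\<close> norm continuous, so that its pairings with functions are
  Borel and the mean applies to them. Positivity of the new representation holds because a
  translation commutes with the modulus, and so does the isometry onto the \<open>L^p\<close>
  space.\<close>

definition lip2 :: "(complex \<Rightarrow> complex \<Rightarrow> complex) \<Rightarrow> bool" where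
  "lip2 H \<longleftrightarrow> H 0 0 = 0 \<and>
     (\<exists>C. \<forall>a b a' b'. cmod (H a b - H a' b') \<le> C * (cmod (a - a') + cmod (b - b')))"

lemma lip2I:
  assumes "H 0 0 = 0"
    and "\<And>a b a' b'. cmod (H a b - H a' b') \<le> C * (cmod (a - a') + cmod (b - b'))"
  shows "lip2 H"
  using assms unfolding lip2_def by blast

lemma lip2E:
  assumes "lip2 H"
  shows "\<exists>C\<ge>0. \<forall>a b a' b'. cmod (H a b - H a' b') \<le> C * (cmod (a - a') + cmod (b - b'))"
proof -
  obtain C where H: "H 0 0 = 0"
    and C: "\<And>a b a' b'. cmod (H a b - H a' b') \<le> C * (cmod (a - a') + cmod (b - b'))"
    using assms unfolding lip2_def by blast
  show ?thesis
  proof (intro exI[of _ "\<bar>C\<bar>"] conjI allI)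
    fix a b a' b'
    show "cmod (H a b - H a' b') \<le> \<bar>C\<bar> * (cmod (a - a') + cmod (b - b'))"
      by (rule order_trans[OF C]) (auto intro!: mult_right_mono)
  qed (use H in auto)
qed

lemma lip2_linear: "lip2 (\<lambda>a b. c * a + d * b)"
proof (rule lip2I[where C = "cmod c + cmod d"])
  fix a b a' b'
  have "c * a + d * b - (c * a' + d * b') = c * (a - a') + d * (b - b')"
    by (simp add: algebra_simps)
  also have "cmod \<dots> \<le> cmod c * cmod (a - a') + cmod d * cmod (b - b')"
    by (metis norm_mult norm_triangle_ineq)
  also have "\<dots> \<le> (cmod c + cmod d) * (cmod (a - a') + cmod (b - b'))"
    by (simp add: algebra_simps)
  finally show "cmod (c * a + d * b - (c * a' + d * b')) \<le> \<dots>" .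
qed simp

lemma lip2_real:
  assumes "h 0 0 = 0"
    and "\<And>a b a' b'. \<bar>h a b - h a' b'\<bar> \<le> C * (cmod (a - a') + cmod (b - b'))"
  shows "lip2 (\<lambda>a b. complex_of_real (h a b))"
  using assms(2) by (intro lip2I[where C = C])
    (simp_all add: assms(1) of_real_diff[symmetric] del: of_real_diff)

lemma abs_cmod_diff: "\<bar>cmod a - cmod b\<bar> \<le> cmod (a - b)"
  by (rule norm_triangle_ineq3)

lemma lip2_norm: "lip2 (\<lambda>a b. complex_of_real (cmod a))"
  by (rule lip2_real[where C = 1]) (auto intro: order_trans[OF abs_cmod_diff])

lemma lip2_min: "lip2 (\<lambda>a b. complex_of_real (min (cmod a) (cmod b)))"
proof (rule lip2_real[where C = 1])
  fix a b a' b' :: complex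
  show "\<bar>min (cmod a) (cmod b) - min (cmod a') (cmod b')\<bar> \<le> 1 * (cmod (a - a') + cmod (b - b'))"
    using abs_cmod_diff[of a a'] abs_cmod_diff[of b b'] unfolding mult_1_left by linarith
qed simp

lemma lip2_max: "lip2 (\<lambda>a b. complex_of_real (max (cmod a) (cmod b)))"
proof (rule lip2_real[where C = 1])
  fix a b a' b' :: complex
  show "\<bar>max (cmod a) (cmod b) - max (cmod a') (cmod b')\<bar> \<le> 1 * (cmod (a - a') + cmod (b - b'))"
    using abs_cmod_diff[of a a'] abs_cmod_diff[of b b'] unfolding mult_1_left by linarith
qed simp

lemma lip2_pos_part: "lip2 (\<lambda>a b. complex_of_real (max 0 (c * Re a + d * Re b)))"
proof (rule lip2_real[where C = "\<bar>c\<bar> + \<bar>d\<bar>"])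
  fix a b a' b' :: complex
  have "\<bar>max 0 (c * Re a + d * Re b) - max 0 (c * Re a' + d * Re b')\<bar>
    \<le> \<bar>c * Re a + d * Re b - (c * Re a' + d * Re b')\<bar>" by linarith
  also have "\<dots> = \<bar>c * Re (a - a') + d * Re (b - b')\<bar>" by (simp add: algebra_simps)
  also have "\<dots> \<le> \<bar>c\<bar> * \<bar>Re (a - a')\<bar> + \<bar>d\<bar> * \<bar>Re (b - b')\<bar>"
    by (metis abs_mult abs_triangle_ineq)
  also have "\<dots> \<le> \<bar>c\<bar> * cmod (a - a') + \<bar>d\<bar> * cmod (b - b')"
    by (intro add_mono mult_left_mono abs_Re_le_cmod) auto
  also have "\<dots> \<le> (\<bar>c\<bar> + \<bar>d\<bar>) * (cmod (a - a') + cmod (b - b'))"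
    by (simp add: algebra_simps)
  finally show "\<bar>max 0 (c * Re a + d * Re b) - max 0 (c * Re a' + d * Re b')\<bar> \<le> \<dots>" .
qed simp

lemma lip2_Re: "lip2 (\<lambda>a b. complex_of_real (Re a))"
proof (rule lip2_real[where C = 1])
  fix a b a' b' :: complex
  show "\<bar>Re a - Re a'\<bar> \<le> 1 * (cmod (a - a') + cmod (b - b'))"
    using abs_Re_le_cmod[of "a - a'"] norm_ge_zero[of "b - b'"] unfolding minus_complex.sel mult_1_left by linarith
qed simp

text \<open>The shrinkage of \<open>a\<close> by \<open>|b|\<close> towards \<open>0\<close>; unlike a truncation to \<open>|a| > |b|\<close> it is Lipschitz.\<close>
definition shrink :: "complex \<Rightarrow> complex \<Rightarrow> complex" where
  "shrink a b = complex_of_real (max 0 (cmod a - cmod b)) * sgn a"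

lemma cmod_shrink: "cmod (shrink a b) = max 0 (cmod a - cmod b)"
proof (cases "a = 0")
  case False
  then show ?thesis by (simp add: shrink_def norm_mult norm_sgn del: of_real_diff)
qed (simp add: shrink_def)

lemma shrink_0: "cmod a \<le> cmod b \<Longrightarrow> shrink a b = 0"
  by (simp add: shrink_def)

text \<open>\<open>sgn\<close> is not Lipschitz near 0, but its variation is damped by a factor at
  most \<open>cmod a\<close>: multiplying by \<open>cmod a\<close> turns the difference of signs
  into \<open>a - a'\<close> plus a radial correction of the same size. The factor \<open>r\<close>
  will be the modulus of \<open>shrink a b\<close>.\<close>

lemma norm_sgn_diff:
  fixes a a' :: complex
  assumes "a \<noteq> 0" "a' \<noteq> 0" "r \<le> cmod a" "0 \<le> r"
  shows "r * cmod (sgn a - sgn a') \<le> 2 * cmod (a - a')"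
proof -
  have "complex_of_real (cmod a) * (sgn a - sgn a')
      = (a - a') + complex_of_real (cmod a' - cmod a) * sgn a'"
    using assms by (simp add: sgn_eq field_simps)
  then have "cmod a * cmod (sgn a - sgn a') = cmod ((a - a') + complex_of_real (cmod a' - cmod a) * sgn a')"
    by (metis norm_mult norm_of_real abs_norm_cancel)
  also have "\<dots> \<le> cmod (a - a') + \<bar>cmod a' - cmod a\<bar>"
    using assms by (intro order_trans[OF norm_triangle_ineq]) (simp add: norm_mult norm_sgn del: of_real_diff)
  also have "\<dots> \<le> 2 * cmod (a - a')"
    using abs_cmod_diff[of a a'] by linarith
  finally have "cmod a * cmod (sgn a - sgn a') \<le> 2 * cmod (a - a')" .
  moreover have "r * cmod (sgn a - sgn a') \<le> cmod a * cmod (sgn a - sgn a')"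
    by (intro mult_right_mono assms) auto
  ultimately show ?thesis by linarith
qed

text \<open>Product rule for modulus times sign: the sign varies at cost 2 by
  \<open>norm_sgn_diff\<close>, the modulus at cost 1 in each variable, which gives 3.\<close>

lemma lip2_shrink: "lip2 shrink"
proof (rule lip2I[where C = 3])
  fix a b a' b' :: complex
  show "cmod (shrink a b - shrink a' b') \<le> 3 * (cmod (a - a') + cmod (b - b'))"
  proof (cases "a = 0 \<or> a' = 0")
    case True
    then have "cmod (shrink a b - shrink a' b') \<le> cmod (a - a')"
      by (auto simp: cmod_shrink shrink_def[of 0])
    then show ?thesis using norm_ge_zero[of "b - b'"] norm_ge_zero[of "a - a'"]
      unfolding distrib_left by linarith
  next
    case False
    define r where "r = max 0 (cmod a - cmod b)"
    define r' where "r' = max 0 (cmod a' - cmod b')"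
    have "shrink a b - shrink a' b' = of_real r * (sgn a - sgn a') + of_real (r - r') * sgn a'"
      by (simp add: shrink_def r_def r'_def algebra_simps)
    then have "cmod (shrink a b - shrink a' b') \<le> cmod (of_real r * (sgn a - sgn a')) + cmod (of_real (r - r') * sgn a')"
      by (simp only: norm_triangle_ineq)
    also have "\<dots> = r * cmod (sgn a - sgn a') + \<bar>r - r'\<bar>"
      using False by (simp add: norm_mult norm_sgn r_def del: of_real_diff)
    finally have 1: "cmod (shrink a b - shrink a' b') \<le> r * cmod (sgn a - sgn a') + \<bar>r - r'\<bar>" .
    have 2: "r * cmod (sgn a - sgn a') \<le> 2 * cmod (a - a')"
      by (rule norm_sgn_diff) (use False in \<open>auto simp: r_def\<close>)
    have 3: "\<bar>r - r'\<bar> \<le> cmod (a - a') + cmod (b - b')"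
      unfolding r_def r'_def using abs_cmod_diff[of a a'] abs_cmod_diff[of b b'] by linarith
    show ?thesis using 1 2 3 norm_ge_zero[of "b - b'"] unfolding distrib_left by linarith
  qed
qed (simp add: shrink_def)

text \<open>
  \<open>\<Phi>\<close> is the \<open>p\<close>-th power of a seminorm. Closure of \<open>V\<close> under Lipschitz functions is the form of the
  lattice property that survives completion; \<open>convex\<close> is the triangle inequality, optimized over \<open>l\<close>.
\<close>

locale plattice =
  fixes p :: real and V :: "('x \<Rightarrow> complex) set" and \<Phi> :: "('x \<Rightarrow> complex) \<Rightarrow> real"
  assumes p1: "1 < p"
    and zero_in: "(\<lambda>_. 0) \<in> V"
    and lip_in: "u \<in> V \<Longrightarrow> v \<in> V \<Longrightarrow> lip2 H \<Longrightarrow> (\<lambda>x. H (u x) (v x)) \<in> V"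
    and mono: "u \<in> V \<Longrightarrow> v \<in> V \<Longrightarrow> (\<And>x. cmod (u x) \<le> cmod (v x)) \<Longrightarrow> \<Phi> u \<le> \<Phi> v"
    and scale: "u \<in> V \<Longrightarrow> \<Phi> (\<lambda>x. c * u x) = cmod c powr p * \<Phi> u"
    and convex: "u \<in> V \<Longrightarrow> v \<in> V \<Longrightarrow> 0 < l \<Longrightarrow> l < 1 \<Longrightarrow>
      \<Phi> (\<lambda>x. u x + v x) \<le> l powr (1 - p) * \<Phi> u + (1 - l) powr (1 - p) * \<Phi> v"
    and superadd: "u \<in> V \<Longrightarrow> v \<in> V \<Longrightarrow> (\<And>x. cmod (u x + v x) = cmod (u x) + cmod (v x)) \<Longrightarrow>
      \<Phi> u + \<Phi> v \<le> \<Phi> (\<lambda>x. u x + v x)"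
    and disjoint_add: "u \<in> V \<Longrightarrow> v \<in> V \<Longrightarrow> (\<And>x. u x = 0 \<or> v x = 0) \<Longrightarrow>
      \<Phi> (\<lambda>x. u x + v x) = \<Phi> u + \<Phi> v"
begin

lemma zero: "\<Phi> (\<lambda>_. 0) = 0"
  using scale[OF zero_in, of 0] by simp

lemma nonneg: "u \<in> V \<Longrightarrow> 0 \<le> \<Phi> u"
  using mono[OF zero_in, of u] by (simp add: zero)

lemma cong_norm: "u \<in> V \<Longrightarrow> v \<in> V \<Longrightarrow> (\<And>x. cmod (u x) = cmod (v x)) \<Longrightarrow> \<Phi> u = \<Phi> v"
  by (intro antisym mono) auto

lemma lin_in: "u \<in> V \<Longrightarrow> v \<in> V \<Longrightarrow> (\<lambda>x. c * u x + d * v x) \<in> V"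
  using lip_in[OF _ _ lip2_linear] .

lemma add_in: "u \<in> V \<Longrightarrow> v \<in> V \<Longrightarrow> (\<lambda>x. u x + v x) \<in> V"
  using lin_in[of u v 1 1] by simp

lemma diff_in: "u \<in> V \<Longrightarrow> v \<in> V \<Longrightarrow> (\<lambda>x. u x - v x) \<in> V"
  using lin_in[of u v 1 "-1"] by simp

lemma scale_in: "u \<in> V \<Longrightarrow> (\<lambda>x. c * u x) \<in> V"
  using lin_in[of u u c 0] by simp

lemma norm_in: "u \<in> V \<Longrightarrow> (\<lambda>x. complex_of_real (cmod (u x))) \<in> V"
  using lip_in[OF _ _ lip2_norm, of u u] .

lemma norm_add_in: "u \<in> V \<Longrightarrow> v \<in> V \<Longrightarrow> (\<lambda>x. complex_of_real (cmod (u x) + cmod (v x))) \<in> V"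
  using add_in[OF norm_in norm_in, of u v] by simp

lemma norm_eq: "u \<in> V \<Longrightarrow> \<Phi> (\<lambda>x. complex_of_real (cmod (u x))) = \<Phi> u"
  by (rule cong_norm) (auto intro: norm_in)

lemma sum_in: "finite I \<Longrightarrow> (\<And>i. i \<in> I \<Longrightarrow> u i \<in> V) \<Longrightarrow> (\<lambda>x. \<Sum>i\<in>I. u i x) \<in> V"
  by (induction I rule: finite_induct) (auto intro: zero_in add_in)

lemma minus_commute: "u \<in> V \<Longrightarrow> v \<in> V \<Longrightarrow> \<Phi> (\<lambda>x. u x - v x) = \<Phi> (\<lambda>x. v x - u x)"
  by (rule cong_norm) (auto intro: diff_in simp: norm_minus_commute)

text \<open>The case \<open>l = 1/2\<close> of \<open>convex\<close>. The factor
  \<open>2 powr (p - 1)\<close> is rounded up to \<open>2 powr p\<close>, a constant that recurs in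
  the later estimates.\<close>

lemma quasi_triangle:
  assumes "u \<in> V" "v \<in> V" shows "\<Phi> (\<lambda>x. u x + v x) \<le> 2 powr p * (\<Phi> u + \<Phi> v)"
proof -
  have "\<Phi> (\<lambda>x. u x + v x) \<le> (1/2) powr (1 - p) * (\<Phi> u + \<Phi> v)"
    using convex[OF assms, of "1/2"] by (simp add: algebra_simps)
  also have "(1/2::real) powr (1 - p) = 2 powr (p - 1)"
    by (simp add: powr_divide powr_minus_divide[symmetric])
  also have "2 powr (p - 1) * (\<Phi> u + \<Phi> v) \<le> 2 powr p * (\<Phi> u + \<Phi> v)"
    using nonneg assms by (intro mult_right_mono) auto
  finally show ?thesis .
qed

lemma dominated:
  assumes "u \<in> V" "v \<in> V" "w \<in> V" "\<And>x. cmod (u x) \<le> cmod (v x) + cmod (w x)"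
  shows "\<Phi> u \<le> 2 powr p * (\<Phi> v + \<Phi> w)"
proof -
  have "\<Phi> u \<le> \<Phi> (\<lambda>x. complex_of_real (cmod (v x)) + complex_of_real (cmod (w x)))"
    using assms by (intro mono) (auto intro!: norm_add_in simp flip: of_real_add)
  also have "\<dots> \<le> 2 powr p * (\<Phi> v + \<Phi> w)"
    using quasi_triangle[OF norm_in norm_in, of v w] assms by (simp add: norm_eq)
  finally show ?thesis .
qed

lemma diff_triangle:
  assumes "u \<in> V" "v \<in> V" "w \<in> V"
  shows "\<Phi> (\<lambda>x. u x - w x) \<le> 2 powr p * (\<Phi> (\<lambda>x. u x - v x) + \<Phi> (\<lambda>x. v x - w x))"
  using quasi_triangle[of "\<lambda>x. u x - v x" "\<lambda>x. v x - w x"] assms by (simp add: diff_in)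

section \<open>The seminorm belonging to the \<open>p\<close>-th power, and convergence with respect
  to it\<close>

definition nm :: "('x \<Rightarrow> complex) \<Rightarrow> real" where "nm u = \<Phi> u powr (1 / p)"

lemma nm_nonneg: "0 \<le> nm u" by (simp add: nm_def)

lemma nm_powr: "u \<in> V \<Longrightarrow> nm u powr p = \<Phi> u"
  using nonneg[of u] p1 by (simp add: nm_def powr_powr)

lemma triangle:
  assumes u: "u \<in> V" and v: "v \<in> V" shows "nm (\<lambda>x. u x + v x) \<le> nm u + nm v"
proof (rule field_le_epsilon)
  fix e :: real assume e: "0 < e"
  \<comment> \<open>The summand \<open>e/2\<close> keeps \<open>a\<close> and \<open>b\<close>
    positive when a seminorm vanishes, so that the optimal weight \<open>l = a / (a + b)\<close>
    lies strictly between 0 and 1.\<close>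
  define a where "a = nm u + e/2" define b where "b = nm v + e/2"
  have ab: "0 < a" "0 < b" using nm_nonneg e by (auto simp: a_def b_def add_nonneg_pos)
  have *: "\<Phi> u \<le> a powr p" "\<Phi> v \<le> b powr p"
    using e p1 by (auto simp: a_def b_def nm_powr[symmetric] u v nm_nonneg intro!: powr_mono2)
  define l where "l = a / (a + b)"
  have l: "0 < l" "l < 1" "1 - l = b / (a + b)" using ab by (auto simp: l_def field_simps)
  have eq: "(c / (a+b)) powr (1 - p) * c powr p = (a + b) powr (p - 1) * c" if "0 < c" for c
    using that ab by (simp add: powr_divide powr_diff)
  have "\<Phi> (\<lambda>x. u x + v x) \<le> l powr (1 - p) * \<Phi> u + (1 - l) powr (1 - p) * \<Phi> v"
    by (rule convex[OF u v l(1,2)])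
  also have "\<dots> \<le> l powr (1 - p) * a powr p + (1 - l) powr (1 - p) * b powr p"
    using * by (intro add_mono mult_left_mono) auto
  also have "\<dots> = (a + b) powr (p - 1) * a + (a + b) powr (p - 1) * b"
    unfolding l(3) unfolding l_def using ab by (simp add: eq)
  also have "\<dots> = (a + b) powr p"
    using ab powr_mult_base[of "a + b" "p - 1"] by (simp add: algebra_simps)
  finally have "nm (\<lambda>x. u x + v x) \<le> ((a + b) powr p) powr (1 / p)"
    unfolding nm_def using p1 nonneg[OF add_in[OF u v]] by (intro powr_mono2) auto
  also have "\<dots> = a + b" using ab p1 by (simp add: powr_powr)
  finally show "nm (\<lambda>x. u x + v x) \<le> nm u + nm v + e" by (simp add: a_def b_def)
qed

lemma dominated_nm:
  assumes "u \<in> V" "v \<in> V" "w \<in> V" "\<And>x. cmod (u x) \<le> cmod (v x) + cmod (w x)"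
  shows "nm u \<le> nm v + nm w"
proof -
  have "nm u \<le> nm (\<lambda>x. complex_of_real (cmod (v x)) + complex_of_real (cmod (w x)))"
    unfolding nm_def using assms p1
    by (intro powr_mono2 mono) (auto intro!: norm_add_in nonneg simp flip: of_real_add)
  also have "\<dots> \<le> nm v + nm w"
    using triangle[OF norm_in norm_in, of v w] assms by (simp add: nm_def norm_eq)
  finally show ?thesis .
qed

lemma nm_diff_le:
  assumes "u \<in> V" "v \<in> V" shows "\<bar>nm u - nm v\<bar> \<le> nm (\<lambda>x. u x - v x)"
proof -
  have "nm u \<le> nm (\<lambda>x. u x - v x) + nm v"
    using triangle[OF diff_in[OF assms] assms(2)] by simp
  moreover have "nm v \<le> nm (\<lambda>x. v x - u x) + nm u"
    using triangle[OF diff_in[OF assms(2,1)] assms(1)] by simp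
  moreover have "nm (\<lambda>x. v x - u x) = nm (\<lambda>x. u x - v x)"
    unfolding nm_def using minus_commute[OF assms] by simp
  ultimately show ?thesis by linarith
qed

text \<open>Lets limits be computed for \<open>nm\<close>, which satisfies the triangle inequality
  with constant 1, and stated for \<open>\<Phi>\<close>, which satisfies it only up to a
  factor.\<close>

lemma nm_tendsto_0_iff:
  assumes "\<forall>\<^sub>F n in F. u n \<in> V"
  shows "((\<lambda>n. nm (u n)) \<longlongrightarrow> 0) F \<longleftrightarrow> ((\<lambda>n. \<Phi> (u n)) \<longlongrightarrow> 0) F"
proof
  assume "((\<lambda>n. nm (u n)) \<longlongrightarrow> 0) F"
  then have "((\<lambda>n. nm (u n) powr p) \<longlongrightarrow> 0) F"
    using tendsto_zero_powrI[of "\<lambda>n. nm (u n)" F "\<lambda>_. p" p] p1 by (auto simp: nm_nonneg)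
  then show "((\<lambda>n. \<Phi> (u n)) \<longlongrightarrow> 0) F"
    by (rule Lim_transform_eventually) (use assms in \<open>eventually_elim, simp add: nm_powr\<close>)
next
  assume "((\<lambda>n. \<Phi> (u n)) \<longlongrightarrow> 0) F"
  then show "((\<lambda>n. nm (u n)) \<longlongrightarrow> 0) F"
    unfolding nm_def using p1
    by (intro tendsto_zero_powrI[where b = "1/p"])
      (use assms in \<open>auto elim!: eventually_mono simp: nonneg\<close>)
qed

lemma tendsto_\<Phi>:
  assumes "\<forall>\<^sub>F n in F. u n \<in> V" "v \<in> V" "((\<lambda>n. \<Phi> (\<lambda>x. u n x - v x)) \<longlongrightarrow> 0) F"
  shows "((\<lambda>n. \<Phi> (u n)) \<longlongrightarrow> \<Phi> v) F"
proof -
  have "\<forall>\<^sub>F n in F. (\<lambda>x. u n x - v x) \<in> V"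
    using assms(1) by eventually_elim (rule diff_in[OF _ assms(2)])
  then have "((\<lambda>n. nm (\<lambda>x. u n x - v x)) \<longlongrightarrow> 0) F"
    using nm_tendsto_0_iff[of "\<lambda>n x. u n x - v x" F] assms(3) by blast
  then have "((\<lambda>n. nm (u n) - nm v) \<longlongrightarrow> 0) F"
    by (rule Lim_null_comparison[rotated])
      (use assms(1) in \<open>eventually_elim, simp add: nm_diff_le assms(2)\<close>)
  then have "((\<lambda>n. nm (u n)) \<longlongrightarrow> nm v) F" by (simp add: LIM_zero_iff)
  then have "((\<lambda>n. nm (u n) powr p) \<longlongrightarrow> nm v powr p) F"
    using p1 by (intro tendsto_powr2[OF _ tendsto_const]) (auto simp: nm_nonneg)
  then have "((\<lambda>n. nm (u n) powr p) \<longlongrightarrow> \<Phi> v) F" by (simp add: nm_powr assms(2))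
  then show ?thesis
    by (rule Lim_transform_eventually) (use assms(1) in \<open>eventually_elim, simp add: nm_powr\<close>)
qed

lemma null_cong:
  assumes "u \<in> V" "v \<in> V" "\<Phi> (\<lambda>x. u x - v x) = 0" shows "\<Phi> u = \<Phi> v"
proof -
  have "nm u = nm v" using nm_diff_le[OF assms(1,2)] assms(3) by (simp add: nm_def)
  then show ?thesis using nm_powr assms by metis
qed

definition cauchy :: "(nat \<Rightarrow> 'x \<Rightarrow> complex) \<Rightarrow> bool" where
  "cauchy u \<longleftrightarrow> (\<forall>n. u n \<in> V) \<and> (\<forall>e>0. \<exists>N. \<forall>m\<ge>N. \<forall>n\<ge>N. \<Phi> (\<lambda>x. u m x - u n x) < e)"

lemma cauchyI:
  assumes "\<And>n. u n \<in> V" and b: "\<And>m n. \<Phi> (\<lambda>x. u m x - u n x) \<le> C * (d m + d n)"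
    and "d \<longlonglongrightarrow> (0::real)"
  shows "cauchy u"
  unfolding cauchy_def
proof safe
  fix e :: real assume e: "0 < e"
  have "(\<lambda>n. C * d n) \<longlonglongrightarrow> 0" using tendsto_mult_left[OF assms(3), of C] by simp
  then obtain N where N: "\<And>n. n \<ge> N \<Longrightarrow> C * d n < e / 2"
    using order_tendstoD(2)[of "\<lambda>n. C * d n" 0 sequentially "e/2"] e
    by (auto simp: eventually_sequentially)
  show "\<exists>N. \<forall>m\<ge>N. \<forall>n\<ge>N. \<Phi> (\<lambda>x. u m x - u n x) < e"
  proof (intro exI[of _ N] allI impI)
    fix m n assume "N \<le> m" "N \<le> n"
    then show "\<Phi> (\<lambda>x. u m x - u n x) < e"
      using N[of m] N[of n] b[of m n] by (simp add: distrib_left)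
  qed
qed (use assms in auto)

lemma cauchy_comp:
  assumes "cauchy u" "filterlim r at_top sequentially" shows "cauchy (\<lambda>n. u (r n))"
  unfolding cauchy_def
proof safe
  fix e :: real assume "0 < e"
  then obtain N where N: "\<And>m n. m \<ge> N \<Longrightarrow> n \<ge> N \<Longrightarrow> \<Phi> (\<lambda>x. u m x - u n x) < e"
    using assms(1) unfolding cauchy_def by blast
  obtain N' where "\<And>n. n \<ge> N' \<Longrightarrow> r n \<ge> N"
    using assms(2) by (metis eventually_at_top_linorder filterlim_at_top)
  then show "\<exists>N. \<forall>m\<ge>N. \<forall>n\<ge>N. \<Phi> (\<lambda>x. u (r m) x - u (r n) x) < e"
    using N by (intro exI[of _ N']) auto
qed (use assms in \<open>auto simp: cauchy_def\<close>)

text \<open>Quantitative form of closure under Lipschitz functions. It lets \<open>H\<close> act on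
  Cauchy sequences and, with a constant independent of the functions, on uniformly continuous
  families.\<close>

lemma lip_bound:
  assumes "lip2 H"
  shows "\<exists>C>0. \<forall>u\<in>V. \<forall>v\<in>V. \<forall>u'\<in>V. \<forall>v'\<in>V.
    \<Phi> (\<lambda>x. H (u x) (v x) - H (u' x) (v' x)) \<le> C * (\<Phi> (\<lambda>x. u x - u' x) + \<Phi> (\<lambda>x. v x - v' x))"
proof -
  obtain C where C: "C \<ge> 0" "\<And>a b a' b'. cmod (H a b - H a' b') \<le> C * (cmod (a - a') + cmod (b - b'))"
    using lip2E[OF assms] by blast
  show ?thesis
  \<comment> \<open>The added 1 keeps the constant positive when \<open>C = 0\<close>, so that later
    estimates may divide by it.\<close>
  proof (intro exI[of _ "2 powr p * (C powr p + 1)"] conjI ballI)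
    show "2 powr p * (C powr p + 1) > 0" using C by (simp add: add_nonneg_pos)
    fix u v u' v' assume V: "u \<in> V" "v \<in> V" "u' \<in> V" "v' \<in> V"
    let ?d = "\<lambda>x. u x - u' x" let ?e = "\<lambda>x. v x - v' x"
    have "\<Phi> (\<lambda>x. H (u x) (v x) - H (u' x) (v' x)) \<le>
       2 powr p * (\<Phi> (\<lambda>x. of_real C * ?d x) + \<Phi> (\<lambda>x. of_real C * ?e x))"
      using C V by (intro dominated diff_in lip_in[OF _ _ assms] scale_in)
        (auto simp: norm_mult distrib_left)
    also have "\<dots> = 2 powr p * C powr p * (\<Phi> ?d + \<Phi> ?e)"
      unfolding scale[OF diff_in[OF V(1,3)]] scale[OF diff_in[OF V(2,4)]]
      using C by (simp add: algebra_simps)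
    also have "\<dots> \<le> 2 powr p * (C powr p + 1) * (\<Phi> ?d + \<Phi> ?e)"
      using nonneg V diff_in by (intro mult_right_mono) auto
    finally show "\<Phi> (\<lambda>x. H (u x) (v x) - H (u' x) (v' x)) \<le> \<dots>" .
  qed
qed

end

text \<open>Completeness finds a limit only up to a null function. \<open>dom_in\<close> goes
  further: a prescribed function, such as an indicator times a weight, lies in \<open>V\<close>
  itself once members of \<open>V\<close> approximate it pointwise up to dominating functions of
  small seminorm.\<close>

locale clattice = plattice +
  assumes complete: "cauchy u \<Longrightarrow> \<exists>v\<in>V. (\<lambda>n. \<Phi> (\<lambda>x. u n x - v x)) \<longlonglongrightarrow> 0"
    and dom_in: "(\<And>e. e > 0 \<Longrightarrow> \<exists>a\<in>V. \<exists>w\<in>V. \<Phi> w < e \<and> (\<forall>x. cmod (f x - a x) \<le> cmod (w x))) \<Longrightarrow> f \<in> V"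
begin

lemma null_in: "w \<in> V \<Longrightarrow> \<Phi> w = 0 \<Longrightarrow> (\<And>x. cmod (f x) \<le> cmod (w x)) \<Longrightarrow> f \<in> V"
  by (rule dom_in, rule bexI[OF _ zero_in], rule bexI[of _ w]) auto

end

section \<open>Completion\<close>

lemma null_squeeze:
  fixes f g :: "nat \<Rightarrow> real"
  assumes "g \<longlonglongrightarrow> 0" "\<And>n. 0 \<le> f n" "\<And>n. f n \<le> g n"
  shows "f \<longlonglongrightarrow> 0"
  by (rule real_tendsto_sandwich[OF _ _ tendsto_const assms(1)])
    (simp_all add: assms always_eventually)

text \<open>\<open>r n\<close> is the largest \<open>k \<le> n\<close> for which \<open>P k\<close>
  holds from \<open>n\<close> on, and 0 while there is none. Every \<open>k\<close> qualifies for
  large \<open>n\<close>, so \<open>r\<close> tends to infinity.\<close>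

lemma diagonal_index:
  fixes P :: "nat \<Rightarrow> nat \<Rightarrow> bool"
  assumes "\<And>k. \<forall>\<^sub>F n in sequentially. P k n"
  obtains r where "filterlim r at_top sequentially" "\<forall>\<^sub>F n in sequentially. P (r n) n"
proof -
  define S where "S n = {k. k \<le> n \<and> (\<forall>j\<ge>n. P k j)}" for n
  define r where "r n = Max (insert 0 (S n))" for n
  have fin: "finite (S n)" for n unfolding S_def by auto
  obtain N where N: "\<And>k j. j \<ge> N k \<Longrightarrow> P k j"
    using assms unfolding eventually_sequentially by metis
  have mem: "k \<in> S n" if "n \<ge> max k (N k)" for k n
    using that N by (auto simp: S_def)
  show thesis
  proof
    show "filterlim r at_top sequentially"
      unfolding filterlim_at_top eventually_sequentially
    proof (intro allI exI impI)
      fix k n assume "max k (N k) \<le> n"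
      then show "k \<le> r n" using mem fin unfolding r_def by (intro Max_ge) auto
    qed
    show "\<forall>\<^sub>F n in sequentially. P (r n) n"
      unfolding eventually_sequentially
    proof (intro exI allI impI)
      fix n assume "N 0 \<le> n"
      then have "0 \<in> S n" using mem[of 0 n] by simp
      then have "r n \<in> S n"
        unfolding r_def insert_absorb[OF \<open>0 \<in> S n\<close>] using fin[of n] by (intro Max_in) auto
      then show "P (r n) n" by (auto simp: S_def)
    qed
  qed
qed

context plattice
begin

text \<open>\<open>nm\<close> is 1-Lipschitz for the seminorm, so its values along \<open>a\<close>
  form a Cauchy sequence of reals; raising to the power \<open>p\<close> returns to
  \<open>\<Phi>\<close>.\<close>

lemma cauchy_lim:
  assumes "cauchy a" shows "convergent (\<lambda>n. \<Phi> (a n))"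
proof -
  have V: "a n \<in> V" for n using assms by (auto simp: cauchy_def)
  have "Cauchy (\<lambda>n. nm (a n))"
    unfolding Cauchy_def
  proof safe
    fix e :: real assume e: "0 < e"
    then have "0 < e powr p" by simp
    then obtain N where N: "\<And>m n. m \<ge> N \<Longrightarrow> n \<ge> N \<Longrightarrow> \<Phi> (\<lambda>x. a m x - a n x) < e powr p"
      using assms unfolding cauchy_def by blast
    have "dist (nm (a m)) (nm (a n)) < e" if "m \<ge> N" "n \<ge> N" for m n
    proof -
      have "dist (nm (a m)) (nm (a n)) \<le> nm (\<lambda>x. a m x - a n x)"
        unfolding dist_real_def by (rule nm_diff_le[OF V V])
      also have "\<dots> < (e powr p) powr (1 / p)"
        unfolding nm_def using N[OF that] p1 by (intro powr_less_mono2 nonneg diff_in V) auto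
      also have "\<dots> = e" using e p1 by (simp add: powr_powr)
      finally show ?thesis .
    qed
    then show "\<exists>M. \<forall>m\<ge>M. \<forall>n\<ge>M. dist (nm (a m)) (nm (a n)) < e" by blast
  qed
  then obtain l where l: "(\<lambda>n. nm (a n)) \<longlonglongrightarrow> l"
    using convergentD real_Cauchy_convergent by blast
  then have "(\<lambda>n. nm (a n) powr p) \<longlonglongrightarrow> l powr p"
    using p1 by (intro tendsto_powr2[OF _ tendsto_const]) (auto simp: nm_nonneg)
  then show ?thesis using V by (auto simp: nm_powr convergent_def)
qed

text \<open>
  Cauchy sequences up to errors which are dominated by null sequences: this makes the completion
  closed under domination.
\<close>

definition asymp :: "('x \<times> nat \<Rightarrow> complex) \<Rightarrow> (nat \<Rightarrow> 'x \<Rightarrow> complex) \<Rightarrow> bool" where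
  "asymp f a \<longleftrightarrow> cauchy a \<and> (\<exists>w. (\<forall>n. w n \<in> V) \<and>
     (\<forall>n y. cmod (f (y, n) - a n y) \<le> cmod (w n y)) \<and> (\<lambda>n. \<Phi> (w n)) \<longlonglongrightarrow> 0)"

definition CV :: "('x \<times> nat \<Rightarrow> complex) set" where
  "CV = {f. \<exists>a. asymp f a}"

text \<open>The choice is harmless: \<open>asymp_lim\<close> shows that every sequence asymptotic to
  \<open>f\<close> gives the same limit.\<close>

definition C\<Phi> :: "('x \<times> nat \<Rightarrow> complex) \<Rightarrow> real" where
  "C\<Phi> f = lim (\<lambda>n. \<Phi> ((SOME a. asymp f a) n))"

lemma asymp_in: "asymp f a \<Longrightarrow> a n \<in> V"
  by (simp add: asymp_def cauchy_def)

text \<open>Both sequences differ from the sections of \<open>f\<close> by functions that null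
  sequences dominate, so their difference is dominated by the sum of the two.\<close>

lemma asymp_unique:
  assumes "asymp f a" "asymp f b" shows "(\<lambda>n. \<Phi> (\<lambda>x. a n x - b n x)) \<longlonglongrightarrow> 0"
proof -
  obtain v w where v: "\<And>n. v n \<in> V" "\<And>n y. cmod (f (y, n) - a n y) \<le> cmod (v n y)" "(\<lambda>n. \<Phi> (v n)) \<longlonglongrightarrow> 0"
    and w: "\<And>n. w n \<in> V" "\<And>n y. cmod (f (y, n) - b n y) \<le> cmod (w n y)" "(\<lambda>n. \<Phi> (w n)) \<longlonglongrightarrow> 0"
    using assms unfolding asymp_def by blast
  note V = asymp_in[OF assms(1)] asymp_in[OF assms(2)]
  have "cmod (a n y - b n y) \<le> cmod (v n y) + cmod (w n y)" for n y
    using norm_triangle_ineq4[of "f (y, n) - b n y" "f (y, n) - a n y"] v(2)[of y n] w(2)[of y n] by simp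
  then have le: "\<Phi> (\<lambda>x. a n x - b n x) \<le> 2 powr p * (\<Phi> (v n) + \<Phi> (w n))" for n
    by (intro dominated diff_in V v w)
  have "(\<lambda>n. 2 powr p * (\<Phi> (v n) + \<Phi> (w n))) \<longlonglongrightarrow> 2 powr p * (0 + 0)"
    by (intro tendsto_intros v w)
  then show ?thesis
    by (intro null_squeeze[OF _ nonneg[OF diff_in[OF V]] le]) simp
qed

lemma asymp_lim:
  assumes "asymp f a" shows "(\<lambda>n. \<Phi> (a n)) \<longlonglongrightarrow> C\<Phi> f"
proof -
  define b where "b = (SOME a. asymp f a)"
  have b: "asymp f b" unfolding b_def by (rule someI[of "asymp f", OF assms])
  have l: "(\<lambda>n. \<Phi> (b n)) \<longlonglongrightarrow> C\<Phi> f"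
    using cauchy_lim[of b] b unfolding C\<Phi>_def b_def[symmetric] asymp_def convergent_LIMSEQ_iff by blast
  note V = asymp_in[OF assms] asymp_in[OF b]
  have "(\<lambda>n. nm (\<lambda>x. a n x - b n x)) \<longlonglongrightarrow> 0"
    by (subst nm_tendsto_0_iff)
      (intro always_eventually allI diff_in V, rule asymp_unique[OF assms b])
  then have "(\<lambda>n. nm (a n) - nm (b n)) \<longlonglongrightarrow> 0"
    by (rule Lim_null_comparison[rotated]) (auto intro!: always_eventually nm_diff_le V)
  moreover have "(\<lambda>n. nm (b n)) \<longlonglongrightarrow> C\<Phi> f powr (1/p)"
    unfolding nm_def using p1 by (intro tendsto_powr2[OF l tendsto_const] always_eventually allI nonneg V) auto
  ultimately have "(\<lambda>n. nm (a n) - nm (b n) + nm (b n)) \<longlonglongrightarrow> 0 + C\<Phi> f powr (1/p)"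
    by (rule tendsto_add)
  then have "(\<lambda>n. nm (a n)) \<longlonglongrightarrow> C\<Phi> f powr (1/p)" by simp
  then have "(\<lambda>n. nm (a n) powr p) \<longlonglongrightarrow> (C\<Phi> f powr (1/p)) powr p"
    using p1 by (intro tendsto_powr2[OF _ tendsto_const]) (auto simp: nm_nonneg)
  moreover have "0 \<le> C\<Phi> f" by (rule LIMSEQ_le_const[OF l]) (auto intro: nonneg V)
  ultimately show ?thesis using p1 by (simp add: nm_powr V powr_powr)
qed

lemma cauchy_lip:
  assumes "cauchy a" "cauchy b" "lip2 H" shows "cauchy (\<lambda>n y. H (a n y) (b n y))"
proof -
  have V: "a n \<in> V" "b n \<in> V" for n using assms(1,2) by (simp_all add: cauchy_def)
  obtain C where "C > 0" and C: "\<forall>u\<in>V. \<forall>v\<in>V. \<forall>u'\<in>V. \<forall>v'\<in>V.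
    \<Phi> (\<lambda>x. H (u x) (v x) - H (u' x) (v' x)) \<le> C * (\<Phi> (\<lambda>x. u x - u' x) + \<Phi> (\<lambda>x. v x - v' x))"
    using lip_bound[OF assms(3)] by blast
  show ?thesis unfolding cauchy_def
  proof (intro conjI allI impI)
    fix e :: real assume "0 < e"
    then have e: "0 < e / (2 * C)" using \<open>C > 0\<close> by simp
    obtain N where N: "\<And>m n. m \<ge> N \<Longrightarrow> n \<ge> N \<Longrightarrow> \<Phi> (\<lambda>x. a m x - a n x) < e / (2 * C)"
      using assms(1) e unfolding cauchy_def by blast
    obtain N' where N': "\<And>m n. m \<ge> N' \<Longrightarrow> n \<ge> N' \<Longrightarrow> \<Phi> (\<lambda>x. b m x - b n x) < e / (2 * C)"
      using assms(2) e unfolding cauchy_def by blast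
    show "\<exists>N. \<forall>m\<ge>N. \<forall>n\<ge>N. \<Phi> (\<lambda>x. H (a m x) (b m x) - H (a n x) (b n x)) < e"
    proof (intro exI[of _ "max N N'"] allI impI)
      fix m n assume mn: "max N N' \<le> m" "max N N' \<le> n"
      have "C * (\<Phi> (\<lambda>x. a m x - a n x) + \<Phi> (\<lambda>x. b m x - b n x)) < C * (e / (2 * C) + e / (2 * C))"
        using N[of m n] N'[of m n] mn \<open>C > 0\<close> by (intro mult_strict_left_mono add_strict_mono) auto
      then show "\<Phi> (\<lambda>x. H (a m x) (b m x) - H (a n x) (b n x)) < e"
        using C[rule_format, OF V(1)[of m] V(2)[of m] V(1)[of n] V(2)[of n]] \<open>C > 0\<close> by (simp add: field_simps)
    qed
  qed (rule lip_in[OF V assms(3)])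
qed

lemma asymp_lip:
  assumes f: "asymp f a" and g: "asymp g b" and H: "lip2 H"
  shows "asymp (\<lambda>x. H (f x) (g x)) (\<lambda>n y. H (a n y) (b n y))"
proof -
  obtain v w where v: "\<And>n. v n \<in> V" "\<And>n y. cmod (f (y, n) - a n y) \<le> cmod (v n y)" "(\<lambda>n. \<Phi> (v n)) \<longlonglongrightarrow> 0"
    and w: "\<And>n. w n \<in> V" "\<And>n y. cmod (g (y, n) - b n y) \<le> cmod (w n y)" "(\<lambda>n. \<Phi> (w n)) \<longlonglongrightarrow> 0"
    using assms unfolding asymp_def by blast
  obtain C where C: "C \<ge> 0" "\<And>a b a' b'. cmod (H a b - H a' b') \<le> C * (cmod (a - a') + cmod (b - b'))"
    using lip2E[OF H] by blast
  let ?z = "\<lambda>n y. complex_of_real C * complex_of_real (cmod (v n y) + cmod (w n y))"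
  have z: "?z n \<in> V" for n by (intro scale_in norm_add_in v w)
  have le: "\<Phi> (?z n) \<le> C powr p * (2 powr p * (\<Phi> (v n) + \<Phi> (w n)))" for n
  proof -
    have "\<Phi> (\<lambda>y. complex_of_real (cmod (v n y) + cmod (w n y))) \<le> 2 powr p * (\<Phi> (v n) + \<Phi> (w n))"
      by (intro dominated norm_add_in v w) (simp del: of_real_add)
    then show ?thesis
      unfolding scale[OF norm_add_in[OF v(1) w(1)]] norm_of_real abs_of_nonneg[OF C(1)]
      by (rule mult_left_mono) simp
  qed
  have "(\<lambda>n. C powr p * (2 powr p * (\<Phi> (v n) + \<Phi> (w n)))) \<longlonglongrightarrow> C powr p * (2 powr p * (0 + 0))"
    by (intro tendsto_intros v w)
  then have "(\<lambda>n. \<Phi> (?z n)) \<longlonglongrightarrow> 0"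
    by (intro null_squeeze[OF _ nonneg[OF z] le]) simp
  moreover have "cmod (H (f (y, n)) (g (y, n)) - H (a n y) (b n y)) \<le> cmod (?z n y)" for n y
  proof -
    have "cmod (H (f (y, n)) (g (y, n)) - H (a n y) (b n y)) \<le> C * (cmod (f (y, n) - a n y) + cmod (g (y, n) - b n y))"
      by (rule C)
    also have "\<dots> \<le> C * (cmod (v n y) + cmod (w n y))"
      by (intro mult_left_mono add_mono v w C)
    also have "\<dots> = cmod (?z n y)" using C(1) by (simp add: norm_mult del: of_real_add)
    finally show ?thesis .
  qed
  moreover have "cauchy (\<lambda>n y. H (a n y) (b n y))"
    using f g unfolding asymp_def by (blast intro: cauchy_lip[OF _ _ H])
  ultimately show ?thesis
    unfolding asymp_def using z by (intro conjI exI[of _ ?z] allI)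
qed

lemma asymp_add: "asymp f a \<Longrightarrow> asymp g b \<Longrightarrow> asymp (\<lambda>x. f x + g x) (\<lambda>n y. a n y + b n y)"
  using asymp_lip[OF _ _ lip2_linear, of f a g b 1 1] by simp

lemma asymp_diff: "asymp f a \<Longrightarrow> asymp g b \<Longrightarrow> asymp (\<lambda>x. f x - g x) (\<lambda>n y. a n y - b n y)"
  using asymp_lip[OF _ _ lip2_linear, of f a g b 1 "-1"] by simp

lemma asymp_scale: "asymp f a \<Longrightarrow> asymp (\<lambda>x. c * f x) (\<lambda>n y. c * a n y)"
  using asymp_lip[OF _ _ lip2_linear, of f a f a c 0] by simp

lemma asymp_norm:
  "asymp f a \<Longrightarrow> asymp (\<lambda>x. complex_of_real (cmod (f x))) (\<lambda>n y. complex_of_real (cmod (a n y)))"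
  using asymp_lip[OF _ _ lip2_norm, of f a f a] by simp

text \<open>The inequality passes from \<open>f\<close> and \<open>g\<close> to \<open>a n\<close>
  and \<open>b n\<close> only up to the two dominating error functions, which vanish in the limit.
  In terms of \<open>nm\<close> the errors enter additively, without a constant that would spoil the
  comparison.\<close>

lemma C\<Phi>_mono:
  assumes f: "asymp f a" and g: "asymp g b" and le: "\<And>x. cmod (f x) \<le> cmod (g x)"
  shows "C\<Phi> f \<le> C\<Phi> g"
proof -
  note V = asymp_in[OF f] asymp_in[OF g]
  obtain v w where v: "\<And>n. v n \<in> V" "\<And>n y. cmod (f (y, n) - a n y) \<le> cmod (v n y)" "(\<lambda>n. \<Phi> (v n)) \<longlonglongrightarrow> 0"
    and w: "\<And>n. w n \<in> V" "\<And>n y. cmod (g (y, n) - b n y) \<le> cmod (w n y)" "(\<lambda>n. \<Phi> (w n)) \<longlonglongrightarrow> 0"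
    using assms unfolding asymp_def by blast
  have nm0: "(\<lambda>n. nm (v n)) \<longlonglongrightarrow> 0" "(\<lambda>n. nm (w n)) \<longlonglongrightarrow> 0"
    using v w nm_tendsto_0_iff[of v sequentially] nm_tendsto_0_iff[of w sequentially] by auto
  have le': "nm (a n) \<le> nm (b n) + (nm (v n) + nm (w n))" for n
  proof -
    let ?z = "\<lambda>y. complex_of_real (cmod (v n y) + cmod (w n y))"
    have "nm (a n) \<le> nm (b n) + nm ?z"
    proof (intro dominated_nm V norm_add_in v w)
      fix y
      show "cmod (a n y) \<le> cmod (b n y) + cmod (complex_of_real (cmod (v n y) + cmod (w n y)))"
        using v(2)[of y n] w(2)[of y n] le[of "(y, n)"]
          norm_triangle_sub[of "a n y" "f (y, n)"] norm_triangle_sub[of "g (y, n)" "b n y"]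
        by (simp add: norm_minus_commute del: of_real_add)
    qed
    also have "nm ?z \<le> nm (v n) + nm (w n)"
      by (intro dominated_nm norm_add_in v w) (simp del: of_real_add)
    finally show ?thesis by simp
  qed
  have lims: "(\<lambda>n. nm (a n)) \<longlonglongrightarrow> C\<Phi> f powr (1/p)" "(\<lambda>n. nm (b n)) \<longlonglongrightarrow> C\<Phi> g powr (1/p)"
    unfolding nm_def using p1
    by (intro tendsto_powr2[OF asymp_lim[OF f] tendsto_const]
          tendsto_powr2[OF asymp_lim[OF g] tendsto_const] always_eventually allI nonneg V; simp)+
  have "(\<lambda>n. nm (b n) + (nm (v n) + nm (w n))) \<longlonglongrightarrow> C\<Phi> g powr (1/p) + (0 + 0)"
    by (intro tendsto_intros lims nm0)
  then have "C\<Phi> f powr (1/p) \<le> C\<Phi> g powr (1/p)"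
    using LIMSEQ_le[OF lims(1)] le' by auto
  moreover have "0 \<le> C\<Phi> f" "0 \<le> C\<Phi> g"
    by (auto intro!: LIMSEQ_le_const[OF asymp_lim[OF f]] LIMSEQ_le_const[OF asymp_lim[OF g]] nonneg V)
  ultimately show ?thesis
    using p1 powr_less_mono2[of "1/p" "C\<Phi> g" "C\<Phi> f"] by force
qed

lemma shrink_eq: "a = 0 \<or> b = 0 \<Longrightarrow> shrink a b = a"
  by (auto simp: shrink_def sgn_eq)

text \<open>Inequalities pass to the limit along approximating sequences. The last two axioms carry
  a pointwise condition that the approximations of \<open>u\<close> and \<open>v\<close> need not
  satisfy; they are repaired by taking moduli and by \<open>shrink\<close>.\<close>

lemma plattice_CV: "plattice p CV C\<Phi>"
proof
  show "1 < p" by (rule p1)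
  have "asymp (\<lambda>_. 0) (\<lambda>_ _. 0)"
    unfolding asymp_def cauchy_def
    by (intro conjI exI[of _ "\<lambda>_ _. 0"]) (auto simp: zero zero_in)
  then show "(\<lambda>_. 0) \<in> CV" by (auto simp: CV_def)
  show "(\<lambda>x. H (u x) (v x)) \<in> CV" if "u \<in> CV" "v \<in> CV" "lip2 H" for u v H
    using that asymp_lip unfolding CV_def by blast
  show "C\<Phi> u \<le> C\<Phi> v" if "u \<in> CV" "v \<in> CV" "\<And>x. cmod (u x) \<le> cmod (v x)" for u v
    using that C\<Phi>_mono unfolding CV_def by blast
next
  fix u and c :: complex assume "u \<in> CV"
  then obtain a where a: "asymp u a" by (auto simp: CV_def)
  have "(\<lambda>n. \<Phi> (\<lambda>y. c * a n y)) \<longlonglongrightarrow> C\<Phi> (\<lambda>x. c * u x)"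
    by (rule asymp_lim[OF asymp_scale[OF a]])
  then have "(\<lambda>n. cmod c powr p * \<Phi> (a n)) \<longlonglongrightarrow> C\<Phi> (\<lambda>x. c * u x)"
    by (simp add: scale asymp_in[OF a])
  moreover have "(\<lambda>n. cmod c powr p * \<Phi> (a n)) \<longlonglongrightarrow> cmod c powr p * C\<Phi> u"
    by (intro tendsto_intros asymp_lim[OF a])
  ultimately show "C\<Phi> (\<lambda>x. c * u x) = cmod c powr p * C\<Phi> u"
    by (rule LIMSEQ_unique)
next
  fix u v :: "'x \<times> nat \<Rightarrow> complex" assume "u \<in> CV" "v \<in> CV"
  then obtain a b where a: "asymp u a" and b: "asymp v b" by (auto simp: CV_def)
  note V = asymp_in[OF a] asymp_in[OF b]
  note lims = asymp_lim[OF a] asymp_lim[OF b]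
  show "C\<Phi> (\<lambda>x. u x + v x) \<le> l powr (1 - p) * C\<Phi> u + (1 - l) powr (1 - p) * C\<Phi> v"
    if "0 < l" "l < 1" for l
  proof (rule LIMSEQ_le[OF asymp_lim[OF asymp_add[OF a b]]])
    show "(\<lambda>n. l powr (1 - p) * \<Phi> (a n) + (1 - l) powr (1 - p) * \<Phi> (b n))
      \<longlonglongrightarrow> l powr (1 - p) * C\<Phi> u + (1 - l) powr (1 - p) * C\<Phi> v"
      by (intro tendsto_intros lims)
  qed (use convex[OF V that] in auto)
  show "C\<Phi> u + C\<Phi> v \<le> C\<Phi> (\<lambda>x. u x + v x)" if eq: "\<And>x. cmod (u x + v x) = cmod (u x) + cmod (v x)"
  proof -
    \<comment> \<open>The moduli of the approximations satisfy the condition of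
      \<open>superadd\<close> exactly, and the sum of the moduli of \<open>u\<close> and
      \<open>v\<close> is by assumption the modulus of their sum.\<close>
    let ?n = "\<lambda>f x. complex_of_real (cmod (f x))"
    have s: "asymp (\<lambda>x. ?n u x + ?n v x) (\<lambda>n y. ?n (a n) y + ?n (b n) y)"
      by (intro asymp_add asymp_norm a b)
    have "C\<Phi> u + C\<Phi> v \<le> C\<Phi> (\<lambda>x. ?n u x + ?n v x)"
    proof (rule LIMSEQ_le[OF tendsto_add[OF lims] asymp_lim[OF s]], intro exI allI impI)
      fix n
      show "\<Phi> (a n) + \<Phi> (b n) \<le> \<Phi> (\<lambda>y. ?n (a n) y + ?n (b n) y)"
        using superadd[OF norm_in[OF V(1)[of n]] norm_in[OF V(2)[of n]]]
        by (simp add: norm_eq V flip: of_real_add)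
    qed
    also have "\<dots> \<le> C\<Phi> (\<lambda>x. u x + v x)"
      by (rule C\<Phi>_mono[OF s asymp_add[OF a b]]) (simp add: eq flip: of_real_add)
    finally show ?thesis .
  qed
  show "C\<Phi> (\<lambda>x. u x + v x) = C\<Phi> u + C\<Phi> v" if d: "\<And>x. u x = 0 \<or> v x = 0"
  proof -
    \<comment> \<open>At each point one of \<open>u\<close>, \<open>v\<close> vanishes, so shrinking
      either by the other changes nothing. Applied to the approximations, where the smaller modulus
      is sent to 0, it makes them disjoint.\<close>
    have "shrink (u x) (v x) = u x" "shrink (v x) (u x) = v x" for x
      using d[of x] by (auto intro: shrink_eq)
    then have a': "asymp u (\<lambda>n y. shrink (a n y) (b n y))" and b': "asymp v (\<lambda>n y. shrink (b n y) (a n y))"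
      using asymp_lip[OF a b lip2_shrink] asymp_lip[OF b a lip2_shrink] by auto
    have "(\<lambda>n. \<Phi> (\<lambda>y. shrink (a n y) (b n y)) + \<Phi> (\<lambda>y. shrink (b n y) (a n y))) \<longlonglongrightarrow> C\<Phi> (\<lambda>x. u x + v x)"
    proof (rule Lim_transform_eventually[OF asymp_lim[OF asymp_add[OF a' b']]], intro always_eventually allI)
      fix n
      show "\<Phi> (\<lambda>y. shrink (a n y) (b n y) + shrink (b n y) (a n y))
        = \<Phi> (\<lambda>y. shrink (a n y) (b n y)) + \<Phi> (\<lambda>y. shrink (b n y) (a n y))"
        using asymp_in[OF a'] asymp_in[OF b']
        by (intro disjoint_add) (auto, metis shrink_0 linear)
    qed
    then show ?thesis
      using LIMSEQ_unique tendsto_add[OF asymp_lim[OF a'] asymp_lim[OF b']] by blast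
  qed
qed

section \<open>Constant sequences in the completion: embedding, density, completeness\<close>

abbreviation cst :: "('x \<Rightarrow> complex) \<Rightarrow> 'x \<times> nat \<Rightarrow> complex" where
  "cst u \<equiv> \<lambda>x. u (fst x)"

lemma asymp_cst: "u \<in> V \<Longrightarrow> asymp (cst u) (\<lambda>_. u)"
  unfolding asymp_def cauchy_def by (intro conjI exI[of _ "\<lambda>_ _. 0"]) (auto simp: zero zero_in)

lemma cst_in: "u \<in> V \<Longrightarrow> cst u \<in> CV"
  using asymp_cst unfolding CV_def by blast

lemma C\<Phi>_cst: "u \<in> V \<Longrightarrow> C\<Phi> (cst u) = \<Phi> u"
  using asymp_lim[OF asymp_cst] LIMSEQ_unique[OF _ tendsto_const] by blast

lemma asymp_cst_lim:
  assumes "asymp f a" shows "(\<lambda>k. C\<Phi> (\<lambda>x. f x - cst (a k) x)) \<longlonglongrightarrow> 0"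
  unfolding LIMSEQ_iff
proof (intro allI impI)
  interpret C: plattice p CV C\<Phi> by (rule plattice_CV)
  fix e :: real assume e: "0 < e"
  note V = asymp_in[OF assms]
  have "\<exists>N. \<forall>m\<ge>N. \<forall>n\<ge>N. \<Phi> (\<lambda>x. a m x - a n x) < e/2"
    using assms e half_gt_zero[of e] unfolding asymp_def cauchy_def by blast
  then obtain N where N: "\<And>m n. m \<ge> N \<Longrightarrow> n \<ge> N \<Longrightarrow> \<Phi> (\<lambda>x. a m x - a n x) < e/2" by blast
  show "\<exists>N. \<forall>n\<ge>N. norm (C\<Phi> (\<lambda>x. f x - cst (a n) x) - 0) < e"
  proof (intro exI allI impI)
    fix k assume k: "N \<le> k"
    have d: "asymp (\<lambda>x. f x - cst (a k) x) (\<lambda>n y. a n y - a k y)"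
      by (intro asymp_diff assms asymp_cst V)
    have "C\<Phi> (\<lambda>x. f x - cst (a k) x) \<le> e/2"
      by (rule LIMSEQ_le_const2[OF asymp_lim[OF d]]) (use N k in \<open>auto intro!: exI[of _ N] less_imp_le\<close>)
    moreover have "0 \<le> C\<Phi> (\<lambda>x. f x - cst (a k) x)"
      using d by (intro C.nonneg) (auto simp: CV_def)
    ultimately show "norm (C\<Phi> (\<lambda>x. f x - cst (a k) x) - 0) < e" using e by simp
  qed
qed

lemma cst_dense:
  assumes "f \<in> CV" "0 < e" shows "\<exists>u\<in>V. C\<Phi> (\<lambda>x. f x - cst u x) < e"
proof -
  obtain a where a: "asymp f a" using assms by (auto simp: CV_def)
  obtain k where "C\<Phi> (\<lambda>x. f x - cst (a k) x) < e"
    using order_tendstoD(2)[OF asymp_cst_lim[OF a] assms(2)] by (auto simp: eventually_sequentially)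
  then show ?thesis using asymp_in[OF a] by blast
qed

text \<open>Each \<open>f k\<close> is replaced by a constant sequence \<open>cst (c k)\<close>
  within \<open>1 / (k + 1)\<close>; the limit is the function whose \<open>n\<close>-th section is
  \<open>c n\<close>.\<close>

lemma CV_complete:
  assumes "plattice.cauchy CV C\<Phi> f"
  shows "\<exists>v\<in>CV. (\<lambda>n. C\<Phi> (\<lambda>x. f n x - v x)) \<longlonglongrightarrow> 0"
proof -
  interpret C: plattice p CV C\<Phi> by (rule plattice_CV)
  have f: "f n \<in> CV" for n using assms by (simp add: C.cauchy_def)
  have "\<forall>k. \<exists>u\<in>V. C\<Phi> (\<lambda>x. f k x - cst u x) < 1 / real (Suc k)"
    using cst_dense f by simp
  then obtain c where c: "\<And>k. c k \<in> V" "\<And>k. C\<Phi> (\<lambda>x. f k x - cst (c k) x) < 1 / real (Suc k)"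
    by metis
  have fc: "(\<lambda>k. C\<Phi> (\<lambda>x. f k x - cst (c k) x)) \<longlonglongrightarrow> 0"
    by (rule null_squeeze[OF LIMSEQ_Suc[OF lim_1_over_n]])
      (intro less_imp_le[OF c(2)] C.nonneg C.diff_in f cst_in c)+
  have "cauchy c" unfolding cauchy_def
  proof (intro conjI allI impI c)
    fix e :: real assume "0 < e"
    define K where "K = (2::real) powr p"
    have K: "K > 0" by (simp add: K_def)
    \<comment> \<open>Two uses of the quasi-triangle inequality cost
      \<open>K * (d + K * (d + d))\<close>, which is at most
      \<open>4 * (K + K * K) * d = e\<close>.\<close>
    define d where "d = e / (4 * (K + K * K))"
    have d: "d > 0" unfolding d_def using K \<open>0 < e\<close> by (intro divide_pos_pos mult_pos_pos add_pos_pos) auto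
    obtain N where N: "\<And>m n. m \<ge> N \<Longrightarrow> n \<ge> N \<Longrightarrow> C\<Phi> (\<lambda>x. f m x - f n x) < d"
      using assms d unfolding C.cauchy_def by blast
    obtain N' where N': "\<And>n. n \<ge> N' \<Longrightarrow> C\<Phi> (\<lambda>x. f n x - cst (c n) x) < d"
      using order_tendstoD(2)[OF fc d] by (auto simp: eventually_sequentially)
    show "\<exists>N. \<forall>m\<ge>N. \<forall>n\<ge>N. \<Phi> (\<lambda>x. c m x - c n x) < e"
    proof (intro exI[of _ "max N N'"] allI impI)
      fix m n assume mn: "max N N' \<le> m" "max N N' \<le> n"
      have "\<Phi> (\<lambda>x. c m x - c n x) = C\<Phi> (\<lambda>x. cst (c m) x - cst (c n) x)"
        using C\<Phi>_cst[OF diff_in[OF c(1)[of m] c(1)[of n]]] by simp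
      also have "\<dots> \<le> K * (C\<Phi> (\<lambda>x. cst (c m) x - f m x) + C\<Phi> (\<lambda>x. f m x - cst (c n) x))"
        unfolding K_def by (intro C.diff_triangle cst_in c f)
      also have "C\<Phi> (\<lambda>x. f m x - cst (c n) x) \<le> K * (C\<Phi> (\<lambda>x. f m x - f n x) + C\<Phi> (\<lambda>x. f n x - cst (c n) x))"
        unfolding K_def by (intro C.diff_triangle cst_in c f)
      also have "C\<Phi> (\<lambda>x. cst (c m) x - f m x) = C\<Phi> (\<lambda>x. f m x - cst (c m) x)"
        by (intro C.minus_commute cst_in c f)
      also have "K * (C\<Phi> (\<lambda>x. f m x - cst (c m) x) + K * (C\<Phi> (\<lambda>x. f m x - f n x) + C\<Phi> (\<lambda>x. f n x - cst (c n) x)))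
        < K * (d + K * (d + d))"
        using N[of m n] N'[of m] N'[of n] mn K
        by (intro mult_strict_left_mono add_strict_mono) auto
      also have "\<dots> \<le> 4 * (K + K * K) * d" using K d by (simp add: algebra_simps)
      also have "\<dots> = e"
        unfolding d_def using K add_pos_pos[OF K mult_pos_pos[OF K K]]
        by (metis nonzero_mult_div_cancel_left times_divide_eq_right mult_pos_pos zero_less_numeral less_irrefl)
      finally show "\<Phi> (\<lambda>x. c m x - c n x) < e" using K by (simp add: mult_left_mono)
    qed
  qed
  define v where "v = (\<lambda>x. c (snd x) (fst x))"
  have v: "asymp v c"
    unfolding asymp_def v_def by (intro conjI \<open>cauchy c\<close> exI[of _ "\<lambda>_ _. 0"]) (auto simp: zero zero_in)
  then have vC: "v \<in> CV" by (auto simp: CV_def)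
  show ?thesis
  proof (intro bexI[OF _ vC])
    have "(\<lambda>k. 2 powr p * (C\<Phi> (\<lambda>x. f k x - cst (c k) x) + C\<Phi> (\<lambda>x. v x - cst (c k) x))) \<longlonglongrightarrow> 2 powr p * (0 + 0)"
      by (intro tendsto_intros fc asymp_cst_lim v)
    then have *: "(\<lambda>k. 2 powr p * (C\<Phi> (\<lambda>x. f k x - cst (c k) x) + C\<Phi> (\<lambda>x. v x - cst (c k) x))) \<longlonglongrightarrow> 0" by simp
    show "(\<lambda>n. C\<Phi> (\<lambda>x. f n x - v x)) \<longlonglongrightarrow> 0"
    proof (rule null_squeeze[OF *])
      fix k
      show "0 \<le> C\<Phi> (\<lambda>x. f k x - v x)" by (intro C.nonneg C.diff_in f vC)
      show "C\<Phi> (\<lambda>x. f k x - v x) \<le> 2 powr p * (C\<Phi> (\<lambda>x. f k x - cst (c k) x) + C\<Phi> (\<lambda>x. v x - cst (c k) x))"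
        using C.diff_triangle[OF f[of k] cst_in[OF c(1)[of k]] vC] C.minus_commute[OF vC cst_in[OF c(1)[of k]]]
        by simp
    qed
  qed
qed

text \<open>For each \<open>k\<close> some \<open>c k\<close> in \<open>V\<close> approximates every
  section of \<open>f\<close> up to \<open>d k n\<close>, but \<open>d k n\<close> is small only for
  \<open>n\<close> large, depending on \<open>k\<close>. Letting \<open>k = r n\<close> grow slowly
  enough with \<open>n\<close> gives one asymptotic sequence.\<close>

lemma CV_dominated:
  assumes "\<And>e. e > 0 \<Longrightarrow> \<exists>g\<in>CV. \<exists>h\<in>CV. C\<Phi> h < e \<and> (\<forall>x. cmod (f x - g x) \<le> cmod (h x))"
  shows "f \<in> CV"
proof -
  interpret C: plattice p CV C\<Phi> by (rule plattice_CV)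
  \<comment> \<open>The factor \<open>2 powr p\<close> is paid twice, for joining \<open>h\<close>
    and \<open>g - cst c\<close> to \<open>H\<close> and for joining the approximations of
    \<open>H\<close> to their error; 2 adds two errors \<open>e\<close>, and 1 makes the inequality
    strict.\<close>
  define K where "K = 2 powr p * (2 powr p * 2) + (1::real)"
  have K: "K > 0" unfolding K_def by (simp add: add_pos_pos)
  have "\<exists>c d. c \<in> V \<and> (\<forall>n. d n \<in> V) \<and> (\<forall>n y. cmod (f (y, n) - c y) \<le> cmod (d n y)) \<and>
      (\<forall>\<^sub>F n in sequentially. \<Phi> (d n) < K / real (Suc k))" for k
  proof -
    define e where "e = 1 / real (Suc k)"
    have e: "e > 0" by (simp add: e_def)
    obtain g h where gh: "g \<in> CV" "h \<in> CV" "C\<Phi> h < e" "\<And>x. cmod (f x - g x) \<le> cmod (h x)"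
      using assms[OF e] by blast
    obtain c where c: "c \<in> V" "C\<Phi> (\<lambda>x. g x - cst c x) < e"
      using cst_dense[OF gh(1) e] by blast
    let ?g = "\<lambda>x. g x - cst c x"
    have g': "?g \<in> CV" by (intro C.diff_in gh cst_in c)
    define H where "H = (\<lambda>x. complex_of_real (cmod (h x) + cmod (?g x)))"
    have H: "H \<in> CV" unfolding H_def by (intro C.norm_add_in gh g')
    have "C\<Phi> H \<le> 2 powr p * (C\<Phi> h + C\<Phi> ?g)"
      by (intro C.dominated H gh g') (simp add: H_def del: of_real_add)
    also have "\<dots> \<le> 2 powr p * (e + e)"
      using gh c by (intro mult_left_mono add_mono) auto
    finally have "2 powr p * C\<Phi> H \<le> 2 powr p * (2 powr p * (e + e))" by (intro mult_left_mono) auto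
    also have "\<dots> < K * e" using e by (simp add: K_def distrib_right distrib_left)
    finally have He: "2 powr p * C\<Phi> H < K * e" .
    have fH: "cmod (f (y, n) - c y) \<le> cmod (H (y, n))" for y n
      using norm_triangle_ineq[of "f (y, n) - g (y, n)" "g (y, n) - c y"] gh(4)[of "(y, n)"]
      by (simp add: H_def del: of_real_add)
    obtain b where "asymp H b" using H by (auto simp: CV_def)
    note V = asymp_in[OF \<open>asymp H b\<close>]
    obtain w where w: "\<And>n. w n \<in> V" "\<And>n y. cmod (H (y, n) - b n y) \<le> cmod (w n y)" "(\<lambda>n. \<Phi> (w n)) \<longlonglongrightarrow> 0"
      using \<open>asymp H b\<close> unfolding asymp_def by blast
    define d where "d = (\<lambda>n y. complex_of_real (cmod (b n y) + cmod (w n y)))"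
    have d: "d n \<in> V" for n unfolding d_def by (intro norm_add_in V w)
    have "(\<lambda>n. 2 powr p * (\<Phi> (b n) + \<Phi> (w n))) \<longlonglongrightarrow> 2 powr p * (C\<Phi> H + 0)"
      by (intro tendsto_intros w asymp_lim \<open>asymp H b\<close>)
    then have "\<forall>\<^sub>F n in sequentially. 2 powr p * (\<Phi> (b n) + \<Phi> (w n)) < K * e"
      by (rule order_tendstoD(2)) (simp add: He)
    then have "\<forall>\<^sub>F n in sequentially. \<Phi> (d n) < K * e"
    proof eventually_elim
      case (elim n)
      have "\<Phi> (d n) \<le> 2 powr p * (\<Phi> (b n) + \<Phi> (w n))"
        by (intro dominated d V w) (simp add: d_def del: of_real_add)
      then show ?case using elim by simp
    qed
    moreover have "cmod (f (y, n) - c y) \<le> cmod (d n y)" for n y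
      using fH[of y n] w(2)[of y n] norm_triangle_sub[of "H (y, n)" "b n y"]
      by (simp add: d_def del: of_real_add)
    ultimately show ?thesis using c d unfolding e_def by (intro exI[of _ c] exI[of _ d]) simp
  qed
  then obtain c d where c: "\<And>k. c k \<in> V" and d: "\<And>k n. d k n \<in> V"
      "\<And>k n y. cmod (f (y, n) - c k y) \<le> cmod (d k n y)"
      "\<And>k. \<forall>\<^sub>F n in sequentially. \<Phi> (d k n) < K / real (Suc k)"
    by metis
  have "cauchy c"
  proof (rule cauchyI[OF c])
    show "(\<lambda>k. K / real (Suc k)) \<longlonglongrightarrow> 0"
      using LIMSEQ_Suc[OF lim_const_over_n[of K]] by simp
    fix k l
    \<comment> \<open>\<open>c k\<close> and \<open>c l\<close> do not depend on \<open>n\<close>,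
      so they can be compared at any one index where both bounds hold.\<close>
    obtain n where n: "\<Phi> (d k n) < K / real (Suc k)" "\<Phi> (d l n) < K / real (Suc l)"
      using eventually_conj[OF d(3)[of k] d(3)[of l]] by (auto simp: eventually_sequentially)
    have "cmod (c k y - c l y) \<le> cmod (d k n y) + cmod (d l n y)" for y
      using norm_triangle_ineq4[of "f (y, n) - c l y" "f (y, n) - c k y"] d(2)[where k = k and y = y and n = n] d(2)[where k = l and y = y and n = n] by simp
    then have "\<Phi> (\<lambda>x. c k x - c l x) \<le> 2 powr p * (\<Phi> (d k n) + \<Phi> (d l n))"
      by (intro dominated diff_in c d)
    also have "\<dots> \<le> 2 powr p * (K / real (Suc k) + K / real (Suc l))"
      using n by (intro mult_left_mono add_mono) auto
    finally show "\<Phi> (\<lambda>x. c k x - c l x) \<le> 2 powr p * (K / real (Suc k) + K / real (Suc l))" .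
  qed
  obtain r where r: "filterlim r at_top sequentially"
    "\<forall>\<^sub>F n in sequentially. \<Phi> (d (r n) n) < K / real (Suc (r n))"
    using diagonal_index[of "\<lambda>k n. \<Phi> (d k n) < K / real (Suc k)"] d(3) by blast
  have "(\<lambda>n. \<Phi> (d (r n) n)) \<longlonglongrightarrow> 0"
  proof (rule real_tendsto_sandwich[OF _ _ tendsto_const])
    show "(\<lambda>n. K / real (Suc (r n))) \<longlonglongrightarrow> 0"
      using filterlim_compose[OF LIMSEQ_Suc[OF lim_const_over_n[of K]] r(1)] by simp
    show "\<forall>\<^sub>F n in sequentially. \<Phi> (d (r n) n) \<le> K / real (Suc (r n))"
      using r(2) by eventually_elim simp
    show "\<forall>\<^sub>F n in sequentially. 0 \<le> \<Phi> (d (r n) n)"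
      by (intro always_eventually allI nonneg d)
  qed
  then have "asymp f (\<lambda>n. c (r n))"
    unfolding asymp_def using cauchy_comp[OF \<open>cauchy c\<close> r(1)] d
    by (intro conjI exI[of _ "\<lambda>n. d (r n) n"]) auto
  then show ?thesis by (auto simp: CV_def)
qed

lemma clattice_CV: "clattice p CV C\<Phi>"
proof -
  interpret C: plattice p CV C\<Phi> by (rule plattice_CV)
  show ?thesis by unfold_locales (auto intro: CV_complete CV_dominated)
qed

end

section \<open>\<open>L\<^sup>p\<close> spaces as lattices\<close>

text \<open>Convexity of the power at the points \<open>a / l\<close> and \<open>b / (1 - l)\<close>
  with weights \<open>l\<close> and \<open>1 - l\<close>. It is applied at positive arguments; if
  \<open>a\<close> or \<open>b\<close> is 0, the bound \<open>l powr (1 - p) \<ge> 1\<close>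
  suffices.\<close>

lemma convex_powr_split:
  fixes a b l p :: real
  assumes "1 < p" "0 \<le> a" "0 \<le> b" "0 < l" "l < 1"
  shows "(a + b) powr p \<le> l powr (1 - p) * a powr p + (1 - l) powr (1 - p) * b powr p"
proof -
  have scale: "l * (c / l) powr p = l powr (1 - p) * c powr p" if "0 < l" "0 \<le> c" for c l :: real
    using that by (simp add: powr_divide powr_diff)
  have mono1: "c powr p \<le> l powr (1 - p) * c powr p" if "0 < l" "l < 1" for c l :: real
  proof -
    have "1 powr (1 - p) \<le> l powr (1 - p)"
      using that assms(1) by (intro powr_mono2') auto
    then show ?thesis using mult_right_mono[of 1 "l powr (1 - p)" "c powr p"] by simp
  qed
  show ?thesis
  proof (cases "a = 0 \<or> b = 0")
    case True
    then show ?thesis using mono1[of "1 - l" b] mono1[of l a] assms by auto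
  next
    case False
    then have pos: "a / l > 0" "b / (1 - l) > 0" using assms by auto
    have "((1 - (1 - l)) *\<^sub>R (a / l) + (1 - l) *\<^sub>R (b / (1 - l))) powr p
        \<le> (1 - (1 - l)) * (a / l) powr p + (1 - l) * (b / (1 - l)) powr p"
      by (rule convex_onD[OF powr_convex]) (use assms pos in auto)
    then show ?thesis using assms by (simp add: scale)
  qed
qed

lemma powr_superadd:
  fixes a b p :: real
  assumes "1 < p" "0 \<le> a" "0 \<le> b"
  shows "a powr p + b powr p \<le> (a + b) powr p"
proof -
  have *: "c powr p = c * c powr (p - 1)" if "0 \<le> c" for c :: real
    using powr_mult_base[of c "p - 1"] that by simp
  have "a * a powr (p - 1) + b * b powr (p - 1) \<le> a * (a + b) powr (p - 1) + b * (a + b) powr (p - 1)"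
    using assms by (intro add_mono mult_left_mono powr_mono2) auto
  also have "\<dots> = (a + b) powr p" using *[of "a + b"] assms by (simp add: distrib_right)
  finally show ?thesis using assms by (simp add: *)
qed

lemma powr_quasi:
  fixes a b p :: real
  assumes "1 < p" "0 \<le> a" "0 \<le> b"
  shows "(a + b) powr p \<le> 2 powr p * (a powr p + b powr p)"
proof -
  have "(a + b) powr p \<le> (2 * max a b) powr p" using assms by (intro powr_mono2) auto
  also have "\<dots> = 2 powr p * max a b powr p" using assms by (simp add: powr_mult)
  also have "\<dots> \<le> 2 powr p * (a powr p + b powr p)"
    by (intro mult_left_mono) (auto simp: max_def)
  finally show ?thesis .
qed

lemma lip2_continuous:
  assumes "lip2 H" shows "continuous_on UNIV (\<lambda>z. H (fst z) (snd z))"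
proof -
  obtain C where C: "C \<ge> 0" "\<And>a b a' b'. cmod (H a b - H a' b') \<le> C * (cmod (a - a') + cmod (b - b'))"
    using lip2E[OF assms] by blast
  have "(2 * C)-lipschitz_on UNIV (\<lambda>z. H (fst z) (snd z))"
  proof (rule lipschitz_onI)
    fix x y :: "complex \<times> complex"
    have "dist (H (fst x) (snd x)) (H (fst y) (snd y)) \<le> C * (dist (fst x) (fst y) + dist (snd x) (snd y))"
      unfolding dist_norm by (rule C)
    also have "\<dots> \<le> C * (dist x y + dist x y)"
      by (intro mult_left_mono add_mono dist_fst_le dist_snd_le C)
    finally show "dist (H (fst x) (snd x)) (H (fst y) (snd y)) \<le> 2 * C * dist x y" by simp
  qed (use C in auto)
  then show ?thesis by (rule lipschitz_on_continuous_on)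
qed

definition Ip :: "real \<Rightarrow> 'a measure \<Rightarrow> ('a \<Rightarrow> complex) \<Rightarrow> real" where
  "Ip p M f = (\<integral>x. cmod (f x) powr p \<partial>M)"

lemma Lp_fun_measurable: "f \<in> Lp_fun p M \<Longrightarrow> f \<in> borel_measurable M"
  by (simp add: Lp_fun_def)

lemma Lp_fun_integrable: "f \<in> Lp_fun p M \<Longrightarrow> integrable M (\<lambda>x. cmod (f x) powr p)"
  by (simp add: Lp_fun_def)

lemma Lp_funI_bound:
  assumes "f \<in> borel_measurable M" "integrable M g" "\<And>x. cmod (f x) powr p \<le> g x"
  shows "f \<in> Lp_fun p M"
proof -
  have [measurable]: "f \<in> borel_measurable M" by fact
  have "integrable M (\<lambda>x. cmod (f x) powr p)"
    by (rule Bochner_Integration.integrable_bound[OF assms(2)])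
      (auto intro!: order_trans[OF assms(3)])
  then show ?thesis using assms by (simp add: Lp_fun_def)
qed

lemma Lp_fun_lip:
  assumes p: "1 < p" and f: "f \<in> Lp_fun p M" and g: "g \<in> Lp_fun p M" and H: "lip2 H"
  shows "(\<lambda>x. H (f x) (g x)) \<in> Lp_fun p M"
proof -
  obtain C where C: "C \<ge> 0" "\<And>a b a' b'. cmod (H a b - H a' b') \<le> C * (cmod (a - a') + cmod (b - b'))"
    using lip2E[OF H] by blast
  have H0: "H 0 0 = 0" using H by (simp add: lip2_def)
  show ?thesis
  proof (rule Lp_funI_bound)
    show "(\<lambda>x. H (f x) (g x)) \<in> borel_measurable M"
      using borel_measurable_continuous_Pair[OF Lp_fun_measurable[OF f] Lp_fun_measurable[OF g] lip2_continuous[OF H]]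
      by simp
    show "integrable M (\<lambda>x. C powr p * (2 powr p * (cmod (f x) powr p + cmod (g x) powr p)))"
      by (intro integrable_mult_right Bochner_Integration.integrable_add Lp_fun_integrable f g)
    fix x
    have "cmod (H (f x) (g x)) \<le> C * (cmod (f x) + cmod (g x))"
      using C(2)[of "f x" "g x" 0 0] H0 by simp
    then have "cmod (H (f x) (g x)) powr p \<le> (C * (cmod (f x) + cmod (g x))) powr p"
      using p by (intro powr_mono2) auto
    also have "\<dots> = C powr p * (cmod (f x) + cmod (g x)) powr p"
      using C by (simp add: powr_mult)
    also have "\<dots> \<le> C powr p * (2 powr p * (cmod (f x) powr p + cmod (g x) powr p))"
      by (intro mult_left_mono powr_quasi p) auto
    finally show "cmod (H (f x) (g x)) powr p \<le> \<dots>" .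
  qed
qed

text \<open>The axioms are pointwise statements about the \<open>p\<close>-th power of the modulus,
  integrated.\<close>

lemma plattice_Lp:
  assumes p: "1 < p" shows "plattice p (Lp_fun p M) (Ip p M)"
proof
  show "1 < p" by fact
  show "(\<lambda>_. 0) \<in> Lp_fun p M" by (simp add: Lp_fun_def)
  show "(\<lambda>x. H (u x) (v x)) \<in> Lp_fun p M" if "u \<in> Lp_fun p M" "v \<in> Lp_fun p M" "lip2 H" for u v H
    by (rule Lp_fun_lip[OF p that])
  show "Ip p M u \<le> Ip p M v" if "u \<in> Lp_fun p M" "v \<in> Lp_fun p M" "\<And>x. cmod (u x) \<le> cmod (v x)" for u v
    unfolding Ip_def using that p
    by (intro integral_mono Lp_fun_integrable powr_mono2) auto
  show "Ip p M (\<lambda>x. c * u x) = cmod c powr p * Ip p M u" if "u \<in> Lp_fun p M" for c u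
    unfolding Ip_def by (simp add: norm_mult powr_mult)
next
  fix u v :: "'a \<Rightarrow> complex" assume uv: "u \<in> Lp_fun p M" "v \<in> Lp_fun p M"
  have s: "(\<lambda>x. u x + v x) \<in> Lp_fun p M"
    using Lp_fun_lip[OF p uv lip2_linear[of 1 1]] by simp
  note int = Lp_fun_integrable[OF uv(1)] Lp_fun_integrable[OF uv(2)] Lp_fun_integrable[OF s]
  show "Ip p M (\<lambda>x. u x + v x) \<le> l powr (1 - p) * Ip p M u + (1 - l) powr (1 - p) * Ip p M v"
    if "0 < l" "l < 1" for l
  proof -
    have "Ip p M (\<lambda>x. u x + v x) \<le> (\<integral>x. l powr (1 - p) * cmod (u x) powr p + (1 - l) powr (1 - p) * cmod (v x) powr p \<partial>M)"
      unfolding Ip_def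
    proof (intro integral_mono int Bochner_Integration.integrable_add integrable_mult_right)
      fix x
      have "cmod (u x + v x) powr p \<le> (cmod (u x) + cmod (v x)) powr p"
        using p by (intro powr_mono2 norm_triangle_ineq) auto
      also have "\<dots> \<le> l powr (1 - p) * cmod (u x) powr p + (1 - l) powr (1 - p) * cmod (v x) powr p"
        by (intro convex_powr_split p that) auto
      finally show "cmod (u x + v x) powr p \<le> \<dots>" .
    qed
    also have "\<dots> = l powr (1 - p) * Ip p M u + (1 - l) powr (1 - p) * Ip p M v"
      unfolding Ip_def using int by (subst Bochner_Integration.integral_add) auto
    finally show ?thesis .
  qed
  show "Ip p M u + Ip p M v \<le> Ip p M (\<lambda>x. u x + v x)"
    if "\<And>x. cmod (u x + v x) = cmod (u x) + cmod (v x)"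
  proof -
    have "Ip p M u + Ip p M v = (\<integral>x. cmod (u x) powr p + cmod (v x) powr p \<partial>M)"
      unfolding Ip_def using int by simp
    also have "\<dots> \<le> Ip p M (\<lambda>x. u x + v x)"
      unfolding Ip_def using p
      by (intro integral_mono int Bochner_Integration.integrable_add) (simp add: that powr_superadd)
    finally show ?thesis .
  qed
  show "Ip p M (\<lambda>x. u x + v x) = Ip p M u + Ip p M v" if "\<And>x. u x = 0 \<or> v x = 0"
  proof -
    have eq: "cmod (u x + v x) powr p = cmod (u x) powr p + cmod (v x) powr p" for x
      using that[of x] p by auto
    show ?thesis unfolding Ip_def eq using int by simp
  qed
qed

lemma nn_integral_Lp:
  "f \<in> Lp_fun p M \<Longrightarrow> (\<integral>\<^sup>+x. ennreal (cmod (f x) powr p) \<partial>M) = ennreal (Ip p M f)"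
  unfolding Ip_def by (rule nn_integral_eq_integral) (auto simp: Lp_fun_def)

lemma Lp_funI_nn:
  assumes [measurable]: "f \<in> borel_measurable M"
    and le: "(\<integral>\<^sup>+x. ennreal (cmod (f x) powr p) \<partial>M) \<le> ennreal c" and "0 \<le> c"
  shows "f \<in> Lp_fun p M" "Ip p M f \<le> c"
proof -
  have "integrable M (\<lambda>x. cmod (f x) powr p)"
    by (intro integrableI_nonneg) (use le in \<open>auto intro: le_less_trans[OF le ennreal_less_top]\<close>)
  then show f: "f \<in> Lp_fun p M" by (simp add: Lp_fun_def)
  show "Ip p M f \<le> c" using le \<open>0 \<le> c\<close> by (simp add: nn_integral_Lp[OF f])
qed

lemma Ip_AE_cong:
  assumes "f \<in> Lp_fun p M" "g \<in> Lp_fun p M" "AE x in M. f x = g x"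
  shows "Ip p M f = Ip p M g"
proof -
  have [measurable]: "f \<in> borel_measurable M" "g \<in> borel_measurable M"
    using assms by (auto simp: Lp_fun_def)
  show ?thesis unfolding Ip_def by (rule integral_cong_AE) (use assms(3) in auto)
qed

lemma Ip_eq_0_iff:
  assumes f: "f \<in> Lp_fun p M"
  shows "Ip p M f = 0 \<longleftrightarrow> (AE x in M. f x = 0)"
  unfolding Ip_def using f
  by (subst integral_nonneg_eq_0_iff_AE) (auto simp: Lp_fun_def)

lemma rapid_subsequence:
  fixes P :: "nat \<Rightarrow> nat \<Rightarrow> nat \<Rightarrow> bool"
  assumes "\<And>k. \<exists>N. \<forall>m\<ge>N. \<forall>n\<ge>N. P k m n"
  shows "\<exists>r. strict_mono r \<and> (\<forall>k. \<forall>n\<ge>r k. P k (r k) n)"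
proof -
  obtain N where N: "\<And>k m n. m \<ge> N k \<Longrightarrow> n \<ge> N k \<Longrightarrow> P k m n" using assms by metis
  define r where "r = rec_nat (N 0) (\<lambda>k x. max (Suc x) (N (Suc k)))"
  have r: "r k \<ge> N k" "r k < r (Suc k)" for k
    by (cases k; simp add: r_def) (simp add: r_def)
  show ?thesis
    by (intro exI[of _ r]) (auto simp: strict_mono_Suc_iff r(2) intro!: N r(1) order_trans[OF r(1)])
qed

text \<open>A rapidly converging subsequence converges almost everywhere, and Fatou's lemma
  transfers the Cauchy estimate to the limit function.\<close>

lemma Riesz_Fischer:
  assumes p: "1 < p" and u: "plattice.cauchy (Lp_fun p M) (Ip p M) u"
  shows "\<exists>f\<in>Lp_fun p M. (\<lambda>n. Ip p M (\<lambda>x. u n x - f x)) \<longlonglongrightarrow> 0"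
proof -
  interpret plattice p "Lp_fun p M" "Ip p M" by (rule plattice_Lp[OF p])
  have L: "u n \<in> Lp_fun p M" for n using u by (simp add: cauchy_def)
  then have [measurable]: "u n \<in> borel_measurable M" for n by (simp add: Lp_fun_def)
  have ex: "\<exists>N. \<forall>m\<ge>N. \<forall>n\<ge>N. Ip p M (\<lambda>x. u m x - u n x) < e" if "0 < e" for e
    using u that unfolding cauchy_def by blast
  \<comment> \<open>The bound leaves room for a weight \<open>(2 powr p) ^ k\<close>: the weighted
    integrals are still dominated by a geometric series of ratio \<open>1 / 2 powr p\<close>, and
    where the weighted sum is finite, \<open>cmod (d k x) \<le> (1/2) ^ k\<close>
    eventually.\<close>
  have "\<exists>r. strict_mono r \<and> (\<forall>k. \<forall>n\<ge>r k. Ip p M (\<lambda>x. u (r k) x - u n x) < (1/4 powr p) ^ k)"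
    by (intro rapid_subsequence ex) simp
  then obtain r where r: "strict_mono r"
    and rk: "\<And>k n. n \<ge> r k \<Longrightarrow> Ip p M (\<lambda>x. u (r k) x - u n x) < (1/4 powr p) ^ k" by blast
  define d where "d = (\<lambda>k x. u (r k) x - u (r (Suc k)) x)"
  have d: "d k \<in> Lp_fun p M" for k unfolding d_def by (intro diff_in L)
  then have [measurable]: "d k \<in> borel_measurable M" for k by (simp add: Lp_fun_def)
  have dI: "Ip p M (d k) \<le> (1/4 powr p) ^ k" for k
    unfolding d_def using rk[of k "r (Suc k)"] strict_mono_leD[OF r, of k "Suc k"] by simp
  have "(\<integral>\<^sup>+x. (\<Sum>k. ennreal ((2 powr p) ^ k * cmod (d k x) powr p)) \<partial>M)
      = (\<Sum>k. \<integral>\<^sup>+x. ennreal ((2 powr p) ^ k * cmod (d k x) powr p) \<partial>M)"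
    by (rule nn_integral_suminf) measurable
  also have "\<dots> \<le> (\<Sum>k. ennreal ((1 / 2 powr p) ^ k))"
  proof (intro suminf_le allI)
    fix k
    have "(\<integral>\<^sup>+x. ennreal ((2 powr p) ^ k * cmod (d k x) powr p) \<partial>M) = ennreal ((2 powr p) ^ k) * ennreal (Ip p M (d k))"
      by (simp add: ennreal_mult nn_integral_cmult nn_integral_Lp[OF d])
    also have "\<dots> \<le> ennreal ((2 powr p) ^ k) * ennreal ((1/4 powr p) ^ k)"
      by (intro mult_left_mono ennreal_leI dI) auto
    also have "\<dots> = ennreal ((2 powr p * (1/4 powr p)) ^ k)"
      by (simp add: power_divide flip: ennreal_mult)
    also have "2 powr p * (1 / 4 powr p) = 1 / 2 powr p"
      using powr_mult[of 2 2 p] by (simp add: field_simps)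
    finally show "(\<integral>\<^sup>+x. ennreal ((2 powr p) ^ k * cmod (d k x) powr p) \<partial>M) \<le> ennreal ((1 / 2 powr p) ^ k)" .
  qed auto
  also have "\<dots> < \<infinity>"
  proof -
    have "(1::real) < 2 powr p" using p powr_less_mono[of 0 p 2] by simp
    then have "summable (\<lambda>k. (1 / 2 powr p) ^ k)" by (intro summable_geometric) auto
    then show ?thesis by (simp add: suminf_ennreal2 less_top[symmetric])
  qed
  finally have "AE x in M. (\<Sum>k. ennreal ((2 powr p) ^ k * cmod (d k x) powr p)) \<noteq> \<infinity>"
    by (intro nn_integral_noteq_infinite) auto
  then have conv: "AE x in M. convergent (\<lambda>k. u (r k) x)"
  proof eventually_elim
    fix x assume "(\<Sum>k. ennreal ((2 powr p) ^ k * cmod (d k x) powr p)) \<noteq> \<infinity>"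
    then have "summable (\<lambda>k. (2 powr p) ^ k * cmod (d k x) powr p)"
      by (intro summable_suminf_not_top) auto
    then have "(\<lambda>k. (2 powr p) ^ k * cmod (d k x) powr p) \<longlonglongrightarrow> 0"
      by (rule summable_LIMSEQ_zero)
    then have "\<forall>\<^sub>F k in sequentially. (2 powr p) ^ k * cmod (d k x) powr p < 1"
      by (rule order_tendstoD) simp
    then have "\<forall>\<^sub>F k in sequentially. cmod (d k x) \<le> (1/2) ^ k"
    proof eventually_elim
      case (elim k)
      have "((2::real) powr p) ^ k = (2 ^ k) powr p"
        by (simp add: powr_powr powr_realpow[symmetric] mult.commute)
      then have "(2 ^ k * cmod (d k x)) powr p < 1 powr p"
        using elim by (simp add: powr_mult)
      then have "2 ^ k * cmod (d k x) < 1"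
        using p powr_less_cancel2[of p "2 ^ k * cmod (d k x)" 1] by (cases "d k x = 0") auto
      then show ?case by (simp add: field_simps power_divide)
    qed
    then have "summable (\<lambda>k. d k x)"
      by (rule summable_comparison_test_ev) (simp add: summable_geometric)
    then have "summable (\<lambda>k. u (r (Suc k)) x - u (r k) x)"
      using summable_minus[of "\<lambda>k. d k x"] by (simp add: d_def)
    then obtain s where s: "(\<lambda>n. \<Sum>k<n. u (r (Suc k)) x - u (r k) x) \<longlonglongrightarrow> s"
      using summable_LIMSEQ by blast
    have "(\<lambda>n. (\<Sum>k<n. u (r (Suc k)) x - u (r k) x) + u (r 0) x) \<longlonglongrightarrow> s + u (r 0) x"
      by (intro tendsto_intros s)
    moreover have "(\<Sum>k<n. u (r (Suc k)) x - u (r k) x) = u (r n) x - u (r 0) x" for n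
      by (rule sum_lessThan_telescope)
    ultimately show "convergent (\<lambda>k. u (r k) x)"
      using convergentI by simp
  qed
  define f where "f x = lim (\<lambda>k. u (r k) x)" for x
  have f[measurable]: "f \<in> borel_measurable M" unfolding f_def by measurable
  have lim: "AE x in M. (\<lambda>k. u (r k) x) \<longlonglongrightarrow> f x"
    using conv by eventually_elim (simp add: f_def convergent_LIMSEQ_iff)
  have close: "(\<lambda>x. u n x - f x) \<in> Lp_fun p M \<and> Ip p M (\<lambda>x. u n x - f x) \<le> e"
    if e: "0 < e" and N: "\<And>m. m \<ge> N \<Longrightarrow> Ip p M (\<lambda>x. u n x - u m x) < e" for n N e
  proof -
    have "(\<integral>\<^sup>+x. ennreal (cmod (u n x - f x) powr p) \<partial>M)
      = (\<integral>\<^sup>+x. liminf (\<lambda>k. ennreal (cmod (u n x - u (r k) x) powr p)) \<partial>M)"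
    proof (rule nn_integral_cong_AE)
      show "AE x in M. ennreal (cmod (u n x - f x) powr p) = liminf (\<lambda>k. ennreal (cmod (u n x - u (r k) x) powr p))"
        using lim
      proof eventually_elim
        case (elim x)
        have "(\<lambda>k. ennreal (cmod (u n x - u (r k) x) powr p)) \<longlonglongrightarrow> ennreal (cmod (u n x - f x) powr p)"
          using p by (intro tendsto_ennrealI tendsto_powr2 tendsto_intros elim) auto
        then show ?case by (metis lim_imp_Liminf trivial_limit_sequentially)
      qed
    qed
    also have "\<dots> \<le> liminf (\<lambda>k. \<integral>\<^sup>+x. ennreal (cmod (u n x - u (r k) x) powr p) \<partial>M)"
      by (rule nn_integral_liminf) measurable
    also have "\<dots> \<le> ennreal e"
    proof (rule Liminf_le)
      have "\<forall>\<^sub>F k in sequentially. r k \<ge> N"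
        using filterlim_subseq[OF r] by (simp add: filterlim_at_top)
      then show "\<forall>\<^sub>F k in sequentially. (\<integral>\<^sup>+x. ennreal (cmod (u n x - u (r k) x) powr p) \<partial>M) \<le> ennreal e"
        by eventually_elim
          (simp only: nn_integral_Lp[OF diff_in[OF L L]], rule ennreal_leI, rule less_imp_le, rule N)
    qed auto
    finally show ?thesis using Lp_funI_nn[of "\<lambda>x. u n x - f x" M p e] e by auto
  qed
  obtain N where "\<And>m n. m \<ge> N \<Longrightarrow> n \<ge> N \<Longrightarrow> Ip p M (\<lambda>x. u m x - u n x) < 1"
    using ex[of 1] by auto
  then have "(\<lambda>x. u N x - f x) \<in> Lp_fun p M" using close[of 1 N N] by auto
  then have fL: "f \<in> Lp_fun p M" using diff_in[OF L[of N], of "\<lambda>x. u N x - f x"] by simp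
  show ?thesis
  proof (intro bexI[OF _ fL] LIMSEQ_I)
    fix e :: real assume e: "0 < e"
    obtain N where N: "\<And>m n. m \<ge> N \<Longrightarrow> n \<ge> N \<Longrightarrow> Ip p M (\<lambda>x. u m x - u n x) < e/2"
      using ex[of "e/2"] e by auto
    show "\<exists>no. \<forall>n\<ge>no. norm (Ip p M (\<lambda>x. u n x - f x) - 0) < e"
    proof (intro exI allI impI)
      fix n assume "N \<le> n"
      then have "Ip p M (\<lambda>x. u n x - f x) \<le> e/2" using close[of "e/2" N n] N e by auto
      then show "norm (Ip p M (\<lambda>x. u n x - f x) - 0) < e"
        using nonneg[OF diff_in[OF L[of n] fL]] e by simp
    qed
  qed
qed

section \<open>Uniform convexity and the dual of \<open>L\<^sup>p\<close>\<close>

text \<open>Mean value theorem on both halves of the interval: the derivative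
  \<open>q * x powr (q - 1)\<close> is strictly larger on the right half.\<close>

lemma powr_strict_midpoint:
  fixes u v q :: real
  assumes q: "1 < q" and u: "0 \<le> u" "u < v"
  shows "((u + v) / 2) powr q < (u powr q + v powr q) / 2"
proof -
  define m where "m = (u + v) / 2"
  have m: "u < m" "m < v" using u by (auto simp: m_def)
  have cont: "continuous_on {a..b} (\<lambda>x. x powr q)" if "0 \<le> a" for a b :: real
    using that q by (intro continuous_on_powr' continuous_intros) auto
  have der: "((\<lambda>x. x powr q) has_real_derivative q * x powr (q - 1)) (at x)" if "0 < x" for x :: real
    using that by (auto intro!: derivative_eq_intros simp: powr_diff field_simps)
  have mvt: "\<exists>z. a < z \<and> z < b \<and> b powr q - a powr q = (b - a) * (q * z powr (q - 1))"
    if ab: "0 \<le> a" "a < b" for a b :: real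
  proof -
    obtain l z where "a < z" "z < b" and z: "((\<lambda>x. x powr q) has_real_derivative l) (at z)"
        "b powr q - a powr q = (b - a) * l"
      using MVT[OF ab(2) cont[OF ab(1)]] der ab real_differentiable_def
      by (metis le_less_trans)
    moreover have "l = q * z powr (q - 1)"
      using DERIV_unique[OF z(1) der[of z]] ab \<open>a < z\<close> by simp
    ultimately show ?thesis by blast
  qed
  obtain z where z: "u < z" "z < m" "m powr q - u powr q = (m - u) * (q * z powr (q - 1))"
    using mvt[of u m] m u by auto
  obtain w where w: "m < w" "w < v" "v powr q - m powr q = (v - m) * (q * w powr (q - 1))"
    using mvt[of m v] m u by auto
  have "z powr (q - 1) < w powr (q - 1)" using z w u q by (intro powr_less_mono2) auto
  then have "(m - u) * (q * z powr (q - 1)) < (m - u) * (q * w powr (q - 1))"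
    using m q by simp
  also have "m - u = v - m" by (simp add: m_def field_simps)
  finally have "m powr q - u powr q < v powr q - m powr q"
    using z(3) w(3) \<open>m - u = v - m\<close> by simp
  then show ?thesis by (simp add: m_def)
qed

text \<open>Different moduli reduce to the real case; for equal moduli the parallelogram law makes
  the midpoint strictly shorter.\<close>

lemma powr_norm_strict_midpoint:
  fixes a b :: complex
  assumes q: "1 < q" and ne: "a \<noteq> b"
  shows "cmod ((a + b) / 2) powr q < (cmod a powr q + cmod b powr q) / 2"
proof -
  have le: "cmod ((a + b) / 2) \<le> (cmod a + cmod b) / 2"
    using norm_triangle_ineq[of a b] by (simp add: norm_divide)
  consider "cmod a < cmod b" | "cmod b < cmod a" | "cmod a = cmod b" by linarith
  then show ?thesis
  proof cases
    case 1
    have "cmod ((a + b) / 2) powr q \<le> ((cmod a + cmod b) / 2) powr q" using q le by (intro powr_mono2) auto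
    then show ?thesis using powr_strict_midpoint[OF q _ 1] by simp
  next
    case 2
    have "cmod ((a + b) / 2) powr q \<le> ((cmod a + cmod b) / 2) powr q" using q le by (intro powr_mono2) auto
    then show ?thesis using powr_strict_midpoint[OF q _ 2] by (simp add: add.commute)
  next
    case 3
    have "(cmod (a + b))\<^sup>2 + (cmod (a - b))\<^sup>2 = 2 * (cmod a)\<^sup>2 + 2 * (cmod b)\<^sup>2"
      unfolding cmod_power2 by (simp add: power2_eq_square algebra_simps)
    moreover have "0 < (cmod (a - b))\<^sup>2" using ne by simp
    ultimately have "(cmod (a + b))\<^sup>2 < (2 * cmod a)\<^sup>2" using 3 by (simp add: power2_eq_square)
    then have "cmod (a + b) < 2 * cmod a" by (rule power2_less_imp_less) simp
    then have "cmod ((a + b) / 2) < cmod a" by (simp add: norm_divide)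
    then have "cmod ((a + b) / 2) powr q < cmod a powr q" using q by (intro powr_less_mono2) auto
    then show ?thesis using 3 by simp
  qed
qed

text \<open>
  The defect on the right is homogeneous and, by strict convexity, positive on the compact set of
  \<open>(a, b)\<close> in the unit sphere with \<open>|a - b|\<^sup>q \<ge> \<delta>\<close>.
\<close>

lemma uniform_convexity_powr:
  fixes q \<delta> :: real
  assumes q: "1 < q" and \<delta>: "0 < \<delta>"
  shows "\<exists>K>0. \<forall>a b. cmod (a - b) powr q \<le> \<delta> * (cmod a powr q + cmod b powr q)
    + K * ((cmod a powr q + cmod b powr q) / 2 - cmod ((a + b) / 2) powr q)"
proof -
  define G where "G = (\<lambda>z::complex \<times> complex. (cmod (fst z) powr q + cmod (snd z) powr q) / 2
    - cmod ((fst z + snd z) / 2) powr q)"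
  define N where "N = (\<lambda>z::complex \<times> complex. cmod (fst z) powr q + cmod (snd z) powr q)"
  define D where "D = (\<lambda>z::complex \<times> complex. cmod (fst z - snd z) powr q)"
  have cont: "continuous_on UNIV G" "continuous_on UNIV N" "continuous_on UNIV D"
    unfolding G_def N_def D_def using q
    by (auto intro!: continuous_intros continuous_on_powr')
  define S where "S = {z. N z = 1 \<and> \<delta> \<le> D z}"
  have "closed S"
    unfolding S_def by (intro closed_Collect_conj closed_Collect_eq closed_Collect_le cont continuous_intros)
  moreover have "bounded S"
  proof (rule boundedI)
    fix z assume "z \<in> S"
    then have "N z = 1" by (simp add: S_def)
    then have "cmod (fst z) powr q \<le> 1 powr q" "cmod (snd z) powr q \<le> 1 powr q"
      unfolding N_def using powr_ge_zero[of "cmod (fst z)" q] powr_ge_zero[of "cmod (snd z)" q]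
      by (simp_all del: powr_ge_zero)
    then have "cmod (fst z) \<le> 1" "cmod (snd z) \<le> 1"
      using q powr_less_mono2[of q 1 "cmod (fst z)"] powr_less_mono2[of q 1 "cmod (snd z)"]
      by (simp_all add: not_less[symmetric]) fastforce+
    then show "norm z \<le> 2" using norm_Pair_le[of "fst z" "snd z"] by simp
  qed
  ultimately have S: "compact S" by (simp add: compact_eq_bounded_closed)
  have pos: "0 < G z" if "z \<in> S" for z
    using that \<delta> q powr_norm_strict_midpoint[OF q, of "fst z" "snd z"]
    by (cases "fst z = snd z") (auto simp: S_def D_def G_def)
  obtain \<eta> where \<eta>: "0 < \<eta>" "\<And>z. z \<in> S \<Longrightarrow> \<eta> \<le> G z"
  proof (cases "S = {}")
    case True then show ?thesis using that[of 1] by auto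
  next
    case False
    then obtain z where "z \<in> S" "\<And>y. y \<in> S \<Longrightarrow> G z \<le> G y"
      using continuous_attains_inf[OF S _ continuous_on_subset[OF cont(1)]] by auto
    then show ?thesis using that pos by blast
  qed
  \<comment> \<open>On \<open>S\<close> the defect is at least \<open>\<eta>\<close>, so
    \<open>K * G z\<close> is at least \<open>2 powr q\<close>, the crude bound for \<open>D\<close>
    where \<open>N z = 1\<close>. Off \<open>S\<close> the term with \<open>\<delta>\<close>
    suffices.\<close>
  define K where "K = 2 powr q / \<eta>"
  have K: "0 < K" using \<eta> by (simp add: K_def)
  have G0: "0 \<le> G z" for z
    using q powr_norm_strict_midpoint[OF q, of "fst z" "snd z"]
    by (cases "fst z = snd z") (auto simp: G_def less_imp_le)
  have unit: "D z \<le> \<delta> * N z + K * G z" if z: "N z = 1" for z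
  proof (cases "\<delta> \<le> D z")
    case True
    then have "\<eta> \<le> G z" using \<eta> z by (simp add: S_def)
    then have "2 powr q \<le> K * G z" using \<eta>(1) by (simp add: K_def field_simps)
    moreover have "D z \<le> 2 powr q * N z"
    proof -
      have "D z \<le> (cmod (fst z) + cmod (snd z)) powr q"
        unfolding D_def using q by (intro powr_mono2 norm_triangle_ineq4) auto
      also have "\<dots> \<le> 2 powr q * N z" unfolding N_def by (intro powr_quasi q) auto
      finally show ?thesis .
    qed
    ultimately show ?thesis using z \<delta> by simp
  next
    case False
    have "0 \<le> K * G z" using K G0[of z] by simp
    then show ?thesis using False z by (simp del: mult_nonneg_nonneg)
  qed
  have hom: "D (of_real c * a, of_real c * b) = c powr q * D (a, b)"
      "N (of_real c * a, of_real c * b) = c powr q * N (a, b)"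
      "G (of_real c * a, of_real c * b) = c powr q * G (a, b)" if "0 \<le> c" for c a b
  proof -
    have "of_real c * a - of_real c * b = of_real c * (a - b)"
      "(of_real c * a + of_real c * b) / 2 = of_real c * ((a + b) / 2)"
      by (simp_all add: algebra_simps)
    then show "D (of_real c * a, of_real c * b) = c powr q * D (a, b)"
      "N (of_real c * a, of_real c * b) = c powr q * N (a, b)"
      "G (of_real c * a, of_real c * b) = c powr q * G (a, b)"
      using that unfolding D_def N_def G_def fst_conv snd_conv
      by (simp_all only: norm_mult norm_of_real powr_mult abs_of_nonneg norm_ge_zero)
        (simp_all add: algebra_simps)
  qed
  have "D (a, b) \<le> \<delta> * N (a, b) + K * G (a, b)" for a b
  proof (cases "N (a, b) = 0")
    case True
    then have "a = 0 \<and> b = 0"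
      unfolding N_def fst_conv snd_conv by (metis add_nonneg_eq_0_iff powr_ge_zero powr_eq_0_iff norm_eq_zero)
    then show ?thesis by (simp add: D_def N_def G_def)
  next
    case False
    then have Np: "0 < N (a, b)" unfolding N_def by (simp add: order_less_le)
    \<comment> \<open>Scaling by \<open>c\<close> brings \<open>N\<close> to 1. All three functions
      are homogeneous of degree \<open>q\<close>, so the inequality scales back.\<close>
    define c where "c = N (a, b) powr (- 1 / q)"
    have c: "0 \<le> c" by (simp add: c_def)
    have cq: "c powr q = 1 / N (a, b)" unfolding c_def powr_powr using q Np by (simp add: powr_minus_divide)
    have "D (of_real c * a, of_real c * b) \<le> \<delta> * N (of_real c * a, of_real c * b) + K * G (of_real c * a, of_real c * b)"
      by (rule unit) (use hom(2)[OF c] cq False in simp)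
    then have "D (a, b) / N (a, b) \<le> (\<delta> * N (a, b) + K * G (a, b)) / N (a, b)"
      unfolding hom[OF c] cq add_divide_distrib by (simp only: times_divide_eq_left times_divide_eq_right mult_1)
    then show ?thesis using divide_le_cancel[of "D (a, b)" "N (a, b)"] Np by (meson less_asym)
  qed
  then show ?thesis using K unfolding D_def N_def G_def by auto
qed

text \<open>The conjugate of the gradient of \<open>\<lambda>z. cmod z powr q / q\<close>, that is,
  the duality map of \<open>L^q\<close> taken pointwise. The factor \<open>cnj z\<close> makes the
  value at 0 equal to 0 for every \<open>q\<close>.\<close>

definition dual :: "real \<Rightarrow> complex \<Rightarrow> complex" where
  "dual q z = of_real (cmod z powr (q - 2)) * cnj z"

lemma cmod_dual: "1 < q \<Longrightarrow> cmod (dual q z) = cmod z powr (q - 1)"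
  using powr_mult_base[of "cmod z" "q - 2"] by (simp add: dual_def norm_mult mult.commute)

lemma dual_mult: "1 < q \<Longrightarrow> dual q z * z = of_real (cmod z powr q)"
proof -
  assume q: "1 < q"
  have "dual q z * z = of_real (cmod z powr (q - 2)) * (z * cnj z)" by (simp add: dual_def mult_ac)
  also have "\<dots> = of_real (cmod z powr (q - 2) * (cmod z * cmod z))"
    by (simp add: complex_norm_square[symmetric] power2_eq_square)
  also have "cmod z powr (q - 2) * (cmod z * cmod z) = cmod z powr q"
    using powr_mult_base[of "cmod z" "q - 2"] powr_mult_base[of "cmod z" "q - 1"] by (simp add: mult_ac)
  finally show ?thesis .
qed

lemma isCont_dual:
  assumes q: "1 < q" shows "isCont (dual q) z"
proof (cases "z = 0")
  case True
  have "(\<lambda>w. cmod (dual q w)) \<midarrow>0\<rightarrow> 0"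
    unfolding cmod_dual[OF q]
    using q by (intro tendsto_zero_powrI[where b = "q - 1"] tendsto_eq_intros) (auto intro: tendsto_norm_zero tendsto_ident_at)
  then have "dual q \<midarrow>0\<rightarrow> 0" by (rule tendsto_norm_zero_cancel)
  then show ?thesis using True by (simp add: isCont_def dual_def[of q 0])
next
  case False
  then show ?thesis unfolding dual_def[abs_def] by (intro continuous_intros) auto
qed

lemma dual_measurable [measurable]: "1 < q \<Longrightarrow> dual q \<in> borel_measurable borel"
  by (intro borel_measurable_continuous_onI continuous_at_imp_continuous_on ballI isCont_dual)

text \<open>The tangent inequality at \<open>a\<close> of the convex function
  \<open>\<lambda>z. cmod z powr q\<close>. It is Young's inequality for
  \<open>cmod a powr (q - 1)\<close> and \<open>cmod b\<close>, rearranged.\<close>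

lemma dual_tangent:
  assumes q: "1 < q"
  shows "q * Re (dual q a * (b - a)) \<le> cmod b powr q - cmod a powr q"
proof -
  define p where "p = q / (q - 1)"
  have p: "1 < p" "1 / p + 1 / q = 1" "(q - 1) * p = q" using q by (auto simp: p_def field_simps)
  have "Re (dual q a * b) \<le> cmod a powr (q - 1) * cmod b"
    using complex_Re_le_cmod[of "dual q a * b"] by (simp add: norm_mult cmod_dual[OF q])
  also have "\<dots> \<le> (cmod a powr (q - 1)) powr p / p + cmod b powr q / q"
    by (rule Youngs_inequality) (use p q in auto)
  also have "\<dots> = cmod a powr q * (1 - 1 / q) + cmod b powr q / q"
    using p by (simp add: powr_powr) (metis add_diff_cancel_right' divide_inverse inverse_eq_divide)
  finally have "q * Re (dual q a * b) \<le> q * (cmod a powr q * (1 - 1 / q) + cmod b powr q / q)"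
    using q by simp
  also have "\<dots> = (q - 1) * cmod a powr q + cmod b powr q" using q by (simp add: field_simps)
  finally show ?thesis using dual_mult[OF q, of a] by (simp add: algebra_simps)
qed

lemma dual_integrable:
  assumes q: "1 < q" and f: "f \<in> Lp_fun q M" and g: "g \<in> Lp_fun q M"
  shows "integrable M (\<lambda>x. dual q (f x) * g x)"
proof (rule Bochner_Integration.integrable_bound)
  have [measurable]: "f \<in> borel_measurable M" "g \<in> borel_measurable M"
    using f g by (auto simp: Lp_fun_def)
  note dual_measurable[OF q, measurable]
  show "(\<lambda>x. dual q (f x) * g x) \<in> borel_measurable M" by measurable
  show "integrable M (\<lambda>x. 2 powr q * (cmod (f x) powr q + cmod (g x) powr q))"
    by (intro integrable_mult_right Bochner_Integration.integrable_add Lp_fun_integrable f g)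
  show "AE x in M. norm (dual q (f x) * g x) \<le> norm (2 powr q * (cmod (f x) powr q + cmod (g x) powr q))"
  proof (rule AE_I2)
    fix x
    have "norm (dual q (f x) * g x) = cmod (f x) powr (q - 1) * cmod (g x)"
      by (simp add: norm_mult cmod_dual[OF q])
    also have "\<dots> \<le> (cmod (f x) + cmod (g x)) powr (q - 1) * (cmod (f x) + cmod (g x))"
      using q by (intro mult_mono powr_mono2) auto
    also have "\<dots> = (cmod (f x) + cmod (g x)) powr q"
      using powr_mult_base[of "cmod (f x) + cmod (g x)" "q - 1"] by (simp add: mult.commute)
    also have "\<dots> \<le> 2 powr q * (cmod (f x) powr q + cmod (g x) powr q)"
      by (intro powr_quasi q) auto
    finally show "norm (dual q (f x) * g x) \<le> norm (2 powr q * (cmod (f x) powr q + cmod (g x) powr q))"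
      by simp
  qed
qed

text \<open>
  Minimizers of \<open>\<parallel>y\<parallel>\<^sup>q - q Re (\<phi> y)\<close> exist by uniform convexity, and the Euler equation represents \<open>\<phi>\<close>.
  No \<open>\<sigma>\<close>-finiteness is needed, in contrast to the argument by the Radon-Nikodym theorem.
\<close>

theorem Riesz_representation_Lp:
  fixes \<phi> :: "('a \<Rightarrow> complex) \<Rightarrow> complex"
  assumes p: "1 < p" and q: "1 < q" and pq: "1 / p + 1 / q = 1" and C: "0 \<le> C"
    and add: "\<And>f g. f \<in> Lp_fun q M \<Longrightarrow> g \<in> Lp_fun q M \<Longrightarrow> \<phi> (\<lambda>x. f x + g x) = \<phi> f + \<phi> g"
    and scale: "\<And>c f. f \<in> Lp_fun q M \<Longrightarrow> \<phi> (\<lambda>x. c * f x) = c * \<phi> f"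
    and bound: "\<And>f. f \<in> Lp_fun q M \<Longrightarrow> cmod (\<phi> f) \<le> C * Ip q M f powr (1 / q)"
  shows "\<exists>g\<in>Lp_fun p M. Ip p M g \<le> C powr p \<and> (\<forall>f\<in>Lp_fun q M. \<phi> f = (\<integral>x. g x * f x \<partial>M))"
proof -
  interpret Q: plattice q "Lp_fun q M" "Ip q M" by (rule plattice_Lp[OF q])
  let ?L = "Lp_fun q M"
  have nmp: "Q.nm y powr q = Ip q M y" if "y \<in> ?L" for y by (rule Q.nm_powr[OF that])
  have bound': "cmod (\<phi> y) \<le> C * Q.nm y" if "y \<in> ?L" for y using bound[OF that] by (simp add: Q.nm_def)
  have diff: "\<phi> (\<lambda>x. f x - g x) = \<phi> f - \<phi> g" if "f \<in> ?L" "g \<in> ?L" for f g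
    using add[OF that(1) Q.scale_in[OF that(2), of "-1"]] scale[OF that(2), of "-1"] by simp
  define I where "I y = Ip q M y - q * Re (\<phi> y)" for y
  \<comment> \<open>Young's inequality with \<open>2 * C\<close> in place of \<open>C\<close> leaves
    half of \<open>Ip q M y\<close> over; this makes \<open>I\<close> coercive and minimizing
    sequences bounded.\<close>
  define E where "E = q * ((2 * C) powr p / p)"
  have low: "Ip q M y / 2 - E / 2 \<le> I y" if y: "y \<in> ?L" for y
  proof -
    have "(2 * C) * Q.nm y \<le> (2 * C) powr p / p + Q.nm y powr q / q"
      by (rule Youngs_inequality) (use p q pq C Q.nm_nonneg in auto)
    then have "q * ((2 * C) * Q.nm y) \<le> q * ((2 * C) powr p / p + Q.nm y powr q / q)"
      using q by (intro mult_left_mono) auto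
    also have "\<dots> = E + Ip q M y" using q by (simp add: E_def nmp[OF y] field_simps)
    finally have 1: "q * (C * Q.nm y) \<le> (E + Ip q M y) / 2" by simp
    have "q * Re (\<phi> y) \<le> q * (C * Q.nm y)"
      using q order_trans[OF complex_Re_le_cmod bound'[OF y]] by (intro mult_left_mono) auto
    then show ?thesis using 1 by (simp add: I_def field_simps)
  qed
  have bdd: "bdd_below (I ` ?L)"
  proof (rule bdd_belowI2)
    fix y assume "y \<in> ?L"
    then show "- E / 2 \<le> I y" using low[of y] Q.nonneg[of y] by simp
  qed
  define m where "m = (INF y\<in>?L. I y)"
  have m: "m \<le> I y" if "y \<in> ?L" for y unfolding m_def by (rule cINF_lower[OF bdd that])
  have "\<exists>y\<in>?L. I y < m + 1 / real (Suc n)" for n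
    using cInf_lessD[of "I ` ?L" "m + 1 / real (Suc n)"] Q.zero_in unfolding m_def by auto
  then obtain y where y: "\<And>n. y n \<in> ?L" "\<And>n. I (y n) < m + 1 / real (Suc n)" by metis
  define B where "B = 2 * (m + 1) + E"
  have B: "Ip q M (y n) \<le> B" for n
  proof -
    have "I (y n) < m + 1" by (rule less_le_trans[OF y(2)]) simp
    then show ?thesis using low[OF y(1)[of n]] unfolding B_def by argo
  qed
  have B0: "0 \<le> B" using B[of 0] Q.nonneg[OF y(1)[of 0]] by simp
  have "Q.cauchy y" unfolding Q.cauchy_def
  proof (intro conjI allI impI y)
    fix e :: real assume e: "0 < e"
    \<comment> \<open>Chosen so that the error \<open>\<delta> * (B + B)\<close> of the uniform
      convexity estimate is at most \<open>e / 2\<close>; the 1 covers \<open>B = 0\<close>.\<close>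
    define \<delta> where "\<delta> = e / (4 * (B + 1))"
    have \<delta>: "0 < \<delta>" using e B0 by (simp add: \<delta>_def)
    obtain K where K: "0 < K" and UC: "\<And>a b. cmod (a - b) powr q \<le> \<delta> * (cmod a powr q + cmod b powr q)
        + K * ((cmod a powr q + cmod b powr q) / 2 - cmod ((a + b) / 2) powr q)"
      using uniform_convexity_powr[OF q \<delta>] by blast
    have main: "Ip q M (\<lambda>x. y j x - y k x) \<le> e / 2 + K * ((1 / real (Suc j) + 1 / real (Suc k)) / 2)" for j k
    proof -
      let ?mid = "\<lambda>x. (y j x + y k x) / 2"
      have mid: "?mid \<in> ?L" using Q.lin_in[OF y(1)[of j] y(1)[of k], of "1/2" "1/2"] by (simp add: add_divide_distrib)
      have lmid: "\<phi> ?mid = (\<phi> (y j) + \<phi> (y k)) / 2"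
        using scale[OF Q.add_in[OF y(1)[of j] y(1)[of k]], of "1/2"] add[OF y(1)[of j] y(1)[of k]] by simp
      note int = Lp_fun_integrable[OF y(1)[of j]] Lp_fun_integrable[OF y(1)[of k]] Lp_fun_integrable[OF mid]
      have "Ip q M (\<lambda>x. y j x - y k x) \<le> (\<integral>x. \<delta> * (cmod (y j x) powr q + cmod (y k x) powr q)
        + K * ((cmod (y j x) powr q + cmod (y k x) powr q) / 2 - cmod (?mid x) powr q) \<partial>M)"
        unfolding Ip_def
        by (intro integral_mono UC Bochner_Integration.integrable_add Bochner_Integration.integrable_diff
            integrable_mult_right integrable_divide int Lp_fun_integrable Q.diff_in y)
      also have "\<dots> = \<delta> * (Ip q M (y j) + Ip q M (y k)) + K * ((Ip q M (y j) + Ip q M (y k)) / 2 - Ip q M ?mid)"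
        unfolding Ip_def using int by simp
      \<comment> \<open>\<open>\<phi>\<close> is linear and cancels, so the convexity defect of the
        norm is that of \<open>I\<close>. It is small since \<open>I\<close> at the midpoint is no
        less than the infimum \<open>m\<close>, which the sequence nearly attains.\<close>
      also have "(Ip q M (y j) + Ip q M (y k)) / 2 - Ip q M ?mid = (I (y j) + I (y k)) / 2 - I ?mid"
        by (simp add: I_def lmid field_simps)
      also have "\<delta> * (Ip q M (y j) + Ip q M (y k)) + K * ((I (y j) + I (y k)) / 2 - I ?mid)
        \<le> \<delta> * (B + B) + K * ((1 / real (Suc j) + 1 / real (Suc k)) / 2)"
      proof (intro add_mono mult_left_mono B less_imp_le[OF \<delta>] less_imp_le[OF K])
        show "(I (y j) + I (y k)) / 2 - I ?mid \<le> (1 / real (Suc j) + 1 / real (Suc k)) / 2"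
          using y(2)[of j] y(2)[of k] m[OF mid] by argo
      qed
      also have "\<delta> * (B + B) \<le> e / 2"
      proof -
        have "\<delta> * (B + B) \<le> \<delta> * (2 * (B + 1))" using \<delta> by (intro mult_left_mono) auto
        also have "\<dots> = e / 2" using B0 by (simp add: \<delta>_def field_simps)
        finally show ?thesis .
      qed
      finally show ?thesis by simp
    qed
    obtain N where N: "K / real (Suc N) < e / 2"
      using order_tendstoD(2)[OF LIMSEQ_Suc[OF lim_const_over_n[of K]], of "e/2"] e
      by (auto simp: eventually_sequentially)
    show "\<exists>N. \<forall>j\<ge>N. \<forall>k\<ge>N. Ip q M (\<lambda>x. y j x - y k x) < e"
    proof (intro exI allI impI)
      fix j k assume jk: "N \<le> j" "N \<le> k"
      have "1 / real (Suc i) \<le> 1 / real (Suc N)" if "N \<le> i" for i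
        using that by (intro divide_left_mono) auto
      then have "K * ((1 / real (Suc j) + 1 / real (Suc k)) / 2) \<le> K * ((1 / real (Suc N) + 1 / real (Suc N)) / 2)"
        using jk K by (intro mult_left_mono divide_right_mono add_mono) auto
      moreover have "K * ((1 / real (Suc N) + 1 / real (Suc N)) / 2) = K / real (Suc N)"
        by (simp add: field_simps del: of_nat_Suc)
      ultimately show "Ip q M (\<lambda>x. y j x - y k x) < e" using main[of j k] N by argo
    qed
  qed
  then obtain z where z: "z \<in> ?L" "(\<lambda>n. Ip q M (\<lambda>x. y n x - z x)) \<longlonglongrightarrow> 0"
    using Riesz_Fischer[OF q] by blast
  have "(\<lambda>n. Ip q M (y n)) \<longlonglongrightarrow> Ip q M z"
    by (rule Q.tendsto_\<Phi>[OF _ z]) (simp add: y)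
  moreover have "(\<lambda>n. \<phi> (y n)) \<longlonglongrightarrow> \<phi> z"
  proof -
    have "(\<lambda>n. C * Q.nm (\<lambda>x. y n x - z x)) \<longlonglongrightarrow> C * 0"
      using Q.nm_tendsto_0_iff[of "\<lambda>n x. y n x - z x" sequentially] z Q.diff_in[OF y(1) z(1)]
      by (intro tendsto_mult_left) auto
    then have "(\<lambda>n. \<phi> (y n) - \<phi> z) \<longlonglongrightarrow> 0"
      using bound'[OF Q.diff_in[OF y(1) z(1)]]
      by (intro Lim_null_comparison[of "\<lambda>n. \<phi> (y n) - \<phi> z" "\<lambda>n. C * Q.nm (\<lambda>x. y n x - z x)"])
        (auto simp: diff y z)
    then show ?thesis by (simp add: LIM_zero_iff)
  qed
  ultimately have "(\<lambda>n. I (y n)) \<longlonglongrightarrow> I z" unfolding I_def by (intro tendsto_intros)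
  moreover have "(\<lambda>n. m + 1 / real (Suc n)) \<longlonglongrightarrow> m + 0"
    by (intro tendsto_intros LIMSEQ_Suc lim_1_over_n)
  ultimately have zm: "I z \<le> m + 0"
    by (rule LIMSEQ_le) (use y(2) in \<open>auto intro: less_imp_le\<close>)
  \<comment> \<open>First variation at the minimizer. The tangent inequality is used at the
    perturbed point \<open>w n\<close>, where it bounds the increase from above by a term linear in
    \<open>t n\<close>; after division by \<open>t n\<close>, letting \<open>n\<close> grow moves
    the point back to \<open>z\<close>.\<close>
  have var: "Re (\<phi> f) \<le> Re (\<integral>x. dual q (z x) * f x \<partial>M)" if f: "f \<in> ?L" for f
  proof -
    define t where "t n = 1 / real (Suc n)" for n
    define w where "w n x = z x + of_real (t n) * f x" for n x
    have t: "0 < t n" "t n \<le> 1" for n by (auto simp: t_def)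
    have w: "w n \<in> ?L" for n unfolding w_def by (intro Q.add_in z Q.scale_in f)
    have wle: "cmod (w n x) \<le> cmod (z x) + cmod (f x)" for n x
    proof -
      have "cmod (w n x) \<le> cmod (z x) + t n * cmod (f x)"
        unfolding w_def using t(1)[of n] by (metis norm_triangle_ineq norm_mult norm_of_real abs_of_pos)
      also have "t n * cmod (f x) \<le> 1 * cmod (f x)" using t by (intro mult_right_mono) auto
      finally show ?thesis by simp
    qed
    have step: "Re (\<phi> f) \<le> Re (\<integral>x. dual q (w n x) * f x \<partial>M)" for n
    proof -
      have "I z \<le> I (w n)" using zm m[OF w[of n]] by simp
      moreover have "\<phi> (w n) = \<phi> z + of_real (t n) * \<phi> f"
        unfolding w_def by (simp add: add z f Q.scale_in scale)
      ultimately have "q * t n * Re (\<phi> f) \<le> Ip q M (w n) - Ip q M z"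
        by (simp add: I_def algebra_simps)
      also have "\<dots> = (\<integral>x. cmod (w n x) powr q - cmod (z x) powr q \<partial>M)"
        unfolding Ip_def by (simp add: Lp_fun_integrable w z)
      also have "\<dots> \<le> (\<integral>x. q * t n * Re (dual q (w n x) * f x) \<partial>M)"
      proof (intro integral_mono Bochner_Integration.integrable_diff Lp_fun_integrable w z
          integrable_mult_right integrable_Re dual_integrable q f)
        fix x
        have "z x - w n x = - (of_real (t n) * f x)" by (simp add: w_def)
        then have "q * Re (- of_real (t n) * (dual q (w n x) * f x)) \<le> cmod (z x) powr q - cmod (w n x) powr q"
          using dual_tangent[OF q, of "w n x" "z x"] by (simp add: mult_ac)
        then show "cmod (w n x) powr q - cmod (z x) powr q \<le> q * t n * Re (dual q (w n x) * f x)"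
          by simp
      qed
      also have "\<dots> = q * t n * Re (\<integral>x. dual q (w n x) * f x \<partial>M)"
        by (simp only: integral_mult_right_zero integral_Re[OF dual_integrable[OF q w f]])
      finally show ?thesis using q t[of n] by simp
    qed
    have "(\<lambda>n. \<integral>x. dual q (w n x) * f x \<partial>M) \<longlonglongrightarrow> (\<integral>x. dual q (z x) * f x \<partial>M)"
    proof (rule integral_dominated_convergence)
      have [measurable]: "f \<in> borel_measurable M" "z \<in> borel_measurable M" "\<And>n. w n \<in> borel_measurable M"
        using f z w by (auto simp: Lp_fun_def)
      note dual_measurable[OF q, measurable]
      show "(\<lambda>x. dual q (z x) * f x) \<in> borel_measurable M" "\<And>n. (\<lambda>x. dual q (w n x) * f x) \<in> borel_measurable M"
        by measurable
      have "(\<lambda>x. complex_of_real (cmod (z x) + cmod (f x) + cmod (f x))) \<in> ?L"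
        using Q.norm_add_in[OF Q.norm_add_in[OF z(1) f] f] by (simp del: of_real_add)
      then have "integrable M (\<lambda>x. cmod (complex_of_real (cmod (z x) + cmod (f x) + cmod (f x))) powr q)"
        by (rule Lp_fun_integrable)
      then show "integrable M (\<lambda>x. (cmod (z x) + cmod (f x) + cmod (f x)) powr q)"
        by (simp del: of_real_add)
      show "AE x in M. (\<lambda>n. dual q (w n x) * f x) \<longlonglongrightarrow> dual q (z x) * f x"
      proof (rule AE_I2)
        fix x
        have "(\<lambda>n. w n x) \<longlonglongrightarrow> z x + of_real 0 * f x"
          unfolding w_def t_def by (intro tendsto_intros LIMSEQ_Suc lim_1_over_n)
        then show "(\<lambda>n. dual q (w n x) * f x) \<longlonglongrightarrow> dual q (z x) * f x"
          by (intro tendsto_mult_right isCont_tendsto_compose[OF isCont_dual[OF q]]) simp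
      qed
      show "AE x in M. norm (dual q (w n x) * f x) \<le> (cmod (z x) + cmod (f x) + cmod (f x)) powr q" for n
      proof (rule AE_I2)
        fix x
        let ?s = "cmod (z x) + cmod (f x) + cmod (f x)"
        have "norm (dual q (w n x) * f x) = cmod (w n x) powr (q - 1) * cmod (f x)"
          by (simp add: norm_mult cmod_dual[OF q])
        also have "\<dots> \<le> ?s powr (q - 1) * ?s"
          using q order_trans[OF wle[of n x], of ?s] by (intro mult_mono powr_mono2) auto
        also have "\<dots> = ?s powr q"
          using powr_mult_base[of ?s "q - 1"] by (simp add: mult.commute)
        finally show "norm (dual q (w n x) * f x) \<le> ?s powr q" .
      qed
    qed
    then have "(\<lambda>n. Re (\<integral>x. dual q (w n x) * f x \<partial>M)) \<longlonglongrightarrow> Re (\<integral>x. dual q (z x) * f x \<partial>M)"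
      by (rule tendsto_Re)
    then show ?thesis by (rule LIMSEQ_le_const) (use step in auto)
  qed
  \<comment> \<open>The inequality for \<open>f\<close> and for \<open>- f\<close> gives equality of
    real parts; replacing \<open>f\<close> by \<open>\<i>\<close> times \<open>f\<close> will give
    the imaginary parts.\<close>
  have eqRe: "Re (\<phi> f) = Re (\<integral>x. dual q (z x) * f x \<partial>M)" if f: "f \<in> ?L" for f
    using var[OF f] var[OF Q.scale_in[OF f, of "-1"]] scale[OF f, of "-1"]
    by (simp add: dual_integrable q z f)
  have rep: "\<phi> f = (\<integral>x. dual q (z x) * f x \<partial>M)" if f: "f \<in> ?L" for f
  proof (rule complex_eqI[OF eqRe[OF f]])
    have "Re (\<i> * \<phi> f) = Re (\<integral>x. \<i> * (dual q (z x) * f x) \<partial>M)"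
      using eqRe[OF Q.scale_in[OF f, of \<i>]] scale[OF f, of \<i>] by (simp add: mult.left_commute)
    also have "(\<integral>x. \<i> * (dual q (z x) * f x) \<partial>M) = \<i> * (\<integral>x. dual q (z x) * f x \<partial>M)"
      by (rule integral_mult_right_zero)
    finally show "Im (\<phi> f) = Im (\<integral>x. dual q (z x) * f x \<partial>M)" by simp
  qed
  have pow: "cmod (dual q (z x)) powr p = cmod (z x) powr q" for x
  proof -
    have "(q - 1) * p = q" using pq p q by (simp add: field_simps)
    then show ?thesis by (simp add: cmod_dual[OF q] powr_powr)
  qed
  have zL: "(\<lambda>x. dual q (z x)) \<in> Lp_fun p M"
  proof -
    have [measurable]: "z \<in> borel_measurable M" using z by (simp add: Lp_fun_def)
    note dual_measurable[OF q, measurable]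
    have "(\<lambda>x. dual q (z x)) \<in> borel_measurable M" by measurable
    then show ?thesis using Lp_fun_integrable[OF z(1)] by (simp add: Lp_fun_def pow)
  qed
  have "Ip p M (\<lambda>x. dual q (z x)) \<le> C powr p"
  proof -
    have eq: "Ip p M (\<lambda>x. dual q (z x)) = Ip q M z" by (simp add: Ip_def pow)
    \<comment> \<open>At the minimizer \<open>\<phi> z\<close> is the \<open>q\<close>-th power of
      the norm of \<open>z\<close>, so the bound for \<open>\<phi>\<close> gives
      \<open>Q.nm z powr (q - 1) \<le> C\<close>, and the \<open>p\<close>-th power of this is the
      norm estimate.\<close>
    have "\<phi> z = of_real (Ip q M z)"
      unfolding rep[OF z(1)] dual_mult[OF q] Ip_def by simp
    then have le: "Ip q M z \<le> C * Q.nm z"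
      using bound'[OF z(1)] Q.nonneg[OF z(1)] by simp
    show ?thesis
    proof (cases "Q.nm z = 0")
      case True
      then show ?thesis using nmp[OF z(1)] eq q by (simp add: C)
    next
      case False
      then have n: "0 < Q.nm z" using Q.nm_nonneg[of z] by simp
      have "Q.nm z * Q.nm z powr (q - 1) \<le> C * Q.nm z"
        using le nmp[OF z(1)] powr_mult_base[of "Q.nm z" "q - 1"] n by simp
      then have "Q.nm z powr (q - 1) \<le> C" using n by (simp add: mult.commute)
      then have "(Q.nm z powr (q - 1)) powr p \<le> C powr p" using p by (intro powr_mono2) auto
      moreover have "(q - 1) * p = q" using pq p q by (simp add: field_simps)
      ultimately show ?thesis by (simp add: powr_powr nmp[OF z(1)] eq)
    qed
  qed
  then show ?thesis using zL rep by (intro bexI[OF _ zL]) auto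
qed

section \<open>Measures on sets of ultrafilters\<close>

text \<open>
  \<open>U z\<close> is an ultrafilter; by \<open>compact\<close>, \<open>Z\<close> contains enough of them for a finitely additive \<open>\<nu>\<close>
  to become countably additive on the sets \<open>{z \<in> Z. A \<in> U z}\<close>.
\<close>

locale stone =
  fixes Z :: "'z set" and U :: "'z \<Rightarrow> 'y set set" and R :: "'y set set" and \<nu> :: "'y set \<Rightarrow> real"
  assumes R_empty: "{} \<in> R" and R_Un: "A \<in> R \<Longrightarrow> B \<in> R \<Longrightarrow> A \<union> B \<in> R"
    and R_Diff: "A \<in> R \<Longrightarrow> B \<in> R \<Longrightarrow> A - B \<in> R"
    and \<nu>_nonneg: "A \<in> R \<Longrightarrow> 0 \<le> \<nu> A"
    and \<nu>_add: "A \<in> R \<Longrightarrow> B \<in> R \<Longrightarrow> A \<inter> B = {} \<Longrightarrow> \<nu> (A \<union> B) = \<nu> A + \<nu> B"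
    and U_mono: "z \<in> Z \<Longrightarrow> A \<in> U z \<Longrightarrow> A \<subseteq> B \<Longrightarrow> B \<in> U z"
    and U_Int: "z \<in> Z \<Longrightarrow> A \<in> U z \<Longrightarrow> B \<in> U z \<Longrightarrow> A \<inter> B \<in> U z"
    and U_empty: "z \<in> Z \<Longrightarrow> {} \<notin> U z"
    and U_ultra: "z \<in> Z \<Longrightarrow> A \<in> U z \<or> - A \<in> U z"
    and compact: "(\<And>n::nat. S n \<in> R) \<Longrightarrow> decseq S \<Longrightarrow> (\<And>n. S n \<noteq> {}) \<Longrightarrow> \<exists>z\<in>Z. \<forall>n. S n \<in> U z"
begin

text \<open>The clopen subset of the Stone space that represents \<open>A\<close>.\<close>

definition hat :: "'y set \<Rightarrow> 'z set" where "hat A = {z \<in> Z. A \<in> U z}"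

lemma R_Int: "A \<in> R \<Longrightarrow> B \<in> R \<Longrightarrow> A \<inter> B \<in> R"
  using R_Diff[OF _ R_Diff, of A A B] by (simp add: Diff_Diff_Int)

lemma R_UN: "finite I \<Longrightarrow> (\<And>i. i \<in> I \<Longrightarrow> A i \<in> R) \<Longrightarrow> (\<Union>i\<in>I. A i) \<in> R"
  by (induction I rule: finite_induct) (auto intro: R_empty R_Un)

lemma \<nu>_empty: "\<nu> {} = 0"
  using \<nu>_add[of "{}" "{}"] R_empty by simp

lemma hat_empty: "hat {} = {}" using U_empty by (auto simp: hat_def)

lemma hat_subset: "hat A \<subseteq> Z" by (auto simp: hat_def)

lemma Compl_U: "z \<in> Z \<Longrightarrow> - A \<in> U z \<longleftrightarrow> A \<notin> U z"
  using U_ultra[of z A] U_Int[of z A "- A"] U_empty[of z] by auto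

lemma Int_U: "z \<in> Z \<Longrightarrow> A \<inter> B \<in> U z \<longleftrightarrow> A \<in> U z \<and> B \<in> U z"
  using U_Int[of z A B] U_mono[of z "A \<inter> B" A] U_mono[of z "A \<inter> B" B] by auto

lemma hat_Int: "hat (A \<inter> B) = hat A \<inter> hat B"
  by (auto simp: hat_def Int_U)

lemma hat_Diff: "hat (A - B) = hat A - hat B"
  by (auto simp: hat_def Diff_eq Int_U Compl_U)

lemma Un_U: "z \<in> Z \<Longrightarrow> A \<union> B \<in> U z \<longleftrightarrow> A \<in> U z \<or> B \<in> U z"
  using Compl_U[of z "- A \<inter> - B"] by (simp add: Int_U Compl_U)

lemma hat_Un: "hat (A \<union> B) = hat A \<union> hat B"
  by (auto simp: hat_def Un_U)

lemma UN_U: "finite I \<Longrightarrow> z \<in> Z \<Longrightarrow> (\<Union>i\<in>I. A i) \<in> U z \<longleftrightarrow> (\<exists>i\<in>I. A i \<in> U z)"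
  by (induction I rule: finite_induct) (auto simp: Un_U U_empty)

lemma UNIV_U: "z \<in> Z \<Longrightarrow> UNIV \<in> U z"
  using Compl_U[of z "{}"] U_empty by simp

lemma hat_UN: "finite I \<Longrightarrow> hat (\<Union>i\<in>I. A i) = (\<Union>i\<in>I. hat (A i))"
  by (auto simp: hat_def UN_U)

text \<open>\<open>compact\<close> for a constant sequence: a nonempty set of \<open>R\<close>
  belongs to some ultrafilter of \<open>Z\<close>. Hence \<open>hat\<close> is injective on
  \<open>R\<close>, and \<nu> can be transported to the sets \<open>hat A\<close>.\<close>

lemma hat_eq_empty: "A \<in> R \<Longrightarrow> hat A = {} \<Longrightarrow> A = {}"
  using compact[of "\<lambda>_. A"] by (auto simp: hat_def decseq_def)

lemma hat_inj: "inj_on hat R"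
proof (rule inj_onI)
  fix A B assume "A \<in> R" "B \<in> R" "hat A = hat B"
  then have "A - B = {}" "B - A = {}"
    using hat_eq_empty[of "A - B"] hat_eq_empty[of "B - A"] by (simp_all add: R_Diff hat_Diff)
  then show "A = B" by auto
qed

abbreviation RZ :: "'z set set" where "RZ \<equiv> hat ` R"

definition f0 :: "'z set \<Rightarrow> ennreal" where "f0 S = ennreal (\<nu> (inv_into R hat S))"

lemma f0_hat: "A \<in> R \<Longrightarrow> f0 (hat A) = ennreal (\<nu> A)"
  by (simp add: f0_def inv_into_f_f[OF hat_inj])

lemma ring_RZ: "ring_of_sets Z RZ"
  unfolding ring_of_sets_iff
proof (intro conjI ballI)
  show "RZ \<subseteq> Pow Z" using hat_subset by auto
  show "{} \<in> RZ" using R_empty hat_empty by force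
  show "a \<union> b \<in> RZ" "a - b \<in> RZ" if "a \<in> RZ" "b \<in> RZ" for a b
    using that by (auto simp: hat_Un[symmetric] hat_Diff[symmetric] intro!: imageI R_Un R_Diff)
qed

lemma f0_positive: "positive RZ f0"
  using f0_hat[OF R_empty] by (simp add: positive_def hat_empty \<nu>_empty)

lemma f0_additive: "additive RZ f0"
  unfolding additive_def
proof safe
  fix A B assume A: "A \<in> R" "B \<in> R" and d: "hat A \<inter> hat B = {}"
  then have "A \<inter> B = {}" by (intro hat_eq_empty R_Int) (auto simp: hat_Int)
  then show "f0 (hat A \<union> hat B) = f0 (hat A) + f0 (hat B)"
    using A by (simp add: hat_Un[symmetric] f0_hat R_Un \<nu>_add \<nu>_nonneg ennreal_plus)
qed

text \<open>Compactness: a decreasing sequence of sets \<open>hat (B n)\<close> with empty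
  intersection is eventually empty. So continuity at the empty set is automatic, and finite
  additivity becomes countable additivity.\<close>

lemma f0_continuous:
  assumes "range A \<subseteq> RZ" "decseq A" "(\<Inter>i. A i) = {}" shows "(\<lambda>i. f0 (A i)) \<longlonglongrightarrow> 0"
proof -
  define B where "B i = inv_into R hat (A i)" for i
  have B: "B i \<in> R" "hat (B i) = A i" for i
    using assms(1) by (auto simp: B_def inv_into_into f_inv_into_f image_subset_iff)
  have "decseq B" unfolding decseq_def
  proof (intro allI impI)
    fix m n :: nat assume "m \<le> n"
    then have "hat (B n - B m) = {}" using assms(2) B by (auto simp: hat_Diff decseq_def)
    then show "B n \<subseteq> B m" using hat_eq_empty[OF R_Diff[OF B(1) B(1)]] by blast
  qed
  have "\<exists>n. B n = {}"
  proof (rule ccontr)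
    assume "\<nexists>n. B n = {}"
    then obtain z where z: "z \<in> Z" "\<And>n. B n \<in> U z" using compact[OF B(1) \<open>decseq B\<close>] by blast
    have "z \<in> A i" for i unfolding B(2)[of i, symmetric] hat_def using z by simp
    then show False using assms(3) by blast
  qed
  then obtain n where n: "B n = {}" ..
  have "f0 (A i) = 0" if "n \<le> i" for i
  proof -
    have "A i \<subseteq> A n" using assms(2) that by (auto simp: decseq_def)
    then have "A i = {}" using B(2)[of n] n by (simp add: hat_empty)
    then show ?thesis using f0_positive by (simp add: positive_def)
  qed
  then show ?thesis by (intro tendsto_eventually) (auto simp: eventually_sequentially)
qed

lemma f0_countably_additive: "countably_additive RZ f0"
proof -
  interpret ring_of_sets Z RZ by (rule ring_RZ)
  show ?thesis
    by (rule empty_continuous_imp_countably_additive[OF f0_positive f0_additive _ f0_continuous])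
      (auto simp: f0_def)
qed

text \<open>Caratheodory's extension. The outer measure is kept explicit because its covers by
  countably many sets of \<open>RZ\<close> are what \<open>finite_sets_approx\<close> works
  with.\<close>

definition N :: "'z measure" where
  "N = measure_of Z (sigma_sets Z RZ) (outer_measure RZ f0)"

lemma measure_space_outer: "measure_space Z (sigma_sets Z RZ) (outer_measure RZ f0)"
proof -
  interpret ring_of_sets Z RZ by (rule ring_RZ)
  have inc: "increasing RZ f0"
    by (rule additive_increasing[OF f0_positive f0_additive])
  define ls where "ls = lambda_system Z (Pow Z) (outer_measure RZ f0)"
  have mls: "measure_space Z ls (outer_measure RZ f0)"
    using sigma_algebra.caratheodory_lemma[OF sigma_algebra_Pow outer_measure_space_outer_measure[OF f0_positive inc]]
    by (simp add: ls_def)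
  then have sls: "sigma_algebra Z ls" by (simp add: measure_space_def)
  have "RZ \<subseteq> ls"
    unfolding ls_def by (rule algebra_subset_lambda_system[OF f0_positive inc f0_additive])
  then have "sigma_sets Z RZ \<subseteq> ls"
    using sigma_algebra.sigma_sets_subset[OF sls, of RZ] by simp
  then show ?thesis
    by (intro measure_down[OF mls] sigma_algebra_sigma_sets space_closed)
qed

lemma space_N: "space N = Z"
  unfolding N_def by (rule space_measure_of) (use sigma_sets_into_sp[of RZ Z] hat_subset in auto)

lemma sets_N: "sets N = sigma_sets Z RZ"
  unfolding N_def
  by (subst sets_measure_of) (use sigma_sets_into_sp[of RZ Z] hat_subset in \<open>auto intro!: sigma_algebra.sigma_sets_eq sigma_algebra_sigma_sets\<close>)

lemma emeasure_N: "S \<in> sets N \<Longrightarrow> emeasure N S = outer_measure RZ f0 S"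
  unfolding sets_N unfolding N_def
  using measure_space_outer unfolding measure_space_def
  by (intro emeasure_measure_of_sigma) auto

lemma hat_sets: "A \<in> R \<Longrightarrow> hat A \<in> sets N"
  unfolding sets_N by (intro sigma_sets.Basic) auto

lemma emeasure_hat: "A \<in> R \<Longrightarrow> emeasure N (hat A) = ennreal (\<nu> A)"
  using ring_of_sets.outer_measure_agrees[OF ring_RZ f0_positive f0_countably_additive, of "hat A"]
  by (simp add: emeasure_N hat_sets f0_hat)

lemma measure_hat: "A \<in> R \<Longrightarrow> measure N (hat A) = \<nu> A"
  by (simp add: measure_def emeasure_hat \<nu>_nonneg)

text \<open>A cover of \<open>S\<close> by countably many disjoint sets of \<open>RZ\<close> exceeds
  \<open>S\<close> by less than \<open>e/2\<close>, and finitely many of its members exhaust it up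
  to \<open>e/2\<close>; their union is again a \<open>hat\<close>. Finiteness of the measure of
  \<open>S\<close> permits the subtractions.\<close>

lemma finite_sets_approx:
  assumes S: "S \<in> sets N" "emeasure N S < \<infinity>" and e: "0 < e"
  shows "\<exists>B\<in>R. measure N (S - hat B) + measure N (hat B - S) < e"
proof -
  interpret ring_of_sets Z RZ by (rule ring_RZ)
  have "outer_measure RZ f0 S < emeasure N S + ennreal (e/2)"
    using S e by (simp add: emeasure_N[symmetric] ennreal_add_left_cancel_less[of _ 0, simplified] less_top)
  from outer_measure_close[OF this] obtain A where A: "range A \<subseteq> RZ" "disjoint_family A"
      "S \<subseteq> (\<Union>i. A i)" "(\<Sum>i. f0 (A i)) < emeasure N S + ennreal (e/2)" by blast
  define T where "T = (\<Union>i. A i)"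
  have "\<forall>i. \<exists>B\<in>R. hat B = A i" using A(1) by (metis imageE rangeI subsetD)
  then obtain B where B: "\<And>i. B i \<in> R" "\<And>i. hat (B i) = A i" by metis
  have A_sets: "A i \<in> sets N" for i using hat_sets[OF B(1)] B(2) by metis
  then have T: "T \<in> sets N" unfolding T_def by auto
  have "f0 (A i) = emeasure N (A i)" for i
    using f0_hat[OF B(1)[of i]] emeasure_hat[OF B(1)[of i]] by (simp add: B(2))
  then have "emeasure N T = (\<Sum>i. f0 (A i))"
    unfolding T_def using suminf_emeasure[of A N] A(2) A_sets by (simp add: image_subset_iff)
  then have Tlt: "emeasure N T < emeasure N S + ennreal (e/2)" using A(4) by simp
  then have Tfin: "emeasure N T < \<infinity>" using S by (auto simp: less_top[symmetric])
  have TS: "measure N T < measure N S + e/2"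
    using Tlt Tfin S e by (simp add: emeasure_eq_ennreal_measure less_top[symmetric] ennreal_less_iff flip: ennreal_plus)
  define W where "W k = (\<Union>i<k. A i)" for k
  have W: "W k \<in> sets N" for k unfolding W_def using A_sets by auto
  have "(\<lambda>k. emeasure N (W k)) \<longlonglongrightarrow> emeasure N (\<Union>k. W k)"
    using W by (intro Lim_emeasure_incseq) (fastforce simp: incseq_def W_def)+
  also have "(\<Union>k. W k) = T" unfolding W_def T_def by auto
  finally have "(\<lambda>k. measure N (W k)) \<longlonglongrightarrow> measure N T"
    unfolding measure_def using Tfin by (intro tendsto_enn2real) auto
  then obtain k where k: "measure N T - e/2 < measure N (W k)"
    using order_tendstoD(1)[of _ "measure N T" sequentially "measure N T - e/2"] e
    by (auto simp: eventually_sequentially)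
  define C where "C = (\<Union>i<k. B i)"
  have C: "C \<in> R" "hat C = W k" unfolding C_def W_def using B by (auto intro!: R_UN simp: hat_UN)
  have WT: "W k \<subseteq> T" unfolding W_def T_def by auto
  have fm: "X \<in> fmeasurable N" if "X \<in> sets N" "X \<subseteq> T" for X
    using that T Tfin emeasure_mono[OF that(2) T] by (auto simp: fmeasurable_def intro: le_less_trans)
  have "measure N (S - W k) \<le> measure N (T - W k)"
    using A(3) S W T by (intro measure_mono_fmeasurable fm) (auto simp: T_def)
  also have "\<dots> = measure N T - measure N (W k)"
    using WT by (intro measurable_measure_Diff fm W T) auto
  finally have 1: "measure N (S - W k) < e/2" using k by simp
  have "measure N (W k - S) \<le> measure N (T - S)"
    using WT S W T by (intro measure_mono_fmeasurable fm) auto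
  also have "\<dots> = measure N T - measure N S"
    using A(3) S T by (intro measurable_measure_Diff fm) (auto simp: T_def)
  finally have 2: "measure N (W k - S) < e/2" using TS by simp
  show ?thesis using C 1 2 by (intro bexI[OF _ C(1)]) simp
qed

section \<open>Step functions on the Stone space and their density in \<open>L^p\<close>\<close>

definition SR :: "('y \<Rightarrow> complex) set" where
  "SR = {g. finite (range g) \<and> (\<forall>v. v \<noteq> 0 \<longrightarrow> g -` {v} \<in> R)}"

text \<open>The limit of \<open>g\<close> along the ultrafilter \<open>U z\<close>: for finite range
  it is the value whose fibre belongs to \<open>U z\<close>.\<close>

definition lift :: "('y \<Rightarrow> complex) \<Rightarrow> 'z \<Rightarrow> complex" where
  "lift g z = (THE v. g -` {v} \<in> U z)"

lemma lift_eq: "z \<in> Z \<Longrightarrow> g -` {v} \<in> U z \<Longrightarrow> lift g z = v"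
  unfolding lift_def
proof (rule the_equality)
  fix w assume "z \<in> Z" "g -` {v} \<in> U z" "g -` {w} \<in> U z"
  then have "g -` {v} \<inter> g -` {w} \<noteq> {}" using U_Int U_empty by metis
  then show "w = v" by auto
qed

lemma lift_ex: "z \<in> Z \<Longrightarrow> finite (range g) \<Longrightarrow> g -` {lift g z} \<in> U z"
proof -
  assume z: "z \<in> Z" and f: "finite (range g)"
  have "(\<Union>v\<in>range g. g -` {v}) = UNIV" by auto
  then have "\<exists>v\<in>range g. g -` {v} \<in> U z" using UN_U[OF f z] UNIV_U[OF z] by metis
  then show ?thesis using lift_eq[OF z] by auto
qed

text \<open>Limits along an ultrafilter commute with every pointwise operation, since the fibres of
  the two limit values meet in a set of \<open>U z\<close>.\<close>

lemma lift_op: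
  assumes "z \<in> Z" "finite (range g)" "finite (range h)"
  shows "lift (\<lambda>y. H (g y) (h y)) z = H (lift g z) (lift h z)"
proof (rule lift_eq[OF assms(1)])
  have "g -` {lift g z} \<inter> h -` {lift h z} \<in> U z" using assms by (intro U_Int lift_ex)
  then show "(\<lambda>y. H (g y) (h y)) -` {H (lift g z) (lift h z)} \<in> U z"
    by (rule U_mono[OF assms(1)]) auto
qed

lemma SR_preimage: "g \<in> SR \<Longrightarrow> 0 \<notin> S \<Longrightarrow> g -` S \<in> R"
proof -
  assume g: "g \<in> SR" and S: "0 \<notin> S"
  have "g -` S = (\<Union>v\<in>range g \<inter> S. g -` {v})" by auto
  also have "\<dots> \<in> R"
  proof (intro R_UN)
    fix v assume "v \<in> range g \<inter> S"
    then have "v \<noteq> 0" using S by auto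
    then show "g -` {v} \<in> R" using g by (simp add: SR_def)
  qed (use g in \<open>simp add: SR_def\<close>)
  finally show ?thesis .
qed

text \<open>The fibre of 0 is not in \<open>R\<close> in general, so an intersection with it is
  written as a difference. \<open>H 0 0 = 0\<close> excludes the one case in which both factors
  would be fibres of 0.\<close>

lemma SR_op:
  assumes g: "g \<in> SR" and h: "h \<in> SR" and H: "H 0 0 = 0"
  shows "(\<lambda>y. H (g y) (h y)) \<in> SR"
  unfolding SR_def
proof (intro CollectI conjI allI impI)
  have fin: "finite (range g)" "finite (range h)" using g h by (auto simp: SR_def)
  have "range (\<lambda>y. H (g y) (h y)) \<subseteq> (\<lambda>(a, b). H a b) ` (range g \<times> range h)" by auto
  then show "finite (range (\<lambda>y. H (g y) (h y)))" using fin finite_subset by blast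
  fix v :: complex assume v: "v \<noteq> 0"
  have "(\<lambda>y. H (g y) (h y)) -` {v} = (\<Union>(a, b)\<in>(range g \<times> range h) \<inter> {(a, b). H a b = v}. g -` {a} \<inter> h -` {b})"
    by auto
  also have "\<dots> \<in> R"
  proof (intro R_UN)
    fix i assume "i \<in> (range g \<times> range h) \<inter> {(a, b). H a b = v}"
    then obtain a b where i: "i = (a, b)" "H a b = v" by auto
    then have "a \<noteq> 0 \<or> b \<noteq> 0" using H v by auto
    moreover have "g -` {a} \<inter> h -` {b} = g -` {a} - h -` (- {0})" if "b = 0" using that by auto
    moreover have "g -` {a} \<inter> h -` {b} = h -` {b} - g -` (- {0})" if "a = 0" using that by auto
    ultimately have "g -` {a} \<inter> h -` {b} \<in> R"
      using SR_preimage[OF g] SR_preimage[OF h] R_Int R_Diff by (metis ComplD insertCI singletonD)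
    then show "(case i of (a, b) \<Rightarrow> g -` {a} \<inter> h -` {b}) \<in> R" using i by simp
  qed (use fin in auto)
  finally show "(\<lambda>y. H (g y) (h y)) -` {v} \<in> R" .
qed

text \<open>At most one fibre contributes at \<open>z\<close>, that of \<open>lift g z\<close>, and
  \<open>F 0 = 0\<close> accounts for the omitted fibre of 0. Measurability and integrals of lifts
  are read off from this finite sum.\<close>

lemma lift_sum:
  assumes g: "g \<in> SR" and z: "z \<in> Z" and F: "F 0 = (0::real)"
  shows "F (lift g z) = (\<Sum>v\<in>range g - {0}. F v * indicator (hat (g -` {v})) z)"
proof -
  have fin: "finite (range g)" using g by (simp add: SR_def)
  have U: "g -` {v} \<in> U z \<longleftrightarrow> v = lift g z" for v
    using lift_eq[OF z, of g v] lift_ex[OF z fin] by blast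
  have "lift g z \<in> range g"
  proof (rule ccontr)
    assume "lift g z \<notin> range g"
    then have "g -` {lift g z} = {}" by (auto simp: vimage_def) (metis rangeI)
    then show False using lift_ex[OF z fin] U_empty[OF z] by simp
  qed
  have "(\<Sum>v\<in>range g - {0}. F v * indicator (hat (g -` {v})) z) = (\<Sum>v\<in>range g - {0}. if v = lift g z then F v else 0)"
    by (intro sum.cong) (auto simp: hat_def z U indicator_def)
  also have "\<dots> = F (lift g z)"
    using fin F \<open>lift g z \<in> range g\<close> by (auto simp: sum.delta')
  finally show ?thesis by simp
qed

lemma lift_measurable: "g \<in> SR \<Longrightarrow> lift g \<in> borel_measurable N"
proof -
  assume g: "g \<in> SR"
  have m: "(\<lambda>z. \<Sum>v\<in>range g - {0}. F v * indicator (hat (g -` {v})) z) \<in> borel_measurable N" for F :: "complex \<Rightarrow> real"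
    using g by (intro borel_measurable_sum borel_measurable_times borel_measurable_indicator hat_sets SR_preimage) auto
  have "(\<lambda>z. Re (lift g z)) \<in> borel_measurable N" "(\<lambda>z. Im (lift g z)) \<in> borel_measurable N"
    by (rule measurable_cong[THEN iffD2, OF lift_sum[OF g, of _ Re] m[of Re]], simp_all add: space_N)
      (rule measurable_cong[THEN iffD2, OF lift_sum[OF g, of _ Im] m[of Im]], simp_all add: space_N)
  then show ?thesis by (simp add: borel_measurable_complex_iff)
qed

lemma lift_Lp:
  assumes g: "g \<in> SR"
  shows "lift g \<in> Lp_fun p N" "Ip p N (lift g) = (\<Sum>v\<in>range g - {0}. cmod v powr p * \<nu> (g -` {v}))"
proof -
  have int: "integrable N (\<lambda>z. indicat_real (hat (g -` {v})) z)" if "v \<noteq> 0" for v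
    using SR_preimage[OF g, of "{v}"] that
    by (intro integrable_real_indicator) (auto simp: hat_sets emeasure_hat less_top[symmetric])
  have eq: "cmod (lift g z) powr p = (\<Sum>v\<in>range g - {0}. cmod v powr p * indicat_real (hat (g -` {v})) z)"
    if "z \<in> space N" for z
    using that lift_sum[OF g, of z "\<lambda>v. cmod v powr p"] by (simp add: space_N)
  have "integrable N (\<lambda>z. \<Sum>v\<in>range g - {0}. cmod v powr p * indicat_real (hat (g -` {v})) z)"
    using int by (intro Bochner_Integration.integrable_sum integrable_mult_right) auto
  then show "lift g \<in> Lp_fun p N"
    using lift_measurable[OF g] by (simp add: Lp_fun_def eq cong: Bochner_Integration.integrable_cong)
  have "Ip p N (lift g) = (\<integral>z. (\<Sum>v\<in>range g - {0}. cmod v powr p * indicat_real (hat (g -` {v})) z) \<partial>N)"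
    unfolding Ip_def by (rule Bochner_Integration.integral_cong) (auto simp: eq)
  also have "\<dots> = (\<Sum>v\<in>range g - {0}. cmod v powr p * \<nu> (g -` {v}))"
    using int by (subst Bochner_Integration.integral_sum)
      (auto intro!: sum.cong integrable_mult_right simp: measure_hat SR_preimage[OF g] space_N Int_absorb2 hat_subset)
  finally show "Ip p N (lift g) = (\<Sum>v\<in>range g - {0}. cmod v powr p * \<nu> (g -` {v}))" .
qed

lemma indicator_SR: "A \<in> R \<Longrightarrow> (\<lambda>y. c * indicator A y) \<in> SR"
  unfolding SR_def
proof (intro CollectI conjI allI impI)
  assume A: "A \<in> R"
  have "range (\<lambda>y. c * indicator A y) \<subseteq> {0, c}" by (auto simp: indicator_def)
  then show "finite (range (\<lambda>y. c * indicator A y))" using finite_subset by blast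
  fix v :: complex assume "v \<noteq> 0"
  then have "(\<lambda>y. c * indicator A y) -` {v} = (if v = c then A else {})"
    by (auto simp: indicator_def split: if_splits)
  then show "(\<lambda>y. c * indicator A y) -` {v} \<in> R" using A R_empty by simp
qed

lemma lift_indicator:
  assumes z: "z \<in> Z" shows "lift (\<lambda>y. c * indicator A y) z = c * indicator (hat A) z"
proof (rule lift_eq[OF z])
  show "(\<lambda>y. c * indicator A y) -` {c * indicator (hat A) z} \<in> U z"
  proof (cases "A \<in> U z")
    case True
    then show ?thesis using z by (auto intro: U_mono[OF z True] simp: hat_def indicator_def)
  next
    case False
    then have "- A \<in> U z" using Compl_U[OF z] by simp
    then show ?thesis using False z by (auto intro: U_mono[OF z \<open>- A \<in> U z\<close>] simp: hat_def indicator_def)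
  qed
qed

text \<open>The set \<open>D\<close> of approximable functions is closed under sums and limits and
  contains the multiples of indicators of sets of finite measure. Simple functions in
  \<open>L^p\<close> have nonzero fibres of finite measure, and dominated convergence reaches every
  \<open>f\<close> from them.\<close>

lemma SR_dense:
  assumes p: "1 < p" and f: "f \<in> Lp_fun p N" and e: "0 < e"
  shows "\<exists>g\<in>SR. Ip p N (\<lambda>z. f z - lift g z) < e"
proof -
  interpret P: plattice p "Lp_fun p N" "Ip p N" by (rule plattice_Lp[OF p])
  define D where "D = {f \<in> Lp_fun p N. \<forall>e>0. \<exists>g\<in>SR. Ip p N (\<lambda>z. f z - lift g z) < e}"
  have K: "0 < (2::real) powr p" by simp
  have D_add: "(\<lambda>z. f z + h z) \<in> D" if "f \<in> D" "h \<in> D" for f h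
  proof -
    have L: "f \<in> Lp_fun p N" "h \<in> Lp_fun p N" using that by (auto simp: D_def)
    have "\<exists>g\<in>SR. Ip p N (\<lambda>z. f z + h z - lift g z) < e" if e: "0 < e" for e
    proof -
      have e': "0 < e / (2 * 2 powr p)" using e by simp
      obtain a where a: "a \<in> SR" "Ip p N (\<lambda>z. f z - lift a z) < e / (2 * 2 powr p)"
        using \<open>f \<in> D\<close> e' unfolding D_def by blast
      obtain b where b: "b \<in> SR" "Ip p N (\<lambda>z. h z - lift b z) < e / (2 * 2 powr p)"
        using \<open>h \<in> D\<close> e' unfolding D_def by blast
      let ?g = "\<lambda>y. a y + b y"
      have g: "?g \<in> SR" by (rule SR_op[OF a(1) b(1), of "(+)"]) simp
      have "Ip p N (\<lambda>z. f z + h z - lift ?g z) = Ip p N (\<lambda>z. (f z - lift a z) + (h z - lift b z))"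
        unfolding Ip_def using a b
        by (intro Bochner_Integration.integral_cong) (auto simp: space_N lift_op SR_def algebra_simps)
      also have "\<dots> \<le> 2 powr p * (Ip p N (\<lambda>z. f z - lift a z) + Ip p N (\<lambda>z. h z - lift b z))"
        by (intro P.quasi_triangle P.diff_in L lift_Lp a b)
      also have "\<dots> < 2 powr p * (e / (2 * 2 powr p) + e / (2 * 2 powr p))"
        using a b by (intro mult_strict_left_mono add_strict_mono) auto
      also have "\<dots> = e" by simp
      finally show ?thesis using g by blast
    qed
    then show ?thesis using L by (auto simp: D_def intro: P.add_in)
  qed
  have D_lim: "f \<in> D" if "f \<in> Lp_fun p N" "\<And>e. 0 < e \<Longrightarrow> \<exists>h\<in>D. Ip p N (\<lambda>z. f z - h z) < e" for f
  proof -
    have "\<exists>g\<in>SR. Ip p N (\<lambda>z. f z - lift g z) < e" if e: "0 < e" for e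
    proof -
      have e': "0 < e / (2 * 2 powr p)" using e by simp
      obtain h where h: "h \<in> D" "Ip p N (\<lambda>z. f z - h z) < e / (2 * 2 powr p)"
        using \<open>\<And>e. 0 < e \<Longrightarrow> \<exists>h\<in>D. Ip p N (\<lambda>z. f z - h z) < e\<close>[OF e'] by blast
      obtain g where g: "g \<in> SR" "Ip p N (\<lambda>z. h z - lift g z) < e / (2 * 2 powr p)"
        using h(1) e' unfolding D_def by blast
      have "h \<in> Lp_fun p N" using h by (simp add: D_def)
      then have "Ip p N (\<lambda>z. f z - lift g z) \<le> 2 powr p * (Ip p N (\<lambda>z. f z - h z) + Ip p N (\<lambda>z. h z - lift g z))"
        by (intro P.diff_triangle lift_Lp g \<open>f \<in> Lp_fun p N\<close>)
      also have "\<dots> < 2 powr p * (e / (2 * 2 powr p) + e / (2 * 2 powr p))"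
        using g h by (intro mult_strict_left_mono add_strict_mono) auto
      also have "\<dots> = e" by simp
      finally show ?thesis using g(1) by blast
    qed
    then show ?thesis using that(1) by (auto simp: D_def)
  qed
  have ind_Lp: "(\<lambda>z. c * indicator S z) \<in> Lp_fun p N"
    "Ip p N (\<lambda>z. c * indicator S z) = cmod c powr p * measure N S"
    if S: "S \<in> sets N" "emeasure N S < \<infinity>" for S and c :: complex
  proof -
    have eq: "cmod (c * indicator S z) powr p = cmod c powr p * indicat_real S z" for z
      by (simp add: indicator_def)
    show "(\<lambda>z. c * indicator S z) \<in> Lp_fun p N"
    proof -
      have "integrable N (\<lambda>z. cmod (c * indicator S z) powr p)"
        unfolding eq using S by (intro integrable_mult_right integrable_real_indicator)
      then show ?thesis using S by (auto simp only: Lp_fun_def mem_Collect_eq intro!: borel_measurable_times borel_measurable_indicator borel_measurable_const)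
    qed
    show "Ip p N (\<lambda>z. c * indicator S z) = cmod c powr p * measure N S"
      unfolding Ip_def eq using S sets.sets_into_space[OF S(1)] by (simp add: Int_absorb2)
  qed
  have D_ind: "(\<lambda>z. c * indicator S z) \<in> D" if S: "S \<in> sets N" "emeasure N S < \<infinity>" for S and c :: complex
  proof -
    have "\<exists>g\<in>SR. Ip p N (\<lambda>z. c * indicator S z - lift g z) < e" if e: "0 < e" for e
    proof -
      \<comment> \<open>Chosen so that \<open>2 powr p * (cmod c powr p * d) < e\<close>, also for
        \<open>c = 0\<close>.\<close>
      define d where "d = e / (2 powr p * (cmod c powr p + 1))"
      have c0: "0 < cmod c powr p + 1" by (simp add: add_nonneg_pos)
      then have d: "0 < d" using e by (simp add: d_def)
      obtain B where B: "B \<in> R" "measure N (S - hat B) + measure N (hat B - S) < d"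
        using finite_sets_approx[OF S d] by blast
      have Bs: "hat B \<in> sets N" "emeasure N (hat B) < \<infinity>" using B by (auto simp: hat_sets emeasure_hat)
      have fin: "emeasure N (S - hat B) < \<infinity>" "emeasure N (hat B - S) < \<infinity>"
        using S Bs emeasure_mono[of "S - hat B" S N] emeasure_mono[of "hat B - S" "hat B" N] by (auto intro: le_less_trans)
      let ?g = "\<lambda>y. c * indicator B y"
      have "c * indicator S z - lift ?g z = c * indicator (S - hat B) z + (- c) * indicator (hat B - S) z"
        if "z \<in> Z" for z
        unfolding lift_indicator[OF that] by (auto simp: indicator_def)
      then have "Ip p N (\<lambda>z. c * indicator S z - lift ?g z)
        = Ip p N (\<lambda>z. c * indicator (S - hat B) z + (- c) * indicator (hat B - S) z)"
        unfolding Ip_def by (intro Bochner_Integration.integral_cong) (simp_all only: space_N)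
      also have "\<dots> \<le> 2 powr p * (Ip p N (\<lambda>z. c * indicator (S - hat B) z) + Ip p N (\<lambda>z. (- c) * indicator (hat B - S) z))"
        by (intro P.quasi_triangle ind_Lp sets.Diff S Bs fin)
      also have "\<dots> = 2 powr p * (cmod c powr p * (measure N (S - hat B) + measure N (hat B - S)))"
        using ind_Lp(2)[OF sets.Diff[OF S(1) Bs(1)] fin(1), of c] ind_Lp(2)[OF sets.Diff[OF Bs(1) S(1)] fin(2), of "- c"]
        by (simp add: distrib_left)
      also have "\<dots> \<le> 2 powr p * (cmod c powr p * d)"
        using B by (intro mult_left_mono) auto
      also have "\<dots> < 2 powr p * ((cmod c powr p + 1) * d)"
        using d by (intro mult_strict_left_mono) auto
      also have "\<dots> = e" using c0 by (simp add: d_def)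
      finally show ?thesis using indicator_SR[OF B(1), of c] by blast
    qed
    then show ?thesis using ind_Lp(1)[OF S] by (simp add: D_def)
  qed
  have D0: "(\<lambda>_. 0) \<in> D" using D_ind[of "{}" 0] by simp
  have D_sum: "(\<lambda>z. \<Sum>i\<in>I. F i z) \<in> D" if "finite I" "\<And>i. i \<in> I \<Longrightarrow> F i \<in> D" for I :: "complex set" and F
    using that by (induction I rule: finite_induct) (simp_all add: D0 D_add)
  have "f \<in> D"
  proof (rule D_lim[OF f])
    fix e :: real assume e: "0 < e"
    have fm: "f \<in> borel_measurable N" using f by (simp add: Lp_fun_def)
    obtain s where s: "\<And>i. simple_function N (s i)" "\<And>z. z \<in> space N \<Longrightarrow> (\<lambda>i. s i z) \<longlonglongrightarrow> f z"
      "\<And>i z. z \<in> space N \<Longrightarrow> cmod (s i z) \<le> 2 * cmod (f z)"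
      using borel_measurable_implies_sequence_metric[OF fm, of 0] unfolding dist_0_norm dist_norm diff_0_right
      by blast
    have [measurable]: "s i \<in> borel_measurable N" for i using s(1) by (rule borel_measurable_simple_function)
    note [measurable] = fm
    \<comment> \<open>Since \<open>cmod (s i z) \<le> 2 * cmod (f z)\<close>, the factor 4 covers
      both \<open>s i\<close> and \<open>f - s i\<close>, so that one dominating function serves for
      membership and for the limit.\<close>
    have int: "integrable N (\<lambda>z. 4 powr p * cmod (f z) powr p)"
      by (intro integrable_mult_right Lp_fun_integrable f)
    have sL: "s i \<in> Lp_fun p N" for i
    proof -
      have "integrable N (\<lambda>z. cmod (s i z) powr p)"
      proof (rule Bochner_Integration.integrable_bound[OF int])
        show "AE z in N. norm (cmod (s i z) powr p) \<le> norm (4 powr p * cmod (f z) powr p)"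
        proof (rule AE_I2)
          fix z assume "z \<in> space N"
          then have "cmod (s i z) powr p \<le> (4 * cmod (f z)) powr p"
            using p s(3)[of z i] norm_ge_zero[of "f z"] by (intro powr_mono2) (linarith | simp)+
          then show "norm (cmod (s i z) powr p) \<le> norm (4 powr p * cmod (f z) powr p)"
            by (simp add: powr_mult)
        qed
      qed measurable
      then show ?thesis by (simp add: Lp_fun_def)
    qed
    have sD: "s i \<in> D" for i
    proof -
      have fin: "finite (s i ` space N)" using s(1) by (simp add: simple_function_def)
      let ?g = "\<lambda>z. \<Sum>v\<in>s i ` space N. v * indicator (s i -` {v} \<inter> space N) z"
      have "?g \<in> D"
      proof (intro D_sum fin)
        fix v assume "v \<in> s i ` space N"
        show "(\<lambda>z. v * indicator (s i -` {v} \<inter> space N) z) \<in> D"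
        proof (cases "v = 0")
          case False
          have "(\<lambda>z. cmod v powr p * indicat_real (s i -` {v} \<inter> space N) z) \<in> borel_measurable N" by measurable
          then have "integrable N (\<lambda>z. cmod v powr p * indicat_real (s i -` {v} \<inter> space N) z)"
            by (rule Bochner_Integration.integrable_bound[OF Lp_fun_integrable[OF sL[of i]]])
              (auto simp: indicator_def)
          then have "integrable N (indicat_real (s i -` {v} \<inter> space N))" using False by simp
          then have "emeasure N (s i -` {v} \<inter> space N) < \<infinity>"
            by (subst (asm) integrable_indicator_iff) (auto simp: Int_ac)
          then show ?thesis by (intro D_ind) auto
        qed (use D0 in simp)
      qed
      moreover have eq: "?g z = s i z" if "z \<in> space N" for z
      proof -
        have "?g z = (\<Sum>v\<in>s i ` space N. if v = s i z then v else 0)"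
          using that by (intro sum.cong) (auto simp: indicator_def)
        also have "\<dots> = s i z" using fin that by (simp add: sum.delta')
        finally show ?thesis .
      qed
      have "Ip p N (\<lambda>z. s i z - lift g z) = Ip p N (\<lambda>z. ?g z - lift g z)" for g
        unfolding Ip_def by (intro Bochner_Integration.integral_cong) (simp_all only: eq)
      ultimately show ?thesis using sL[of i] by (simp add: D_def)
    qed
    have "(\<lambda>i. \<integral>z. cmod (f z - s i z) powr p \<partial>N) \<longlonglongrightarrow> (\<integral>z. 0 \<partial>N)"
    proof (rule integral_dominated_convergence[OF _ _ int])
      show "AE z in N. (\<lambda>i. cmod (f z - s i z) powr p) \<longlonglongrightarrow> 0"
      proof (rule AE_I2)
        fix z assume "z \<in> space N"
        then have "(\<lambda>i. cmod (f z - s i z)) \<longlonglongrightarrow> cmod (f z - f z)" by (intro tendsto_intros s)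
        then have "(\<lambda>i. cmod (f z - s i z)) \<longlonglongrightarrow> 0" by simp
        then show "(\<lambda>i. cmod (f z - s i z) powr p) \<longlonglongrightarrow> 0"
          using p by (intro tendsto_zero_powrI[where b = p]) auto
      qed
      fix i
      show "AE z in N. norm (cmod (f z - s i z) powr p) \<le> 4 powr p * cmod (f z) powr p"
      proof (rule AE_I2)
        fix z assume "z \<in> space N"
        then have "cmod (f z - s i z) \<le> 4 * cmod (f z)"
          using s(3)[of z i] norm_triangle_ineq4[of "f z" "s i z"] norm_ge_zero[of "f z"] by linarith
        then have "cmod (f z - s i z) powr p \<le> (4 * cmod (f z)) powr p" using p by (intro powr_mono2) auto
        then show "norm (cmod (f z - s i z) powr p) \<le> 4 powr p * cmod (f z) powr p" by (simp add: powr_mult)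
      qed
    qed measurable
    then have "(\<lambda>i. Ip p N (\<lambda>z. f z - s i z)) \<longlonglongrightarrow> 0" by (simp add: Ip_def)
    then obtain i where "Ip p N (\<lambda>z. f z - s i z) < e"
      using order_tendstoD(2)[of _ 0 sequentially e] e by (auto simp: eventually_sequentially)
    then show "\<exists>h\<in>D. Ip p N (\<lambda>z. f z - h z) < e" using sD by blast
  qed
  then show ?thesis using e by (simp add: D_def)
qed

end

section \<open>Kakutani's representation\<close>

definition ultra :: "'x set set \<Rightarrow> bool" where
  "ultra P \<longleftrightarrow> {} \<notin> P \<and> (\<forall>A\<in>P. \<forall>B\<in>P. A \<inter> B \<in> P) \<and> (\<forall>A\<in>P. \<forall>B. A \<subseteq> B \<longrightarrow> B \<in> P)
    \<and> (\<forall>A. A \<in> P \<or> - A \<in> P)"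

text \<open>Zorn's lemma for the proper filters that contain all \<open>S n\<close>; a maximal one
  decides every set.\<close>

lemma ultra_exists:
  fixes S :: "nat \<Rightarrow> 'x set"
  assumes dec: "decseq S" and ne: "\<And>n. S n \<noteq> {}"
  shows "\<exists>P. ultra P \<and> (\<forall>n. S n \<in> P)"
proof -
  define \<A> where "\<A> = {P. {} \<notin> P \<and> (\<forall>A\<in>P. \<forall>B\<in>P. A \<inter> B \<in> P) \<and> (\<forall>A\<in>P. \<forall>B. A \<subseteq> B \<longrightarrow> B \<in> P)
    \<and> (\<forall>n. S n \<in> P)}"
  have "\<exists>P\<in>\<A>. \<forall>X\<in>\<A>. P \<subseteq> X \<longrightarrow> X = P"
  proof (rule subset_Zorn_nonempty)
    define P0 where "P0 = {A. \<exists>n. S n \<subseteq> A}"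
    have "P0 \<in> \<A>"
      unfolding \<A>_def
    proof (intro CollectI conjI ballI allI impI)
      show "{} \<notin> P0" using ne unfolding P0_def by auto
      show "S n \<in> P0" for n unfolding P0_def by auto
      fix A B assume A: "A \<in> P0"
      { assume "B \<in> P0"
        with A obtain m n where mn: "S m \<subseteq> A" "S n \<subseteq> B" unfolding P0_def by auto
        have "S (max m n) \<subseteq> S m" "S (max m n) \<subseteq> S n" using dec by (auto simp: decseq_def)
        then have "S (max m n) \<subseteq> A \<inter> B" using mn by blast
        then show "A \<inter> B \<in> P0" unfolding P0_def by blast }
      { assume "A \<subseteq> B" then show "B \<in> P0" using A unfolding P0_def by blast }
    qed
    then show "\<A> \<noteq> {}" by blast
    fix \<C> assume C: "\<C> \<noteq> {}" "subset.chain \<A> \<C>"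
    then have sub: "\<And>X. X \<in> \<C> \<Longrightarrow> X \<in> \<A>" and lin: "\<And>X Y. X \<in> \<C> \<Longrightarrow> Y \<in> \<C> \<Longrightarrow> X \<subseteq> Y \<or> Y \<subseteq> X"
      unfolding subset.chain_def by auto
    show "\<Union>\<C> \<in> \<A>" unfolding \<A>_def
    proof (intro CollectI conjI ballI allI impI)
      show "{} \<notin> \<Union>\<C>" using sub unfolding \<A>_def by blast
      show "S n \<in> \<Union>\<C>" for n using sub C(1) unfolding \<A>_def by blast
      fix A B assume A: "A \<in> \<Union>\<C>"
      { assume "B \<in> \<Union>\<C>"
        with A obtain X Y where XY: "X \<in> \<C>" "Y \<in> \<C>" "A \<in> X" "B \<in> Y" by blast
        then obtain W where "W \<in> \<C>" "A \<in> W" "B \<in> W" using lin by blast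
        then have "A \<inter> B \<in> W" using sub unfolding \<A>_def by blast
        then show "A \<inter> B \<in> \<Union>\<C>" using \<open>W \<in> \<C>\<close> by blast }
      { assume "A \<subseteq> B" then show "B \<in> \<Union>\<C>" using A sub unfolding \<A>_def by blast }
    qed
  qed
  then obtain P where P: "P \<in> \<A>" and max: "\<And>X. X \<in> \<A> \<Longrightarrow> P \<subseteq> X \<Longrightarrow> X = P" by blast
  have P1: "{} \<notin> P" and P2: "\<And>A B. A \<in> P \<Longrightarrow> B \<in> P \<Longrightarrow> A \<inter> B \<in> P"
    and P3: "\<And>A B. A \<in> P \<Longrightarrow> A \<subseteq> B \<Longrightarrow> B \<in> P" and P4: "\<And>n. S n \<in> P"
    using P unfolding \<A>_def by blast+
  have "A \<in> P \<or> - A \<in> P" for A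
  proof (rule ccontr)
    assume n: "\<not> (A \<in> P \<or> - A \<in> P)"
    \<comment> \<open>The filter generated by \<open>P\<close> and \<open>A\<close>. If it contained
      the empty set, \<open>- A\<close> would contain a set of \<open>P\<close>; so it is proper,
      and maximality puts \<open>A\<close> into \<open>P\<close>.\<close>
    define X where "X = {C. \<exists>D\<in>P. D \<inter> A \<subseteq> C}"
    have "X \<in> \<A>" unfolding \<A>_def
    proof (intro CollectI conjI ballI allI impI)
      show "{} \<notin> X"
      proof
        assume "{} \<in> X"
        then obtain D where "D \<in> P" "D \<inter> A \<subseteq> {}" unfolding X_def by blast
        then have "- A \<in> P" using P3[of D "- A"] by blast
        then show False using n by blast
      qed
      show "S n \<in> X" for n using P4[of n] unfolding X_def by blast
      fix B C assume B: "B \<in> X"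
      { assume "C \<in> X"
        with B obtain D E where DE: "D \<in> P" "E \<in> P" "D \<inter> A \<subseteq> B" "E \<inter> A \<subseteq> C" unfolding X_def by blast
        then have "D \<inter> E \<in> P" "D \<inter> E \<inter> A \<subseteq> B \<inter> C" using P2 by blast+
        then show "B \<inter> C \<in> X" unfolding X_def by blast }
      { assume "B \<subseteq> C" then show "C \<in> X" using B unfolding X_def by blast }
    qed
    moreover have "P \<subseteq> X" unfolding X_def by blast
    ultimately have "X = P" by (rule max)
    moreover have "A \<in> X" unfolding X_def using P4[of 0] by blast
    ultimately show False using n by blast
  qed
  then have "ultra P" unfolding ultra_def using P1 P2 P3 by blast
  then show ?thesis using P4 by blast
qed

context clattice
begin

abbreviation rl :: "('a \<Rightarrow> real) \<Rightarrow> 'a \<Rightarrow> complex" where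
  "rl e \<equiv> \<lambda>x. complex_of_real (e x)"

definition Vpos :: "('a \<Rightarrow> real) set" where
  "Vpos = {e. (\<forall>x. 0 \<le> e x) \<and> rl e \<in> V}"

lemma Vpos_min: "e \<in> Vpos \<Longrightarrow> f \<in> Vpos \<Longrightarrow> (\<lambda>x. min (e x) (f x)) \<in> Vpos"
  using lip_in[OF _ _ lip2_min, of "rl e" "rl f"] by (auto simp: Vpos_def)

lemma Vpos_max: "e \<in> Vpos \<Longrightarrow> f \<in> Vpos \<Longrightarrow> (\<lambda>x. max (e x) (f x)) \<in> Vpos"
  using lip_in[OF _ _ lip2_max, of "rl e" "rl f"] by (auto simp: Vpos_def le_max_iff_disj)

lemma Vpos_scale: "e \<in> Vpos \<Longrightarrow> 0 \<le> c \<Longrightarrow> (\<lambda>x. c * e x) \<in> Vpos"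
  using scale_in[of "rl e" "of_real c"] by (auto simp: Vpos_def)

lemma Vpos_pos_part: "e \<in> Vpos \<Longrightarrow> f \<in> Vpos \<Longrightarrow> (\<lambda>x. max 0 (c * e x + d * f x)) \<in> Vpos"
  using lip_in[OF _ _ lip2_pos_part[of c d], of "rl e" "rl f"] by (auto simp: Vpos_def)

lemma Vpos_diff: "e \<in> Vpos \<Longrightarrow> f \<in> Vpos \<Longrightarrow> (\<And>x. f x \<le> e x) \<Longrightarrow> (\<lambda>x. e x - f x) \<in> Vpos"
  using diff_in[of "rl e" "rl f"] by (auto simp: Vpos_def)

lemma Vpos_sum: "finite I \<Longrightarrow> (\<And>i. i \<in> I \<Longrightarrow> e i \<in> Vpos) \<Longrightarrow> (\<lambda>x. \<Sum>i\<in>I. e i x) \<in> Vpos"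
  by (induction I rule: finite_induct) (auto simp: Vpos_def zero_in intro!: add_in)

lemma Vpos_mono: "e \<in> Vpos \<Longrightarrow> f \<in> Vpos \<Longrightarrow> (\<And>x. e x \<le> f x) \<Longrightarrow> \<Phi> (rl e) \<le> \<Phi> (rl f)"
  by (rule mono) (auto simp: Vpos_def)

lemma Vpos_superadd: "e \<in> Vpos \<Longrightarrow> f \<in> Vpos \<Longrightarrow> \<Phi> (rl e) + \<Phi> (rl f) \<le> \<Phi> (rl (\<lambda>x. e x + f x))"
  using superadd[of "rl e" "rl f"] by (auto simp: Vpos_def simp flip: of_real_add)

lemma Vpos_null_sum:
  "finite I \<Longrightarrow> (\<And>i. i \<in> I \<Longrightarrow> e i \<in> Vpos \<and> \<Phi> (rl (e i)) = 0) \<Longrightarrow> \<Phi> (rl (\<lambda>x. \<Sum>i\<in>I. e i x)) = 0"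
proof (induction I rule: finite_induct)
  case (insert i I)
  let ?s = "\<lambda>x. \<Sum>i\<in>I. e i x"
  have V: "rl (e i) \<in> V" "rl ?s \<in> V" using insert Vpos_sum[of I e] by (auto simp: Vpos_def)
  have "\<Phi> (\<lambda>x. rl (e i) x + rl ?s x) \<le> 2 powr p * (\<Phi> (rl (e i)) + \<Phi> (rl ?s))"
    by (rule quasi_triangle[OF V])
  also have "\<dots> = 0" using insert by simp
  finally have "\<Phi> (\<lambda>x. rl (e i) x + rl ?s x) = 0" using nonneg[OF add_in[OF V]] by simp
  then show ?case using insert by simp
qed (simp add: zero)

text \<open>A disjoint system in the sense of Banach lattices. Distinct members may still overlap
  pointwise, on a null function; \<open>top_set\<close> will remove the overlaps.\<close>

definition disjoint_family_in :: "('a \<Rightarrow> real) set \<Rightarrow> bool" where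
  "disjoint_family_in F \<longleftrightarrow> F \<subseteq> {e \<in> Vpos. \<Phi> (rl e) \<noteq> 0} \<and>
    (\<forall>e\<in>F. \<forall>f\<in>F. e \<noteq> f \<longrightarrow> \<Phi> (rl (\<lambda>x. min (e x) (f x))) = 0)"

text \<open>Zorn's lemma: a non-null \<open>u\<close> disjoint from all members of a maximal family
  could be added to it.\<close>

lemma maximal_disjoint_family:
  "\<exists>F. disjoint_family_in F \<and>
    (\<forall>u\<in>Vpos. (\<forall>e\<in>F. \<Phi> (rl (\<lambda>x. min (u x) (e x))) = 0) \<longrightarrow> \<Phi> (rl u) = 0)"
proof -
  have "\<exists>F\<in>{F. disjoint_family_in F}. \<forall>X\<in>{F. disjoint_family_in F}. F \<subseteq> X \<longrightarrow> X = F"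
  proof (rule subset_Zorn')
    fix C assume "subset.chain {F. disjoint_family_in F} C"
    then have C: "\<And>X. X \<in> C \<Longrightarrow> disjoint_family_in X" "\<And>X Y. X \<in> C \<Longrightarrow> Y \<in> C \<Longrightarrow> X \<subseteq> Y \<or> Y \<subseteq> X"
      unfolding subset.chain_def by auto
    have "disjoint_family_in (\<Union>C)"
      unfolding disjoint_family_in_def
    proof (intro conjI ballI impI)
      show "\<Union>C \<subseteq> {e \<in> Vpos. \<Phi> (rl e) \<noteq> 0}" using C(1) unfolding disjoint_family_in_def by blast
      fix e f assume "e \<in> \<Union>C" "f \<in> \<Union>C" "e \<noteq> f"
      moreover then obtain X where "X \<in> C" "e \<in> X" "f \<in> X" using C(2) by blast
      ultimately show "\<Phi> (rl (\<lambda>x. min (e x) (f x))) = 0"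
        using C(1)[of X] unfolding disjoint_family_in_def by blast
    qed
    then show "\<Union>C \<in> {F. disjoint_family_in F}" by simp
  qed
  then obtain F where F: "disjoint_family_in F" and max: "\<And>X. disjoint_family_in X \<Longrightarrow> F \<subseteq> X \<Longrightarrow> X = F"
    by blast
  have "\<Phi> (rl u) = 0" if u: "u \<in> Vpos" "\<And>e. e \<in> F \<Longrightarrow> \<Phi> (rl (\<lambda>x. min (u x) (e x))) = 0" for u
  proof (rule ccontr)
    assume ne: "\<Phi> (rl u) \<noteq> 0"
    have "disjoint_family_in (insert u F)"
      using F u ne unfolding disjoint_family_in_def by (auto simp: min.commute)
    then have "u \<in> F" using max[of "insert u F"] by blast
    then show False using u(2)[of u] ne by simp
  qed
  then show ?thesis using F by blast
qed

end

text \<open>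
  The points are pairs of a weight \<open>e \<in> F\<close> and an ultrafilter on \<open>'x\<close>, encoded by \<open>enc\<close>. On the
  points over \<open>e\<close> the measure is determined by \<open>A \<mapsto> \<Phi> (1\<^sub>A e)\<close>.
\<close>

locale kakutani = clattice p V \<Phi> for p and V :: "('x \<Rightarrow> complex) set" and \<Phi> +
  fixes F :: "('x \<Rightarrow> real) set" and enc :: "('x \<Rightarrow> real) \<Rightarrow> 'x set set \<Rightarrow> 'z"
  assumes F: "disjoint_family_in F"
    and F_max: "u \<in> Vpos \<Longrightarrow> (\<And>e. e \<in> F \<Longrightarrow> \<Phi> (rl (\<lambda>x. min (u x) (e x))) = 0) \<Longrightarrow> \<Phi> (rl u) = 0"
    and enc_inj: "e \<in> F \<Longrightarrow> e' \<in> F \<Longrightarrow> enc e P = enc e' P' \<Longrightarrow> e = e' \<and> P = P'"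
begin

lemma F_Vpos: "e \<in> F \<Longrightarrow> e \<in> Vpos" using F by (auto simp: disjoint_family_in_def)

lemma F_nonneg: "e \<in> F \<Longrightarrow> 0 \<le> e x" using F_Vpos[of e] by (simp add: Vpos_def)

lemma F_V: "e \<in> F \<Longrightarrow> rl e \<in> V" using F_Vpos[of e] by (simp add: Vpos_def)

lemma F_null: "e \<in> F \<Longrightarrow> f \<in> F \<Longrightarrow> e \<noteq> f \<Longrightarrow> \<Phi> (rl (\<lambda>x. min (e x) (f x))) = 0"
  using F by (simp add: disjoint_family_in_def)

section \<open>The content on sets of pairs of a weight and a point\<close>

definition cut :: "('x \<Rightarrow> real) \<Rightarrow> 'x set \<Rightarrow> 'x \<Rightarrow> complex" where
  "cut e A x = indicator A x * complex_of_real (e x)"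

text \<open>A finite disjoint sum of admissible sets, one over each weight involved. Finiteness
  keeps \<open>\<kappa>\<close> a finite sum and is what yields \<open>compact\<close>.\<close>

definition R :: "(('x \<Rightarrow> real) \<times> 'x) set set" where
  "R = {B. finite (fst ` B) \<and> fst ` B \<subseteq> F \<and> (\<forall>e\<in>F. cut e (B `` {e}) \<in> V)}"

text \<open>Over each weight \<open>e\<close> the function \<open>g\<close> acts as a multiplier of
  \<open>e\<close>, and the results are added. On step functions this is the isometry with the
  \<open>L^p\<close> space before completion.\<close>

definition \<kappa> :: "(('x \<Rightarrow> real) \<times> 'x \<Rightarrow> complex) \<Rightarrow> 'x \<Rightarrow> complex" where
  "\<kappa> g x = (\<Sum>e | \<exists>y. g (e, y) \<noteq> 0. g (e, x) * complex_of_real (e x))"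

definition \<nu> :: "(('x \<Rightarrow> real) \<times> 'x) set \<Rightarrow> real" where
  "\<nu> B = \<Phi> (\<kappa> (indicator B))"

definition Z :: "'z set" where "Z = {enc e P |e P. e \<in> F \<and> ultra P}"

definition U :: "'z \<Rightarrow> (('x \<Rightarrow> real) \<times> 'x) set set" where
  "U z = {B. \<exists>e P. e \<in> F \<and> z = enc e P \<and> B `` {e} \<in> P}"

lemma \<kappa>_eq: "finite E \<Longrightarrow> {e. \<exists>y. g (e, y) \<noteq> 0} \<subseteq> E \<Longrightarrow> \<kappa> g x = (\<Sum>e\<in>E. g (e, x) * complex_of_real (e x))"
  unfolding \<kappa>_def by (rule sum.mono_neutral_left) auto

text \<open>Set operations come from lattice operations on the functions \<open>cut e A\<close>: a
  union is a maximum, a difference in \<open>cut_Diff\<close> a positive part. This makes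
  \<open>R\<close> a ring.\<close>

lemma cut_Un: "e \<in> F \<Longrightarrow> cut e A \<in> V \<Longrightarrow> cut e B \<in> V \<Longrightarrow> cut e (A \<union> B) \<in> V"
proof -
  assume e: "e \<in> F" and V: "cut e A \<in> V" "cut e B \<in> V"
  have "cut e (A \<union> B) = (\<lambda>x. complex_of_real (max (cmod (cut e A x)) (cmod (cut e B x))))"
    using F_nonneg[OF e] by (auto simp: cut_def indicator_def fun_eq_iff norm_mult)
  then show ?thesis using lip_in[OF V lip2_max] by simp
qed

lemma cut_Diff: "e \<in> F \<Longrightarrow> cut e A \<in> V \<Longrightarrow> cut e B \<in> V \<Longrightarrow> cut e (A - B) \<in> V"
proof -
  assume e: "e \<in> F" and V: "cut e A \<in> V" "cut e B \<in> V"
  have "cut e (A - B) = (\<lambda>x. complex_of_real (max 0 (1 * Re (cut e A x) + (-1) * Re (cut e B x))))"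
    using F_nonneg[OF e] by (auto simp: cut_def indicator_def fun_eq_iff)
  then show ?thesis using lip_in[OF V lip2_pos_part[of 1 "-1"]] by simp
qed

lemma \<kappa>_indicator:
  assumes "B \<in> R"
  shows "\<kappa> (indicator B) = (\<lambda>x. \<Sum>e\<in>fst ` B. cut e (B `` {e}) x)"
proof
  fix x
  have "{e. \<exists>y. indicator B (e, y) \<noteq> (0::complex)} \<subseteq> fst ` B"
    by (auto simp: indicator_def image_iff split: if_splits) force
  then have "\<kappa> (indicator B) x = (\<Sum>e\<in>fst ` B. indicator B (e, x) * complex_of_real (e x))"
    using assms by (intro \<kappa>_eq) (auto simp: R_def)
  also have "\<dots> = (\<Sum>e\<in>fst ` B. cut e (B `` {e}) x)"
    by (intro sum.cong) (auto simp: cut_def indicator_def)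
  finally show "\<kappa> (indicator B) x = \<dots>" .
qed

lemma \<kappa>_indicator_in: "B \<in> R \<Longrightarrow> \<kappa> (indicator B) \<in> V"
  unfolding \<kappa>_indicator by (rule sum_in) (auto simp: R_def)

text \<open>
  Restricting each of finitely many weights to the set where it is the largest one changes
  \<open>\<kappa> g\<close> by a null function only and makes the supports disjoint.
\<close>

definition top_set :: "('x \<Rightarrow> real) set \<Rightarrow> ('x \<Rightarrow> real) \<Rightarrow> 'x set" where
  "top_set E e = {x. \<forall>f\<in>E - {e}. f x < e x}"

definition \<kappa>' :: "('x \<Rightarrow> real) set \<Rightarrow> (('x \<Rightarrow> real) \<times> 'x \<Rightarrow> complex) \<Rightarrow> 'x \<Rightarrow> complex" where
  "\<kappa>' E g x = (\<Sum>e\<in>E. if x \<in> top_set E e then g (e, x) * complex_of_real (e x) else 0)"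

text \<open>At most one weight is strictly largest at \<open>x\<close>. The alternative does not
  depend on \<open>g\<close>, so functions on pairs with disjoint supports are sent by
  \<open>\<kappa>'\<close> to disjoint functions.\<close>

lemma \<kappa>'_cases:
  assumes "finite E"
  shows "(\<exists>e\<in>E. x \<in> top_set E e \<and> (\<forall>g. \<kappa>' E g x = g (e, x) * complex_of_real (e x))) \<or> (\<forall>g. \<kappa>' E g x = 0)"
proof (cases "\<exists>e\<in>E. x \<in> top_set E e")
  case True
  then obtain e where e: "e \<in> E" "x \<in> top_set E e" by blast
  have uniq: "f = e" if "f \<in> E" "x \<in> top_set E f" for f
  proof (rule ccontr)
    assume "f \<noteq> e"
    then have "f x < e x" "e x < f x" using e that by (auto simp: top_set_def)
    then show False by simp
  qed
  have "\<kappa>' E g x = g (e, x) * complex_of_real (e x)" for g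
  proof -
    have "\<kappa>' E g x = (\<Sum>f\<in>E. if f = e then g (f, x) * complex_of_real (f x) else 0)"
      unfolding \<kappa>'_def
    proof (intro sum.cong refl)
      fix f assume "f \<in> E"
      then have "x \<in> top_set E f \<longleftrightarrow> f = e" using uniq e by blast
      then show "(if x \<in> top_set E f then g (f, x) * complex_of_real (f x) else 0)
        = (if f = e then g (f, x) * complex_of_real (f x) else 0)" by simp
    qed
    also have "\<dots> = g (e, x) * complex_of_real (e x)" using assms e(1) by (simp add: sum.delta)
    finally show ?thesis .
  qed
  then show ?thesis using e by blast
next
  case False
  then have "\<forall>g. \<kappa>' E g x = 0" unfolding \<kappa>'_def by (auto intro!: sum.neutral)
  then show ?thesis by blast
qed

text \<open>The sum of all pairwise minima dominates, up to a constant, what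
  \<open>\<kappa>'\<close> drops. Each minimum is null because the family is disjoint.\<close>

lemma overlap:
  assumes "finite E" "E \<subseteq> F"
  shows "(\<lambda>x. \<Sum>e\<in>E. \<Sum>f\<in>E - {e}. min (e x) (f x)) \<in> Vpos"
    and "\<Phi> (rl (\<lambda>x. \<Sum>e\<in>E. \<Sum>f\<in>E - {e}. min (e x) (f x))) = 0"
proof -
  have m: "(\<lambda>x. min (e x) (f x)) \<in> Vpos" "\<Phi> (rl (\<lambda>x. min (e x) (f x))) = 0" if "e \<in> E" "f \<in> E - {e}" for e f
  proof -
    have ef: "e \<in> F" "f \<in> F" "e \<noteq> f" using that assms(2) by auto
    show "(\<lambda>x. min (e x) (f x)) \<in> Vpos" by (rule Vpos_min[OF F_Vpos[OF ef(1)] F_Vpos[OF ef(2)]])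
    show "\<Phi> (rl (\<lambda>x. min (e x) (f x))) = 0" by (rule F_null[OF ef])
  qed
  have s: "(\<lambda>x. \<Sum>f\<in>E - {e}. min (e x) (f x)) \<in> Vpos \<and> \<Phi> (rl (\<lambda>x. \<Sum>f\<in>E - {e}. min (e x) (f x))) = 0" if "e \<in> E" for e
    using Vpos_sum[of "E - {e}" "\<lambda>f x. min (e x) (f x)"] Vpos_null_sum[of "E - {e}" "\<lambda>f x. min (e x) (f x)"]
      m[OF that] assms(1) by blast
  show "(\<lambda>x. \<Sum>e\<in>E. \<Sum>f\<in>E - {e}. min (e x) (f x)) \<in> Vpos"
    using Vpos_sum[of E "\<lambda>e x. \<Sum>f\<in>E - {e}. min (e x) (f x)"] s assms(1) by blast
  show "\<Phi> (rl (\<lambda>x. \<Sum>e\<in>E. \<Sum>f\<in>E - {e}. min (e x) (f x))) = 0"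
    using Vpos_null_sum[of E "\<lambda>e x. \<Sum>f\<in>E - {e}. min (e x) (f x)"] s assms(1) by blast
qed

text \<open>Where \<open>e\<close> is not strictly largest, some other \<open>f\<close> has
  \<open>e x \<le> f x\<close>, so \<open>e x\<close> is the minimum of the two and the dropped term
  is at most \<open>C\<close> times the overlap. Domination by a null function also puts the
  difference into \<open>V\<close>.\<close>

lemma \<kappa>'_null:
  assumes E: "finite E" "E \<subseteq> F" "{e. \<exists>y. g (e, y) \<noteq> 0} \<subseteq> E" and fin: "finite (range g)" and \<kappa>: "\<kappa> g \<in> V"
  shows "\<kappa>' E g \<in> V" "\<Phi> (\<lambda>x. \<kappa> g x - \<kappa>' E g x) = 0"
proof -
  let ?n = "\<lambda>x. \<Sum>e\<in>E. \<Sum>f\<in>E - {e}. min (e x) (f x)"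
  define C where "C = Max (insert 0 (cmod ` range g))"
  have C: "0 \<le> C" "\<And>y. cmod (g y) \<le> C" unfolding C_def using fin by (intro Max_ge; simp)+
  have n: "rl ?n \<in> V" "\<Phi> (rl ?n) = 0" using overlap[OF E(1,2)] by (auto simp: Vpos_def)
  have bound: "cmod (\<kappa> g x - \<kappa>' E g x) \<le> cmod (complex_of_real C * rl ?n x)" for x
  proof -
    have "\<kappa> g x - \<kappa>' E g x = (\<Sum>e\<in>E. if x \<in> top_set E e then 0 else g (e, x) * complex_of_real (e x))"
      unfolding \<kappa>_eq[OF E(1,3)] \<kappa>'_def sum_subtractf[symmetric] by (intro sum.cong) auto
    also have "cmod \<dots> \<le> (\<Sum>e\<in>E. C * (\<Sum>f\<in>E - {e}. min (e x) (f x)))"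
    proof (intro sum_norm_le)
      fix e assume e: "e \<in> E"
      have nn: "0 \<le> min (e x) (f x)" if "f \<in> E" for f using e that E(2) F_nonneg by (auto simp: subset_eq)
      show "cmod (if x \<in> top_set E e then 0 else g (e, x) * complex_of_real (e x)) \<le> C * (\<Sum>f\<in>E - {e}. min (e x) (f x))"
      proof (cases "x \<in> top_set E e")
        case True
        then show ?thesis using C(1) nn by (auto intro!: mult_nonneg_nonneg sum_nonneg)
      next
        case False
        then obtain f where f: "f \<in> E - {e}" "e x \<le> f x" by (auto simp: top_set_def not_less)
        have "e x = min (e x) (f x)" using f by simp
        also have "\<dots> \<le> (\<Sum>f\<in>E - {e}. min (e x) (f x))"
          using f(1) E(1) nn by (intro member_le_sum) auto
        finally have "cmod (g (e, x)) * e x \<le> C * (\<Sum>f\<in>E - {e}. min (e x) (f x))"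
          using C e E(2) F_nonneg by (intro mult_mono) (auto simp: subset_eq)
        then show ?thesis using False e E(2) F_nonneg[of e x] by (simp add: norm_mult subset_eq)
      qed
    qed
    also have "\<dots> = C * ?n x" by (simp add: sum_distrib_left)
    also have "\<dots> \<le> cmod (complex_of_real C * rl ?n x)"
      unfolding of_real_mult[symmetric] norm_of_real by simp
    finally show ?thesis .
  qed
  have w: "(\<lambda>x. complex_of_real C * rl ?n x) \<in> V" "\<Phi> (\<lambda>x. complex_of_real C * rl ?n x) = 0"
    using scale_in[OF n(1)] scale[OF n(1), of "complex_of_real C"] n(2) by simp_all
  have d: "(\<lambda>x. \<kappa> g x - \<kappa>' E g x) \<in> V" by (rule null_in[OF w bound])
  show "\<kappa>' E g \<in> V" using diff_in[OF \<kappa> d] by simp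
  show "\<Phi> (\<lambda>x. \<kappa> g x - \<kappa>' E g x) = 0"
    using mono[OF d w(1) bound] w(2) nonneg[OF d] by simp
qed

lemma indicator_support: "{e. \<exists>y. indicator B (e, y) \<noteq> (0::complex)} \<subseteq> fst ` B"
  by (auto simp: indicator_def image_iff split: if_splits) force

lemma finite_range_indicator: "finite (range (indicator B :: _ \<Rightarrow> complex))"
  by (rule finite_subset[of _ "{0, 1}"]) (auto simp: indicator_def)

lemma \<kappa>'_indicator:
  assumes "B \<in> R" "finite E" "E \<subseteq> F" "fst ` B \<subseteq> E"
  shows "\<kappa>' E (indicator B) \<in> V" "\<Phi> (\<kappa>' E (indicator B)) = \<nu> B"
proof -
  note \<kappa>'_null[OF assms(2,3) order_trans[OF indicator_support assms(4)] finite_range_indicator \<kappa>_indicator_in[OF assms(1)]]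
  then show "\<kappa>' E (indicator B) \<in> V" "\<Phi> (\<kappa>' E (indicator B)) = \<nu> B"
    using null_cong[OF \<kappa>_indicator_in[OF assms(1)], of "\<kappa>' E (indicator B)"] by (auto simp: \<nu>_def)
qed

lemma U_enc: "e \<in> F \<Longrightarrow> B \<in> U (enc e P) \<longleftrightarrow> B `` {e} \<in> P"
  unfolding U_def using enc_inj by blast

sublocale S: stone Z U R \<nu>
proof
  have "cut e {} = (\<lambda>_. 0)" for e by (rule ext) (simp add: cut_def)
  then show "{} \<in> R" by (simp add: R_def zero_in)
  show un: "A \<union> B \<in> R" if "A \<in> R" "B \<in> R" for A B
    using that cut_Un by (simp add: R_def image_Un Un_Image)
  show "A - B \<in> R" if "A \<in> R" "B \<in> R" for A B
  proof -
    have "fst ` (A - B) \<subseteq> fst ` A" by auto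
    moreover have "(A - B) `` {e} = A `` {e} - B `` {e}" for e by auto
    ultimately show ?thesis using that finite_subset[of "fst ` (A - B)" "fst ` A"] cut_Diff
      by (simp add: R_def subset_trans[of "fst ` (A - B)" "fst ` A" F])
  qed
  show "0 \<le> \<nu> A" if "A \<in> R" for A unfolding \<nu>_def by (rule nonneg[OF \<kappa>_indicator_in[OF that]])
  show "\<nu> (A \<union> B) = \<nu> A + \<nu> B" if A: "A \<in> R" and B: "B \<in> R" and d: "A \<inter> B = {}" for A B
  proof -
    \<comment> \<open>A common finite set of weights, so that the modifications
      \<open>\<kappa>' E\<close> for \<open>A\<close>, \<open>B\<close> and their union are additive
      in the indicator.\<close>
    define E where "E = fst ` A \<union> fst ` B"
    have E: "finite E" "E \<subseteq> F" "fst ` A \<subseteq> E" "fst ` B \<subseteq> E" "fst ` (A \<union> B) \<subseteq> E"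
      using A B by (auto simp: R_def E_def)
    have split: "indicator (A \<union> B) y = (indicator A y + indicator B y :: complex)" for y
      using d by (auto simp: indicator_def)
    have eq: "\<kappa>' E (indicator (A \<union> B)) = (\<lambda>x. \<kappa>' E (indicator A) x + \<kappa>' E (indicator B) x)"
      unfolding \<kappa>'_def sum.distrib[symmetric] by (intro ext sum.cong) (auto simp: split distrib_right)
    have dis: "\<kappa>' E (indicator A) x = 0 \<or> \<kappa>' E (indicator B) x = 0" for x
      using \<kappa>'_cases[OF E(1), of x] d by (auto simp: indicator_def)
    show ?thesis
      using disjoint_add[OF \<kappa>'_indicator(1)[OF A E(1,2,3)] \<kappa>'_indicator(1)[OF B E(1,2,4)] dis]
      unfolding eq[symmetric] \<kappa>'_indicator(2)[OF A E(1,2,3)] \<kappa>'_indicator(2)[OF B E(1,2,4)]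
        \<kappa>'_indicator(2)[OF un[OF A B] E(1,2,5)] .
  qed
next
  fix z :: 'z and A B :: "(('x \<Rightarrow> real) \<times> 'x) set" assume "z \<in> Z"
  then obtain e P where z: "z = enc e P" "e \<in> F" "ultra P" by (auto simp: Z_def)
  have Int: "(A \<inter> B) `` {e} = A `` {e} \<inter> B `` {e}" and C: "(- A) `` {e} = - (A `` {e})" by auto
  show "B \<in> U z" if "A \<in> U z" "A \<subseteq> B"
  proof -
    have "A `` {e} \<subseteq> B `` {e}" using that by auto
    then show ?thesis using that z by (simp add: U_enc ultra_def)
  qed
  show "A \<inter> B \<in> U z" if "A \<in> U z" "B \<in> U z"
    using that z unfolding z(1) U_enc[OF z(2)] Int by (simp add: ultra_def)
  show "{} \<notin> U z" using z by (simp add: U_enc ultra_def)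
  show "A \<in> U z \<or> - A \<in> U z" using z(3) unfolding z(1) U_enc[OF z(2)] C ultra_def by blast
next
  fix S :: "nat \<Rightarrow> (('x \<Rightarrow> real) \<times> 'x) set"
  assume S: "\<And>n. S n \<in> R" "decseq S" "\<And>n. S n \<noteq> {}"
  \<comment> \<open>Only finitely many weights occur in \<open>S 0\<close>. If over each of them
    some section were empty, then \<open>S m\<close> would be empty at the largest of these indices.
    So one weight has only nonempty sections, and \<open>ultra_exists\<close> applies over
    it.\<close>
  have "\<exists>e\<in>fst ` S 0. \<forall>n. S n `` {e} \<noteq> {}"
  proof (rule ccontr)
    assume "\<not> (\<exists>e\<in>fst ` S 0. \<forall>n. S n `` {e} \<noteq> {})"
    then obtain n where n: "\<And>e. e \<in> fst ` S 0 \<Longrightarrow> S (n e) `` {e} = {}" by metis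
    define m where "m = Max (n ` fst ` S 0)"
    have fin: "finite (fst ` S 0)" using S(1)[of 0] by (simp add: R_def)
    obtain e y where ey: "(e, y) \<in> S m" using S(3)[of m] by auto
    have "S m \<subseteq> S 0" using S(2) by (simp add: decseq_def)
    then have e0: "e \<in> fst ` S 0" using ey by (metis fst_conv imageI subsetD)
    then have "n e \<le> m" unfolding m_def using fin by (intro Max_ge) auto
    then have "S m \<subseteq> S (n e)" using S(2) by (simp add: decseq_def)
    then show False using n[OF e0] ey by blast
  qed
  then obtain e where e: "e \<in> fst ` S 0" "\<And>n. S n `` {e} \<noteq> {}" by blast
  have eF: "e \<in> F" using e(1) S(1)[of 0] by (auto simp: R_def)
  have "decseq (\<lambda>n. S n `` {e})" using S(2) by (auto simp: decseq_def)
  then obtain P where P: "ultra P" "\<And>n. S n `` {e} \<in> P"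
    using ultra_exists[of "\<lambda>n. S n `` {e}"] e(2) by blast
  show "\<exists>z\<in>Z. \<forall>n. S n \<in> U z"
    by (rule bexI[of _ "enc e P"]) (use P eF in \<open>auto simp: U_enc Z_def\<close>)
qed

end

text \<open>\<open>t\<close> is measured in steps of height \<open>h\<close>, one for each level
  \<open>c i\<close> below \<open>t\<close>. A level may lie anywhere inside its interval, which
  leaves room to choose admissible ones. The error \<open>D k\<close> up to height
  \<open>k * h\<close> is 0 while \<open>k * h \<le> t\<close>, since all \<open>k\<close> levels
  have then been passed.\<close>

lemma staircase:
  fixes h t :: real
  assumes "0 < h" "0 \<le> t" "t \<le> real m * h"
    and c: "\<And>i. real i * h < c i" "\<And>i. c i < (real i + 1) * h"
  shows "\<bar>t - h * (\<Sum>i<m. if c i < t then 1 else 0)\<bar> \<le> h"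
proof -
  define D where "D k = min t (real k * h) - h * (\<Sum>i<k. if c i < t then 1 else 0)" for k
  have "(real k * h \<le> t \<longrightarrow> D k = 0) \<and> \<bar>D k\<bar> \<le> h" for k
  proof (induction k)
    case 0
    then show ?case using assms by (simp add: D_def)
  next
    case (Suc k)
    have S: "real (Suc k) * h = real k * h + h" by (simp add: algebra_simps)
    have D: "D (Suc k) = D k + (min t (real k * h + h) - min t (real k * h)) - h * (if c k < t then 1 else 0)"
      unfolding D_def S by (simp add: algebra_simps)
    have ck: "real k * h < c k" "c k < real k * h + h" using c[of k] by (simp_all add: algebra_simps)
    show ?case
    proof (cases "real k * h \<le> t")
      case True
      then have "D k = 0" using Suc by simp
      then show ?thesis using D S ck True \<open>0 < h\<close> by (auto split: if_splits simp: min_def)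
    next
      case False
      then have "\<not> c k < t" "\<not> real (Suc k) * h \<le> t" using ck S \<open>0 < h\<close> by linarith+
      then show ?thesis using D S Suc False \<open>0 < h\<close> by (simp add: min_def)
    qed
  qed
  then have "\<bar>D m\<bar> \<le> h" by blast
  then show ?thesis using assms(3) by (simp add: D_def)
qed

context clattice
begin

lemma disjoint_sum:
  assumes "finite I" "\<And>i. i \<in> I \<Longrightarrow> u i \<in> V"
    and "\<And>i j x. i \<in> I \<Longrightarrow> j \<in> I \<Longrightarrow> i \<noteq> j \<Longrightarrow> u i x = 0 \<or> u j x = 0"
  shows "\<Phi> (\<lambda>x. \<Sum>i\<in>I. u i x) = (\<Sum>i\<in>I. \<Phi> (u i))"
  using assms
proof (induction I rule: finite_induct)
  case (insert i I)
  have "\<Phi> (\<lambda>x. u i x + (\<Sum>j\<in>I. u j x)) = \<Phi> (u i) + \<Phi> (\<lambda>x. \<Sum>j\<in>I. u j x)"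
  proof (rule disjoint_add)
    fix x
    show "u i x = 0 \<or> (\<Sum>j\<in>I. u j x) = 0"
    proof (cases "u i x = 0")
      case False
      then have "u j x = 0" if "j \<in> I" for j using insert.prems(2)[of i j x] insert.hyps that by auto
      then show ?thesis by simp
    qed simp
  qed (use insert in \<open>auto intro!: sum_in\<close>)
  then show ?case using insert by simp
qed (simp add: zero)

end

section \<open>Admissible level sets, and the isometry on step functions\<close>

context kakutani
begin

text \<open>The functions \<open>min e (max 0 (n * (u - c * e)))\<close> lie in \<open>V\<close> and
  increase to the cut. They differ from it only where \<open>0 < u - c * e\<close>, and there by at
  most the function assumed to be small, so \<open>dom_in\<close> applies.\<close>

lemma level_set_in:
  assumes e: "e \<in> Vpos" and u: "u \<in> Vpos"
    and small: "\<And>\<epsilon>. 0 < \<epsilon> \<Longrightarrow> \<exists>n::nat. \<Phi> (rl (\<lambda>x. max 0 (e x - real n * \<bar>u x - c * e x\<bar>))) < \<epsilon>"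
  shows "cut e {x. c * e x < u x} \<in> V"
proof (rule dom_in)
  fix \<epsilon> :: real assume "0 < \<epsilon>"
  then obtain n :: nat where n: "\<Phi> (rl (\<lambda>x. max 0 (e x - real n * \<bar>u x - c * e x\<bar>))) < \<epsilon>"
    using small by blast
  have e0: "0 \<le> e x" for x using e by (simp add: Vpos_def)
  have V: "rl e \<in> V" "rl u \<in> V" using e u by (auto simp: Vpos_def)
  have "(\<lambda>x. complex_of_real (cmod (1 * rl u x + complex_of_real (- c) * rl e x))) \<in> V"
    by (intro norm_in lin_in V)
  moreover have "cmod (1 * rl u x + complex_of_real (- c) * rl e x) = \<bar>u x - c * e x\<bar>" for x
    by (simp flip: of_real_mult of_real_diff)
  ultimately have w: "(\<lambda>x. \<bar>u x - c * e x\<bar>) \<in> Vpos" by (simp add: Vpos_def)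
  have h: "(\<lambda>x. max 0 (e x - real n * \<bar>u x - c * e x\<bar>)) \<in> Vpos"
    using Vpos_pos_part[OF e w, of 1 "- real n"] by simp
  have a: "(\<lambda>x. min (e x) (max 0 (real n * u x + (- (real n * c)) * e x))) \<in> Vpos"
    by (intro Vpos_min e Vpos_pos_part u)
  show "\<exists>a\<in>V. \<exists>w\<in>V. \<Phi> w < \<epsilon> \<and> (\<forall>x. cmod (cut e {x. c * e x < u x} x - a x) \<le> cmod (w x))"
  proof (intro bexI conjI allI)
    show "\<Phi> (rl (\<lambda>x. max 0 (e x - real n * \<bar>u x - c * e x\<bar>))) < \<epsilon>" by (rule n)
    show "rl (\<lambda>x. max 0 (e x - real n * \<bar>u x - c * e x\<bar>)) \<in> V" using h by (simp add: Vpos_def)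
    show "rl (\<lambda>x. min (e x) (max 0 (real n * u x + (- (real n * c)) * e x))) \<in> V" using a by (simp add: Vpos_def)
    fix x
    have eq: "real n * u x + (- (real n * c)) * e x = real n * (u x - c * e x)" by (simp add: algebra_simps)
    show "cmod (cut e {x. c * e x < u x} x - rl (\<lambda>x. min (e x) (max 0 (real n * u x + (- (real n * c)) * e x))) x)
      \<le> cmod (rl (\<lambda>x. max 0 (e x - real n * \<bar>u x - c * e x\<bar>)) x)"
    proof (cases "c * e x < u x")
      case True
      then have "0 \<le> real n * (u x - c * e x)" by simp
      moreover have "cmod (cut e {x. c * e x < u x} x - rl (\<lambda>x. min (e x) (max 0 (real n * u x + (- (real n * c)) * e x))) x)
        = \<bar>e x - min (e x) (max 0 (real n * (u x - c * e x)))\<bar>"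
        unfolding eq using True by (simp add: cut_def flip: of_real_diff)
      moreover have "\<bar>u x - c * e x\<bar> = u x - c * e x" using True by simp
      ultimately show ?thesis using e0[of x] by (simp add: min_def max_def)
    next
      case False
      then have "real n * (u x - c * e x) \<le> 0" by (simp add: mult_nonneg_nonpos)
      then have "min (e x) (max 0 (real n * u x + (- (real n * c)) * e x)) = 0"
        unfolding eq using e0[of x] by simp
      then show ?thesis using False by (simp add: cut_def)
    qed
  qed
qed

text \<open>
  For all but countably many levels \<open>c\<close> the set \<open>{u > c e}\<close> is admissible: the functions which bound
  the error at level \<open>c\<close> have disjoint supports for finitely many \<open>c\<close> and are at most \<open>e\<close>.
\<close>

lemma good_level:
  assumes e: "e \<in> Vpos" and u: "u \<in> Vpos" and ab: "a < (b::real)"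
  shows "\<exists>c. a < c \<and> c < b \<and> cut e {x. c * e x < u x} \<in> V"
proof -
  define h where "h n c x = max 0 (e x - real n * \<bar>u x - c * e x\<bar>)" for n c x
  have e0: "0 \<le> e x" for x using e by (simp add: Vpos_def)
  have V: "rl e \<in> V" "rl u \<in> V" using e u by (auto simp: Vpos_def)
  have hV: "h n c \<in> Vpos" for n c
  proof -
    have "(\<lambda>x. complex_of_real (cmod (1 * rl u x + complex_of_real (- c) * rl e x))) \<in> V"
      by (intro norm_in lin_in V)
    moreover have "cmod (1 * rl u x + complex_of_real (- c) * rl e x) = \<bar>u x - c * e x\<bar>" for x
      by (simp flip: of_real_mult of_real_diff)
    ultimately have "(\<lambda>x. \<bar>u x - c * e x\<bar>) \<in> Vpos" by (simp add: Vpos_def)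
    from Vpos_pos_part[OF e this, of 1 "- real n"] show ?thesis by (simp add: h_def[abs_def])
  qed
  \<comment> \<open>The bad levels, at which every error function keeps a value of
    \<open>\<Phi>\<close> of at least \<open>1 / (k + 1)\<close>. Each \<open>B k\<close> is finite,
    so the levels bad for some \<open>k\<close> are countable.\<close>
  define B where "B k = {c. \<forall>n. 1 / real (Suc k) \<le> \<Phi> (rl (h n c))}" for k
  have "finite (B k)" for k
  proof -
    have "card T \<le> nat \<lfloor>real (Suc k) * \<Phi> (rl e)\<rfloor>" if T: "T \<subseteq> B k" "finite T" for T
    proof -
      have "\<forall>\<^sub>F n in sequentially. \<forall>c\<in>T. \<forall>d\<in>T. c \<noteq> d \<longrightarrow> 2 \<le> real n * \<bar>c - d\<bar>"
      proof (intro eventually_ball_finite T ballI)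
        fix c d
        show "\<forall>\<^sub>F n in sequentially. c \<noteq> d \<longrightarrow> 2 \<le> real n * \<bar>c - d\<bar>"
        proof (cases "c = d")
          case False
          have "\<forall>\<^sub>F n in sequentially. 2 / \<bar>c - d\<bar> \<le> real n"
            using filterlim_real_sequentially unfolding filterlim_at_top by blast
          then show ?thesis by eventually_elim (use False in \<open>simp add: field_simps\<close>)
        qed simp
      qed
      then obtain n where n: "\<And>c d. c \<in> T \<Longrightarrow> d \<in> T \<Longrightarrow> c \<noteq> d \<Longrightarrow> 2 \<le> real n * \<bar>c - d\<bar>"
        unfolding eventually_sequentially by blast
      \<comment> \<open>Two nonzero values put \<open>u x\<close> within \<open>e x / n\<close> of
        both \<open>c * e x\<close> and \<open>d * e x\<close>, which forces
        \<open>n * |c - d| < 2\<close>, against the choice of \<open>n\<close>.\<close>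
      have dis: "h n c x = 0 \<or> h n d x = 0" if cd: "c \<in> T" "d \<in> T" "c \<noteq> d" for c d x
      proof (rule ccontr)
        assume "\<not> (h n c x = 0 \<or> h n d x = 0)"
        then have lt: "real n * \<bar>u x - c * e x\<bar> < e x" "real n * \<bar>u x - d * e x\<bar> < e x"
          unfolding h_def by (auto simp: max_def split: if_splits)
        have ex: "0 < e x" using lt(1) by (rule le_less_trans[rotated]) simp
        have "(c - d) * e x = (u x - d * e x) - (u x - c * e x)" by (simp add: left_diff_distrib)
        then have "\<bar>c - d\<bar> * e x = \<bar>(u x - d * e x) - (u x - c * e x)\<bar>"
          using ex by (metis abs_mult abs_of_pos)
        also have "\<dots> \<le> \<bar>u x - d * e x\<bar> + \<bar>u x - c * e x\<bar>" by simp
        finally have "real n * (\<bar>c - d\<bar> * e x) \<le> real n * (\<bar>u x - d * e x\<bar> + \<bar>u x - c * e x\<bar>)"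
          by (intro mult_left_mono) auto
        also have "\<dots> < 2 * e x" using lt by (simp add: distrib_left)
        finally have "(real n * \<bar>c - d\<bar>) * e x < 2 * e x" by (simp add: mult.assoc)
        then show False using n[OF cd] ex by simp
      qed
      have le: "(\<Sum>c\<in>T. h n c x) \<le> e x" for x
      proof (cases "\<exists>c\<in>T. h n c x \<noteq> 0")
        case True
        then obtain c where c: "c \<in> T" "h n c x \<noteq> 0" by blast
        have "(\<Sum>d\<in>T. h n d x) = (\<Sum>d\<in>T. if d = c then h n d x else 0)"
          by (intro sum.cong) (use dis[of c _ x] c in auto)
        also have "\<dots> = h n c x" using c T by (simp add: sum.delta)
        also have "\<dots> \<le> e x" using e0[of x] by (simp add: h_def)
        finally show ?thesis .
      qed (use e0 in \<open>simp add: sum.neutral\<close>)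
      have "real (card T) * (1 / real (Suc k)) \<le> (\<Sum>c\<in>T. \<Phi> (rl (h n c)))"
        using T by (intro sum_bounded_below) (auto simp: B_def)
      also have "\<dots> = \<Phi> (\<lambda>x. \<Sum>c\<in>T. rl (h n c) x)"
        using hV dis T by (intro disjoint_sum[symmetric]) (auto simp: Vpos_def)
      also have "(\<lambda>x. \<Sum>c\<in>T. rl (h n c) x) = rl (\<lambda>x. \<Sum>c\<in>T. h n c x)" by simp
      also have "\<Phi> (rl (\<lambda>x. \<Sum>c\<in>T. h n c x)) \<le> \<Phi> (rl e)"
        using le T hV by (intro Vpos_mono Vpos_sum e) auto
      finally have "real (card T) \<le> real (Suc k) * \<Phi> (rl e)" by (simp add: field_simps)
      then show ?thesis by (simp add: le_nat_floor)
    qed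
    then show ?thesis using finite_if_finite_subsets_card_bdd[of "B k"] by blast
  qed
  then have "countable (\<Union>k. B k)" by (auto intro: countable_finite)
  moreover have "uncountable {a<..<b}" using uncountable_open_interval ab by blast
  ultimately obtain c where c: "c \<in> {a<..<b}" "c \<notin> (\<Union>k. B k)"
    by (meson countable_subset subsetI)
  have "cut e {x. c * e x < u x} \<in> V"
  proof (rule level_set_in[OF e u])
    fix \<epsilon> :: real assume "0 < \<epsilon>"
    then obtain k where k: "1 / real (Suc k) < \<epsilon>"
      using reals_Archimedean by (auto simp: inverse_eq_divide)
    have "c \<notin> B k" using c by blast
    then obtain n where "\<Phi> (rl (h n c)) < 1 / real (Suc k)" unfolding B_def by (auto simp: not_le)
    then show "\<exists>n. \<Phi> (rl (\<lambda>x. max 0 (e x - real n * \<bar>u x - c * e x\<bar>))) < \<epsilon>"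
      using k unfolding h_def by (intro exI[of _ n]) simp
  qed
  then show ?thesis using c by auto
qed

lemma SR_support:
  assumes "g \<in> S.SR"
  shows "finite {e. \<exists>y. g (e, y) \<noteq> 0}" "{e. \<exists>y. g (e, y) \<noteq> 0} \<subseteq> F"
proof -
  have "g -` (- {0}) \<in> R" by (rule S.SR_preimage[OF assms]) simp
  moreover have "{e. \<exists>y. g (e, y) \<noteq> 0} = fst ` (g -` (- {0}))" by force
  ultimately show "finite {e. \<exists>y. g (e, y) \<noteq> 0}" "{e. \<exists>y. g (e, y) \<noteq> 0} \<subseteq> F"
    by (simp_all add: R_def)
qed

lemma \<kappa>_add:
  assumes "g \<in> S.SR" "h \<in> S.SR"
  shows "\<kappa> (\<lambda>y. c * g y + d * h y) x = c * \<kappa> g x + d * \<kappa> h x"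
proof -
  let ?E = "{e. \<exists>y. g (e, y) \<noteq> 0} \<union> {e. \<exists>y. h (e, y) \<noteq> 0}"
  have E: "finite ?E" using SR_support assms by blast
  have "\<kappa> (\<lambda>y. c * g y + d * h y) x = (\<Sum>e\<in>?E. (c * g (e, x) + d * h (e, x)) * complex_of_real (e x))"
    by (rule \<kappa>_eq[OF E]) auto
  also have "\<dots> = c * (\<Sum>e\<in>?E. g (e, x) * complex_of_real (e x)) + d * (\<Sum>e\<in>?E. h (e, x) * complex_of_real (e x))"
    by (simp add: sum_distrib_left sum.distrib algebra_simps)
  also have "\<dots> = c * \<kappa> g x + d * \<kappa> h x"
    by (subst (1 2) \<kappa>_eq[OF E]) auto
  finally show ?thesis .
qed

lemma SR_expand:
  assumes "g \<in> S.SR"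
  shows "g y = (\<Sum>v\<in>range g - {0}. v * indicator (g -` {v}) y)"
proof -
  have "(\<Sum>v\<in>range g - {0}. v * indicator (g -` {v}) y) = (\<Sum>v\<in>range g - {0}. if v = g y then v else 0)"
    by (intro sum.cong) (auto simp: indicator_def)
  also have "\<dots> = g y" using assms by (auto simp: S.SR_def sum.delta')
  finally show ?thesis by simp
qed

lemma \<kappa>_expand:
  assumes g: "g \<in> S.SR"
  shows "\<kappa> g x = (\<Sum>v\<in>range g - {0}. v * \<kappa> (indicator (g -` {v})) x)"
proof -
  let ?E = "{e. \<exists>y. g (e, y) \<noteq> 0}"
  have E: "finite ?E" using SR_support[OF g] by blast
  have v: "\<kappa> (indicator (g -` {v})) x = (\<Sum>e\<in>?E. indicator (g -` {v}) (e, x) * complex_of_real (e x))" if "v \<noteq> 0" for v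
    by (rule \<kappa>_eq[OF E]) (use that in \<open>auto simp: indicator_def split: if_splits\<close>)
  have "\<kappa> g x = (\<Sum>e\<in>?E. (\<Sum>v\<in>range g - {0}. v * indicator (g -` {v}) (e, x)) * complex_of_real (e x))"
    unfolding \<kappa>_def by (intro sum.cong) (simp_all flip: SR_expand[OF g])
  also have "\<dots> = (\<Sum>v\<in>range g - {0}. \<Sum>e\<in>?E. v * (indicator (g -` {v}) (e, x) * complex_of_real (e x)))"
    unfolding sum_distrib_right by (subst sum.swap) (simp add: mult.assoc)
  also have "\<dots> = (\<Sum>v\<in>range g - {0}. v * \<kappa> (indicator (g -` {v})) x)"
    by (intro sum.cong) (auto simp: v sum_distrib_left)
  finally show ?thesis .
qed

lemma \<kappa>'_expand:
  assumes g: "g \<in> S.SR"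
  shows "\<kappa>' E g x = (\<Sum>v\<in>range g - {0}. v * \<kappa>' E (indicator (g -` {v})) x)"
proof -
  have "\<kappa>' E g x = (\<Sum>e\<in>E. \<Sum>v\<in>range g - {0}. v * (if x \<in> top_set E e then indicator (g -` {v}) (e, x) * complex_of_real (e x) else 0))"
    unfolding \<kappa>'_def
  proof (intro sum.cong refl)
    fix e
    show "(if x \<in> top_set E e then g (e, x) * complex_of_real (e x) else 0) =
      (\<Sum>v\<in>range g - {0}. v * (if x \<in> top_set E e then indicator (g -` {v}) (e, x) * complex_of_real (e x) else 0))"
      by (subst SR_expand[OF g]) (simp add: sum_distrib_right mult.assoc)
  qed
  also have "\<dots> = (\<Sum>v\<in>range g - {0}. v * \<kappa>' E (indicator (g -` {v})) x)"
    unfolding \<kappa>'_def sum_distrib_left by (rule sum.swap)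
  finally show ?thesis .
qed

lemma \<kappa>_in: "g \<in> S.SR \<Longrightarrow> \<kappa> g \<in> V"
proof -
  assume g: "g \<in> S.SR"
  have "(\<lambda>x. \<Sum>v\<in>range g - {0}. v * \<kappa> (indicator (g -` {v})) x) \<in> V"
    using g by (intro sum_in scale_in \<kappa>_indicator_in S.SR_preimage[OF g]) (auto simp: S.SR_def)
  then show ?thesis by (simp flip: \<kappa>_expand[OF g])
qed

text \<open>After passing to \<open>\<kappa>'\<close>, the pieces belonging to different values of
  \<open>g\<close> are disjoint, and \<open>p\<close>-additivity gives the same finite sum that
  computes the integral of the lift.\<close>

lemma \<Phi>_\<kappa>:
  assumes g: "g \<in> S.SR"
  shows "\<Phi> (\<kappa> g) = Ip p S.N (S.lift g)"
proof -
  let ?E = "{e. \<exists>y. g (e, y) \<noteq> 0}"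
  have fin: "finite (range g)" using g by (simp add: S.SR_def)
  note E = SR_support[OF g]
  note null = \<kappa>'_null[OF E order_refl fin \<kappa>_in[OF g]]
  let ?i = "\<lambda>v. \<kappa>' ?E (indicator (g -` {v}))"
  have B: "g -` {v} \<in> R" "?i v \<in> V" "\<Phi> (?i v) = \<nu> (g -` {v})" if "v \<noteq> 0" for v
  proof -
    show B: "g -` {v} \<in> R" using that by (intro S.SR_preimage[OF g]) simp
    have "fst ` (g -` {v}) \<subseteq> ?E" using that by force
    then show "?i v \<in> V" "\<Phi> (?i v) = \<nu> (g -` {v})" by (rule \<kappa>'_indicator[OF B E])+
  qed
  have "\<Phi> (\<kappa> g) = \<Phi> (\<kappa>' ?E g)" by (rule null_cong[OF \<kappa>_in[OF g] null])
  also have "\<kappa>' ?E g = (\<lambda>x. \<Sum>v\<in>range g - {0}. v * ?i v x)"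
    by (rule ext) (rule \<kappa>'_expand[OF g])
  also have "\<Phi> \<dots> = (\<Sum>v\<in>range g - {0}. \<Phi> (\<lambda>x. v * ?i v x))"
  proof (rule disjoint_sum)
    fix v w x assume "v \<in> range g - {0}" "w \<in> range g - {0}" "v \<noteq> w"
    then show "v * ?i v x = 0 \<or> w * ?i w x = 0"
      using \<kappa>'_cases[OF E(1), of x] by (auto simp: indicator_def)
  qed (use fin B in \<open>auto intro!: scale_in\<close>)
  also have "\<dots> = (\<Sum>v\<in>range g - {0}. cmod v powr p * \<nu> (g -` {v}))"
    by (intro sum.cong) (auto simp: scale B)
  also have "\<dots> = Ip p S.N (S.lift g)" by (rule S.lift_Lp(2)[OF g, symmetric])
  finally show ?thesis .
qed

lemma norm_SR: "g \<in> S.SR \<Longrightarrow> (\<lambda>y. complex_of_real (cmod (g y))) \<in> S.SR"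
  using S.SR_op[of g g "\<lambda>a b. complex_of_real (cmod a)"] by simp

text \<open>For \<open>\<kappa>'\<close> the modulus of the image is exactly the image of the
  modulus, because at most one term is present at a point and the weights are nonnegative. Both
  \<open>\<kappa> g\<close> and \<open>\<kappa>\<close> of the modulus differ from this by null
  functions.\<close>

lemma \<kappa>_norm:
  assumes g: "g \<in> S.SR"
  shows "\<Phi> (\<lambda>x. complex_of_real (cmod (\<kappa> g x)) - \<kappa> (\<lambda>y. complex_of_real (cmod (g y))) x) = 0"
proof -
  let ?E = "{e. \<exists>y. g (e, y) \<noteq> 0}" and ?g = "\<lambda>y. complex_of_real (cmod (g y))"
  have fin: "finite (range g)" "finite (range ?g)" using g norm_SR[OF g] by (auto simp: S.SR_def)
  note E = SR_support[OF g]
  note n1 = \<kappa>'_null[OF E order_refl fin(1) \<kappa>_in[OF g]]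
  have sub: "{e. \<exists>y. ?g (e, y) \<noteq> 0} \<subseteq> ?E" by auto
  note n2 = \<kappa>'_null[OF E sub fin(2) \<kappa>_in[OF norm_SR[OF g]]]
  have eq: "complex_of_real (cmod (\<kappa>' ?E g x)) = \<kappa>' ?E ?g x" for x
    using \<kappa>'_cases[OF E(1), of x] E(2) F_nonneg by (auto simp: norm_mult subset_eq)
  note V = \<kappa>_in[OF g] \<kappa>_in[OF norm_SR[OF g]]
  have "\<Phi> (\<lambda>x. complex_of_real (cmod (\<kappa> g x)) - \<kappa> ?g x)
    \<le> 2 powr p * (\<Phi> (\<lambda>x. \<kappa> g x - \<kappa>' ?E g x) + \<Phi> (\<lambda>x. \<kappa> ?g x - \<kappa>' ?E ?g x))"
  proof (intro dominated diff_in norm_in V n1 n2)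
    fix x
    have "complex_of_real (cmod (\<kappa> g x)) - \<kappa> ?g x
      = complex_of_real (cmod (\<kappa> g x) - cmod (\<kappa>' ?E g x)) - (\<kappa> ?g x - \<kappa>' ?E ?g x)"
      by (simp add: eq)
    also have "cmod \<dots> \<le> \<bar>cmod (\<kappa> g x) - cmod (\<kappa>' ?E g x)\<bar> + cmod (\<kappa> ?g x - \<kappa>' ?E ?g x)"
      by (rule order_trans[OF norm_triangle_ineq4]) (simp only: norm_of_real order_refl)
    also have "\<dots> \<le> cmod (\<kappa> g x - \<kappa>' ?E g x) + cmod (\<kappa> ?g x - \<kappa>' ?E ?g x)"
      by (intro add_right_mono abs_cmod_diff)
    finally show "cmod (complex_of_real (cmod (\<kappa> g x)) - \<kappa> ?g x)
      \<le> cmod (\<kappa> g x - \<kappa>' ?E g x) + cmod (\<kappa> ?g x - \<kappa>' ?E ?g x)" .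
  qed
  also have "\<dots> = 0" using n1(2) n2(2) by simp
  finally show ?thesis
    using nonneg[OF diff_in[OF norm_in[OF V(1)] V(2)]] by linarith
qed

end

section \<open>Density of the images of step functions\<close>

context kakutani
begin

lemma SR_add: "g \<in> S.SR \<Longrightarrow> h \<in> S.SR \<Longrightarrow> (\<lambda>y. c * g y + d * h y) \<in> S.SR"
  using S.SR_op[of g h "\<lambda>a b. c * a + d * b"] by simp

definition Cl :: "('x \<Rightarrow> complex) set" where
  "Cl = {u \<in> V. \<forall>\<epsilon>>0. \<exists>g\<in>S.SR. \<Phi> (\<lambda>x. u x - \<kappa> g x) < \<epsilon>}"

lemma Cl_lin:
  assumes u: "u \<in> Cl" and v: "v \<in> Cl"
  shows "(\<lambda>x. c * u x + d * v x) \<in> Cl"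
proof -
  have V: "u \<in> V" "v \<in> V" using u v by (auto simp: Cl_def)
  have "\<exists>g\<in>S.SR. \<Phi> (\<lambda>x. c * u x + d * v x - \<kappa> g x) < \<epsilon>" if e: "0 < \<epsilon>" for \<epsilon>
  proof -
    define C where "C = 2 powr p * (cmod c powr p + cmod d powr p + 1)"
    have C: "0 < C" by (simp add: C_def add_nonneg_pos)
    then have e': "0 < \<epsilon> / C" using e by simp
    obtain g where g: "g \<in> S.SR" "\<Phi> (\<lambda>x. u x - \<kappa> g x) < \<epsilon> / C" using u e' unfolding Cl_def by blast
    obtain h where h: "h \<in> S.SR" "\<Phi> (\<lambda>x. v x - \<kappa> h x) < \<epsilon> / C" using v e' unfolding Cl_def by blast
    note D = diff_in[OF V(1) \<kappa>_in[OF g(1)]] diff_in[OF V(2) \<kappa>_in[OF h(1)]]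
    have eq: "(\<lambda>x. c * u x + d * v x - \<kappa> (\<lambda>y. c * g y + d * h y) x)
        = (\<lambda>x. c * (u x - \<kappa> g x) + d * (v x - \<kappa> h x))"
      unfolding \<kappa>_add[OF g(1) h(1)] by (simp add: algebra_simps)
    have "\<Phi> (\<lambda>x. c * u x + d * v x - \<kappa> (\<lambda>y. c * g y + d * h y) x)
        \<le> 2 powr p * (\<Phi> (\<lambda>x. c * (u x - \<kappa> g x)) + \<Phi> (\<lambda>x. d * (v x - \<kappa> h x)))"
      unfolding eq by (intro quasi_triangle scale_in D)
    also have "\<dots> = 2 powr p * (cmod c powr p * \<Phi> (\<lambda>x. u x - \<kappa> g x) + cmod d powr p * \<Phi> (\<lambda>x. v x - \<kappa> h x))"
      unfolding scale[OF D(1)] scale[OF D(2)] ..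
    also have "\<dots> \<le> 2 powr p * (cmod c powr p * (\<epsilon> / C) + cmod d powr p * (\<epsilon> / C))"
      using g(2) h(2) by (intro mult_left_mono add_mono) auto
    also have "\<dots> < C * (\<epsilon> / C)"
      using e' by (simp add: C_def algebra_simps del: times_divide_eq_right times_divide_eq_left)
    also have "\<dots> = \<epsilon>" using C by simp
    finally show ?thesis using SR_add[OF g(1) h(1)] by blast
  qed
  then show ?thesis using V by (auto simp: Cl_def intro: lin_in)
qed

lemma Cl_limit:
  assumes u: "u \<in> V" and lim: "\<And>\<epsilon>. 0 < \<epsilon> \<Longrightarrow> \<exists>v\<in>Cl. \<Phi> (\<lambda>x. u x - v x) < \<epsilon>"
  shows "u \<in> Cl"
proof -
  have "\<exists>g\<in>S.SR. \<Phi> (\<lambda>x. u x - \<kappa> g x) < \<epsilon>" if e: "0 < \<epsilon>" for \<epsilon>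
  proof -
    have e': "0 < \<epsilon> / (2 * 2 powr p)" using e by simp
    obtain v where v: "v \<in> Cl" "\<Phi> (\<lambda>x. u x - v x) < \<epsilon> / (2 * 2 powr p)" using lim[OF e'] by blast
    obtain g where g: "g \<in> S.SR" "\<Phi> (\<lambda>x. v x - \<kappa> g x) < \<epsilon> / (2 * 2 powr p)"
      using v(1) e' unfolding Cl_def by blast
    have "v \<in> V" using v(1) by (simp add: Cl_def)
    then have "\<Phi> (\<lambda>x. u x - \<kappa> g x) \<le> 2 powr p * (\<Phi> (\<lambda>x. u x - v x) + \<Phi> (\<lambda>x. v x - \<kappa> g x))"
      by (intro diff_triangle u \<kappa>_in g)
    also have "\<dots> < 2 powr p * (\<epsilon> / (2 * 2 powr p) + \<epsilon> / (2 * 2 powr p))"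
      using v g by (intro mult_strict_left_mono add_strict_mono) auto
    also have "\<dots> = \<epsilon>" by simp
    finally show ?thesis using g(1) by blast
  qed
  then show ?thesis using u by (auto simp: Cl_def)
qed

lemma Cl_0: "(\<lambda>_. 0) \<in> Cl"
proof -
  have "(\<lambda>_. 0) \<in> S.SR" using S.indicator_SR[OF S.R_empty, of 0] by simp
  moreover have "\<kappa> (\<lambda>_. 0) = (\<lambda>_. 0)" by (rule ext) (simp add: \<kappa>_def)
  ultimately show ?thesis unfolding Cl_def using zero_in zero by (auto intro!: bexI[of _ "\<lambda>_. 0"])
qed

text \<open>The quotient \<open>u / e\<close> is bounded by \<open>n\<close>. Replacing it by a
  staircase of step \<open>h\<close> with admissible levels changes \<open>u\<close> by at most
  \<open>h * e\<close>, and \<open>\<Phi>\<close> of this is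
  \<open>h powr p * \<Phi> (rl e)\<close>.\<close>

lemma Cl_bounded_by_weight:
  assumes e: "e \<in> F" and u: "u \<in> Vpos" and le: "\<And>x. u x \<le> real n * e x"
  shows "rl u \<in> Cl"
proof (rule Cl_limit)
  show uV: "rl u \<in> V" using u by (simp add: Vpos_def)
  have u0: "0 \<le> u x" for x using u by (simp add: Vpos_def)
  fix \<epsilon> :: real assume \<epsilon>: "0 < \<epsilon>"
  have "((\<lambda>h. h powr p * \<Phi> (rl e)) \<longlongrightarrow> 0 * \<Phi> (rl e)) (at_right 0)"
    using p1 by (intro tendsto_mult_right tendsto_zero_powrI[where b = p] tendsto_ident_at tendsto_const)
      (auto simp: eventually_at_right_less eventually_at_filter)
  then have "\<forall>\<^sub>F h in at_right 0. h powr p * \<Phi> (rl e) < \<epsilon>"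
    using \<epsilon> by (intro order_tendstoD(2)[where a = \<epsilon>]) auto
  then obtain h where h: "0 < h" "h powr p * \<Phi> (rl e) < \<epsilon>"
    using eventually_happens[OF eventually_conj[OF eventually_at_right_less[of "0::real"]], of "\<lambda>h. h powr p * \<Phi> (rl e) < \<epsilon>"]
    by auto
  have "\<forall>i::nat. \<exists>c. real i * h < c \<and> c < (real i + 1) * h \<and> cut e {x. c * e x < u x} \<in> V"
    using good_level[OF F_Vpos[OF e] u] h(1) by simp
  then obtain c where c: "\<And>i. real i * h < c i" "\<And>i. c i < (real i + 1) * h"
      "\<And>i. cut e {x. c i * e x < u x} \<in> V" by metis
  \<comment> \<open>Enough steps of height \<open>h\<close> to reach the bound \<open>n\<close> of
    the quotient.\<close>
  obtain m where m: "real n \<le> real m * h"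
    using reals_Archimedean3[OF h(1)] by (metis less_imp_le)
  define A where "A i = {e} \<times> {x. c i * e x < u x}" for i
  have A: "A i \<in> R" for i
  proof -
    have "cut f {} = (\<lambda>_. 0)" for f by (rule ext) (simp add: cut_def)
    moreover have "A i `` {f} = (if f = e then {x. c i * e x < u x} else {})" for f by (auto simp: A_def)
    ultimately have "cut f (A i `` {f}) \<in> V" for f using c(3)[of i] zero_in by simp
    moreover have "fst ` A i \<subseteq> {e}" by (auto simp: A_def)
    ultimately show ?thesis using e finite_subset[of "fst ` A i" "{e}"] by (auto simp: R_def)
  qed
  define g where "g k y = (\<Sum>i<k. complex_of_real h * indicator (A i) y)" for k y
  have g: "g k \<in> S.SR" for k
  proof (induction k)
    case 0
    then show ?case using S.indicator_SR[OF S.R_empty, of 0] by (simp add: g_def[abs_def])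
  next
    case (Suc k)
    have "g (Suc k) = (\<lambda>y. 1 * g k y + 1 * (complex_of_real h * indicator (A k) y))"
      by (rule ext) (simp only: g_def sum.lessThan_Suc mult_1)
    then show ?case
      using SR_add[OF Suc S.indicator_SR[OF A[of k], of "complex_of_real h"], of 1 1] by (simp only:)
  qed
  have "{f. \<exists>y. g m (f, y) \<noteq> 0} \<subseteq> {e}"
  proof
    fix f assume "f \<in> {f. \<exists>y. g m (f, y) \<noteq> 0}"
    then obtain y where "g m (f, y) \<noteq> 0" by blast
    moreover have "g m (f, y) = 0" if "f \<noteq> e"
      unfolding g_def by (rule sum.neutral) (use that in \<open>simp add: A_def\<close>)
    ultimately show "f \<in> {e}" by blast
  qed
  then have \<kappa>: "\<kappa> (g m) x = g m (e, x) * complex_of_real (e x)" for x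
    using \<kappa>_eq[of "{e}" "g m" x] by simp
  have bound: "cmod (rl u x - \<kappa> (g m) x) \<le> cmod (complex_of_real h * rl e x)" for x
  proof (cases "e x = 0")
    case True
    then show ?thesis using le[of x] u0[of x] by (simp add: \<kappa>)
  next
    case False
    then have ex: "0 < e x" using F_nonneg[OF e, of x] by simp
    define t where "t = u x / e x"
    have t: "0 \<le> t" "u x = t * e x" using ex u0[of x] by (auto simp: t_def)
    have "t * e x \<le> real n * e x" using le[of x] t by simp
    then have tm: "t \<le> real m * h" using ex m by simp
    have "g m (e, x) = complex_of_real (h * (\<Sum>i<m. if c i < t then 1 else 0))"
      unfolding g_def sum_distrib_left of_real_sum
      by (intro sum.cong) (use ex t in \<open>auto simp: A_def indicator_def\<close>)
    then have "rl u x - \<kappa> (g m) x = complex_of_real ((t - h * (\<Sum>i<m. if c i < t then 1 else 0)) * e x)"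
      unfolding \<kappa> t(2) by (simp only: of_real_diff of_real_mult left_diff_distrib)
    then have "cmod (rl u x - \<kappa> (g m) x) = \<bar>t - h * (\<Sum>i<m. if c i < t then 1 else 0)\<bar> * e x"
      using ex by (simp only: norm_of_real abs_mult abs_of_pos)
    also have "\<dots> \<le> h * e x"
      using ex by (intro mult_right_mono staircase[OF h(1) t(1) tm c(1,2)]) auto
    also have "\<dots> = cmod (complex_of_real h * rl e x)" using h(1) ex by (simp add: norm_mult)
    finally show ?thesis .
  qed
  have "\<Phi> (\<lambda>x. rl u x - \<kappa> (g m) x) \<le> \<Phi> (\<lambda>x. complex_of_real h * rl e x)"
    by (intro mono diff_in uV \<kappa>_in g scale_in F_V e bound)
  also have "\<dots> < \<epsilon>" using h scale[OF F_V[OF e], of "complex_of_real h"] by simp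
  finally have *: "\<Phi> (\<lambda>x. rl u x - \<kappa> (g m) x) < \<epsilon>" .
  have "\<kappa> (g m) \<in> Cl"
    unfolding Cl_def using \<kappa>_in[OF g] zero by (auto intro!: bexI[of _ "g m"] g)
  then show "\<exists>v\<in>Cl. \<Phi> (\<lambda>x. rl u x - v x) < \<epsilon>" using * by blast
qed

text \<open>Riesz decomposition: \<open>min b (n * e)\<close> is bounded by one weight, and the
  remainder by \<open>n\<close> times the sum of the others.\<close>

lemma Cl_ideal:
  assumes "finite E" "E \<subseteq> F" "b \<in> Vpos" "\<And>x. b x \<le> real n * (\<Sum>e\<in>E. e x)"
  shows "rl b \<in> Cl"
  using assms
proof (induction E arbitrary: b rule: finite_induct)
  case empty
  then have "b x = 0" for x using empty(2) empty(3)[of x] by (simp add: Vpos_def order_antisym)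
  then show ?case using Cl_0 by simp
next
  case (insert e E)
  have e: "e \<in> F" using insert by simp
  define c where "c x = min (b x) (real n * e x)" for x
  have c: "c \<in> Vpos" unfolding c_def[abs_def] by (intro Vpos_min insert Vpos_scale F_Vpos e) simp
  have d: "(\<lambda>x. b x - c x) \<in> Vpos" by (intro Vpos_diff insert c) (simp add: c_def)
  have 1: "rl c \<in> Cl" by (rule Cl_bounded_by_weight[OF e c, of n]) (simp add: c_def)
  have s0: "0 \<le> (\<Sum>e\<in>E. e x)" for x using insert.prems(1) F_nonneg by (intro sum_nonneg) auto
  have "b x - c x \<le> real n * (\<Sum>e\<in>E. e x)" for x
    using insert.prems(3)[of x] insert.hyps mult_nonneg_nonneg[OF of_nat_0_le_iff[of n] s0[of x]]
    by (simp add: c_def min_def distrib_left)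
  then have 2: "rl (\<lambda>x. b x - c x) \<in> Cl" using insert.IH[OF _ d] insert.prems(1) by simp
  show ?case using Cl_lin[OF 1 2, of 1 1] by simp
qed

text \<open>
  The part of \<open>u\<close> in the band generated by \<open>F\<close> is the limit of a sequence in the ideal generated by
  \<open>F\<close> which is closest to \<open>u\<close>; the rest is disjoint from \<open>F\<close>, hence null.
\<close>

lemma Cl_pos:
  assumes u: "u \<in> Vpos"
  shows "rl u \<in> Cl"
proof -
  have uV: "rl u \<in> V" and u0: "\<And>x. 0 \<le> u x" using u by (auto simp: Vpos_def)
  \<comment> \<open>The functions below \<open>u\<close> in the ideal generated by \<open>F\<close>.
    They are closed under maxima, which is what lets a minimizing sequence converge.\<close>
  define I where "I = {b \<in> Vpos. (\<forall>x. b x \<le> u x) \<and>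
    (\<exists>E n. finite E \<and> E \<subseteq> F \<and> (\<forall>x. b x \<le> real n * (\<Sum>e\<in>E. e x)))}"
  have I_V: "b \<in> Vpos" "\<And>x. b x \<le> u x" if "b \<in> I" for b using that by (auto simp: I_def)
  have I_0: "(\<lambda>_. 0) \<in> I"
    unfolding I_def using zero_in u0 by (auto simp: Vpos_def intro!: exI[of _ "{}"])
  have I_max: "(\<lambda>x. max (b x) (c x)) \<in> I" if b: "b \<in> I" and c: "c \<in> I" for b c
  proof -
    obtain E n where E: "finite E" "E \<subseteq> F" "\<And>x. b x \<le> real n * (\<Sum>e\<in>E. e x)" using b by (auto simp: I_def)
    obtain E' n' where E': "finite E'" "E' \<subseteq> F" "\<And>x. c x \<le> real n' * (\<Sum>e\<in>E'. e x)" using c by (auto simp: I_def)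
    have "max (b x) (c x) \<le> real (max n n') * (\<Sum>e\<in>E \<union> E'. e x)" for x
    proof -
      have nn: "0 \<le> e x" if "e \<in> E \<union> E'" for e using that E E' F_nonneg by auto
      have "real n * (\<Sum>e\<in>E. e x) \<le> real (max n n') * (\<Sum>e\<in>E \<union> E'. e x)"
        "real n' * (\<Sum>e\<in>E'. e x) \<le> real (max n n') * (\<Sum>e\<in>E \<union> E'. e x)"
        by (intro mult_mono sum_mono2 sum_nonneg; use E E' nn in auto)+
      then show ?thesis using E(3)[of x] E'(3)[of x] by simp
    qed
    then show ?thesis using I_V[OF b] I_V[OF c] E E' unfolding I_def
      by (auto intro!: Vpos_max exI[of _ "E \<union> E'"] exI[of _ "max n n'"])
  qed
  have I_e: "(\<lambda>x. min (u x) (real n * e x)) \<in> I" if e: "e \<in> F" for e n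
    unfolding I_def using e u F_Vpos[OF e]
    by (auto intro!: Vpos_min Vpos_scale exI[of _ "{e}"] exI[of _ n])
  define d where "d b = \<Phi> (rl (\<lambda>x. u x - b x))" for b
  have dV: "(\<lambda>x. u x - b x) \<in> Vpos" if "b \<in> I" for b
    using I_V[OF that] by (intro Vpos_diff u)
  have d0: "0 \<le> d b" if "b \<in> I" for b
    unfolding d_def using dV[OF that] by (intro nonneg) (simp add: Vpos_def)
  define \<alpha> where "\<alpha> = (INF b\<in>I. d b)"
  have \<alpha>: "\<alpha> \<le> d b" if "b \<in> I" for b
    unfolding \<alpha>_def using that d0 by (intro cINF_lower bdd_belowI2[where m = 0])
  have "\<exists>b\<in>I. d b < \<alpha> + 1 / real (Suc k)" for k
    using cInf_lessD[of "d ` I" "\<alpha> + 1 / real (Suc k)"] I_0 unfolding \<alpha>_def by auto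
  then obtain b where b: "\<And>k. b k \<in> I" "\<And>k. d (b k) < \<alpha> + 1 / real (Suc k)" by metis
  \<comment> \<open>Superadditivity for \<open>u - b k = (u - c) + (c - b k)\<close>: a larger
    \<open>c\<close> in \<open>I\<close> cannot bring the distance to \<open>u\<close> below the
    infimum \<open>\<alpha>\<close>, and \<open>b k\<close> nearly attains it, so
    \<open>c - b k\<close> is small.\<close>
  have close: "\<Phi> (rl (\<lambda>x. c x - b k x)) \<le> 1 / real (Suc k)"
    if c: "c \<in> I" "\<And>x. b k x \<le> c x" for c k
  proof -
    have "d c + \<Phi> (rl (\<lambda>x. c x - b k x)) \<le> \<Phi> (rl (\<lambda>x. (u x - c x) + (c x - b k x)))"
      unfolding d_def by (intro Vpos_superadd dV c Vpos_diff I_V b)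
    also have "\<dots> = d (b k)" by (simp add: d_def)
    finally show ?thesis using b(2)[of k] \<alpha>[OF c(1)] by linarith
  qed
  have bV: "rl (b k) \<in> V" for k using I_V[OF b(1)] by (simp add: Vpos_def)
  have "cauchy (\<lambda>k. rl (b k))"
  proof (rule cauchyI[OF bV])
    show "(\<lambda>k. 1 / real (Suc k)) \<longlonglongrightarrow> 0" by (rule LIMSEQ_Suc[OF lim_1_over_n])
    fix k l
    let ?c = "\<lambda>x. max (b k x) (b l x)"
    have c: "?c \<in> I" by (intro I_max b)
    have D: "(\<lambda>x. ?c x - b k x) \<in> Vpos" "(\<lambda>x. ?c x - b l x) \<in> Vpos"
      by (intro Vpos_diff I_V c b; simp)+
    have "\<Phi> (\<lambda>x. rl (b k) x - rl (b l) x)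
      \<le> 2 powr p * (\<Phi> (rl (\<lambda>x. ?c x - b k x)) + \<Phi> (rl (\<lambda>x. ?c x - b l x)))"
    proof (intro dominated diff_in bV)
      fix x
      show "cmod (rl (b k) x - rl (b l) x) \<le> cmod (rl (\<lambda>x. ?c x - b k x) x) + cmod (rl (\<lambda>x. ?c x - b l x) x)"
        unfolding of_real_diff[symmetric] norm_of_real by linarith
    qed (use D in \<open>auto simp: Vpos_def\<close>)
    also have "\<dots> \<le> 2 powr p * (1 / real (Suc k) + 1 / real (Suc l))"
      by (intro mult_left_mono add_mono close c) auto
    finally show "\<Phi> (\<lambda>x. rl (b k) x - rl (b l) x) \<le> 2 powr p * (1 / real (Suc k) + 1 / real (Suc l))" .
  qed
  then obtain v where v: "v \<in> V" "(\<lambda>k. \<Phi> (\<lambda>x. rl (b k) x - v x)) \<longlonglongrightarrow> 0"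
    using complete by blast
  \<comment> \<open>The limit \<open>v\<close> is only known as a complex function. Its real part is
    at least as close to the functions \<open>b k\<close>, since these are real.\<close>
  let ?s = "\<lambda>x. complex_of_real (Re (v x))"
  have sV: "?s \<in> V" using lip_in[OF v(1) v(1) lip2_Re] .
  define r where "r k = \<Phi> (\<lambda>x. rl (b k) x - ?s x)" for k
  have r: "r \<longlonglongrightarrow> 0"
  proof (rule null_squeeze[OF v(2)])
    show "0 \<le> r k" for k unfolding r_def by (intro nonneg diff_in bV sV)
    show "r k \<le> \<Phi> (\<lambda>x. rl (b k) x - v x)" for k
      unfolding r_def
    proof (intro mono diff_in bV sV v)
      fix x
      have "cmod (rl (b k) x - ?s x) = \<bar>Re (rl (b k) x - v x)\<bar>"
        unfolding of_real_diff[symmetric] norm_of_real by simp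
      also have "\<dots> \<le> cmod (rl (b k) x - v x)" by (rule abs_Re_le_cmod)
      finally show "cmod (rl (b k) x - ?s x) \<le> cmod (rl (b k) x - v x)" .
    qed
  qed
  \<comment> \<open>The part of \<open>u\<close> not reached by the limit. It is disjoint from every
    \<open>e\<close>, because adding \<open>min u (n * e)\<close> to \<open>b k\<close> by a maximum
    stays in \<open>I\<close> and hence changes \<open>b k\<close> by little.\<close>
  define w where "w x = max 0 (u x - Re (v x))" for x
  have wV: "w \<in> Vpos"
    using lip_in[OF uV v(1) lip2_pos_part[of 1 "-1"]] by (simp add: Vpos_def w_def)
  have "\<Phi> (rl w) = 0"
  proof (rule F_max[OF wV])
    fix e assume e: "e \<in> F"
    let ?m = "\<lambda>x. min (w x) (e x)"
    have m: "?m \<in> Vpos" by (intro Vpos_min wV F_Vpos e)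
    \<comment> \<open>If \<open>n * e x < u x\<close>, then \<open>e x \<le> u x / n\<close>.
      Otherwise \<open>u x\<close> is at most \<open>?c x\<close>, and the excess over
      \<open>v\<close> is bounded by \<open>?c - b k\<close> plus the distance of \<open>b k\<close>
      from the limit. Letting first \<open>k\<close>, then \<open>n\<close> tend to infinity gives
      0.\<close>
    have step: "\<Phi> (rl ?m) \<le> 2 powr p * ((1 / real n) powr p * \<Phi> (rl u) + 2 powr p * (1 / real (Suc k) + r k))"
      if n: "0 < n" for n k
    proof -
      let ?c = "\<lambda>x. max (b k x) (min (u x) (real n * e x))"
      have c: "?c \<in> I" by (intro I_max b I_e e)
      have D: "(\<lambda>x. ?c x - b k x) \<in> Vpos" by (intro Vpos_diff I_V c b) simp
      let ?q = "\<lambda>x. complex_of_real (?c x - b k x)" and ?t = "\<lambda>x. rl (b k) x - ?s x"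
      have qV: "?q \<in> V" "?t \<in> V" using D by (auto simp: Vpos_def intro: diff_in bV sV)
      let ?z = "\<lambda>x. complex_of_real (cmod (?q x) + cmod (?t x))"
      have "\<Phi> (rl ?m) \<le> 2 powr p * (\<Phi> (\<lambda>x. complex_of_real (1 / real n) * rl u x) + \<Phi> ?z)"
      proof (intro dominated scale_in uV norm_add_in qV)
        show "rl ?m \<in> V" using m by (simp add: Vpos_def)
        fix x
        have e0: "0 \<le> e x" using F_nonneg[OF e] .
        have t: "\<bar>b k x - Re (v x)\<bar> = cmod (?t x)" unfolding of_real_diff[symmetric] norm_of_real ..
        have q: "?c x - b k x = cmod (?q x)" unfolding norm_of_real by linarith
        have "?m x \<le> u x / real n + (?c x - b k x) + \<bar>b k x - Re (v x)\<bar>"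
        proof (cases "real n * e x < u x")
          case True
          then have "e x \<le> u x / real n" using n by (simp add: field_simps)
          then show ?thesis by linarith
        next
          case False
          then have "u x \<le> ?c x" by linarith
          moreover have "0 \<le> u x / real n" using u0[of x] by simp
          ultimately show ?thesis unfolding w_def by linarith
        qed
        moreover have "cmod (complex_of_real (1 / real n) * rl u x) = u x / real n"
          using u0[of x] by (simp add: norm_mult norm_divide)
        moreover have "cmod (?z x) = cmod (?q x) + cmod (?t x)"
          by (simp only: norm_of_real[of "cmod (?q x) + cmod (?t x)"] abs_of_nonneg add_nonneg_nonneg norm_ge_zero)
        moreover have "cmod (rl ?m x) = ?m x" using m by (simp add: Vpos_def)
        ultimately show "cmod (rl ?m x) \<le> cmod (complex_of_real (1 / real n) * rl u x) + cmod (?z x)"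
          using t q by linarith
      qed
      also have "\<Phi> (\<lambda>x. complex_of_real (1 / real n) * rl u x) = (1 / real n) powr p * \<Phi> (rl u)"
        unfolding scale[OF uV] norm_of_real by simp
      also have "\<Phi> ?z \<le> 2 powr p * (\<Phi> ?q + \<Phi> ?t)"
        by (intro dominated norm_add_in qV) (simp del: of_real_add)
      also have "\<Phi> ?q \<le> 1 / real (Suc k)" by (rule close[OF c]) simp
      finally show ?thesis by (simp add: r_def mult_left_mono)
    qed
    have step2: "\<Phi> (rl ?m) \<le> 2 powr p * ((1 / real n) powr p * \<Phi> (rl u) + 2 powr p * (0 + 0))" if n: "0 < n" for n
    proof (rule LIMSEQ_le_const)
      show "(\<lambda>k. 2 powr p * ((1 / real n) powr p * \<Phi> (rl u) + 2 powr p * (1 / real (Suc k) + r k)))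
        \<longlonglongrightarrow> 2 powr p * ((1 / real n) powr p * \<Phi> (rl u) + 2 powr p * (0 + 0))"
        by (intro tendsto_intros r LIMSEQ_Suc[OF lim_1_over_n])
    qed (rule exI[of _ 0], intro allI impI, rule step[OF n])
    have "(\<lambda>n. (1 / real n) powr p) \<longlonglongrightarrow> 0"
      using p1 by (intro tendsto_zero_powrI[where b = p] lim_1_over_n tendsto_const) auto
    then have "(\<lambda>n. 2 powr p * ((1 / real n) powr p * \<Phi> (rl u) + 2 powr p * (0 + 0)))
      \<longlonglongrightarrow> 2 powr p * (0 * \<Phi> (rl u) + 2 powr p * (0 + 0))"
      by (intro tendsto_intros)
    then have "\<Phi> (rl ?m) \<le> 2 powr p * (0 * \<Phi> (rl u) + 2 powr p * (0 + 0))"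
      by (rule LIMSEQ_le_const) (rule exI[of _ 1], intro allI impI, rule step2, simp)
    then show "\<Phi> (rl ?m) = 0" using nonneg[of "rl ?m"] m by (simp add: Vpos_def)
  qed
  have wV': "rl w \<in> V" using wV by (simp add: Vpos_def)
  have fin: "\<Phi> (\<lambda>x. rl u x - rl (b k) x) \<le> 2 powr p * (\<Phi> (rl w) + r k)" for k
    unfolding r_def
  proof (intro dominated diff_in uV bV wV' sV)
    fix x
    have "cmod (rl u x - rl (b k) x) = u x - b k x" "cmod (rl (b k) x - ?s x) = \<bar>b k x - Re (v x)\<bar>"
      using I_V[OF b(1)[of k]] unfolding of_real_diff[symmetric] norm_of_real by auto
    moreover have "cmod (rl w x) = max 0 (u x - Re (v x))" by (simp add: w_def)
    ultimately show "cmod (rl u x - rl (b k) x) \<le> cmod (rl w x) + cmod (rl (b k) x - ?s x)" by linarith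
  qed
  have "(\<lambda>k. 2 powr p * (\<Phi> (rl w) + r k)) \<longlonglongrightarrow> 2 powr p * (\<Phi> (rl w) + 0)"
    by (intro tendsto_intros r)
  then have lim: "(\<lambda>k. 2 powr p * (\<Phi> (rl w) + r k)) \<longlonglongrightarrow> 0" using \<open>\<Phi> (rl w) = 0\<close> by simp
  show ?thesis
  proof (rule Cl_limit[OF uV])
    fix \<epsilon> :: real assume "0 < \<epsilon>"
    then obtain k where "2 powr p * (\<Phi> (rl w) + r k) < \<epsilon>"
      using order_tendstoD(2)[OF lim] by (auto simp: eventually_sequentially)
    then have "\<Phi> (\<lambda>x. rl u x - rl (b k) x) < \<epsilon>" using fin[of k] by linarith
    moreover have "rl (b k) \<in> Cl"
    proof -
      obtain E n where "finite E" "E \<subseteq> F" "\<And>x. b k x \<le> real n * (\<Sum>e\<in>E. e x)"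
        using b(1)[of k] by (auto simp: I_def)
      then show ?thesis by (rule Cl_ideal[OF _ _ I_V(1)[OF b(1)]])
    qed
    ultimately show "\<exists>v\<in>Cl. \<Phi> (\<lambda>x. rl u x - v x) < \<epsilon>"
      by (rule bexI[where x = "rl (b k)"])
  qed
qed

text \<open>Positive and negative parts of the real and imaginary parts; the imaginary part of
  \<open>u\<close> is the real part of \<open>- \<i> * u\<close>.\<close>

lemma Cl_all: "V \<subseteq> Cl"
proof
  fix u assume u: "u \<in> V"
  have pos: "rl (\<lambda>x. max 0 (c * Re (w x) + 0 * Re (w x))) \<in> Cl" if "w \<in> V" for w and c :: real
    by (rule Cl_pos) (use lip_in[OF that that lip2_pos_part[of c 0]] in \<open>simp add: Vpos_def\<close>)
  have iu: "(\<lambda>x. - \<i> * u x) \<in> V" by (rule scale_in[OF u])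
  have "(\<lambda>x. 1 * (1 * rl (\<lambda>x. max 0 (1 * Re (u x) + 0 * Re (u x))) x + (-1) * rl (\<lambda>x. max 0 ((-1) * Re (u x) + 0 * Re (u x))) x)
    + \<i> * (1 * rl (\<lambda>x. max 0 (1 * Re (- \<i> * u x) + 0 * Re (- \<i> * u x))) x
      + (-1) * rl (\<lambda>x. max 0 ((-1) * Re (- \<i> * u x) + 0 * Re (- \<i> * u x))) x)) \<in> Cl"
    by (intro Cl_lin[OF Cl_lin[OF pos[OF u] pos[OF u]] Cl_lin[OF pos[OF iu] pos[OF iu]]])
  also have "(\<lambda>x. 1 * (1 * rl (\<lambda>x. max 0 (1 * Re (u x) + 0 * Re (u x))) x + (-1) * rl (\<lambda>x. max 0 ((-1) * Re (u x) + 0 * Re (u x))) x)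
    + \<i> * (1 * rl (\<lambda>x. max 0 (1 * Re (- \<i> * u x) + 0 * Re (- \<i> * u x))) x
      + (-1) * rl (\<lambda>x. max 0 ((-1) * Re (- \<i> * u x) + 0 * Re (- \<i> * u x))) x)) = u"
    by (rule ext, rule complex_eqI) (auto simp: max_def)
  finally show "u \<in> Cl" .
qed

lemma \<kappa>_dense: "u \<in> V \<Longrightarrow> 0 < \<epsilon> \<Longrightarrow> \<exists>g\<in>S.SR. \<Phi> (\<lambda>x. u x - \<kappa> g x) < \<epsilon>"
  using Cl_all unfolding Cl_def by blast

end

section \<open>The isometry between the completed lattice and the \<open>L^p\<close> space\<close>

context plattice
begin

lemma lin_tendsto:
  assumes "\<And>n. u n \<in> V" "\<And>n. v n \<in> V" "(\<lambda>n. \<Phi> (u n)) \<longlonglongrightarrow> 0" "(\<lambda>n. \<Phi> (v n)) \<longlonglongrightarrow> 0"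
  shows "(\<lambda>n. \<Phi> (\<lambda>x. c * u n x + d * v n x)) \<longlonglongrightarrow> 0"
proof (rule null_squeeze)
  show "0 \<le> \<Phi> (\<lambda>x. c * u n x + d * v n x)" for n by (intro nonneg lin_in assms)
  show "\<Phi> (\<lambda>x. c * u n x + d * v n x) \<le> 2 powr p * (cmod c powr p * \<Phi> (u n) + cmod d powr p * \<Phi> (v n))" for n
    using quasi_triangle[OF scale_in scale_in, OF assms(1,2)] by (simp add: scale assms)
  have "(\<lambda>n. 2 powr p * (cmod c powr p * \<Phi> (u n) + cmod d powr p * \<Phi> (v n)))
    \<longlonglongrightarrow> 2 powr p * (cmod c powr p * 0 + cmod d powr p * 0)"
    by (intro tendsto_intros assms)
  then show "(\<lambda>n. 2 powr p * (cmod c powr p * \<Phi> (u n) + cmod d powr p * \<Phi> (v n))) \<longlonglongrightarrow> 0" by simp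
qed

lemma norm_tendsto:
  assumes "\<And>n. u n \<in> V" "v \<in> V" "(\<lambda>n. \<Phi> (\<lambda>x. v x - u n x)) \<longlonglongrightarrow> 0"
  shows "(\<lambda>n. \<Phi> (\<lambda>x. complex_of_real (cmod (v x)) - complex_of_real (cmod (u n x)))) \<longlonglongrightarrow> 0"
proof (rule null_squeeze[OF assms(3)])
  show "0 \<le> \<Phi> (\<lambda>x. complex_of_real (cmod (v x)) - complex_of_real (cmod (u n x)))" for n
    by (intro nonneg diff_in norm_in assms)
  show "\<Phi> (\<lambda>x. complex_of_real (cmod (v x)) - complex_of_real (cmod (u n x))) \<le> \<Phi> (\<lambda>x. v x - u n x)" for n
    by (intro mono diff_in norm_in assms) (simp add: abs_cmod_diff flip: of_real_diff)
qed

lemma tendsto_\<Phi>':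
  assumes "\<And>n. u n \<in> V" "v \<in> V" "(\<lambda>n. \<Phi> (\<lambda>x. v x - u n x)) \<longlonglongrightarrow> 0"
  shows "(\<lambda>n. \<Phi> (u n)) \<longlonglongrightarrow> \<Phi> v"
proof (rule tendsto_\<Phi>)
  show "(\<lambda>n. \<Phi> (\<lambda>x. u n x - v x)) \<longlonglongrightarrow> 0"
    using assms(3) minus_commute[OF assms(2,1)] by simp
qed (simp_all add: assms)

end

context kakutani
begin

interpretation P: plattice p "Lp_fun p S.N" "Ip p S.N" by (rule plattice_Lp[OF p1])

text \<open>The closure of the correspondence between \<open>S.lift g\<close> and
  \<open>\<kappa> g\<close>: both sides are approximated by one and the same sequence of step
  functions.\<close>

definition K :: "('z \<Rightarrow> complex) \<Rightarrow> ('x \<Rightarrow> complex) \<Rightarrow> bool" where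
  "K f u \<longleftrightarrow> f \<in> Lp_fun p S.N \<and> u \<in> V \<and> (\<exists>g. (\<forall>n. g n \<in> S.SR) \<and>
    (\<lambda>n. Ip p S.N (\<lambda>z. f z - S.lift (g n) z)) \<longlonglongrightarrow> 0 \<and> (\<lambda>n. \<Phi> (\<lambda>x. u x - \<kappa> (g n) x)) \<longlonglongrightarrow> 0)"

lemma Ip_cong_Z: "(\<And>z. z \<in> Z \<Longrightarrow> f z = g z) \<Longrightarrow> Ip p S.N f = Ip p S.N g"
  unfolding Ip_def by (intro Bochner_Integration.integral_cong) (simp_all add: S.space_N)

lemma K_in: "K f u \<Longrightarrow> f \<in> Lp_fun p S.N \<and> u \<in> V"
  by (simp add: K_def)

lemma K_isometric:
  assumes "K f u" shows "Ip p S.N f = \<Phi> u"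
proof -
  obtain g where g: "\<And>n. g n \<in> S.SR" and f: "f \<in> Lp_fun p S.N" "u \<in> V"
    and lim: "(\<lambda>n. Ip p S.N (\<lambda>z. f z - S.lift (g n) z)) \<longlonglongrightarrow> 0" "(\<lambda>n. \<Phi> (\<lambda>x. u x - \<kappa> (g n) x)) \<longlonglongrightarrow> 0"
    using assms unfolding K_def by blast
  have "(\<lambda>n. Ip p S.N (S.lift (g n))) \<longlonglongrightarrow> Ip p S.N f"
    by (rule P.tendsto_\<Phi>'[OF S.lift_Lp(1)[OF g] f(1) lim(1)])
  moreover have "(\<lambda>n. Ip p S.N (S.lift (g n))) \<longlonglongrightarrow> \<Phi> u"
    using tendsto_\<Phi>'[OF \<kappa>_in[OF g] f(2) lim(2)] by (simp add: \<Phi>_\<kappa>[OF g])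
  ultimately show ?thesis by (rule LIMSEQ_unique)
qed

lemma K_lin:
  assumes "K f u" "K h v" shows "K (\<lambda>z. c * f z + d * h z) (\<lambda>x. c * u x + d * v x)"
proof -
  obtain g where g: "\<And>n. g n \<in> S.SR" and f: "f \<in> Lp_fun p S.N" "u \<in> V"
    and lim: "(\<lambda>n. Ip p S.N (\<lambda>z. f z - S.lift (g n) z)) \<longlonglongrightarrow> 0" "(\<lambda>n. \<Phi> (\<lambda>x. u x - \<kappa> (g n) x)) \<longlonglongrightarrow> 0"
    using assms(1) unfolding K_def by blast
  obtain k where k: "\<And>n. k n \<in> S.SR" and h: "h \<in> Lp_fun p S.N" "v \<in> V"
    and lim': "(\<lambda>n. Ip p S.N (\<lambda>z. h z - S.lift (k n) z)) \<longlonglongrightarrow> 0" "(\<lambda>n. \<Phi> (\<lambda>x. v x - \<kappa> (k n) x)) \<longlonglongrightarrow> 0"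
    using assms(2) unfolding K_def by blast
  let ?g = "\<lambda>n y. c * g n y + d * k n y"
  have eq1: "Ip p S.N (\<lambda>z. c * f z + d * h z - S.lift (?g n) z)
    = Ip p S.N (\<lambda>z. c * (f z - S.lift (g n) z) + d * (h z - S.lift (k n) z))" for n
  proof (rule Ip_cong_Z)
    fix z assume z: "z \<in> Z"
    have "S.lift (?g n) z = c * S.lift (g n) z + d * S.lift (k n) z"
      using g[of n] k[of n] by (intro S.lift_op[OF z]) (simp_all add: S.SR_def)
    then show "c * f z + d * h z - S.lift (?g n) z = c * (f z - S.lift (g n) z) + d * (h z - S.lift (k n) z)"
      by (simp add: algebra_simps)
  qed
  have eq2: "(\<lambda>x. c * u x + d * v x - \<kappa> (?g n) x) = (\<lambda>x. c * (u x - \<kappa> (g n) x) + d * (v x - \<kappa> (k n) x))" for n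
    unfolding \<kappa>_add[OF g k] by (simp add: algebra_simps)
  have "(\<lambda>n. Ip p S.N (\<lambda>z. c * f z + d * h z - S.lift (?g n) z)) \<longlonglongrightarrow> 0"
    unfolding eq1 by (rule P.lin_tendsto[OF P.diff_in[OF f(1) S.lift_Lp(1)[OF g]] P.diff_in[OF h(1) S.lift_Lp(1)[OF k]] lim(1) lim'(1)])
  moreover have "(\<lambda>n. \<Phi> (\<lambda>x. c * u x + d * v x - \<kappa> (?g n) x)) \<longlonglongrightarrow> 0"
    unfolding eq2 by (rule lin_tendsto[OF diff_in[OF f(2) \<kappa>_in[OF g]] diff_in[OF h(2) \<kappa>_in[OF k]] lim(2) lim'(2)])
  moreover have "\<forall>n. ?g n \<in> S.SR" using SR_add[OF g k] by blast
  ultimately show ?thesis unfolding K_def using P.lin_in[OF f(1) h(1), of c d] lin_in[OF f(2) h(2), of c d]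
    by (intro conjI exI[of _ ?g])
qed

lemma K_norm:
  assumes "K f u" shows "K (\<lambda>z. complex_of_real (cmod (f z))) (\<lambda>x. complex_of_real (cmod (u x)))"
proof -
  obtain g where g: "\<And>n. g n \<in> S.SR" and f: "f \<in> Lp_fun p S.N" "u \<in> V"
    and lim: "(\<lambda>n. Ip p S.N (\<lambda>z. f z - S.lift (g n) z)) \<longlonglongrightarrow> 0" "(\<lambda>n. \<Phi> (\<lambda>x. u x - \<kappa> (g n) x)) \<longlonglongrightarrow> 0"
    using assms unfolding K_def by blast
  let ?g = "\<lambda>n y. complex_of_real (cmod (g n y))"
  let ?u = "\<lambda>x. complex_of_real (cmod (u x))"
  have eq: "Ip p S.N (\<lambda>z. complex_of_real (cmod (f z)) - S.lift (?g n) z)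
    = Ip p S.N (\<lambda>z. complex_of_real (cmod (f z)) - complex_of_real (cmod (S.lift (g n) z)))" for n
  proof (rule Ip_cong_Z)
    fix z assume z: "z \<in> Z"
    have "S.lift (?g n) z = complex_of_real (cmod (S.lift (g n) z))"
      using S.lift_op[OF z, of "g n" "g n" "\<lambda>a b. complex_of_real (cmod a)"] g[of n] by (simp add: S.SR_def)
    then show "complex_of_real (cmod (f z)) - S.lift (?g n) z = complex_of_real (cmod (f z)) - complex_of_real (cmod (S.lift (g n) z))"
      by simp
  qed
  have 1: "(\<lambda>n. Ip p S.N (\<lambda>z. complex_of_real (cmod (f z)) - S.lift (?g n) z)) \<longlonglongrightarrow> 0"
    unfolding eq by (rule P.norm_tendsto[OF S.lift_Lp(1)[OF g] f(1) lim(1)])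
  have V: "?u \<in> V" "\<kappa> (?g n) \<in> V" "(\<lambda>x. complex_of_real (cmod (\<kappa> (g n) x))) \<in> V" for n
    by (intro norm_in f \<kappa>_in norm_SR g)+
  have 2: "(\<lambda>n. \<Phi> (\<lambda>x. ?u x - \<kappa> (?g n) x)) \<longlonglongrightarrow> 0"
  proof (rule null_squeeze)
    show "(\<lambda>n. 2 powr p * \<Phi> (\<lambda>x. ?u x - complex_of_real (cmod (\<kappa> (g n) x)))) \<longlonglongrightarrow> 0"
      using tendsto_mult_left[OF norm_tendsto[OF \<kappa>_in[OF g] f(2) lim(2)], of "2 powr p"] by simp
    show "0 \<le> \<Phi> (\<lambda>x. ?u x - \<kappa> (?g n) x)" for n by (intro nonneg diff_in V)
    show "\<Phi> (\<lambda>x. ?u x - \<kappa> (?g n) x) \<le> 2 powr p * \<Phi> (\<lambda>x. ?u x - complex_of_real (cmod (\<kappa> (g n) x)))" for n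
      using diff_triangle[OF V(1) V(3)[of n] V(2)[of n]] \<kappa>_norm[OF g[of n]] by simp
  qed
  show ?thesis unfolding K_def using 1 2 P.norm_in[OF f(1)] V(1) norm_SR[OF g]
    by (intro conjI exI[of _ ?g] allI)
qed

lemma \<kappa>_diff: "g \<in> S.SR \<Longrightarrow> h \<in> S.SR \<Longrightarrow>
  \<Phi> (\<lambda>x. \<kappa> g x - \<kappa> h x) = Ip p S.N (\<lambda>z. S.lift g z - S.lift h z)"
proof -
  assume g: "g \<in> S.SR" "h \<in> S.SR"
  let ?d = "\<lambda>y. 1 * g y + (-1) * h y"
  have eq: "(\<lambda>x. \<kappa> g x - \<kappa> h x) = \<kappa> ?d" by (rule ext) (subst \<kappa>_add[OF g], simp)
  have "\<Phi> (\<lambda>x. \<kappa> g x - \<kappa> h x) = Ip p S.N (S.lift ?d)" unfolding eq by (rule \<Phi>_\<kappa>[OF SR_add[OF g]])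
  also have "\<dots> = Ip p S.N (\<lambda>z. S.lift g z - S.lift h z)"
  proof (rule Ip_cong_Z)
    fix z assume z: "z \<in> Z"
    have "S.lift ?d z = 1 * S.lift g z + (-1) * S.lift h z"
      using g by (intro S.lift_op[OF z]) (simp_all add: S.SR_def)
    then show "S.lift ?d z = S.lift g z - S.lift h z" by simp
  qed
  finally show ?thesis .
qed

text \<open>Step functions approximating \<open>f\<close> are sent by \<open>\<kappa>\<close>
  isometrically to a Cauchy sequence of \<open>V\<close>, and \<open>complete\<close> supplies its
  limit. The converse \<open>K_onto\<close> uses \<open>\<kappa>_dense\<close> and the Riesz-Fischer
  theorem in the same way.\<close>

lemma K_total: "f \<in> Lp_fun p S.N \<Longrightarrow> \<exists>u. K f u"
proof -
  assume f: "f \<in> Lp_fun p S.N"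
  have "\<forall>n. \<exists>g\<in>S.SR. Ip p S.N (\<lambda>z. f z - S.lift g z) < 1 / real (Suc n)"
    using S.SR_dense[OF p1 f] by simp
  then obtain g where g: "\<And>n. g n \<in> S.SR" "\<And>n. Ip p S.N (\<lambda>z. f z - S.lift (g n) z) < 1 / real (Suc n)"
    by metis
  note L = S.lift_Lp(1)[OF g(1)]
  have lim: "(\<lambda>n. Ip p S.N (\<lambda>z. f z - S.lift (g n) z)) \<longlonglongrightarrow> 0"
    by (rule null_squeeze[OF LIMSEQ_Suc[OF lim_1_over_n] P.nonneg[OF P.diff_in[OF f L]] less_imp_le[OF g(2)]])
  have "cauchy (\<lambda>n. \<kappa> (g n))"
  proof (rule cauchyI[OF \<kappa>_in[OF g(1)] _ lim])
    fix m n
    show "\<Phi> (\<lambda>x. \<kappa> (g m) x - \<kappa> (g n) x)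
      \<le> 2 powr p * (Ip p S.N (\<lambda>z. f z - S.lift (g m) z) + Ip p S.N (\<lambda>z. f z - S.lift (g n) z))"
      unfolding \<kappa>_diff[OF g(1) g(1)]
      using P.diff_triangle[OF L[of m] f L[of n]] P.minus_commute[OF f L[of m]] by simp
  qed
  then obtain u where u: "u \<in> V" "(\<lambda>n. \<Phi> (\<lambda>x. \<kappa> (g n) x - u x)) \<longlonglongrightarrow> 0" using complete by blast
  then have "(\<lambda>n. \<Phi> (\<lambda>x. u x - \<kappa> (g n) x)) \<longlonglongrightarrow> 0"
    by (simp add: minus_commute[OF u(1) \<kappa>_in[OF g(1)]])
  then show ?thesis unfolding K_def using f u(1) g(1) lim by blast
qed

lemma K_onto: "u \<in> V \<Longrightarrow> \<exists>f. K f u"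
proof -
  assume u: "u \<in> V"
  have "\<forall>n. \<exists>g\<in>S.SR. \<Phi> (\<lambda>x. u x - \<kappa> g x) < 1 / real (Suc n)"
    using \<kappa>_dense[OF u] by simp
  then obtain g where g: "\<And>n. g n \<in> S.SR" "\<And>n. \<Phi> (\<lambda>x. u x - \<kappa> (g n) x) < 1 / real (Suc n)"
    by metis
  note L = S.lift_Lp(1)[OF g(1)] and V = \<kappa>_in[OF g(1)]
  have lim: "(\<lambda>n. \<Phi> (\<lambda>x. u x - \<kappa> (g n) x)) \<longlonglongrightarrow> 0"
    by (rule null_squeeze[OF LIMSEQ_Suc[OF lim_1_over_n] nonneg[OF diff_in[OF u V]] less_imp_le[OF g(2)]])
  have "P.cauchy (\<lambda>n. S.lift (g n))"
  proof (rule P.cauchyI[OF L _ lim])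
    fix m n
    show "Ip p S.N (\<lambda>z. S.lift (g m) z - S.lift (g n) z)
      \<le> 2 powr p * (\<Phi> (\<lambda>x. u x - \<kappa> (g m) x) + \<Phi> (\<lambda>x. u x - \<kappa> (g n) x))"
      unfolding \<kappa>_diff[OF g(1) g(1), symmetric]
      using diff_triangle[OF V[of m] u V[of n]] minus_commute[OF u V[of m]] by simp
  qed
  then obtain f where f: "f \<in> Lp_fun p S.N" "(\<lambda>n. Ip p S.N (\<lambda>z. S.lift (g n) z - f z)) \<longlonglongrightarrow> 0"
    using Riesz_Fischer[OF p1] by blast
  then have "(\<lambda>n. Ip p S.N (\<lambda>z. f z - S.lift (g n) z)) \<longlonglongrightarrow> 0"
    by (simp add: P.minus_commute[OF f(1) L])
  then show ?thesis unfolding K_def using u f(1) g(1) lim by blast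
qed

end

text \<open>
  The isometry is a relation \<open>K\<close> because both sides consist of functions which are determined up to
  null functions only.
\<close>

theorem Kakutani_representation:
  fixes V :: "('x \<Rightarrow> complex) set" and enc :: "('x \<Rightarrow> real) \<Rightarrow> 'x set set \<Rightarrow> 'z"
  assumes V: "clattice p V \<Phi>" and enc: "\<And>e e' P P'. enc e P = enc e' P' \<Longrightarrow> e = e' \<and> P = P'"
  shows "\<exists>(N :: 'z measure) K.
    (\<forall>f u. K f u \<longrightarrow> f \<in> Lp_fun p N \<and> u \<in> V \<and> Ip p N f = \<Phi> u) \<and>
    (\<forall>f\<in>Lp_fun p N. \<exists>u. K f u) \<and> (\<forall>u\<in>V. \<exists>f. K f u) \<and>
    (\<forall>f h u v c d. K f u \<longrightarrow> K h v \<longrightarrow> K (\<lambda>z. c * f z + d * h z) (\<lambda>x. c * u x + d * v x)) \<and>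
    (\<forall>f u. K f u \<longrightarrow> K (\<lambda>z. complex_of_real (cmod (f z))) (\<lambda>x. complex_of_real (cmod (u x))))"
proof -
  interpret clattice p V \<Phi> by (rule V)
  obtain F where F: "disjoint_family_in F"
    "\<And>u. u \<in> Vpos \<Longrightarrow> (\<And>e. e \<in> F \<Longrightarrow> \<Phi> (rl (\<lambda>x. min (u x) (e x))) = 0) \<Longrightarrow> \<Phi> (rl u) = 0"
    using maximal_disjoint_family by blast
  interpret kakutani p V \<Phi> F enc
    by unfold_locales (use F enc in blast)+
  show ?thesis
    by (rule exI[of _ S.N], rule exI[of _ K])
      (intro conjI allI ballI impI; (elim K_in[THEN conjunct1] K_in[THEN conjunct2])?;
        rule K_isometric K_total K_onto K_lin K_norm; assumption)
qed

section \<open>Pairings and almost-everywhere classes\<close>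

text \<open>
  The index in \<open>nat\<close> is absorbed by coding a sequence of complex numbers as one complex number. In
  the code of \<open>(e, P)\<close> the imaginary part \<open>1\<close> tells \<open>e\<close> from the indicator functions of sets in \<open>P\<close>.
\<close>

lemma encoding_exists:
  "\<exists>enc :: ((('g \<times> 'a) \<times> nat) \<Rightarrow> real) \<Rightarrow> (('g \<times> 'a) \<times> nat) set set \<Rightarrow> ('g \<Rightarrow> 'a \<Rightarrow> complex) set.
    \<forall>e e' P P'. enc e P = enc e' P' \<longrightarrow> e = e' \<and> P = P'"
proof -
  have "(UNIV :: real set) \<lesssim> (UNIV :: nat set set)" "(UNIV :: nat set set) \<lesssim> (UNIV :: real set)"
    using nat_sets_eqpoll_reals eqpoll_sym by (auto intro: eqpoll_imp_lepoll)
  then obtain a :: "real \<Rightarrow> nat set" and b :: "nat set \<Rightarrow> real" where ab: "inj a" "inj b"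
    unfolding lepoll_def by auto
  \<comment> \<open>A sequence of complex numbers becomes one set of naturals: the real part of the
    \<open>n\<close>-th term is stored under the tag \<open>i = 0\<close>, its imaginary part under
    every other tag. The injection \<open>b\<close> turns the set into one real number.\<close>
  define S where "S f = {prod_encode (n, prod_encode (i, k)) |n i k.
      k \<in> a (if i = 0 then Re (f n) else Im (f n))}" for f :: "nat \<Rightarrow> complex"
  have S: "prod_encode (n, prod_encode (i, k)) \<in> S f \<longleftrightarrow> k \<in> a (if i = 0 then Re (f n) else Im (f n))" for f n i k
    unfolding S_def mem_Collect_eq prod_encode_eq prod.inject by blast
  define code where "code f = complex_of_real (b (S f))" for f
  have code: "f = f'" if "code f = code f'" for f f'
  proof
    fix n
    have "b (S f) = b (S f')" using that unfolding code_def of_real_eq_iff .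
    then have eq: "S f = S f'" by (rule injD[OF ab(2)])
    have "a (if i = 0 then Re (f n) else Im (f n)) = a (if i = 0 then Re (f' n) else Im (f' n))" for i :: nat
    proof (rule set_eqI)
      fix k
      show "k \<in> a (if i = 0 then Re (f n) else Im (f n)) \<longleftrightarrow> k \<in> a (if i = 0 then Re (f' n) else Im (f' n))"
        unfolding S[symmetric] eq ..
    qed
    from this[of 0] this[of 1] have "a (Re (f n)) = a (Re (f' n))" "a (Im (f n)) = a (Im (f' n))" by simp_all
    then show "f n = f' n" using injD[OF ab(1)] complex_eqI by blast
  qed
  define h :: "((('g \<times> 'a) \<times> nat) \<Rightarrow> complex) \<Rightarrow> 'g \<Rightarrow> 'a \<Rightarrow> complex" where
    "h f s w = code (\<lambda>n. f ((s, w), n))" for f s w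
  have h: "f = f'" if "h f = h f'" for f f'
  proof
    fix x :: "('g \<times> 'a) \<times> nat"
    obtain s w n where x: "x = ((s, w), n)" by (metis surj_pair)
    have "(\<lambda>n. f ((s, w), n)) = (\<lambda>n. f' ((s, w), n))"
      by (rule code) (use fun_cong[OF fun_cong[OF that, of s], of w] in \<open>simp add: h_def\<close>)
    then show "f x = f' x" unfolding x by (rule fun_cong)
  qed
  define enc where "enc e P = insert (h (\<lambda>x. Complex (e x) 1)) ((\<lambda>A. h (indicator A)) ` P)"
    for e :: "(('g \<times> 'a) \<times> nat) \<Rightarrow> real" and P
  have ne: "h (\<lambda>x. Complex (e x) 1) \<noteq> h (indicator A)" for e A
  proof
    assume "h (\<lambda>x. Complex (e x) 1) = h (indicator A)"
    from fun_cong[OF h[OF this], of undefined] show False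
      by (cases "undefined \<in> A") (auto simp: complex_eq_iff)
  qed
  have tag: "e = e'" if "h (\<lambda>x. Complex (e x) 1) = h (\<lambda>x. Complex (e' x) 1)" for e e'
    by (rule ext) (use fun_cong[OF h[OF that]] in simp)
  have ind: "A = B" if "h (indicator A) = h (indicator B)" for A B
  proof -
    have "indicator A = (indicator B :: _ \<Rightarrow> complex)" by (rule h[OF that])
    then have "x \<in> A \<longleftrightarrow> x \<in> B" for x by (metis indicator_eq_1_iff)
    then show ?thesis by blast
  qed
  have sub: "P \<subseteq> P'" if eq: "enc e P = enc e' P'" for e e' P P'
  proof
    fix A assume "A \<in> P"
    then have "h (indicator A) \<in> enc e P" unfolding enc_def by (intro insertI2 imageI)
    then have "h (indicator A) \<in> enc e' P'" unfolding eq .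
    then obtain B where "B \<in> P'" "h (indicator A) = h (indicator B)"
      using ne[of e' A] unfolding enc_def by auto
    then show "A \<in> P'" using ind[of A B] by simp
  qed
  have "e = e' \<and> P = P'" if eq: "enc e P = enc e' P'" for e e' P P'
  proof
    have "h (\<lambda>x. Complex (e x) 1) \<in> enc e P" unfolding enc_def by (rule insertI1)
    then have "h (\<lambda>x. Complex (e x) 1) \<in> enc e' P'" unfolding eq .
    then have "h (\<lambda>x. Complex (e x) 1) = h (\<lambda>x. Complex (e' x) 1)"
      unfolding enc_def using ne[of e] by auto
    then show "e = e'" by (rule tag)
    show "P = P'" using sub[OF eq] sub[OF eq[symmetric]] by (rule subset_antisym)
  qed
  then show ?thesis by (intro exI[of _ enc] allI impI)
qed

text \<open>Young's inequality for the functions divided by their norms, integrated. If one norm is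
  0, the product vanishes almost everywhere.\<close>

lemma Holder:
  assumes p: "1 < p" and q: "1 < q" and pq: "1 / p + 1 / q = 1"
    and f: "f \<in> Lp_fun p M" and g: "g \<in> Lp_fun q M"
  shows "integrable M (\<lambda>x. f x * g x)"
    and "cmod (\<integral>x. f x * g x \<partial>M) \<le> Ip p M f powr (1/p) * Ip q M g powr (1/q)"
proof -
  have [measurable]: "f \<in> borel_measurable M" "g \<in> borel_measurable M" using f g by (auto simp: Lp_fun_def)
  have Y: "cmod (f x) * cmod (g x) \<le> cmod (f x) powr p / p + cmod (g x) powr q / q" for x
    by (rule Youngs_inequality) (use p q pq in auto)
  note int = Lp_fun_integrable[OF f] Lp_fun_integrable[OF g]
  show fg: "integrable M (\<lambda>x. f x * g x)"
  proof (rule Bochner_Integration.integrable_bound)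
    show "integrable M (\<lambda>x. cmod (f x) powr p / p + cmod (g x) powr q / q)"
      by (intro Bochner_Integration.integrable_add integrable_divide int)
    show "AE x in M. norm (f x * g x) \<le> norm (cmod (f x) powr p / p + cmod (g x) powr q / q)"
      using Y p q by (intro AE_I2) (simp add: norm_mult)
  qed measurable
  define A where "A = Ip p M f powr (1/p)"
  define B where "B = Ip q M g powr (1/q)"
  have nn: "0 \<le> Ip p M f" "0 \<le> Ip q M g" by (simp_all add: Ip_def)
  have Ap: "A powr p = Ip p M f" "B powr q = Ip q M g"
    using nn p q by (simp_all add: A_def B_def powr_powr)
  show "cmod (\<integral>x. f x * g x \<partial>M) \<le> Ip p M f powr (1/p) * Ip q M g powr (1/q)"
  proof (cases "A = 0 \<or> B = 0")
    case True
    have "AE x in M. f x * g x = 0"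
    proof (cases "A = 0")
      case True
      then have "Ip p M f = 0" using Ap(1) p by simp
      then show ?thesis using Ip_eq_0_iff[OF f] by auto
    next
      case False
      then have "Ip q M g = 0" using True Ap(2) q by simp
      then show ?thesis using Ip_eq_0_iff[OF g] by auto
    qed
    then have "(\<integral>x. f x * g x \<partial>M) = (\<integral>x. 0 \<partial>M)" by (intro integral_cong_AE) auto
    then show ?thesis by simp
  next
    case False
    then have AB: "0 < A" "0 < B" using powr_ge_zero by (simp_all add: A_def B_def order_less_le)
    have "cmod (\<integral>x. f x * g x \<partial>M) \<le> (\<integral>x. cmod (f x * g x) \<partial>M)" by (rule integral_norm_bound)
    also have "\<dots> \<le> (\<integral>x. A * B * (cmod (f x) powr p / (p * A powr p) + cmod (g x) powr q / (q * B powr q)) \<partial>M)"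
    proof (intro integral_mono integrable_mult_right Bochner_Integration.integrable_add integrable_divide int
        integrable_norm fg)
      fix x
      have "(cmod (f x) / A) * (cmod (g x) / B) \<le> (cmod (f x) / A) powr p / p + (cmod (g x) / B) powr q / q"
        by (rule Youngs_inequality) (use p q pq AB in auto)
      then have "A * B * ((cmod (f x) / A) * (cmod (g x) / B))
        \<le> A * B * (cmod (f x) powr p / (p * A powr p) + cmod (g x) powr q / (q * B powr q))"
        using AB by (intro mult_left_mono) (simp_all add: powr_divide mult.commute)
      then show "cmod (f x * g x) \<le> A * B * (cmod (f x) powr p / (p * A powr p) + cmod (g x) powr q / (q * B powr q))"
        using AB by (simp add: norm_mult)
    qed
    also have "\<dots> = A * B * (Ip p M f / (p * A powr p) + Ip q M g / (q * B powr q))"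
      unfolding Ip_def using int by simp
    also have "\<dots> = A * B * (1 / p + 1 / q)" using AB by (simp add: Ap[symmetric])
    finally show ?thesis using pq by (simp add: A_def B_def)
  qed
qed

lemma dual_Lp:
  assumes p: "1 < p" and q: "1 < q" and pq: "1 / p + 1 / q = 1" and f: "f \<in> Lp_fun p M"
  shows "(\<lambda>x. dual p (f x)) \<in> Lp_fun q M"
proof -
  have "(p - 1) * q = p" using pq p q by (simp add: field_simps)
  then have pow: "cmod (dual p (f x)) powr q = cmod (f x) powr p" for x
    by (simp add: cmod_dual[OF p] powr_powr)
  have [measurable]: "f \<in> borel_measurable M" using f by (simp add: Lp_fun_def)
  note dual_measurable[OF p, measurable]
  have "(\<lambda>x. dual p (f x)) \<in> borel_measurable M" by measurable
  then show ?thesis using Lp_fun_integrable[OF f] by (simp add: Lp_fun_def pow)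
qed

text \<open>Testing against the duality map of \<open>f - g\<close> gives the \<open>p\<close>-th
  power of the norm of \<open>f - g\<close>, which must vanish.\<close>

lemma Lp_separate:
  assumes p: "1 < p" and q: "1 < q" and pq: "1 / p + 1 / q = 1"
    and f: "f \<in> Lp_fun p M" and g: "g \<in> Lp_fun p M"
    and eq: "\<And>y. y \<in> Lp_fun q M \<Longrightarrow> (\<integral>x. f x * y x \<partial>M) = (\<integral>x. g x * y x \<partial>M)"
  shows "AE x in M. f x = g x"
proof -
  interpret P: plattice p "Lp_fun p M" "Ip p M" by (rule plattice_Lp[OF p])
  let ?d = "\<lambda>x. f x - g x"
  have d: "?d \<in> Lp_fun p M" by (rule P.diff_in[OF f g])
  have y: "(\<lambda>x. dual p (?d x)) \<in> Lp_fun q M" by (rule dual_Lp[OF p q pq d])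
  have "(\<integral>x. ?d x * dual p (?d x) \<partial>M) = (\<integral>x. f x * dual p (?d x) \<partial>M) - (\<integral>x. g x * dual p (?d x) \<partial>M)"
    using Holder(1)[OF p q pq f y] Holder(1)[OF p q pq g y] by (simp add: left_diff_distrib)
  also have "\<dots> = 0" using eq[OF y] by simp
  finally have "(\<integral>x. complex_of_real (cmod (?d x) powr p) \<partial>M) = 0"
    using dual_mult[OF p] by (simp add: mult.commute)
  then have "Ip p M ?d = 0" unfolding Ip_def by simp
  then show ?thesis using Ip_eq_0_iff[OF d] by simp
qed

section \<open>Classes, representatives and operator norms\<close>

definition cls :: "real \<Rightarrow> 'a measure \<Rightarrow> ('a \<Rightarrow> complex) \<Rightarrow> ('a \<Rightarrow> complex) set" where
  "cls p M f = ae_rel p M `` {f}"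

definition rp :: "('a \<Rightarrow> complex) set \<Rightarrow> 'a \<Rightarrow> complex" where
  "rp F = (SOME f. f \<in> F)"

lemma mem_cls: "f \<in> Lp_fun p M \<Longrightarrow> g \<in> cls p M f \<longleftrightarrow> g \<in> Lp_fun p M \<and> (AE x in M. f x = g x)"
  by (auto simp: cls_def ae_rel_def)

lemma cls_eq_iff:
  assumes "f \<in> Lp_fun p M" "g \<in> Lp_fun p M"
  shows "cls p M f = cls p M g \<longleftrightarrow> (AE x in M. f x = g x)"
proof
  assume "cls p M f = cls p M g"
  then have "g \<in> cls p M f" using assms by (simp add: mem_cls)
  then show "AE x in M. f x = g x" using assms by (simp add: mem_cls)
next
  assume ae: "AE x in M. f x = g x"
  have "(AE x in M. f x = h x) \<longleftrightarrow> (AE x in M. g x = h x)" for h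
  proof
    assume "AE x in M. f x = h x"
    then show "AE x in M. g x = h x" using ae by eventually_elim simp
  next
    assume "AE x in M. g x = h x"
    then show "AE x in M. f x = h x" using ae by eventually_elim simp
  qed
  then show "cls p M f = cls p M g" using assms by (auto simp: mem_cls set_eq_iff)
qed

lemma vecs_Lp: "vecs (Lp p M) = cls p M ` Lp_fun p M"
  by (auto simp: Lp_def quotient_def cls_def)

lemma rp_vecs:
  assumes "F \<in> vecs (Lp p M)" shows "rp F \<in> Lp_fun p M" "cls p M (rp F) = F"
proof -
  obtain f where f: "f \<in> Lp_fun p M" "F = cls p M f" using assms by (auto simp: vecs_Lp)
  have "f \<in> F" using f by (simp add: mem_cls)
  then have "rp F \<in> F" unfolding rp_def by (rule someI[of "\<lambda>f. f \<in> F"])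
  then show "rp F \<in> Lp_fun p M" "cls p M (rp F) = F" using f cls_eq_iff[of "rp F" p M f]
    by (auto simp: mem_cls elim: AE_mp)
qed

lemma rp_cls: "f \<in> Lp_fun p M \<Longrightarrow> AE x in M. rp (cls p M f) x = f x"
  using rp_vecs[of "cls p M f" p M] cls_eq_iff[of "rp (cls p M f)" p M f] by (simp add: vecs_Lp)

lemma nrm_cls:
  assumes f: "f \<in> Lp_fun p M" shows "nrm (Lp p M) (cls p M f) = Ip p M f powr (1/p)"
proof -
  have "(\<lambda>f. (\<integral>x. norm (f x) powr p \<partial>M) powr (1 / p)) ` cls p M f = {Ip p M f powr (1/p)}"
  proof (intro antisym subsetI)
    fix r assume "r \<in> (\<lambda>f. (\<integral>x. norm (f x) powr p \<partial>M) powr (1 / p)) ` cls p M f"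
    then obtain g where g: "g \<in> cls p M f" "r = Ip p M g powr (1/p)" by (auto simp: Ip_def)
    then show "r \<in> {Ip p M f powr (1/p)}" using f Ip_AE_cong[of f p M g] by (simp add: mem_cls)
  next
    fix r assume "r \<in> {Ip p M f powr (1/p)}"
    then show "r \<in> (\<lambda>f. (\<integral>x. norm (f x) powr p \<partial>M) powr (1 / p)) ` cls p M f"
      using f by (auto simp: Ip_def mem_cls intro!: image_eqI[of _ _ f])
  qed
  then show ?thesis by (simp add: Lp_def)
qed

lemma vadd_cls:
  assumes p: "1 < p" and f: "f \<in> Lp_fun p M" and g: "g \<in> Lp_fun p M"
  shows "vadd (Lp p M) (cls p M f) (cls p M g) = cls p M (\<lambda>x. f x + g x)"
proof -
  interpret P: plattice p "Lp_fun p M" "Ip p M" by (rule plattice_Lp[OF p])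
  have s: "(\<lambda>x. f x + g x) \<in> Lp_fun p M" by (rule P.add_in[OF f g])
  have *: "(\<exists>f'\<in>cls p M f. \<exists>g'\<in>cls p M g. AE x in M. h x = f' x + g' x) \<longleftrightarrow> (AE x in M. f x + g x = h x)"
    if h: "h \<in> Lp_fun p M" for h
  proof
    assume "\<exists>f'\<in>cls p M f. \<exists>g'\<in>cls p M g. AE x in M. h x = f' x + g' x"
    then obtain f' g' where "AE x in M. f x = f' x" "AE x in M. g x = g' x" "AE x in M. h x = f' x + g' x"
      using f g by (auto simp: mem_cls)
    then show "AE x in M. f x + g x = h x" by eventually_elim simp
  next
    assume "AE x in M. f x + g x = h x"
    then have "AE x in M. h x = f x + g x" by eventually_elim simp
    moreover have "f \<in> cls p M f" "g \<in> cls p M g" using f g by (simp_all add: mem_cls)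
    ultimately show "\<exists>f'\<in>cls p M f. \<exists>g'\<in>cls p M g. AE x in M. h x = f' x + g' x" by blast
  qed
  show ?thesis
  proof (rule set_eqI)
    fix h
    have "h \<in> vadd (Lp p M) (cls p M f) (cls p M g) \<longleftrightarrow>
      h \<in> Lp_fun p M \<and> (\<exists>f'\<in>cls p M f. \<exists>g'\<in>cls p M g. AE x in M. h x = f' x + g' x)"
      by (simp add: Lp_def)
    then show "h \<in> vadd (Lp p M) (cls p M f) (cls p M g) \<longleftrightarrow> h \<in> cls p M (\<lambda>x. f x + g x)"
      unfolding mem_cls[OF s] using * by blast
  qed
qed

lemma vscale_cls:
  assumes p: "1 < p" and f: "f \<in> Lp_fun p M"
  shows "vscale (Lp p M) c (cls p M f) = cls p M (\<lambda>x. c * f x)"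
proof -
  interpret P: plattice p "Lp_fun p M" "Ip p M" by (rule plattice_Lp[OF p])
  have s: "(\<lambda>x. c * f x) \<in> Lp_fun p M" by (rule P.scale_in[OF f])
  have *: "(\<exists>f'\<in>cls p M f. AE x in M. h x = c * f' x) \<longleftrightarrow> (AE x in M. c * f x = h x)"
    if h: "h \<in> Lp_fun p M" for h
  proof
    assume "\<exists>f'\<in>cls p M f. AE x in M. h x = c * f' x"
    then obtain f' where "AE x in M. f x = f' x" "AE x in M. h x = c * f' x"
      using f by (auto simp: mem_cls)
    then show "AE x in M. c * f x = h x" by eventually_elim simp
  next
    assume "AE x in M. c * f x = h x"
    then have "AE x in M. h x = c * f x" by eventually_elim simp
    moreover have "f \<in> cls p M f" using f by (simp add: mem_cls)
    ultimately show "\<exists>f'\<in>cls p M f. AE x in M. h x = c * f' x" by blast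
  qed
  show ?thesis
  proof (rule set_eqI)
    fix h
    have "h \<in> vscale (Lp p M) c (cls p M f) \<longleftrightarrow>
      h \<in> Lp_fun p M \<and> (\<exists>f'\<in>cls p M f. AE x in M. h x = c * f' x)"
      by (simp add: Lp_def)
    then show "h \<in> vscale (Lp p M) c (cls p M f) \<longleftrightarrow> h \<in> cls p M (\<lambda>x. c * f x)"
      unfolding mem_cls[OF s] using * by blast
  qed
qed

lemma vdiff_cls:
  assumes p: "1 < p" and f: "f \<in> Lp_fun p M" and g: "g \<in> Lp_fun p M"
  shows "vdiff (Lp p M) (cls p M f) (cls p M g) = cls p M (\<lambda>x. f x - g x)"
proof -
  interpret P: plattice p "Lp_fun p M" "Ip p M" by (rule plattice_Lp[OF p])
  show ?thesis
    unfolding vdiff_def vscale_cls[OF p g] vadd_cls[OF p f P.scale_in[OF g]] by simp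
qed

text \<open>\<open>F\<close> witnesses that the supremum is taken over a nonempty set.\<close>

lemma op_norm_le:
  assumes "0 \<le> C" "F \<in> vecs X" "nrm X F \<le> 1" "\<And>F. F \<in> vecs X \<Longrightarrow> nrm Y (T F) \<le> C * nrm X F"
  shows "op_norm X Y T \<le> C"
  unfolding op_norm_def
proof (rule cSUP_least)
  show "{x \<in> vecs X. nrm X x \<le> 1} \<noteq> {}" using assms by auto
  fix x assume "x \<in> {x \<in> vecs X. nrm X x \<le> 1}"
  then have "nrm Y (T x) \<le> C * nrm X x" "nrm X x \<le> 1" using assms(4) by auto
  then show "nrm Y (T x) \<le> C" using assms(1) mult_left_mono[of "nrm X x" 1 C] by simp
qed

lemma op_norm_ge:
  assumes "bounded_op X Y T" "F \<in> vecs X" "nrm X F \<le> 1" "\<And>x. x \<in> vecs X \<Longrightarrow> 0 \<le> nrm X x"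
  shows "nrm Y (T F) \<le> op_norm X Y T"
proof -
  obtain C where C: "\<And>x. x \<in> vecs X \<Longrightarrow> nrm Y (T x) \<le> C * nrm X x"
    using assms(1) unfolding bounded_op_def by blast
  have "bdd_above ((\<lambda>x. nrm Y (T x)) ` {x \<in> vecs X. nrm X x \<le> 1})"
  proof (rule bdd_aboveI2)
    fix x assume x: "x \<in> {x \<in> vecs X. nrm X x \<le> 1}"
    then have "C * nrm X x \<le> \<bar>C\<bar> * 1" using assms(4) by (intro mult_mono) auto
    then show "nrm Y (T x) \<le> \<bar>C\<bar>" using C[of x] x by simp
  qed
  then show ?thesis unfolding op_norm_def using assms by (intro cSUP_upper) auto
qed

section \<open>Invariant means\<close>

text \<open>Boundedness everywhere does not refer to a Haar measure; it holds for all functions to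
  which the mean is applied below.\<close>

definition bounded_borel :: "('g::topological_space \<Rightarrow> real) set" where
  "bounded_borel = {f \<in> borel_measurable borel. \<exists>B. \<forall>s. \<bar>f s\<bar> \<le> B}"

lemma bounded_borelI: "f \<in> borel_measurable borel \<Longrightarrow> (\<And>s. \<bar>f s\<bar> \<le> B) \<Longrightarrow> f \<in> bounded_borel"
  by (auto simp: bounded_borel_def)

lemma bounded_borel_add: "f \<in> bounded_borel \<Longrightarrow> g \<in> bounded_borel \<Longrightarrow> (\<lambda>s. f s + g s) \<in> bounded_borel"
proof -
  assume "f \<in> bounded_borel" "g \<in> bounded_borel"
  then obtain B B' where fg: "f \<in> borel_measurable borel" "g \<in> borel_measurable borel"
    and B: "\<And>s. \<bar>f s\<bar> \<le> B" "\<And>s. \<bar>g s\<bar> \<le> B'" by (auto simp: bounded_borel_def)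
  show ?thesis
  proof (rule bounded_borelI)
    show "\<bar>f s + g s\<bar> \<le> B + B'" for s using B(1)[of s] B(2)[of s] by linarith
  qed (use fg in measurable)
qed

lemma bounded_borel_scale: "f \<in> bounded_borel \<Longrightarrow> (\<lambda>s. c * f s) \<in> bounded_borel"
proof -
  assume "f \<in> bounded_borel"
  then obtain B where f: "f \<in> borel_measurable borel" and B: "\<And>s. \<bar>f s\<bar> \<le> B" by (auto simp: bounded_borel_def)
  show ?thesis
    by (rule bounded_borelI[where B = "\<bar>c\<bar> * B"]) (use f B in \<open>auto simp: abs_mult intro!: mult_left_mono\<close>)
qed

lemma bounded_borel_const: "(\<lambda>_. c) \<in> bounded_borel"
  by (rule bounded_borelI[of _ "\<bar>c\<bar>"]) auto

lemma bounded_borel_continuous: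
  fixes f :: "'g::t2_space \<Rightarrow> real"
  assumes "\<And>s. (f \<longlongrightarrow> f s) (nhds s)" "\<And>s. \<bar>f s\<bar> \<le> B"
  shows "f \<in> bounded_borel"
proof (rule bounded_borelI[OF _ assms(2)])
  have "isCont f s" for s using assms(1)[of s] by (simp add: isCont_def tendsto_nhds_iff)
  then show "f \<in> borel_measurable borel"
    by (intro borel_measurable_continuous_onI continuous_at_imp_continuous_on) simp
qed

locale mean =
  fixes m :: "('g::{topological_group_add, t2_space} \<Rightarrow> real) \<Rightarrow> real"
  assumes m_add: "f \<in> bounded_borel \<Longrightarrow> g \<in> bounded_borel \<Longrightarrow> m (\<lambda>s. f s + g s) = m f + m g"
    and m_scale: "f \<in> bounded_borel \<Longrightarrow> m (\<lambda>s. c * f s) = c * m f"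
    and m_pos: "f \<in> bounded_borel \<Longrightarrow> (\<And>s. 0 \<le> f s) \<Longrightarrow> 0 \<le> m f"
    and m_1: "m (\<lambda>_. 1) = 1"
    and m_inv: "f \<in> bounded_borel \<Longrightarrow> m (\<lambda>s. f (t + s)) = m f"
begin

lemma m_const: "m (\<lambda>_. c) = c"
  using m_scale[OF bounded_borel_const[of 1], of c] m_1 by simp

lemma m_mono: "f \<in> bounded_borel \<Longrightarrow> g \<in> bounded_borel \<Longrightarrow> (\<And>s. f s \<le> g s) \<Longrightarrow> m f \<le> m g"
  using m_pos[of "\<lambda>s. g s + (-1) * f s"] m_add[of g "\<lambda>s. (-1) * f s"] m_scale[of f "-1"]
    bounded_borel_add[of g "\<lambda>s. (-1) * f s"] bounded_borel_scale[of f "-1"] by simp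

lemma bounded_borel_powr:
  assumes "f \<in> bounded_borel" "\<And>s. 0 \<le> f s" "0 < r"
  shows "(\<lambda>s. f s powr r) \<in> bounded_borel"
proof -
  obtain B where f: "f \<in> borel_measurable borel" and B: "\<And>s. \<bar>f s\<bar> \<le> B"
    using assms(1) by (auto simp: bounded_borel_def)
  show ?thesis
  proof (rule bounded_borelI)
    show "\<bar>f s powr r\<bar> \<le> B powr r" for s
      using B[of s] assms(2)[of s] assms(3) by (simp add: powr_mono2)
  qed (use f in measurable)
qed

text \<open>Jensen's inequality for a finitely additive mean. Young's inequality with a parameter
  \<open>l\<close> bounds \<open>f s powr (1 / p)\<close> by an affine function of
  \<open>f s\<close>, to which \<open>m\<close> applies, and \<open>l = m f powr (1 / p)\<close> is
  the best choice. If \<open>m f = 0\<close>, \<open>l\<close> is taken arbitrarily small.\<close>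

lemma m_powr:
  assumes p: "1 < p" and f: "f \<in> bounded_borel" and pos: "\<And>s. 0 \<le> f s"
  shows "m (\<lambda>s. f s powr (1 / p)) \<le> m f powr (1 / p)"
proof -
  define q where "q = p / (p - 1)"
  have q: "1 < q" "1 / p + 1 / q = 1" "(p - 1) * q = p" using p by (auto simp: q_def field_simps)
  have fp: "(\<lambda>s. f s powr (1 / p)) \<in> bounded_borel" by (rule bounded_borel_powr[OF f pos]) (use p in simp)
  have mf: "0 \<le> m f" by (rule m_pos[OF f pos])
  have key: "m (\<lambda>s. f s powr (1 / p)) \<le> m f / (p * l powr (p - 1)) + l / q" if l: "0 < l" for l
  proof -
    have "m (\<lambda>s. f s powr (1 / p)) \<le> m (\<lambda>s. (1 / (p * l powr (p - 1))) * f s + l / q)"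
    proof (intro m_mono fp bounded_borel_add bounded_borel_scale f bounded_borel_const)
      fix s
      have "f s powr (1/p) * l powr (p - 1) \<le> (f s powr (1/p)) powr p / p + (l powr (p - 1)) powr q / q"
        by (rule Youngs_inequality) (use p q in auto)
      also have "\<dots> = f s / p + l powr p / q" using p q pos[of s] by (simp add: powr_powr)
      also have "l powr p = l * l powr (p - 1)" using powr_mult_base[of l "p - 1"] l by simp
      finally have "f s powr (1/p) \<le> (f s / p + l * l powr (p - 1) / q) / l powr (p - 1)"
        using l by (simp add: pos_le_divide_eq)
      also have "\<dots> = (1 / (p * l powr (p - 1))) * f s + l / q"
        using l by (simp add: add_divide_distrib)
      finally show "f s powr (1/p) \<le> (1 / (p * l powr (p - 1))) * f s + l / q" .
    qed
    also have "\<dots> = m f / (p * l powr (p - 1)) + l / q"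
      by (simp only: m_add[OF bounded_borel_scale[OF f] bounded_borel_const] m_scale[OF f] m_const) simp
    finally show ?thesis .
  qed
  show ?thesis
  proof (cases "m f = 0")
    case True
    have "m (\<lambda>s. f s powr (1 / p)) \<le> 0 + e" if e: "0 < e" for e
    proof -
      have "m (\<lambda>s. f s powr (1 / p)) \<le> (q * e) / q" using key[of "q * e"] q e True by simp
      then show ?thesis using q by simp
    qed
    then have "m (\<lambda>s. f s powr (1 / p)) \<le> 0" by (rule field_le_epsilon)
    then show ?thesis using True p by simp
  next
    case False
    define l where "l = m f powr (1 / p)"
    have l: "0 < l" using False mf by (simp add: l_def)
    have "m f = l powr p" using mf p by (simp add: l_def powr_powr)
    also have "l powr p = l * l powr (p - 1)" using powr_mult_base[of l "p - 1"] l by simp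
    finally have "m f / (p * l powr (p - 1)) = l / p" using l by simp
    then have "m (\<lambda>s. f s powr (1 / p)) \<le> l * (1 / p + 1 / q)"
      using key[OF l] by (simp add: distrib_left)
    then show ?thesis using q by (simp add: l_def)
  qed
qed

section \<open>Means of complex functions\<close>

definition mC :: "('g \<Rightarrow> complex) \<Rightarrow> complex" where
  "mC f = Complex (m (\<lambda>s. Re (f s))) (m (\<lambda>s. Im (f s)))"

definition bounded_borelC :: "('g \<Rightarrow> complex) set" where
  "bounded_borelC = {f. (\<lambda>s. Re (f s)) \<in> bounded_borel \<and> (\<lambda>s. Im (f s)) \<in> bounded_borel \<and> (\<lambda>s. cmod (f s)) \<in> bounded_borel}"

lemma bounded_borelC_continuous:
  assumes f: "\<And>s. (f \<longlongrightarrow> f s) (nhds s)" "\<And>s. cmod (f s) \<le> B"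
  shows "f \<in> bounded_borelC"
proof -
  have "\<bar>Re (f s)\<bar> \<le> B" "\<bar>Im (f s)\<bar> \<le> B" for s
    using abs_Re_le_cmod[of "f s"] abs_Im_le_cmod[of "f s"] f(2)[of s] by linarith+
  then show ?thesis
    unfolding bounded_borelC_def using f(2)
    by (intro CollectI conjI bounded_borel_continuous[where B = B] tendsto_Re tendsto_Im tendsto_norm f(1)) auto
qed

lemma mC_add:
  "f \<in> bounded_borelC \<Longrightarrow> g \<in> bounded_borelC \<Longrightarrow> mC (\<lambda>s. f s + g s) = mC f + mC g"
  by (simp add: mC_def bounded_borelC_def complex_eq_iff m_add)

lemma mC_scale:
  assumes "f \<in> bounded_borelC" shows "mC (\<lambda>s. c * f s) = c * mC f"
proof -
  have f: "(\<lambda>s. Re (f s)) \<in> bounded_borel" "(\<lambda>s. Im (f s)) \<in> bounded_borel"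
    using assms by (auto simp: bounded_borelC_def)
  have "m (\<lambda>s. Re (c * f s)) = m (\<lambda>s. Re c * Re (f s) + (- Im c) * Im (f s))"
    "m (\<lambda>s. Im (c * f s)) = m (\<lambda>s. Re c * Im (f s) + Im c * Re (f s))" by simp_all
  then show ?thesis
    unfolding mC_def using f
    by (simp only: m_add bounded_borel_scale m_scale) (simp add: complex_eq_iff)
qed

lemma mC_const: "mC (\<lambda>_. c) = c"
  by (simp add: mC_def m_const)

text \<open>Rotation by a unimodular \<open>w\<close> makes the mean real and nonnegative, so that
  only real parts have to be compared.\<close>

lemma mC_bound:
  assumes f: "f \<in> bounded_borelC" and g: "g \<in> bounded_borel" "\<And>s. cmod (f s) \<le> g s"
  shows "cmod (mC f) \<le> m g"
proof (cases "mC f = 0")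
  case True
  have "0 \<le> m g" by (rule m_pos[OF g(1)]) (rule order_trans[OF norm_ge_zero g(2)])
  then show ?thesis using True by simp
next
  case False
  define w where "w = cnj (mC f) / complex_of_real (cmod (mC f))"
  have w: "cmod w = 1" using False by (simp add: w_def norm_divide)
  have "w * mC f = complex_of_real (cmod (mC f))"
    using False complex_norm_square[of "mC f"]
    by (simp add: w_def field_simps power2_eq_square)
  then have "cmod (mC f) = Re (mC (\<lambda>s. w * f s))" by (simp add: mC_scale[OF f])
  also have "\<dots> = m (\<lambda>s. Re w * Re (f s) + (- Im w) * Im (f s))" by (simp add: mC_def)
  also have "\<dots> \<le> m g"
  proof (rule m_mono)
    show "(\<lambda>s. Re w * Re (f s) + (- Im w) * Im (f s)) \<in> bounded_borel"
      using f by (intro bounded_borel_add bounded_borel_scale) (auto simp: bounded_borelC_def)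
    fix s
    have "Re w * Re (f s) + (- Im w) * Im (f s) \<le> cmod (w * f s)"
      using complex_Re_le_cmod[of "w * f s"] by simp
    also have "\<dots> \<le> g s" using w g(2)[of s] by (simp add: norm_mult)
    finally show "Re w * Re (f s) + (- Im w) * Im (f s) \<le> g s" .
  qed (rule g)
  finally show ?thesis .
qed

end

section \<open>Translations, the orbit map and the weak mean\<close>

text \<open>\<open>\<sigma> t\<close> is the action of \<pi> on representatives, so its algebraic
  laws hold almost everywhere only. \<open>C\<close> stands for the norm of \<pi>.\<close>

locale mean_rep = mean m for m :: "('g::{topological_group_add, t2_space} \<Rightarrow> real) \<Rightarrow> real" +
  fixes p :: real and M :: "'a measure" and \<sigma> :: "'g \<Rightarrow> ('a \<Rightarrow> complex) \<Rightarrow> 'a \<Rightarrow> complex" and C :: real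
  assumes p: "1 < p" and C: "0 \<le> C"
    and \<sigma>_in: "f \<in> Lp_fun p M \<Longrightarrow> \<sigma> t f \<in> Lp_fun p M"
    and \<sigma>_add: "f \<in> Lp_fun p M \<Longrightarrow> g \<in> Lp_fun p M \<Longrightarrow> AE x in M. \<sigma> t (\<lambda>x. f x + g x) x = \<sigma> t f x + \<sigma> t g x"
    and \<sigma>_scale: "f \<in> Lp_fun p M \<Longrightarrow> AE x in M. \<sigma> t (\<lambda>x. c * f x) x = c * \<sigma> t f x"
    and \<sigma>_mult: "f \<in> Lp_fun p M \<Longrightarrow> AE x in M. \<sigma> (s + t) f x = \<sigma> s (\<sigma> t f) x"
    and \<sigma>_0: "f \<in> Lp_fun p M \<Longrightarrow> AE x in M. \<sigma> 0 f x = f x"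
    and \<sigma>_bound: "f \<in> Lp_fun p M \<Longrightarrow> Ip p M (\<sigma> t f) \<le> C powr p * Ip p M f"
    and \<sigma>_cont: "f \<in> Lp_fun p M \<Longrightarrow> ((\<lambda>s. Ip p M (\<lambda>x. \<sigma> s f x - \<sigma> t f x)) \<longlongrightarrow> 0) (nhds t)"
begin

sublocale P: plattice p "Lp_fun p M" "Ip p M" by (rule plattice_Lp[OF p])

lemma \<sigma>_lin:
  assumes "f \<in> Lp_fun p M" "g \<in> Lp_fun p M"
  shows "AE x in M. \<sigma> t (\<lambda>x. c * f x + d * g x) x = c * \<sigma> t f x + d * \<sigma> t g x"
  using \<sigma>_add[OF P.scale_in[OF assms(1), of c] P.scale_in[OF assms(2), of d], of t]
    \<sigma>_scale[OF assms(1), of t c] \<sigma>_scale[OF assms(2), of t d]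
  by eventually_elim simp

lemma \<sigma>_diff:
  assumes "f \<in> Lp_fun p M" "g \<in> Lp_fun p M"
  shows "AE x in M. \<sigma> t (\<lambda>x. f x - g x) x = \<sigma> t f x - \<sigma> t g x"
  using \<sigma>_lin[OF assms, of t 1 "-1"] by simp

lemma \<sigma>_diff_bound:
  assumes "f \<in> Lp_fun p M" "g \<in> Lp_fun p M"
  shows "Ip p M (\<lambda>x. \<sigma> t f x - \<sigma> t g x) \<le> C powr p * Ip p M (\<lambda>x. f x - g x)"
proof -
  have d: "(\<lambda>x. f x - g x) \<in> Lp_fun p M" by (rule P.diff_in[OF assms])
  have "Ip p M (\<lambda>x. \<sigma> t f x - \<sigma> t g x) = Ip p M (\<sigma> t (\<lambda>x. f x - g x))"
    by (rule Ip_AE_cong[OF P.diff_in[OF \<sigma>_in[OF assms(1)] \<sigma>_in[OF assms(2)]] \<sigma>_in[OF d]])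
      (use \<sigma>_diff[OF assms, of t] in \<open>eventually_elim, simp\<close>)
  also have "\<dots> \<le> C powr p * Ip p M (\<lambda>x. f x - g x)" by (rule \<sigma>_bound[OF d])
  finally show ?thesis .
qed

text \<open>In multiplicative notation \<open>- t + s\<close> is the inverse of \<open>t\<close>
  times \<open>s\<close>. The last condition is thus continuity at the identity of left translation,
  uniformly in \<open>s\<close>; translations of the completion inherit strong continuity from
  it.\<close>

definition V0 :: "('g \<times> 'a \<Rightarrow> complex) set" where
  "V0 = {u. (\<forall>s. (\<lambda>x. u (s, x)) \<in> Lp_fun p M) \<and> (\<exists>B. \<forall>s. Ip p M (\<lambda>x. u (s, x)) \<le> B) \<and>
    (\<forall>e>0. \<forall>\<^sub>F t in nhds 0. \<forall>s. Ip p M (\<lambda>x. u (- t + s, x) - u (s, x)) < e)}"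

definition \<Phi>0 :: "('g \<times> 'a \<Rightarrow> complex) \<Rightarrow> real" where
  "\<Phi>0 u = m (\<lambda>s. Ip p M (\<lambda>x. u (s, x)))"

lemma V0_sec: "u \<in> V0 \<Longrightarrow> (\<lambda>x. u (s, x)) \<in> Lp_fun p M" by (simp add: V0_def)

text \<open>The substitution \<open>t = s + - r\<close> turns the uniform condition at 0 into
  continuity at \<open>s\<close>, because \<open>- (s + - r) + s = r\<close>.\<close>

lemma V0_nhds:
  assumes u: "u \<in> V0"
  shows "((\<lambda>r. Ip p M (\<lambda>x. u (r, x) - u (s, x))) \<longlongrightarrow> 0) (nhds s)"
proof (rule tendstoI)
  fix e :: real assume "0 < e"
  then have E: "\<forall>\<^sub>F t in nhds 0. \<forall>s. Ip p M (\<lambda>x. u (- t + s, x) - u (s, x)) < e"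
    using u by (simp add: V0_def)
  have "((\<lambda>r. s + - r) \<longlongrightarrow> s + - s) (nhds s)"
    by (intro tendsto_add tendsto_const tendsto_minus filterlim_ident)
  then have "((\<lambda>r. s + - r) \<longlongrightarrow> 0) (nhds s)" by simp
  then have "\<forall>\<^sub>F r in nhds s. \<forall>s'. Ip p M (\<lambda>x. u (- (s + - r) + s', x) - u (s', x)) < e"
    using E unfolding filterlim_iff by blast
  then show "\<forall>\<^sub>F r in nhds s. dist (Ip p M (\<lambda>x. u (r, x) - u (s, x))) 0 < e"
  proof eventually_elim
    case (elim r)
    have "- (s + - r) + s = r" by (simp add: minus_add add.assoc)
    then have "Ip p M (\<lambda>x. u (r, x) - u (s, x)) < e" using elim[rule_format, of s] by simp
    moreover have "0 \<le> Ip p M (\<lambda>x. u (r, x) - u (s, x))" by (intro P.nonneg P.diff_in V0_sec[OF u])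
    ultimately show ?case by simp
  qed
qed

lemma V0_Ip_cont: "u \<in> V0 \<Longrightarrow> ((\<lambda>r. Ip p M (\<lambda>x. u (r, x))) \<longlongrightarrow> Ip p M (\<lambda>x. u (s, x))) (nhds s)"
  by (rule P.tendsto_\<Phi>[where u = "\<lambda>r x. u (r, x)", OF _ V0_sec V0_nhds]) (simp_all add: V0_sec)

lemma V0_bounded: "u \<in> V0 \<Longrightarrow> (\<lambda>s. Ip p M (\<lambda>x. u (s, x))) \<in> bounded_borel"
proof -
  assume u: "u \<in> V0"
  then obtain B where B: "\<And>s. Ip p M (\<lambda>x. u (s, x)) \<le> B" by (auto simp: V0_def)
  show ?thesis
    by (rule bounded_borel_continuous[OF V0_Ip_cont[OF u], of B])
      (simp add: B P.nonneg V0_sec[OF u])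
qed

text \<open>The axioms hold in each section by \<open>plattice_Lp\<close> and are averaged by the
  mean. Uniform continuity of \<open>H\<close> applied to \<open>u\<close> and \<open>v\<close>
  comes from \<open>P.lip_bound\<close>, whose constant does not depend on \<open>s\<close>.\<close>

lemma plattice_V0: "plattice p V0 \<Phi>0"
proof
  show "1 < p" by (rule p)
  show "(\<lambda>_. 0) \<in> V0" using P.zero_in P.zero by (auto simp: V0_def)
next
  fix u v :: "'g \<times> 'a \<Rightarrow> complex" and H assume u: "u \<in> V0" and v: "v \<in> V0" and H: "lip2 H"
  obtain K where K: "0 < K" and KB: "\<forall>u\<in>Lp_fun p M. \<forall>v\<in>Lp_fun p M. \<forall>u'\<in>Lp_fun p M. \<forall>v'\<in>Lp_fun p M.
    Ip p M (\<lambda>x. H (u x) (v x) - H (u' x) (v' x)) \<le> K * (Ip p M (\<lambda>x. u x - u' x) + Ip p M (\<lambda>x. v x - v' x))"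
    using P.lip_bound[OF H] by blast
  note KB = KB[rule_format]
  have H0: "H 0 0 = 0" using H by (simp add: lip2_def)
  show "(\<lambda>x. H (u x) (v x)) \<in> V0" unfolding V0_def
  proof (intro CollectI conjI allI impI)
    show "(\<lambda>x. H (u (s, x)) (v (s, x))) \<in> Lp_fun p M" for s
      by (rule P.lip_in[OF V0_sec[OF u] V0_sec[OF v] H])
    obtain B B' where B: "\<And>s. Ip p M (\<lambda>x. u (s, x)) \<le> B" "\<And>s. Ip p M (\<lambda>x. v (s, x)) \<le> B'"
      using u v by (auto simp: V0_def)
    show "\<exists>B. \<forall>s. Ip p M (\<lambda>x. H (u (s, x)) (v (s, x))) \<le> B"
    proof (intro exI allI)
      fix s
      have "Ip p M (\<lambda>x. H (u (s, x)) (v (s, x))) \<le> K * (Ip p M (\<lambda>x. u (s, x)) + Ip p M (\<lambda>x. v (s, x)))"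
        using KB[OF V0_sec[OF u] V0_sec[OF v] P.zero_in P.zero_in, of s s] H0 by simp
      also have "\<dots> \<le> K * (B + B')" using K B by (intro mult_left_mono add_mono) auto
      finally show "Ip p M (\<lambda>x. H (u (s, x)) (v (s, x))) \<le> K * (B + B')" .
    qed
    fix e :: real assume "0 < e"
    then have e: "0 < e / (2 * K)" using K by simp
    have "\<forall>\<^sub>F t in nhds 0. \<forall>s. Ip p M (\<lambda>x. u (- t + s, x) - u (s, x)) < e / (2 * K)"
      "\<forall>\<^sub>F t in nhds 0. \<forall>s. Ip p M (\<lambda>x. v (- t + s, x) - v (s, x)) < e / (2 * K)"
      using u v e unfolding V0_def by blast+
    then show "\<forall>\<^sub>F t in nhds 0. \<forall>s. Ip p M (\<lambda>x. H (u (- t + s, x)) (v (- t + s, x)) - H (u (s, x)) (v (s, x))) < e"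
    proof eventually_elim
      case (elim t)
      show ?case
      proof
        fix s
        have "Ip p M (\<lambda>x. H (u (- t + s, x)) (v (- t + s, x)) - H (u (s, x)) (v (s, x)))
          \<le> K * (Ip p M (\<lambda>x. u (- t + s, x) - u (s, x)) + Ip p M (\<lambda>x. v (- t + s, x) - v (s, x)))"
          by (rule KB; rule V0_sec; fact)
        also have "\<dots> < K * (e / (2 * K) + e / (2 * K))"
          using elim K by (intro mult_strict_left_mono add_strict_mono) auto
        also have "\<dots> = e" using K by simp
        finally show "Ip p M (\<lambda>x. H (u (- t + s, x)) (v (- t + s, x)) - H (u (s, x)) (v (s, x))) < e" .
      qed
    qed
  qed
next
  fix u v :: "'g \<times> 'a \<Rightarrow> complex" assume uv: "u \<in> V0" "v \<in> V0" "\<And>x. cmod (u x) \<le> cmod (v x)"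
  then show "\<Phi>0 u \<le> \<Phi>0 v" unfolding \<Phi>0_def by (intro m_mono V0_bounded P.mono V0_sec) auto
next
  fix u :: "'g \<times> 'a \<Rightarrow> complex" and c :: complex assume u: "u \<in> V0"
  show "\<Phi>0 (\<lambda>x. c * u x) = cmod c powr p * \<Phi>0 u"
    unfolding \<Phi>0_def by (simp add: P.scale V0_sec[OF u] m_scale[OF V0_bounded[OF u]])
next
  fix u v :: "'g \<times> 'a \<Rightarrow> complex" assume u: "u \<in> V0" and v: "v \<in> V0"
  have lip_V0: "(\<lambda>x. u x + v x) \<in> V0 \<Longrightarrow> (\<lambda>s. Ip p M (\<lambda>x. u (s, x) + v (s, x))) \<in> bounded_borel"
    using V0_bounded by fastforce
  have cont: "((\<lambda>r. Ip p M (\<lambda>x. u (r, x) + v (r, x))) \<longlongrightarrow> Ip p M (\<lambda>x. u (s, x) + v (s, x))) (nhds s)" for s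
  proof (rule P.tendsto_\<Phi>[where u = "\<lambda>r x. u (r, x) + v (r, x)"])
    show "\<forall>\<^sub>F r in nhds s. (\<lambda>x. u (r, x) + v (r, x)) \<in> Lp_fun p M" by (simp add: P.add_in V0_sec u v)
    show "(\<lambda>x. u (s, x) + v (s, x)) \<in> Lp_fun p M" by (simp add: P.add_in V0_sec u v)
    have "((\<lambda>r. 2 powr p * (Ip p M (\<lambda>x. u (r, x) - u (s, x)) + Ip p M (\<lambda>x. v (r, x) - v (s, x)))) \<longlongrightarrow> 2 powr p * (0 + 0)) (nhds s)"
      by (intro tendsto_intros V0_nhds u v)
    then have l: "((\<lambda>r. 2 powr p * (Ip p M (\<lambda>x. u (r, x) - u (s, x)) + Ip p M (\<lambda>x. v (r, x) - v (s, x)))) \<longlongrightarrow> 0) (nhds s)" by simp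
    show "((\<lambda>r. Ip p M (\<lambda>x. (u (r, x) + v (r, x)) - (u (s, x) + v (s, x)))) \<longlongrightarrow> 0) (nhds s)"
    proof (rule real_tendsto_sandwich[OF _ _ tendsto_const l]; intro always_eventually allI)
      fix r
      show "0 \<le> Ip p M (\<lambda>x. (u (r, x) + v (r, x)) - (u (s, x) + v (s, x)))"
        by (intro P.nonneg P.diff_in P.add_in V0_sec u v)
      show "Ip p M (\<lambda>x. (u (r, x) + v (r, x)) - (u (s, x) + v (s, x)))
        \<le> 2 powr p * (Ip p M (\<lambda>x. u (r, x) - u (s, x)) + Ip p M (\<lambda>x. v (r, x) - v (s, x)))"
        by (intro P.dominated P.diff_in P.add_in V0_sec u v) (metis add_diff_add norm_triangle_ineq)
    qed
  qed
  obtain B B' where B: "\<And>s. Ip p M (\<lambda>x. u (s, x)) \<le> B" "\<And>s. Ip p M (\<lambda>x. v (s, x)) \<le> B'"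
    using u v by (auto simp: V0_def)
  have bb: "(\<lambda>s. Ip p M (\<lambda>x. u (s, x) + v (s, x))) \<in> bounded_borel"
  proof (rule bounded_borel_continuous[OF cont])
    fix s
    have "Ip p M (\<lambda>x. u (s, x) + v (s, x)) \<le> 2 powr p * (Ip p M (\<lambda>x. u (s, x)) + Ip p M (\<lambda>x. v (s, x)))"
      by (rule P.quasi_triangle[OF V0_sec[OF u] V0_sec[OF v]])
    also have "\<dots> \<le> 2 powr p * (B + B')" using B by (intro mult_left_mono add_mono) auto
    finally show "\<bar>Ip p M (\<lambda>x. u (s, x) + v (s, x))\<bar> \<le> 2 powr p * (B + B')"
      using P.nonneg[OF P.add_in[OF V0_sec[OF u] V0_sec[OF v]], of s s] by simp
  qed
  have sum: "m (\<lambda>s. a * Ip p M (\<lambda>x. u (s, x)) + b * Ip p M (\<lambda>x. v (s, x))) = a * \<Phi>0 u + b * \<Phi>0 v" for a b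
    unfolding \<Phi>0_def
    by (simp add: m_add[OF bounded_borel_scale[OF V0_bounded[OF u]] bounded_borel_scale[OF V0_bounded[OF v]]]
        m_scale[OF V0_bounded[OF u]] m_scale[OF V0_bounded[OF v]])
  have sbb: "(\<lambda>s. a * Ip p M (\<lambda>x. u (s, x)) + b * Ip p M (\<lambda>x. v (s, x))) \<in> bounded_borel" for a b
    by (intro bounded_borel_add bounded_borel_scale V0_bounded u v)
  show "\<Phi>0 (\<lambda>x. u x + v x) \<le> l powr (1 - p) * \<Phi>0 u + (1 - l) powr (1 - p) * \<Phi>0 v" if "0 < l" "l < 1" for l
    unfolding sum[symmetric] unfolding \<Phi>0_def
    by (rule m_mono[OF bb sbb]) (rule P.convex[OF V0_sec[OF u] V0_sec[OF v] that])
  show "\<Phi>0 u + \<Phi>0 v \<le> \<Phi>0 (\<lambda>x. u x + v x)" if "\<And>x. cmod (u x + v x) = cmod (u x) + cmod (v x)"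
  proof -
    have "m (\<lambda>s. 1 * Ip p M (\<lambda>x. u (s, x)) + 1 * Ip p M (\<lambda>x. v (s, x))) \<le> \<Phi>0 (\<lambda>x. u x + v x)"
      unfolding \<Phi>0_def
    proof (rule m_mono[OF sbb bb])
      fix s
      show "1 * Ip p M (\<lambda>x. u (s, x)) + 1 * Ip p M (\<lambda>x. v (s, x)) \<le> Ip p M (\<lambda>x. u (s, x) + v (s, x))"
        using P.superadd[OF V0_sec[OF u, of s] V0_sec[OF v, of s]] that by simp
    qed
    then show ?thesis unfolding sum by simp
  qed
  show "\<Phi>0 (\<lambda>x. u x + v x) = \<Phi>0 u + \<Phi>0 v" if d: "\<And>x. u x = 0 \<or> v x = 0"
  proof -
    have "Ip p M (\<lambda>x. u (s, x) + v (s, x)) = 1 * Ip p M (\<lambda>x. u (s, x)) + 1 * Ip p M (\<lambda>x. v (s, x))" for s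
      using P.disjoint_add[OF V0_sec[OF u, of s] V0_sec[OF v, of s]] d by simp
    then have "\<Phi>0 (\<lambda>x. u x + v x) = m (\<lambda>s. 1 * Ip p M (\<lambda>x. u (s, x)) + 1 * Ip p M (\<lambda>x. v (s, x)))"
      unfolding \<Phi>0_def by simp
    then show ?thesis unfolding sum by simp
  qed
qed

end

section \<open>Substitutions and functionals on the completion\<close>

context plattice
begin

text \<open>A substitution in the first coordinate acts on every section alike, so a symmetry of
  \<open>V\<close> extends to the completion without any choice of limits.\<close>

lemma asymp_comp:
  assumes \<theta>: "\<And>u. u \<in> V \<Longrightarrow> (\<lambda>y. u (\<theta> y)) \<in> V" "\<And>u. u \<in> V \<Longrightarrow> \<Phi> (\<lambda>y. u (\<theta> y)) = \<Phi> u"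
    and f: "asymp f a"
  shows "asymp (\<lambda>x. f (\<theta> (fst x), snd x)) (\<lambda>n y. a n (\<theta> y))"
proof -
  obtain w where w: "\<And>n. w n \<in> V" "\<And>n y. cmod (f (y, n) - a n y) \<le> cmod (w n y)" "(\<lambda>n. \<Phi> (w n)) \<longlonglongrightarrow> 0"
    using f unfolding asymp_def by blast
  have a: "cauchy a" using f by (simp add: asymp_def)
  have V: "a n \<in> V" for n using asymp_in[OF f] .
  have "cauchy (\<lambda>n y. a n (\<theta> y))"
    unfolding cauchy_def
  proof (intro conjI allI impI \<theta>(1) V)
    fix e :: real assume "0 < e"
    moreover have "\<Phi> (\<lambda>y. a k (\<theta> y) - a n (\<theta> y)) = \<Phi> (\<lambda>y. a k y - a n y)" for k n
      by (rule \<theta>(2)[OF diff_in[OF V V]])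
    ultimately show "\<exists>N. \<forall>k\<ge>N. \<forall>n\<ge>N. \<Phi> (\<lambda>y. a k (\<theta> y) - a n (\<theta> y)) < e"
      using a unfolding cauchy_def by simp
  qed
  moreover have "\<forall>n. (\<lambda>y. w n (\<theta> y)) \<in> V" using \<theta>(1)[OF w(1)] by blast
  moreover have "\<forall>n y. cmod (f (\<theta> (fst (y, n)), snd (y, n)) - a n (\<theta> y)) \<le> cmod (w n (\<theta> y))"
    using w(2) by simp
  moreover have "(\<lambda>n. \<Phi> (\<lambda>y. w n (\<theta> y))) \<longlonglongrightarrow> 0" using w(3) by (simp add: \<theta>(2)[OF w(1)])
  ultimately show ?thesis unfolding asymp_def by (intro conjI exI[of _ "\<lambda>n y. w n (\<theta> y)"])
qed

lemma C\<Phi>_comp: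
  assumes \<theta>: "\<And>u. u \<in> V \<Longrightarrow> (\<lambda>y. u (\<theta> y)) \<in> V" "\<And>u. u \<in> V \<Longrightarrow> \<Phi> (\<lambda>y. u (\<theta> y)) = \<Phi> u"
    and f: "f \<in> CV"
  shows "(\<lambda>x. f (\<theta> (fst x), snd x)) \<in> CV" "C\<Phi> (\<lambda>x. f (\<theta> (fst x), snd x)) = C\<Phi> f"
proof -
  obtain a where a: "asymp f a" using f by (auto simp: CV_def)
  note c = asymp_comp[OF \<theta> a]
  then show "(\<lambda>x. f (\<theta> (fst x), snd x)) \<in> CV" by (auto simp: CV_def)
  show "C\<Phi> (\<lambda>x. f (\<theta> (fst x), snd x)) = C\<Phi> f"
    using asymp_lim[OF c] asymp_lim[OF a] by (simp add: \<theta>(2)[OF asymp_in[OF a]] LIMSEQ_unique)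
qed

text \<open>Extension of a functional by continuity. For a functional that is Lipschitz with respect
  to \<open>nm\<close>, \<open>ext_lim\<close> removes the dependence on the choice.\<close>

definition ext :: "(('x \<Rightarrow> complex) \<Rightarrow> complex) \<Rightarrow> ('x \<times> nat \<Rightarrow> complex) \<Rightarrow> complex" where
  "ext L f = lim (\<lambda>n. L ((SOME a. asymp f a) n))"

lemma ext_lim:
  assumes L: "\<And>u v. u \<in> V \<Longrightarrow> v \<in> V \<Longrightarrow> cmod (L u - L v) \<le> B * nm (\<lambda>x. u x - v x)"
    and f: "asymp f a"
  shows "(\<lambda>n. L (a n)) \<longlonglongrightarrow> ext L f"
proof -
  have nm0: "(\<lambda>n. B * nm (u n)) \<longlonglongrightarrow> 0" if "\<And>n. u n \<in> V" "(\<lambda>n. \<Phi> (u n)) \<longlonglongrightarrow> 0" for u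
    using tendsto_mult_left[of "\<lambda>n. nm (u n)" 0 sequentially B] nm_tendsto_0_iff[of u sequentially] that by simp
  define b where "b = (SOME a. asymp f a)"
  have b: "asymp f b" unfolding b_def by (rule someI[of "asymp f", OF f])
  note V = asymp_in[OF f] asymp_in[OF b]
  have "Cauchy (\<lambda>n. L (b n))"
    unfolding Cauchy_def dist_norm
  proof (intro allI impI)
    fix e :: real assume e: "0 < e"
    define d where "d = e / (\<bar>B\<bar> + 1)"
    have d: "0 < d" using e by (simp add: d_def)
    then have "0 < d powr p" by simp
    then obtain N where N: "\<And>k n. k \<ge> N \<Longrightarrow> n \<ge> N \<Longrightarrow> \<Phi> (\<lambda>x. b k x - b n x) < d powr p"
      using b unfolding asymp_def cauchy_def by blast
    show "\<exists>N. \<forall>k\<ge>N. \<forall>n\<ge>N. cmod (L (b k) - L (b n)) < e"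
    proof (intro exI allI impI)
      fix k n assume "N \<le> k" "N \<le> n"
      then have "nm (\<lambda>x. b k x - b n x) < (d powr p) powr (1 / p)"
        unfolding nm_def using p1 N by (intro powr_less_mono2 nonneg diff_in V) auto
      then have lt: "nm (\<lambda>x. b k x - b n x) < d" using d p1 by (simp add: powr_powr)
      have "cmod (L (b k) - L (b n)) \<le> B * nm (\<lambda>x. b k x - b n x)" by (rule L[OF V(2) V(2)])
      also have "\<dots> \<le> (\<bar>B\<bar> + 1) * nm (\<lambda>x. b k x - b n x)" by (intro mult_right_mono nm_nonneg) simp
      also have "\<dots> < (\<bar>B\<bar> + 1) * d" using lt by (intro mult_strict_left_mono) auto
      also have "\<dots> = e" by (simp add: d_def)
      finally show "cmod (L (b k) - L (b n)) < e" .
    qed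
  qed
  then have lb: "(\<lambda>n. L (b n)) \<longlonglongrightarrow> ext L f"
    unfolding ext_def b_def[symmetric] by (simp add: Cauchy_convergent_iff convergent_LIMSEQ_iff)
  have "(\<lambda>n. L (a n) - L (b n)) \<longlonglongrightarrow> 0"
  proof (rule Lim_null_comparison)
    show "\<forall>\<^sub>F n in sequentially. norm (L (a n) - L (b n)) \<le> B * nm (\<lambda>x. a n x - b n x)"
      by (intro always_eventually allI L V)
    show "(\<lambda>n. B * nm (\<lambda>x. a n x - b n x)) \<longlonglongrightarrow> 0"
      by (rule nm0[OF diff_in[OF V] asymp_unique[OF f b]])
  qed
  from tendsto_add[OF this lb] show ?thesis by simp
qed

lemma ext_bound:
  assumes L: "\<And>u v. u \<in> V \<Longrightarrow> v \<in> V \<Longrightarrow> cmod (L u - L v) \<le> B * nm (\<lambda>x. u x - v x)"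
    and L': "\<And>u. u \<in> V \<Longrightarrow> cmod (L u) \<le> B * nm u" and f: "f \<in> CV"
  shows "cmod (ext L f) \<le> B * C\<Phi> f powr (1 / p)"
proof -
  obtain a where a: "asymp f a" using f by (auto simp: CV_def)
  have "(\<lambda>n. nm (a n)) \<longlonglongrightarrow> C\<Phi> f powr (1/p)"
    unfolding nm_def using p1
    by (intro tendsto_powr2[OF asymp_lim[OF a] tendsto_const] always_eventually allI nonneg asymp_in[OF a]) auto
  then have lim: "(\<lambda>n. B * nm (a n)) \<longlonglongrightarrow> B * C\<Phi> f powr (1/p)" by (rule tendsto_mult_left)
  have "\<exists>N. \<forall>n\<ge>N. cmod (L (a n)) \<le> B * nm (a n)" using L'[OF asymp_in[OF a]] by blast
  moreover have "(\<lambda>n. cmod (L (a n))) \<longlonglongrightarrow> cmod (ext L f)"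
    using tendsto_norm[OF ext_lim[of L B, OF _ a]] L by blast
  ultimately show ?thesis using lim LIMSEQ_le by blast
qed

end

section \<open>Translations of the completion and the orbit map\<close>

context mean_rep
begin

sublocale W: plattice p V0 \<Phi>0 by (rule plattice_V0)

sublocale CW: plattice p W.CV W.C\<Phi> by (rule W.plattice_CV)

abbreviation shift :: "'g \<Rightarrow> 'g \<times> 'a \<Rightarrow> 'g \<times> 'a" where
  "shift t y \<equiv> (- t + fst y, snd y)"

text \<open>Left translation, defined pointwise, so that the representation laws and compatibility
  with the modulus are equations between functions and not merely up to null functions.\<close>

definition T :: "'g \<Rightarrow> (('g \<times> 'a) \<times> nat \<Rightarrow> complex) \<Rightarrow> ('g \<times> 'a) \<times> nat \<Rightarrow> complex" where
  "T t f x = f (shift t (fst x), snd x)"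

text \<open>A shift by \<open>t\<close> conjugates the parameter of uniform continuity: the
  condition for \<open>u\<close> is used at \<open>- t + r + t\<close>, which tends to 0 with
  \<open>r\<close>.\<close>

lemma V0_shift:
  assumes u: "u \<in> V0" shows "(\<lambda>y. u (shift t y)) \<in> V0"
  unfolding V0_def
proof (intro CollectI conjI allI impI)
  show "(\<lambda>x. u (shift t (s, x))) \<in> Lp_fun p M" for s using V0_sec[OF u, of "- t + s"] by simp
  obtain B where "\<And>s. Ip p M (\<lambda>x. u (s, x)) \<le> B" using u by (auto simp: V0_def)
  then show "\<exists>B. \<forall>s. Ip p M (\<lambda>x. u (shift t (s, x))) \<le> B" by (intro exI[of _ B]) simp
  fix e :: real assume "0 < e"
  then have E: "\<forall>\<^sub>F r in nhds 0. \<forall>s. Ip p M (\<lambda>x. u (- r + s, x) - u (s, x)) < e"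
    using u by (simp add: V0_def)
  have "((\<lambda>r. - t + r + t) \<longlongrightarrow> - t + 0 + t) (nhds 0)"
    by (intro tendsto_add tendsto_const filterlim_ident)
  then have "((\<lambda>r. - t + r + t) \<longlongrightarrow> 0) (nhds 0)" by simp
  then have "\<forall>\<^sub>F r in nhds 0. \<forall>s. Ip p M (\<lambda>x. u (- (- t + r + t) + s, x) - u (s, x)) < e"
    using E unfolding filterlim_iff by blast
  then show "\<forall>\<^sub>F r in nhds 0. \<forall>s. Ip p M (\<lambda>x. u (shift t (- r + s, x)) - u (shift t (s, x))) < e"
  proof eventually_elim
    case (elim r)
    show ?case
    proof
      fix s
      have "- (- t + r + t) + (- t + s) = - t + (- r + s)"
        by (simp only: minus_add minus_minus add.assoc add_minus_cancel minus_add_cancel)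
      then show "Ip p M (\<lambda>x. u (shift t (- r + s, x)) - u (shift t (s, x))) < e"
        using elim[rule_format, of "- t + s"] by simp
    qed
  qed
qed

lemma \<Phi>0_shift: "u \<in> V0 \<Longrightarrow> \<Phi>0 (\<lambda>y. u (shift t y)) = \<Phi>0 u"
  unfolding \<Phi>0_def using m_inv[OF V0_bounded, of u "- t"] by simp

lemma T_in: "f \<in> W.CV \<Longrightarrow> T t f \<in> W.CV" and C\<Phi>_T: "f \<in> W.CV \<Longrightarrow> W.C\<Phi> (T t f) = W.C\<Phi> f"
  unfolding T_def[abs_def] using W.C\<Phi>_comp[of "shift t" f, OF V0_shift \<Phi>0_shift] by simp_all

lemma T_add: "T (s + t) f = T s (T t f)"
  by (rule ext) (simp only: T_def fst_conv snd_conv minus_add add.assoc)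

lemma T_0: "T 0 f = f"
  by (rule ext) (simp add: T_def)

text \<open>For a constant sequence this is uniform continuity, averaged by the mean. Density of
  these sequences and isometry of the translations give the general case.\<close>

lemma T_cont_0:
  assumes f: "f \<in> W.CV"
  shows "((\<lambda>t. W.C\<Phi> (\<lambda>x. T t f x - f x)) \<longlongrightarrow> 0) (nhds 0)"
proof (rule tendstoI)
  fix e :: real assume e: "0 < e"
  define K where "K = (2::real) powr p"
  have K: "1 \<le> K" using p powr_mono[of 0 p 2] by (simp add: K_def)
  \<comment> \<open>Two quasi-triangle inequalities cost at most \<open>3 * (K * K) * d\<close>, by
    \<open>1 \<le> K\<close>, and this is less than \<open>e\<close>.\<close>
  define d where "d = e / (4 * (K * K))"
  have d: "0 < d" using e K by (simp add: d_def)
  obtain u where u: "u \<in> V0" "W.C\<Phi> (\<lambda>x. f x - W.cst u x) < d" using W.cst_dense[OF f d] by blast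
  have ue: "\<forall>\<^sub>F t in nhds 0. \<forall>s. Ip p M (\<lambda>x. u (- t + s, x) - u (s, x)) < d"
    using u(1) d by (simp add: V0_def)
  note cV = W.cst_in[OF u(1)]
  have fu: "(\<lambda>x. f x - W.cst u x) \<in> W.CV" by (rule CW.diff_in[OF f cV])
  from ue show "\<forall>\<^sub>F t in nhds 0. dist (W.C\<Phi> (\<lambda>x. T t f x - f x)) 0 < e"
  proof eventually_elim
    case (elim t)
    note su = V0_shift[OF u(1), of t]
    have eq: "(\<lambda>x. T t f x - T t (W.cst u) x) = T t (\<lambda>x. f x - W.cst u x)" by (rule ext) (simp add: T_def)
    have "W.C\<Phi> (\<lambda>x. T t (W.cst u) x - W.cst u x) = \<Phi>0 (\<lambda>y. u (shift t y) - u y)"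
      using W.C\<Phi>_cst[OF W.diff_in[OF su u(1)]] by (simp add: T_def)
    also have "\<dots> \<le> m (\<lambda>_. d)"
      unfolding \<Phi>0_def
    proof (rule m_mono[OF V0_bounded[OF W.diff_in[OF su u(1)]] bounded_borel_const])
      fix s
      show "Ip p M (\<lambda>x. u (shift t (s, x)) - u (s, x)) \<le> d" using elim by (simp add: less_imp_le)
    qed
    finally have 1: "W.C\<Phi> (\<lambda>x. T t (W.cst u) x - W.cst u x) \<le> d" by (simp add: m_const)
    have "W.C\<Phi> (\<lambda>x. T t f x - f x) \<le> K * (W.C\<Phi> (\<lambda>x. T t f x - T t (W.cst u) x) + W.C\<Phi> (\<lambda>x. T t (W.cst u) x - f x))"
      unfolding K_def by (intro CW.diff_triangle T_in f cV)
    also have "W.C\<Phi> (\<lambda>x. T t f x - T t (W.cst u) x) = W.C\<Phi> (\<lambda>x. f x - W.cst u x)"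
      unfolding eq by (rule C\<Phi>_T[OF fu])
    also have "W.C\<Phi> (\<lambda>x. T t (W.cst u) x - f x) \<le> K * (W.C\<Phi> (\<lambda>x. T t (W.cst u) x - W.cst u x) + W.C\<Phi> (\<lambda>x. W.cst u x - f x))"
      unfolding K_def by (intro CW.diff_triangle T_in f cV)
    also have "W.C\<Phi> (\<lambda>x. W.cst u x - f x) = W.C\<Phi> (\<lambda>x. f x - W.cst u x)" by (rule CW.minus_commute[OF cV f])
    finally have "W.C\<Phi> (\<lambda>x. T t f x - f x) \<le> K * (W.C\<Phi> (\<lambda>x. f x - W.cst u x)
      + K * (W.C\<Phi> (\<lambda>x. T t (W.cst u) x - W.cst u x) + W.C\<Phi> (\<lambda>x. f x - W.cst u x)))"
      using K by (simp add: mult_left_mono)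
    also have "\<dots> \<le> K * (d + K * (d + d))"
      using u(2) 1 K by (intro mult_left_mono add_mono) auto
    also have "\<dots> \<le> 3 * (K * K) * d"
    proof -
      have "K * d \<le> K * K * d" using K d by (intro mult_right_mono) auto
      then show ?thesis by (simp add: algebra_simps)
    qed
    also have "\<dots> < 4 * (K * K) * d" using K d by simp
    also have "\<dots> = e" using K by (simp add: d_def)
    finally show ?case using CW.nonneg[OF CW.diff_in[OF T_in[OF f] f]] by simp
  qed
qed

text \<open>The isometry \<open>T r\<close> transports continuity at 0 to \<open>r\<close>.\<close>

lemma T_cont:
  assumes f: "f \<in> W.CV"
  shows "((\<lambda>t. W.C\<Phi> (\<lambda>x. T t f x - T r f x)) \<longlongrightarrow> 0) (nhds r)"
proof -
  have "((\<lambda>t. - r + t) \<longlongrightarrow> - r + r) (nhds r)"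
    by (intro tendsto_add tendsto_const filterlim_ident)
  then have l: "filterlim (\<lambda>t. - r + t) (nhds 0) (nhds r)" by simp
  have eq: "W.C\<Phi> (\<lambda>x. T t f x - T r f x) = W.C\<Phi> (\<lambda>x. T (- r + t) f x - f x)" for t
  proof -
    have "(\<lambda>x. T t f x - T r f x) = T r (\<lambda>x. T (- r + t) f x - f x)"
      by (rule ext) (simp only: T_def fst_conv snd_conv minus_add minus_minus add.assoc add_minus_cancel)
    then show ?thesis using C\<Phi>_T[OF CW.diff_in[OF T_in[OF f] f]] by simp
  qed
  show ?thesis unfolding eq by (rule filterlim_compose[OF T_cont_0[OF f] l])
qed

definition J0 :: "('a \<Rightarrow> complex) \<Rightarrow> 'g \<times> 'a \<Rightarrow> complex" where
  "J0 f y = \<sigma> (- fst y) f (snd y)"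

text \<open>The section of \<open>J0 f\<close> at \<open>- t + s\<close> is
  \<open>\<sigma> (- s) (\<sigma> t f)\<close> almost everywhere. Continuity at 0 of the orbit of
  \<open>f\<close> therefore holds uniformly in \<open>s\<close>, by the common bound
  \<open>C\<close> of the operators \<open>\<sigma> (- s)\<close>.\<close>

lemma J0_in:
  assumes f: "f \<in> Lp_fun p M" shows "J0 f \<in> V0"
  unfolding V0_def
proof (intro CollectI conjI allI impI)
  show "(\<lambda>x. J0 f (s, x)) \<in> Lp_fun p M" for s using \<sigma>_in[OF f] by (simp add: J0_def)
  show "\<exists>B. \<forall>s. Ip p M (\<lambda>x. J0 f (s, x)) \<le> B" using \<sigma>_bound[OF f] by (auto simp: J0_def)
  fix e :: real assume e: "0 < e"
  have "((\<lambda>t. C powr p * Ip p M (\<lambda>x. \<sigma> t f x - \<sigma> 0 f x)) \<longlongrightarrow> C powr p * 0) (nhds 0)"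
    by (intro tendsto_mult_left \<sigma>_cont f)
  then have "\<forall>\<^sub>F t in nhds 0. C powr p * Ip p M (\<lambda>x. \<sigma> t f x - \<sigma> 0 f x) < e"
    by (rule order_tendstoD(2)) (simp add: e)
  then show "\<forall>\<^sub>F t in nhds 0. \<forall>s. Ip p M (\<lambda>x. J0 f (- t + s, x) - J0 f (s, x)) < e"
  proof eventually_elim
    case (elim t)
    show ?case
    proof
      fix s
      note L = \<sigma>_in[OF f]
      have ae1: "AE x in M. J0 f (- t + s, x) = \<sigma> (- s) (\<sigma> t f) x"
        using \<sigma>_mult[OF f, of "- s" t] by (simp add: J0_def minus_add)
      have ae2: "AE x in M. J0 f (s, x) = \<sigma> (- s) (\<sigma> 0 f) x"
        using \<sigma>_mult[OF f, of "- s" 0] by (simp add: J0_def)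
      have "Ip p M (\<lambda>x. J0 f (- t + s, x) - J0 f (s, x)) = Ip p M (\<lambda>x. \<sigma> (- s) (\<sigma> t f) x - \<sigma> (- s) (\<sigma> 0 f) x)"
      proof (rule Ip_AE_cong)
        show "(\<lambda>x. J0 f (- t + s, x) - J0 f (s, x)) \<in> Lp_fun p M"
          using P.diff_in[OF L L] by (simp add: J0_def)
        show "(\<lambda>x. \<sigma> (- s) (\<sigma> t f) x - \<sigma> (- s) (\<sigma> 0 f) x) \<in> Lp_fun p M"
          by (intro P.diff_in \<sigma>_in f)
        show "AE x in M. J0 f (- t + s, x) - J0 f (s, x) = \<sigma> (- s) (\<sigma> t f) x - \<sigma> (- s) (\<sigma> 0 f) x"
          using ae1 ae2 by eventually_elim simp
      qed
      also have "\<dots> \<le> C powr p * Ip p M (\<lambda>x. \<sigma> t f x - \<sigma> 0 f x)"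
        by (rule \<sigma>_diff_bound[OF L L])
      finally show "Ip p M (\<lambda>x. J0 f (- t + s, x) - J0 f (s, x)) < e" using elim by simp
    qed
  qed
qed

lemma \<Phi>0_J0: "f \<in> Lp_fun p M \<Longrightarrow> \<Phi>0 (J0 f) \<le> C powr p * Ip p M f"
proof -
  assume f: "f \<in> Lp_fun p M"
  have "\<Phi>0 (J0 f) \<le> m (\<lambda>_. C powr p * Ip p M f)"
    unfolding \<Phi>0_def
    by (rule m_mono[OF V0_bounded[OF J0_in[OF f]] bounded_borel_const]) (simp add: J0_def \<sigma>_bound f)
  then show ?thesis by (simp add: m_const)
qed

lemma \<Phi>0_null: "u \<in> V0 \<Longrightarrow> (\<And>s. AE x in M. u (s, x) = 0) \<Longrightarrow> \<Phi>0 u = 0"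
proof -
  assume u: "u \<in> V0" and z: "\<And>s. AE x in M. u (s, x) = 0"
  have "Ip p M (\<lambda>x. u (s, x)) = 0" for s using Ip_eq_0_iff[OF V0_sec[OF u]] z by simp
  then show ?thesis unfolding \<Phi>0_def using m_const[of 0] by simp
qed

definition J :: "('a \<Rightarrow> complex) \<Rightarrow> ('g \<times> 'a) \<times> nat \<Rightarrow> complex" where
  "J f = W.cst (J0 f)"

lemma J_in: "f \<in> Lp_fun p M \<Longrightarrow> J f \<in> W.CV"
  unfolding J_def by (rule W.cst_in[OF J0_in])

lemma J_bound: "f \<in> Lp_fun p M \<Longrightarrow> W.C\<Phi> (J f) \<le> C powr p * Ip p M f"
  unfolding J_def using W.C\<Phi>_cst[OF J0_in] \<Phi>0_J0 by simp

lemma J_lin: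
  assumes f: "f \<in> Lp_fun p M" and g: "g \<in> Lp_fun p M"
  shows "W.C\<Phi> (\<lambda>x. J (\<lambda>x. c * f x + d * g x) x - (c * J f x + d * J g x)) = 0"
proof -
  note fg = P.lin_in[OF f g, of c d]
  have V: "(\<lambda>y. J0 (\<lambda>x. c * f x + d * g x) y - (c * J0 f y + d * J0 g y)) \<in> V0"
    by (intro W.diff_in W.lin_in J0_in f g fg)
  have "W.C\<Phi> (\<lambda>x. J (\<lambda>x. c * f x + d * g x) x - (c * J f x + d * J g x))
    = \<Phi>0 (\<lambda>y. J0 (\<lambda>x. c * f x + d * g x) y - (c * J0 f y + d * J0 g y))"
    using W.C\<Phi>_cst[OF V] by (simp add: J_def)
  also have "\<dots> = 0"
  proof (rule \<Phi>0_null[OF V])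
    fix s
    show "AE x in M. J0 (\<lambda>x. c * f x + d * g x) (s, x) - (c * J0 f (s, x) + d * J0 g (s, x)) = 0"
      using \<sigma>_lin[OF f g, of "- s" c d] by (simp add: J0_def)
  qed
  finally show ?thesis .
qed

text \<open>Translation by \<open>t\<close> replaces \<open>- s\<close> by \<open>- s + t\<close>,
  that is, \<open>f\<close> by \<open>\<sigma> t f\<close>. The equality holds almost everywhere in
  each section, hence only a null difference.\<close>

lemma J_T:
  assumes f: "f \<in> Lp_fun p M"
  shows "W.C\<Phi> (\<lambda>x. T t (J f) x - J (\<sigma> t f) x) = 0"
proof -
  have V: "(\<lambda>y. J0 f (shift t y) - J0 (\<sigma> t f) y) \<in> V0"
    by (intro W.diff_in V0_shift J0_in \<sigma>_in f)
  have "W.C\<Phi> (\<lambda>x. T t (J f) x - J (\<sigma> t f) x) = \<Phi>0 (\<lambda>y. J0 f (shift t y) - J0 (\<sigma> t f) y)"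
    using W.C\<Phi>_cst[OF V] by (simp add: J_def T_def)
  also have "\<dots> = 0"
  proof (rule \<Phi>0_null[OF V])
    fix s
    show "AE x in M. J0 f (shift t (s, x)) - J0 (\<sigma> t f) (s, x) = 0"
      using \<sigma>_mult[OF f, of "- s" t] by (simp add: J0_def minus_add)
  qed
  finally show ?thesis .
qed

section \<open>The weak mean: a left inverse of the orbit map\<close>

definition q :: real where "q = p / (p - 1)"

lemma q: "1 < q" "1 / p + 1 / q = 1" "1 / q + 1 / p = 1"
  using p by (auto simp: q_def field_simps)

text \<open>The vector function \<open>s \<mapsto> \<sigma>(s) u(s)\<close> tested against
  \<open>y\<close>. The mean acts on scalar functions, so it is applied to these pairings.\<close>

definition pr :: "('g \<times> 'a \<Rightarrow> complex) \<Rightarrow> ('a \<Rightarrow> complex) \<Rightarrow> 'g \<Rightarrow> complex" where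
  "pr u y s = (\<integral>x. \<sigma> s (\<lambda>x. u (s, x)) x * y x \<partial>M)"

lemma \<sigma>_section_in: "u \<in> V0 \<Longrightarrow> \<sigma> s (\<lambda>x. u (s, x)) \<in> Lp_fun p M"
  by (intro \<sigma>_in V0_sec)

lemma pr_bound:
  assumes u: "u \<in> V0" and y: "y \<in> Lp_fun q M"
  shows "cmod (pr u y s) \<le> C * Ip q M y powr (1 / q) * Ip p M (\<lambda>x. u (s, x)) powr (1 / p)"
proof -
  have "cmod (pr u y s) \<le> Ip p M (\<sigma> s (\<lambda>x. u (s, x))) powr (1 / p) * Ip q M y powr (1 / q)"
    unfolding pr_def by (rule Holder(2)[OF p q(1,2) \<sigma>_section_in[OF u] y])
  also have "\<dots> \<le> (C powr p * Ip p M (\<lambda>x. u (s, x))) powr (1 / p) * Ip q M y powr (1 / q)"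
    using p by (intro mult_right_mono powr_mono2 \<sigma>_bound V0_sec u P.nonneg \<sigma>_section_in) auto
  also have "(C powr p * Ip p M (\<lambda>x. u (s, x))) powr (1 / p) = C * Ip p M (\<lambda>x. u (s, x)) powr (1 / p)"
    using C p P.nonneg[OF V0_sec[OF u]] by (simp add: powr_mult powr_powr)
  finally show ?thesis by (simp add: mult_ac)
qed

text \<open>\<open>\<sigma>(r) u(r) - \<sigma>(s) u(s)\<close> is \<open>\<sigma>(r)\<close> of
  \<open>u(r) - u(s)\<close>, small by the uniform bound, plus the difference of
  \<open>\<sigma>(r)\<close> and \<open>\<sigma>(s)\<close> on the fixed function
  \<open>u(s)\<close>, small by strong continuity. Continuity makes the pairing a Borel
  function.\<close>

lemma pr_cont:
  assumes u: "u \<in> V0" and y: "y \<in> Lp_fun q M"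
  shows "(pr u y \<longlongrightarrow> pr u y s) (nhds s)"
proof -
  let ?G = "\<lambda>r. \<sigma> r (\<lambda>x. u (r, x))"
  note us = V0_sec[OF u]
  have G0: "((\<lambda>r. Ip p M (\<lambda>x. ?G r x - ?G s x)) \<longlongrightarrow> 0) (nhds s)"
  proof -
    let ?b = "\<lambda>r. 2 powr p * (C powr p * Ip p M (\<lambda>x. u (r, x) - u (s, x))
        + Ip p M (\<lambda>x. \<sigma> r (\<lambda>x. u (s, x)) x - ?G s x))"
    have "(?b \<longlongrightarrow> 2 powr p * (C powr p * 0 + 0)) (nhds s)"
      by (intro tendsto_mult_left tendsto_add V0_nhds u \<sigma>_cont us)
    then have b: "(?b \<longlongrightarrow> 0) (nhds s)" by simp
    show ?thesis
    proof (rule real_tendsto_sandwich[OF _ _ tendsto_const b]; intro always_eventually allI)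
      fix r
      show "0 \<le> Ip p M (\<lambda>x. ?G r x - ?G s x)" by (intro P.nonneg P.diff_in \<sigma>_section_in u)
      have "Ip p M (\<lambda>x. ?G r x - ?G s x) \<le> 2 powr p * (Ip p M (\<lambda>x. ?G r x - \<sigma> r (\<lambda>x. u (s, x)) x)
        + Ip p M (\<lambda>x. \<sigma> r (\<lambda>x. u (s, x)) x - ?G s x))"
        by (intro P.diff_triangle \<sigma>_section_in u \<sigma>_in us)
      also have "\<dots> \<le> ?b r" by (intro mult_left_mono add_mono \<sigma>_diff_bound us) auto
      finally show "Ip p M (\<lambda>x. ?G r x - ?G s x) \<le> ?b r" .
    qed
  qed
  have nm0: "((\<lambda>r. Ip p M (\<lambda>x. ?G r x - ?G s x) powr (1 / p) * Ip q M y powr (1 / q)) \<longlongrightarrow> 0 * Ip q M y powr (1 / q)) (nhds s)"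
    using P.nm_tendsto_0_iff[where u = "\<lambda>r x. ?G r x - ?G s x" and F = "nhds s"] G0 P.diff_in[OF \<sigma>_section_in[OF u] \<sigma>_section_in[OF u]]
    by (intro tendsto_mult_right) (simp add: P.nm_def)
  have "((\<lambda>r. pr u y r - pr u y s) \<longlongrightarrow> 0) (nhds s)"
  proof (rule Lim_null_comparison)
    show "((\<lambda>r. Ip p M (\<lambda>x. ?G r x - ?G s x) powr (1 / p) * Ip q M y powr (1 / q)) \<longlongrightarrow> 0) (nhds s)"
      using nm0 by simp
    show "\<forall>\<^sub>F r in nhds s. norm (pr u y r - pr u y s) \<le> Ip p M (\<lambda>x. ?G r x - ?G s x) powr (1 / p) * Ip q M y powr (1 / q)"
    proof (intro always_eventually allI)
      fix r
      have "pr u y r - pr u y s = (\<integral>x. (?G r x - ?G s x) * y x \<partial>M)"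
        unfolding pr_def left_diff_distrib
        by (rule Bochner_Integration.integral_diff[symmetric]; rule Holder(1)[OF p q(1,2) \<sigma>_section_in[OF u] y])
      then show "norm (pr u y r - pr u y s) \<le> Ip p M (\<lambda>x. ?G r x - ?G s x) powr (1 / p) * Ip q M y powr (1 / q)"
        using Holder(2)[OF p q(1,2) P.diff_in[OF \<sigma>_section_in[OF u] \<sigma>_section_in[OF u]] y] by simp
    qed
  qed
  then show ?thesis by (simp add: LIM_zero_iff)
qed

lemma pr_bounded: "u \<in> V0 \<Longrightarrow> y \<in> Lp_fun q M \<Longrightarrow> pr u y \<in> bounded_borelC"
proof -
  assume u: "u \<in> V0" and y: "y \<in> Lp_fun q M"
  obtain B where B: "\<And>s. Ip p M (\<lambda>x. u (s, x)) \<le> B" using u by (auto simp: V0_def)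
  show ?thesis
  proof (rule bounded_borelC_continuous[OF pr_cont[OF u y]])
    fix s
    have "cmod (pr u y s) \<le> C * Ip q M y powr (1 / q) * Ip p M (\<lambda>x. u (s, x)) powr (1 / p)"
      by (rule pr_bound[OF u y])
    also have "\<dots> \<le> C * Ip q M y powr (1 / q) * B powr (1 / p)"
      using C p B by (intro mult_left_mono powr_mono2 P.nonneg V0_sec u) auto
    finally show "cmod (pr u y s) \<le> C * Ip q M y powr (1 / q) * B powr (1 / p)" .
  qed
qed

lemma pr_lin:
  assumes u: "u \<in> V0" and v: "v \<in> V0" and y: "y \<in> Lp_fun q M"
  shows "pr (\<lambda>x. c * u x + d * v x) y s = c * pr u y s + d * pr v y s"
proof -
  note I = Holder(1)[OF p q(1,2) \<sigma>_section_in y]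
  note s = W.lin_in[OF u v, of c d]
  have "pr (\<lambda>x. c * u x + d * v x) y s
    = (\<integral>x. c * (\<sigma> s (\<lambda>x. u (s, x)) x * y x) + d * (\<sigma> s (\<lambda>x. v (s, x)) x * y x) \<partial>M)"
    unfolding pr_def
  proof (rule integral_cong_AE)
    show "(\<lambda>x. \<sigma> s (\<lambda>x. c * u (s, x) + d * v (s, x)) x * y x) \<in> borel_measurable M"
      using I[OF s, of s] by (rule borel_measurable_integrable)
    show "(\<lambda>x. c * (\<sigma> s (\<lambda>x. u (s, x)) x * y x) + d * (\<sigma> s (\<lambda>x. v (s, x)) x * y x)) \<in> borel_measurable M"
      using I[OF u, of s] I[OF v, of s] by (intro borel_measurable_add borel_measurable_times borel_measurable_const borel_measurable_integrable)
    show "AE x in M. \<sigma> s (\<lambda>x. c * u (s, x) + d * v (s, x)) x * y x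
      = c * (\<sigma> s (\<lambda>x. u (s, x)) x * y x) + d * (\<sigma> s (\<lambda>x. v (s, x)) x * y x)"
      using \<sigma>_lin[OF V0_sec[OF u, of s] V0_sec[OF v, of s], where t = s and c = c and d = d] by eventually_elim (simp add: algebra_simps)
  qed
  also have "\<dots> = c * pr u y s + d * pr v y s"
    unfolding pr_def using I[OF u, of s] I[OF v, of s] by simp
  finally show ?thesis .
qed

lemma pr_lin2:
  assumes u: "u \<in> V0" and y: "y \<in> Lp_fun q M" and z: "z \<in> Lp_fun q M"
  shows "pr u (\<lambda>x. c * y x + d * z x) s = c * pr u y s + d * pr u z s"
proof -
  note I = Holder(1)[OF p q(1,2) \<sigma>_section_in[OF u, of s]]
  have "pr u (\<lambda>x. c * y x + d * z x) s
    = (\<integral>x. c * (\<sigma> s (\<lambda>x. u (s, x)) x * y x) + d * (\<sigma> s (\<lambda>x. u (s, x)) x * z x) \<partial>M)"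
    unfolding pr_def by (simp add: algebra_simps)
  also have "\<dots> = c * pr u y s + d * pr u z s"
    unfolding pr_def using I[OF y] I[OF z] by simp
  finally show ?thesis .
qed

definition pair :: "('a \<Rightarrow> complex) \<Rightarrow> ('g \<times> 'a \<Rightarrow> complex) \<Rightarrow> complex" where
  "pair y u = mC (pr u y)"

lemma bounded_borelC_scale: "f \<in> bounded_borelC \<Longrightarrow> (\<lambda>s. c * f s) \<in> bounded_borelC"
  unfolding bounded_borelC_def
proof (intro CollectI conjI; elim CollectE conjE)
  assume f: "(\<lambda>s. Re (f s)) \<in> bounded_borel" "(\<lambda>s. Im (f s)) \<in> bounded_borel" "(\<lambda>s. cmod (f s)) \<in> bounded_borel"
  show "(\<lambda>s. Re (c * f s)) \<in> bounded_borel"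
    using bounded_borel_add[OF bounded_borel_scale[OF f(1), of "Re c"] bounded_borel_scale[OF f(2), of "- Im c"]] by simp
  show "(\<lambda>s. Im (c * f s)) \<in> bounded_borel"
    using bounded_borel_add[OF bounded_borel_scale[OF f(2), of "Re c"] bounded_borel_scale[OF f(1), of "Im c"]] by simp
  show "(\<lambda>s. cmod (c * f s)) \<in> bounded_borel"
    using bounded_borel_scale[OF f(3), of "cmod c"] by (simp add: norm_mult)
qed

lemma pair_lin:
  assumes u: "u \<in> V0" and v: "v \<in> V0" and y: "y \<in> Lp_fun q M"
  shows "pair y (\<lambda>x. c * u x + d * v x) = c * pair y u + d * pair y v"
proof -
  have "pr (\<lambda>x. c * u x + d * v x) y = (\<lambda>s. c * pr u y s + d * pr v y s)"
    by (rule ext) (rule pr_lin[OF assms])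
  then show ?thesis
    unfolding pair_def using pr_bounded[OF u y] pr_bounded[OF v y] by (simp add: mC_add bounded_borelC_scale mC_scale)
qed

lemma pair_lin2:
  assumes u: "u \<in> V0" and y: "y \<in> Lp_fun q M" and z: "z \<in> Lp_fun q M"
  shows "pair (\<lambda>x. c * y x + d * z x) u = c * pair y u + d * pair z u"
proof -
  have "pr u (\<lambda>x. c * y x + d * z x) = (\<lambda>s. c * pr u y s + d * pr u z s)"
    by (rule ext) (rule pr_lin2[OF assms])
  then show ?thesis
    unfolding pair_def using pr_bounded[OF u y] pr_bounded[OF u z] by (simp add: mC_add bounded_borelC_scale mC_scale)
qed

text \<open>Hoelder's inequality for each \<open>s\<close>, then Jensen's inequality
  \<open>m_powr\<close> for the mean. The factor \<open>C\<close> becomes the norm bound of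
  \<open>Q\<close>.\<close>

lemma pair_bound:
  assumes u: "u \<in> V0" and y: "y \<in> Lp_fun q M"
  shows "cmod (pair y u) \<le> C * Ip q M y powr (1 / q) * W.nm u"
proof -
  have pos: "0 \<le> Ip p M (\<lambda>x. u (s, x))" for s by (rule P.nonneg[OF V0_sec[OF u]])
  have bb: "(\<lambda>s. Ip p M (\<lambda>x. u (s, x)) powr (1 / p)) \<in> bounded_borel"
    by (rule bounded_borel_powr[OF V0_bounded[OF u] pos]) (use p in simp)
  have "cmod (pair y u) \<le> m (\<lambda>s. C * Ip q M y powr (1 / q) * Ip p M (\<lambda>x. u (s, x)) powr (1 / p))"
    unfolding pair_def by (intro mC_bound pr_bounded u y bounded_borel_scale bb pr_bound)
  also have "\<dots> = C * Ip q M y powr (1 / q) * m (\<lambda>s. Ip p M (\<lambda>x. u (s, x)) powr (1 / p))"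
    by (rule m_scale[OF bb])
  also have "\<dots> \<le> C * Ip q M y powr (1 / q) * W.nm u"
    unfolding W.nm_def \<Phi>0_def using C by (intro mult_left_mono m_powr[OF p V0_bounded[OF u] pos]) auto
  finally show ?thesis .
qed

lemma pair_diff_bound:
  assumes "y \<in> Lp_fun q M" "u \<in> V0" "v \<in> V0"
  shows "cmod (pair y u - pair y v) \<le> C * Ip q M y powr (1 / q) * W.nm (\<lambda>x. u x - v x)"
  using pair_bound[OF W.diff_in[OF assms(2,3)] assms(1)] pair_lin[OF assms(2,3,1), of 1 "-1"] by simp

lemma pair_ext_lim:
  "W.asymp f a \<Longrightarrow> y \<in> Lp_fun q M \<Longrightarrow> (\<lambda>n. pair y (a n)) \<longlonglongrightarrow> W.ext (pair y) f"
  by (rule W.ext_lim[OF pair_diff_bound])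

text \<open>Reflexivity: the functional \<open>y \<mapsto> W.ext (pair y) f\<close> on
  \<open>L^q\<close> has norm at most \<open>C * W.C\<Phi> f powr (1 / p)\<close>, hence is given by
  a function in \<open>L^p\<close> with the same bound.\<close>

lemma Q_ex:
  assumes f: "f \<in> W.CV"
  shows "\<exists>g\<in>Lp_fun p M. Ip p M g \<le> C powr p * W.C\<Phi> f \<and>
    (\<forall>y\<in>Lp_fun q M. W.ext (pair y) f = (\<integral>x. g x * y x \<partial>M))"
proof -
  obtain a where a: "W.asymp f a" using f by (auto simp: W.CV_def)
  note V = W.asymp_in[OF a]
  interpret Q: plattice q "Lp_fun q M" "Ip q M" by (rule plattice_Lp[OF q(1)])
  have lin: "W.ext (pair (\<lambda>x. c * y x + d * z x)) f = c * W.ext (pair y) f + d * W.ext (pair z) f"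
    if y: "y \<in> Lp_fun q M" and z: "z \<in> Lp_fun q M" for c d y z
  proof (rule LIMSEQ_unique[OF pair_ext_lim[OF a Q.lin_in[OF y z]]])
    show "(\<lambda>n. pair (\<lambda>x. c * y x + d * z x) (a n)) \<longlonglongrightarrow> c * W.ext (pair y) f + d * W.ext (pair z) f"
      unfolding pair_lin2[OF V y z] by (intro tendsto_intros pair_ext_lim[OF a] y z)
  qed
  have nn: "0 \<le> W.C\<Phi> f" by (rule CW.nonneg[OF f])
  have "(C * W.C\<Phi> f powr (1 / p)) powr p = C powr p * W.C\<Phi> f"
    using C nn p by (simp add: powr_mult powr_powr)
  moreover have "\<exists>g\<in>Lp_fun p M. Ip p M g \<le> (C * W.C\<Phi> f powr (1 / p)) powr p \<and>
    (\<forall>y\<in>Lp_fun q M. W.ext (pair y) f = (\<integral>x. g x * y x \<partial>M))"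
  proof (rule Riesz_representation_Lp[OF p q(1,2)])
    show "0 \<le> C * W.C\<Phi> f powr (1 / p)" using C by simp
    show "W.ext (pair (\<lambda>x. y x + z x)) f = W.ext (pair y) f + W.ext (pair z) f"
      if "y \<in> Lp_fun q M" "z \<in> Lp_fun q M" for y z using lin[OF that, of 1 1] by simp
    show "W.ext (pair (\<lambda>x. c * y x)) f = c * W.ext (pair y) f" if "y \<in> Lp_fun q M" for c y
      using lin[OF that that, of c 0] by simp
    show "cmod (W.ext (pair y) f) \<le> C * W.C\<Phi> f powr (1 / p) * Ip q M y powr (1 / q)"
      if y: "y \<in> Lp_fun q M" for y
      using W.ext_bound[OF pair_diff_bound[OF y] pair_bound[OF _ y] f] by (simp add: mult_ac)
  qed
  ultimately show ?thesis by simp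
qed

definition Q :: "(('g \<times> 'a) \<times> nat \<Rightarrow> complex) \<Rightarrow> 'a \<Rightarrow> complex" where
  "Q f = (SOME g. g \<in> Lp_fun p M \<and> Ip p M g \<le> C powr p * W.C\<Phi> f \<and>
    (\<forall>y\<in>Lp_fun q M. W.ext (pair y) f = (\<integral>x. g x * y x \<partial>M)))"

lemma Q:
  assumes "f \<in> W.CV"
  shows "Q f \<in> Lp_fun p M" "Ip p M (Q f) \<le> C powr p * W.C\<Phi> f"
    "\<And>y. y \<in> Lp_fun q M \<Longrightarrow> W.ext (pair y) f = (\<integral>x. Q f x * y x \<partial>M)"
proof -
  have ex: "\<exists>g. g \<in> Lp_fun p M \<and> Ip p M g \<le> C powr p * W.C\<Phi> f \<and>
    (\<forall>y\<in>Lp_fun q M. W.ext (pair y) f = (\<integral>x. g x * y x \<partial>M))" using Q_ex[OF assms] by blast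
  have "Q f \<in> Lp_fun p M \<and> Ip p M (Q f) \<le> C powr p * W.C\<Phi> f \<and>
    (\<forall>y\<in>Lp_fun q M. W.ext (pair y) f = (\<integral>x. Q f x * y x \<partial>M))"
    unfolding Q_def by (rule someI_ex[OF ex])
  then show "Q f \<in> Lp_fun p M" "Ip p M (Q f) \<le> C powr p * W.C\<Phi> f"
    "\<And>y. y \<in> Lp_fun q M \<Longrightarrow> W.ext (pair y) f = (\<integral>x. Q f x * y x \<partial>M)" by blast+
qed

text \<open>\<open>Q f\<close> is merely some representing function, so linearity is recovered
  almost everywhere, by testing both sides against \<open>L^q\<close>.\<close>

lemma Q_lin:
  assumes f: "f \<in> W.CV" and g: "g \<in> W.CV"
  shows "AE x in M. Q (\<lambda>x. c * f x + d * g x) x = c * Q f x + d * Q g x"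
proof (rule Lp_separate[OF p q(1,2)])
  note fg = CW.lin_in[OF f g, of c d]
  show "Q (\<lambda>x. c * f x + d * g x) \<in> Lp_fun p M" by (rule Q(1)[OF fg])
  show "(\<lambda>x. c * Q f x + d * Q g x) \<in> Lp_fun p M" by (intro P.lin_in Q f g)
  fix y assume y: "y \<in> Lp_fun q M"
  obtain a b where a: "W.asymp f a" and b: "W.asymp g b" using f g by (auto simp: W.CV_def)
  have "(\<lambda>n. pair y (\<lambda>x. c * a n x + d * b n x)) \<longlonglongrightarrow> W.ext (pair y) (\<lambda>x. c * f x + d * g x)"
    by (rule pair_ext_lim[OF W.asymp_lip[OF a b lip2_linear] y])
  moreover have "(\<lambda>n. pair y (\<lambda>x. c * a n x + d * b n x)) \<longlonglongrightarrow> c * W.ext (pair y) f + d * W.ext (pair y) g"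
    unfolding pair_lin[OF W.asymp_in[OF a] W.asymp_in[OF b] y]
    by (intro tendsto_intros pair_ext_lim[OF a y] pair_ext_lim[OF b y])
  ultimately have "W.ext (pair y) (\<lambda>x. c * f x + d * g x) = c * W.ext (pair y) f + d * W.ext (pair y) g"
    by (rule LIMSEQ_unique)
  then have "(\<integral>x. Q (\<lambda>x. c * f x + d * g x) x * y x \<partial>M) = c * (\<integral>x. Q f x * y x \<partial>M) + d * (\<integral>x. Q g x * y x \<partial>M)"
    by (simp add: Q(3)[OF fg y] Q(3)[OF f y] Q(3)[OF g y])
  also have "\<dots> = (\<integral>x. c * (Q f x * y x) + d * (Q g x * y x) \<partial>M)"
    using Holder(1)[OF p q(1,2) Q(1)[OF f] y] Holder(1)[OF p q(1,2) Q(1)[OF g] y] by simp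
  also have "\<dots> = (\<integral>x. (c * Q f x + d * Q g x) * y x \<partial>M)" by (simp add: algebra_simps)
  finally show "(\<integral>x. Q (\<lambda>x. c * f x + d * g x) x * y x \<partial>M) = (\<integral>x. (c * Q f x + d * Q g x) * y x \<partial>M)" .
qed

lemma Q_cong:
  assumes f: "f \<in> W.CV" and g: "g \<in> W.CV" and null: "W.C\<Phi> (\<lambda>x. f x - g x) = 0"
  shows "AE x in M. Q f x = Q g x"
proof -
  have d: "(\<lambda>x. f x - g x) \<in> W.CV" by (rule CW.diff_in[OF f g])
  have "Ip p M (Q (\<lambda>x. f x - g x)) = 0"
    using Q(2)[OF d] null P.nonneg[OF Q(1)[OF d]] by simp
  then have "AE x in M. Q (\<lambda>x. f x - g x) x = 0" using Ip_eq_0_iff[OF Q(1)[OF d]] by simp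
  with Q_lin[OF f g, of 1 "-1"] show ?thesis by eventually_elim simp
qed

text \<open>For an orbit the averaged function is \<open>\<sigma> s (\<sigma> (- s) f)\<close>,
  which is \<open>f\<close> for every \<open>s\<close>, and the mean of a constant is that
  constant.\<close>

lemma Q_J:
  assumes f: "f \<in> Lp_fun p M" shows "AE x in M. Q (J f) x = f x"
proof (rule Lp_separate[OF p q(1,2) Q(1)[OF J_in[OF f]] f])
  fix y assume y: "y \<in> Lp_fun q M"
  have "pr (J0 f) y s = (\<integral>x. f x * y x \<partial>M)" for s
    unfolding pr_def
  proof (rule integral_cong_AE)
    show "(\<lambda>x. \<sigma> s (\<lambda>x. J0 f (s, x)) x * y x) \<in> borel_measurable M"
      using Holder(1)[OF p q(1,2) \<sigma>_section_in[OF J0_in[OF f]] y] by (rule borel_measurable_integrable)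
    show "(\<lambda>x. f x * y x) \<in> borel_measurable M"
      using Holder(1)[OF p q(1,2) f y] by (rule borel_measurable_integrable)
    show "AE x in M. \<sigma> s (\<lambda>x. J0 f (s, x)) x * y x = f x * y x"
      using \<sigma>_mult[OF f, of s "- s"] \<sigma>_0[OF f] by eventually_elim (simp add: J0_def)
  qed
  then have "pr (J0 f) y = (\<lambda>_. \<integral>x. f x * y x \<partial>M)" by (rule ext)
  then have "pair y (J0 f) = (\<integral>x. f x * y x \<partial>M)" unfolding pair_def by (simp only: mC_const)
  moreover have "W.ext (pair y) (J f) = pair y (J0 f)"
    using LIMSEQ_unique[OF pair_ext_lim[OF W.asymp_cst[OF J0_in[OF f]] y] tendsto_const] by (simp add: J_def)
  ultimately show "(\<integral>x. Q (J f) x * y x \<partial>M) = (\<integral>x. f x * y x \<partial>M)"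
    using Q(3)[OF J_in[OF f] y] by simp
qed

end

section \<open>The dilation\<close>

definition opf :: "real \<Rightarrow> 'b measure \<Rightarrow> (('a \<Rightarrow> complex) \<Rightarrow> 'b \<Rightarrow> complex) \<Rightarrow> ('a \<Rightarrow> complex) set \<Rightarrow> ('b \<Rightarrow> complex) set" where
  "opf p N S F = cls p N (S (rp F))"

locale Lp_operator =
  fixes p :: real and M :: "'a measure" and N :: "'b measure"
    and S :: "('a \<Rightarrow> complex) \<Rightarrow> 'b \<Rightarrow> complex" and C :: real
  assumes p: "1 < p" and C: "0 \<le> C"
    and S_in: "f \<in> Lp_fun p M \<Longrightarrow> S f \<in> Lp_fun p N"
    and S_lin: "f \<in> Lp_fun p M \<Longrightarrow> g \<in> Lp_fun p M \<Longrightarrow>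
      AE x in N. S (\<lambda>x. c * f x + d * g x) x = c * S f x + d * S g x"
    and S_bound: "f \<in> Lp_fun p M \<Longrightarrow> Ip p N (S f) \<le> C powr p * Ip p M f"
begin

interpretation P: plattice p "Lp_fun p M" "Ip p M" by (rule plattice_Lp[OF p])
interpretation P': plattice p "Lp_fun p N" "Ip p N" by (rule plattice_Lp[OF p])

text \<open>Linearity reduces the claim to functions vanishing almost everywhere, and the norm bound
  sends these to functions of norm 0. So \<open>opf\<close> does not depend on
  representatives.\<close>

lemma S_cong:
  assumes f: "f \<in> Lp_fun p M" and g: "g \<in> Lp_fun p M" and ae: "AE x in M. f x = g x"
  shows "AE x in N. S f x = S g x"
proof -
  let ?d = "\<lambda>x. 1 * f x + (-1) * g x"
  have d: "?d \<in> Lp_fun p M" by (rule P.lin_in[OF f g])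
  have "AE x in M. ?d x = 0" using ae by eventually_elim simp
  then have "Ip p M ?d = 0" using Ip_eq_0_iff[OF d] by blast
  then have "Ip p N (S ?d) = 0" using S_bound[OF d] P'.nonneg[OF S_in[OF d]] by simp
  then have "AE x in N. S ?d x = 0" using Ip_eq_0_iff[OF S_in[OF d]] by blast
  then show ?thesis using S_lin[OF f g, of 1 "-1"] by eventually_elim simp
qed

lemma opf_cls:
  assumes f: "f \<in> Lp_fun p M" shows "opf p N S (cls p M f) = cls p N (S f)"
proof -
  have "cls p M f \<in> vecs (Lp p M)" using f by (simp add: vecs_Lp)
  note r = rp_vecs(1)[OF this]
  show ?thesis
    unfolding opf_def cls_eq_iff[OF S_in[OF r] S_in[OF f]] by (rule S_cong[OF r f rp_cls[OF f]])
qed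

lemma nrm_opf:
  assumes f: "f \<in> Lp_fun p M"
  shows "nrm (Lp p N) (opf p N S (cls p M f)) \<le> C * nrm (Lp p M) (cls p M f)"
proof -
  have "Ip p N (S f) powr (1 / p) \<le> (C powr p * Ip p M f) powr (1 / p)"
    using p by (intro powr_mono2 S_bound f P'.nonneg S_in) auto
  also have "\<dots> = C * Ip p M f powr (1 / p)"
    using C p P.nonneg[OF f] by (simp add: powr_mult powr_powr)
  finally show ?thesis by (simp add: opf_cls f nrm_cls S_in)
qed

lemma bounded_opf: "bounded_op (Lp p M) (Lp p N) (opf p N S)"
  unfolding bounded_op_def linear_op_def
proof (intro conjI ballI allI exI[of _ C])
  fix F assume "F \<in> vecs (Lp p M)"
  then obtain f where f: "f \<in> Lp_fun p M" "F = cls p M f" by (auto simp: vecs_Lp)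
  show "opf p N S F \<in> vecs (Lp p N)" using f S_in by (simp add: opf_cls vecs_Lp)
  show "nrm (Lp p N) (opf p N S F) \<le> C * nrm (Lp p M) F" using nrm_opf f by simp
  fix c
  have "AE x in N. S (\<lambda>x. c * f x) x = c * S f x" using S_lin[OF f(1) f(1), of c 0] by simp
  then show "opf p N S (vscale (Lp p M) c F) = vscale (Lp p N) c (opf p N S F)"
    using f p by (simp add: vscale_cls opf_cls P.scale_in S_in cls_eq_iff P'.scale_in)
next
  fix F G assume "F \<in> vecs (Lp p M)" "G \<in> vecs (Lp p M)"
  then obtain f g where f: "f \<in> Lp_fun p M" "F = cls p M f" and g: "g \<in> Lp_fun p M" "G = cls p M g"
    by (auto simp: vecs_Lp)
  have "AE x in N. S (\<lambda>x. f x + g x) x = S f x + S g x" using S_lin[OF f(1) g(1), of 1 1] by simp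
  then show "opf p N S (vadd (Lp p M) F G) = vadd (Lp p N) (opf p N S F) (opf p N S G)"
    using f g p by (simp add: vadd_cls opf_cls P.add_in S_in cls_eq_iff P'.add_in)
qed

lemma op_norm_opf: "0 \<le> op_norm (Lp p M) (Lp p N) (opf p N S)" "op_norm (Lp p M) (Lp p N) (opf p N S) \<le> C"
proof -
  let ?z = "cls p M (\<lambda>_. 0)"
  have z: "?z \<in> vecs (Lp p M)" "nrm (Lp p M) ?z \<le> 1"
    using P.zero_in P.zero p by (simp_all add: vecs_Lp nrm_cls)
  have "0 \<le> nrm (Lp p N) (opf p N S ?z)" using P.zero_in by (simp add: opf_cls nrm_cls S_in)
  also have "\<dots> \<le> op_norm (Lp p M) (Lp p N) (opf p N S)"
    by (rule op_norm_ge[OF bounded_opf z]) (auto simp: vecs_Lp nrm_cls)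
  finally show "0 \<le> op_norm (Lp p M) (Lp p N) (opf p N S)" .
  show "op_norm (Lp p M) (Lp p N) (opf p N S) \<le> C"
    by (rule op_norm_le[OF C z]) (auto simp: vecs_Lp nrm_opf)
qed

end

locale dilation = mean_rep m p M \<sigma> C
  for m :: "('g::{topological_group_add, t2_space} \<Rightarrow> real) \<Rightarrow> real" and p and M :: "'a measure" and \<sigma> and C +
  fixes N :: "'z measure" and K :: "('z \<Rightarrow> complex) \<Rightarrow> (('g \<times> 'a) \<times> nat \<Rightarrow> complex) \<Rightarrow> bool"
  assumes K_in: "K f u \<Longrightarrow> f \<in> Lp_fun p N \<and> u \<in> W.CV \<and> Ip p N f = W.C\<Phi> u"
    and K_total: "f \<in> Lp_fun p N \<Longrightarrow> \<exists>u. K f u" and K_onto: "u \<in> W.CV \<Longrightarrow> \<exists>f. K f u"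
    and K_lin: "K f u \<Longrightarrow> K h v \<Longrightarrow> K (\<lambda>z. c * f z + d * h z) (\<lambda>x. c * u x + d * v x)"
    and K_norm: "K f u \<Longrightarrow> K (\<lambda>z. complex_of_real (cmod (f z))) (\<lambda>x. complex_of_real (cmod (u x)))"
begin

interpretation PN: plattice p "Lp_fun p N" "Ip p N" by (rule plattice_Lp[OF p])

text \<open>\<open>k\<close> and \<open>k'\<close> choose partners under \<open>K\<close> in the two
  directions. They need not be linear or inverse to each other; by \<open>K_AE\<close> and
  \<open>K_null\<close> a choice matters only up to null functions.\<close>

definition k :: "((('g \<times> 'a) \<times> nat \<Rightarrow> complex)) \<Rightarrow> 'z \<Rightarrow> complex" where "k u = (SOME f. K f u)"
definition k' :: "('z \<Rightarrow> complex) \<Rightarrow> ('g \<times> 'a) \<times> nat \<Rightarrow> complex" where "k' f = (SOME u. K f u)"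

lemma K_k: "u \<in> W.CV \<Longrightarrow> K (k u) u" unfolding k_def by (rule someI_ex[OF K_onto])
lemma K_k': "f \<in> Lp_fun p N \<Longrightarrow> K f (k' f)" unfolding k'_def by (rule someI_ex[OF K_total])

lemma k'_in: "f \<in> Lp_fun p N \<Longrightarrow> k' f \<in> W.CV" using K_in[OF K_k'] by blast

lemma K_diff: "K f u \<Longrightarrow> K h v \<Longrightarrow> Ip p N (\<lambda>z. f z - h z) = W.C\<Phi> (\<lambda>x. u x - v x)"
  using K_in[OF K_lin[of f u h v 1 "-1"]] by simp

lemma K_AE: "K f u \<Longrightarrow> K h v \<Longrightarrow> W.C\<Phi> (\<lambda>x. u x - v x) = 0 \<Longrightarrow> AE z in N. f z = h z"
proof -
  assume K: "K f u" "K h v" and null: "W.C\<Phi> (\<lambda>x. u x - v x) = 0"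
  have "(\<lambda>z. f z - h z) \<in> Lp_fun p N" using K_in[OF K(1)] K_in[OF K(2)] PN.diff_in by blast
  from Ip_eq_0_iff[OF this] K_diff[OF K] null have "AE z in N. f z - h z = 0" by simp
  then show ?thesis by eventually_elim simp
qed

lemma K_null: "K f u \<Longrightarrow> K f v \<Longrightarrow> W.C\<Phi> (\<lambda>x. u x - v x) = 0"
  using K_diff[of f u f v] PN.zero by simp

lemma T_null: "u \<in> W.CV \<Longrightarrow> v \<in> W.CV \<Longrightarrow> W.C\<Phi> (\<lambda>x. u x - v x) = 0 \<Longrightarrow> W.C\<Phi> (\<lambda>x. T t u x - T t v x) = 0"
  using C\<Phi>_T[OF CW.diff_in, of u v t] unfolding T_def[abs_def] by simp

definition \<tau> :: "'g \<Rightarrow> ('z \<Rightarrow> complex) \<Rightarrow> 'z \<Rightarrow> complex" where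
  "\<tau> t f = k (T t (k' f))"

lemma K_\<tau>: "f \<in> Lp_fun p N \<Longrightarrow> K (\<tau> t f) (T t (k' f))"
  unfolding \<tau>_def by (intro K_k T_in k'_in)

lemma \<tau>_in: "f \<in> Lp_fun p N \<Longrightarrow> \<tau> t f \<in> Lp_fun p N"
  using K_in[OF K_\<tau>] by blast

text \<open>Computes \<open>\<tau> t f\<close> from any partner \<open>u\<close> of \<open>f\<close>
  and not only from the chosen one; linearity follows by taking a linear combination of chosen
  partners.\<close>

lemma \<tau>_AE:
  assumes f: "f \<in> Lp_fun p N" and u: "K f u" and h: "K h (T t u)"
  shows "AE z in N. \<tau> t f z = h z"
proof (rule K_AE[OF K_\<tau>[OF f] h T_null])
  show "W.C\<Phi> (\<lambda>x. k' f x - u x) = 0" by (rule K_null[OF K_k'[OF f] u])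
qed (use k'_in[OF f] K_in[OF u] in auto)

lemma \<tau>_lin:
  assumes f: "f \<in> Lp_fun p N" and g: "g \<in> Lp_fun p N"
  shows "AE z in N. \<tau> t (\<lambda>z. c * f z + d * g z) z = c * \<tau> t f z + d * \<tau> t g z"
proof (rule \<tau>_AE[OF PN.lin_in[OF f g] K_lin[OF K_k'[OF f] K_k'[OF g]]])
  have "T t (\<lambda>x. c * k' f x + d * k' g x) = (\<lambda>x. c * T t (k' f) x + d * T t (k' g) x)"
    by (rule ext) (simp add: T_def)
  then show "K (\<lambda>z. c * \<tau> t f z + d * \<tau> t g z) (T t (\<lambda>x. c * k' f x + d * k' g x))"
    using K_lin[OF K_\<tau>[OF f] K_\<tau>[OF g]] by simp
qed

lemma \<tau>_isometric: "f \<in> Lp_fun p N \<Longrightarrow> Ip p N (\<tau> t f) = Ip p N f"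
  using K_in[OF K_\<tau>, of f t] K_in[OF K_k', of f] C\<Phi>_T[OF k'_in, of f t] by argo

lemma \<tau>_mult:
  assumes f: "f \<in> Lp_fun p N" shows "AE z in N. \<tau> (s + t) f z = \<tau> s (\<tau> t f) z"
proof -
  have "W.C\<Phi> (\<lambda>x. T t (k' f) x - k' (\<tau> t f) x) = 0"
    by (rule K_null[OF K_\<tau>[OF f] K_k'[OF \<tau>_in[OF f]]])
  then have "W.C\<Phi> (\<lambda>x. T s (T t (k' f)) x - T s (k' (\<tau> t f)) x) = 0"
    by (intro T_null k'_in \<tau>_in f T_in)
  then show ?thesis by (intro K_AE[OF K_\<tau>[OF f] K_\<tau>[OF \<tau>_in[OF f]]]) (simp only: T_add)
qed

lemma \<tau>_0:
  assumes f: "f \<in> Lp_fun p N" shows "AE z in N. \<tau> 0 f z = f z"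
proof (rule K_AE[OF K_\<tau>[OF f] K_k'[OF f]])
  show "W.C\<Phi> (\<lambda>x. T 0 (k' f) x - k' f x) = 0" by (simp add: T_0 CW.zero)
qed

lemma \<tau>_cont:
  assumes f: "f \<in> Lp_fun p N"
  shows "((\<lambda>s. Ip p N (\<lambda>z. \<tau> s f z - \<tau> t f z)) \<longlongrightarrow> 0) (nhds t)"
  unfolding K_diff[OF K_\<tau>[OF f] K_\<tau>[OF f]] by (rule T_cont[OF k'_in[OF f]])

text \<open>Both \<open>K\<close> and \<open>T\<close> respect the modulus. If \<open>f\<close>
  equals its modulus, then so does its partner up to a null function, and this survives translation
  and the way back.\<close>

lemma \<tau>_pos:
  assumes f: "f \<in> Lp_fun p N" and pos: "AE z in N. f z = of_real (cmod (f z))"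
  shows "AE z in N. \<tau> t f z = of_real (cmod (\<tau> t f z))"
proof -
  let ?h = "\<lambda>z. complex_of_real (cmod (f z))" and ?v = "\<lambda>x. complex_of_real (cmod (k' f x))"
  have K: "K ?h ?v" by (rule K_norm[OF K_k'[OF f]])
  have h: "?h \<in> Lp_fun p N" and v: "?v \<in> W.CV" using K_in[OF K] by auto
  have "AE z in N. f z - ?h z = 0" using pos by eventually_elim simp
  then have "Ip p N (\<lambda>z. f z - ?h z) = 0" using Ip_eq_0_iff[OF PN.diff_in[OF f h]] by blast
  then have "W.C\<Phi> (\<lambda>x. k' f x - ?v x) = 0" using K_diff[OF K_k'[OF f] K] by simp
  then have "W.C\<Phi> (\<lambda>x. T t (k' f) x - T t ?v x) = 0" by (rule T_null[OF k'_in[OF f] v])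
  moreover have "T t ?v = (\<lambda>x. complex_of_real (cmod (T t (k' f) x)))" by (rule ext) (simp add: T_def)
  ultimately show ?thesis using K_AE[OF K_\<tau>[OF f] K_norm[OF K_\<tau>[OF f]], of t t] by simp
qed

lemma Lp_operator_\<tau>: "Lp_operator p N N (\<tau> t) 1"
  by unfold_locales (use p \<tau>_in \<tau>_lin \<tau>_isometric in auto)

section \<open>The operators to and from the new \<open>L^p\<close> space\<close>

definition Jk :: "('a \<Rightarrow> complex) \<Rightarrow> 'z \<Rightarrow> complex" where "Jk f = k (J f)"
definition Qk :: "('z \<Rightarrow> complex) \<Rightarrow> 'a \<Rightarrow> complex" where "Qk f = Q (k' f)"

lemma K_Jk: "f \<in> Lp_fun p M \<Longrightarrow> K (Jk f) (J f)"
  unfolding Jk_def by (rule K_k[OF J_in])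

lemma Lp_operator_Jk: "Lp_operator p M N Jk C"
proof
  fix f assume f: "f \<in> Lp_fun p M"
  show "Jk f \<in> Lp_fun p N" using K_in[OF K_Jk[OF f]] by blast
  show "Ip p N (Jk f) \<le> C powr p * Ip p M f" using K_in[OF K_Jk[OF f]] J_bound[OF f] by simp
next
  fix f g c d assume f: "f \<in> Lp_fun p M" and g: "g \<in> Lp_fun p M"
  show "AE x in N. Jk (\<lambda>x. c * f x + d * g x) x = c * Jk f x + d * Jk g x"
    by (rule K_AE[OF K_Jk[OF P.lin_in[OF f g]] K_lin[OF K_Jk[OF f] K_Jk[OF g]] J_lin[OF f g]])
qed (fact p C)+

lemma Lp_operator_Qk: "Lp_operator p N M Qk C"
proof
  fix f assume f: "f \<in> Lp_fun p N"
  show "Qk f \<in> Lp_fun p M" unfolding Qk_def by (rule Q(1)[OF k'_in[OF f]])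
  show "Ip p M (Qk f) \<le> C powr p * Ip p N f"
    using Q(2)[OF k'_in[OF f]] K_in[OF K_k'[OF f]] by (simp add: Qk_def)
next
  fix f g c d assume f: "f \<in> Lp_fun p N" and g: "g \<in> Lp_fun p N"
  note fg = PN.lin_in[OF f g, of c d]
  have "AE x in M. Q (k' (\<lambda>x. c * f x + d * g x)) x = Q (\<lambda>x. c * k' f x + d * k' g x) x"
    by (rule Q_cong[OF k'_in[OF fg] CW.lin_in[OF k'_in[OF f] k'_in[OF g]]
          K_null[OF K_k'[OF fg] K_lin[OF K_k'[OF f] K_k'[OF g]]]])
  moreover have "AE x in M. Q (\<lambda>x. c * k' f x + d * k' g x) x = c * Q (k' f) x + d * Q (k' g) x"
    by (rule Q_lin[OF k'_in[OF f] k'_in[OF g]])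
  ultimately show "AE x in M. Qk (\<lambda>x. c * f x + d * g x) x = c * Qk f x + d * Qk g x"
    unfolding Qk_def by eventually_elim simp
qed (fact p C)+

text \<open>In short \<open>Q T J = Q J \<sigma> = \<sigma>\<close>. Each passage through
  \<open>K\<close> introduces a null function, which \<open>Q_cong\<close> absorbs.\<close>

lemma Qk_\<tau>_Jk:
  assumes f: "f \<in> Lp_fun p M" shows "AE x in M. Qk (\<tau> t (Jk f)) x = \<sigma> t f x"
proof -
  note j = Lp_operator.S_in[OF Lp_operator_Jk f]
  note V = k'_in[OF \<tau>_in[OF j]] T_in[OF k'_in[OF j]] T_in[OF J_in[OF f]] J_in[OF \<sigma>_in[OF f]]
  have "AE x in M. Q (k' (\<tau> t (Jk f))) x = Q (T t (k' (Jk f))) x"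
    by (rule Q_cong[OF V(1,2) K_null[OF K_k'[OF \<tau>_in[OF j]] K_\<tau>[OF j]]])
  moreover have "AE x in M. Q (T t (k' (Jk f))) x = Q (T t (J f)) x"
    by (rule Q_cong[OF V(2,3) T_null[OF k'_in[OF j] J_in[OF f] K_null[OF K_k'[OF j] K_Jk[OF f]]]])
  moreover have "AE x in M. Q (T t (J f)) x = Q (J (\<sigma> t f)) x"
    by (rule Q_cong[OF V(3,4) J_T[OF f]])
  moreover have "AE x in M. Q (J (\<sigma> t f)) x = \<sigma> t f x" by (rule Q_J[OF \<sigma>_in[OF f]])
  ultimately show ?thesis unfolding Qk_def by eventually_elim simp
qed

section \<open>Passage from functions to classes\<close>

lemma representation_\<tau>: "is_representation (Lp p N) (\<lambda>t. opf p N (\<tau> t))"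
  unfolding is_representation_def
proof (intro conjI allI ballI)
  show "bounded_op (Lp p N) (Lp p N) (opf p N (\<tau> t))" for t
    by (rule Lp_operator.bounded_opf[OF Lp_operator_\<tau>])
  fix F assume "F \<in> vecs (Lp p N)"
  then obtain f where f: "f \<in> Lp_fun p N" "F = cls p N f" by (auto simp: vecs_Lp)
  note op = Lp_operator.opf_cls[OF Lp_operator_\<tau>]
  show "opf p N (\<tau> 0) F = F" using f \<tau>_0[OF f(1)] by (simp add: op cls_eq_iff \<tau>_in)
  show "opf p N (\<tau> (s + t)) F = opf p N (\<tau> s) (opf p N (\<tau> t) F)" for s t
    using f \<tau>_mult[OF f(1), of s t] by (simp add: op cls_eq_iff \<tau>_in)
qed

lemma continuous_\<tau>: "continuous_rep (Lp p N) (\<lambda>t. opf p N (\<tau> t))"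
  unfolding continuous_rep_def
proof (intro ballI allI)
  fix F t assume "F \<in> vecs (Lp p N)"
  then obtain f where f: "f \<in> Lp_fun p N" "F = cls p N f" by (auto simp: vecs_Lp)
  note L = \<tau>_in[OF f(1)]
  have "nrm (Lp p N) (vdiff (Lp p N) (opf p N (\<tau> s) F) (opf p N (\<tau> t) F)) = PN.nm (\<lambda>z. \<tau> s f z - \<tau> t f z)" for s
    using f(1) by (simp add: f(2) Lp_operator.opf_cls[OF Lp_operator_\<tau>] vdiff_cls[OF p L L]
        nrm_cls[OF PN.diff_in[OF L L]] PN.nm_def)
  moreover have "((\<lambda>s. PN.nm (\<lambda>z. \<tau> s f z - \<tau> t f z)) \<longlongrightarrow> 0) (nhds t)"
    using PN.nm_tendsto_0_iff[of "\<lambda>s z. \<tau> s f z - \<tau> t f z" "nhds t"] PN.diff_in[OF L L] \<tau>_cont[OF f(1)] by simp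
  ultimately show "((\<lambda>s. nrm (Lp p N) (vdiff (Lp p N) (opf p N (\<tau> s) F) (opf p N (\<tau> t) F))) \<longlongrightarrow> 0) (at t)"
    by (simp add: tendsto_nhds_iff)
qed

lemma isometric_\<tau>: "isometric_rep (Lp p N) (\<lambda>t. opf p N (\<tau> t))"
  unfolding isometric_rep_def vecs_Lp
  by (auto simp: Lp_operator.opf_cls[OF Lp_operator_\<tau>] nrm_cls \<tau>_in \<tau>_isometric)

lemma positive_\<tau>: "positive_op p N N (opf p N (\<tau> t))"
  unfolding positive_op_def
proof (intro ballI impI)
  fix F assume F: "F \<in> vecs (Lp p N)" "Lp_nonneg N F"
  then obtain g where g: "g \<in> Lp_fun p N" "F = cls p N g" by (auto simp: vecs_Lp)
  obtain f where f: "f \<in> F" "AE x in N. f x \<in> \<real>\<^sub>\<ge>\<^sub>0" using F(2) by (auto simp: Lp_nonneg_def)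
  have fL: "f \<in> Lp_fun p N" and "AE x in N. g x = f x" using f(1) g by (simp_all add: mem_cls)
  then have Ff: "F = cls p N f" using g cls_eq_iff by blast
  have "AE x in N. f x = of_real (cmod (f x))"
    using f(2) by eventually_elim (auto elim!: nonneg_Reals_cases)
  then have "AE x in N. \<tau> t f x = of_real (cmod (\<tau> t f x))" by (rule \<tau>_pos[OF fL])
  then have "AE x in N. \<tau> t f x \<in> \<real>\<^sub>\<ge>\<^sub>0"
    by eventually_elim (metis norm_ge_zero nonneg_Reals_of_real_iff)
  moreover have "\<tau> t f \<in> opf p N (\<tau> t) F"
    using fL by (simp add: Ff Lp_operator.opf_cls[OF Lp_operator_\<tau>] mem_cls \<tau>_in)
  ultimately show "Lp_nonneg N (opf p N (\<tau> t) F)" unfolding Lp_nonneg_def by blast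
qed

lemma dilation_opf:
  assumes f: "f \<in> Lp_fun p M"
  shows "opf p M Qk (opf p N (\<tau> t) (opf p N Jk (cls p M f))) = cls p M (\<sigma> t f)"
proof -
  note j = Lp_operator.S_in[OF Lp_operator_Jk f]
  note q = Lp_operator.S_in[OF Lp_operator_Qk \<tau>_in[OF j]]
  show ?thesis
    unfolding Lp_operator.opf_cls[OF Lp_operator_Jk f] Lp_operator.opf_cls[OF Lp_operator_\<tau> j]
      Lp_operator.opf_cls[OF Lp_operator_Qk \<tau>_in[OF j]] cls_eq_iff[OF q \<sigma>_in[OF f]]
    by (rule Qk_\<tau>_Jk[OF f])
qed

lemma op_norms:
  "op_norm (Lp p M) (Lp p N) (opf p N Jk) * op_norm (Lp p N) (Lp p M) (opf p M Qk) \<le> C\<^sup>2"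
  unfolding power2_eq_square
  by (intro mult_mono Lp_operator.op_norm_opf[OF Lp_operator_Jk] Lp_operator.op_norm_opf[OF Lp_operator_Qk] C)

end

text \<open>The vector is normalized before the supremum is used; for a vector of norm 0 any bound
  \<open>B\<close> of the operator settles the claim.\<close>

lemma nrm_op_le:
  assumes p: "1 < p" and T: "bounded_op (Lp p M) (Lp p M) T" and f: "f \<in> Lp_fun p M"
  shows "nrm (Lp p M) (T (cls p M f)) \<le> op_norm (Lp p M) (Lp p M) T * nrm (Lp p M) (cls p M f)"
proof -
  interpret P: plattice p "Lp_fun p M" "Ip p M" by (rule plattice_Lp[OF p])
  have F: "cls p M f \<in> vecs (Lp p M)" using f by (simp add: vecs_Lp)
  have pos: "0 \<le> nrm (Lp p M) x" if "x \<in> vecs (Lp p M)" for x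
    using that by (auto simp: vecs_Lp nrm_cls)
  let ?r = "nrm (Lp p M) (cls p M f)"
  obtain B where B: "\<And>x. x \<in> vecs (Lp p M) \<Longrightarrow> nrm (Lp p M) (T x) \<le> B * nrm (Lp p M) x"
    and lin: "linear_op (Lp p M) (Lp p M) T" using T unfolding bounded_op_def by blast
  have TF: "T x \<in> vecs (Lp p M)" if "x \<in> vecs (Lp p M)" for x using lin that by (simp add: linear_op_def)
  have scale: "nrm (Lp p M) (vscale (Lp p M) (of_real c) x) = c * nrm (Lp p M) x"
    if x: "x \<in> vecs (Lp p M)" and c: "0 \<le> c" for c x
  proof -
    obtain h where h: "h \<in> Lp_fun p M" "x = cls p M h" using x by (auto simp: vecs_Lp)
    have "Ip p M (\<lambda>x. of_real c * h x) = c powr p * Ip p M h"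
      using P.scale[OF h(1), of "of_real c"] c by simp
    then show ?thesis
      using c p h P.nonneg[OF h(1)] by (simp add: vscale_cls nrm_cls P.scale_in powr_mult powr_powr)
  qed
  show ?thesis
  proof (cases "?r = 0")
    case True then show ?thesis using B[OF F] by simp
  next
    case False
    then have r: "0 < ?r" using pos[OF F] by simp
    let ?G = "vscale (Lp p M) (of_real (1 / ?r)) (cls p M f)"
    have G: "?G \<in> vecs (Lp p M)" unfolding vscale_cls[OF p f] vecs_Lp by (intro imageI P.scale_in f)
    have "nrm (Lp p M) (T ?G) \<le> op_norm (Lp p M) (Lp p M) T"
      by (rule op_norm_ge[OF T G]) (use pos scale[OF F, of "1 / ?r"] r in auto)
    moreover have "T ?G = vscale (Lp p M) (of_real (1 / ?r)) (T (cls p M f))"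
      using lin F by (simp add: linear_op_def)
    ultimately have "1 / ?r * nrm (Lp p M) (T (cls p M f)) \<le> op_norm (Lp p M) (Lp p M) T"
      using scale[OF TF[OF F], of "1 / ?r"] r by simp
    then show ?thesis using r by (simp add: field_simps)
  qed
qed

text \<open>A mean on \<open>Linf_fun\<close> restricts to the everywhere bounded Borel functions,
  and an inequality that holds everywhere holds locally almost everywhere.\<close>

lemma mean_amenable:
  assumes "amenable TYPE('g::{topological_group_add, t2_space})"
  obtains m :: "('g::{topological_group_add, t2_space} \<Rightarrow> real) \<Rightarrow> real" where "mean m"
proof -
  obtain \<mu> :: "'g measure" and m where m: "left_invariant_mean \<mu> m"
    using assms unfolding amenable_def by blast
  have bb: "f \<in> Linf_fun \<mu>" if "f \<in> bounded_borel" for f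
    using that by (auto simp: bounded_borel_def Linf_fun_def locally_AE_def)
  have "mean m"
    using m unfolding left_invariant_mean_def by unfold_locales (auto simp: bb locally_AE_def)
  then show ?thesis by (rule that)
qed

theorem corollary6p3:
  fixes p :: real
    and M :: "'a measure"
    and \<pi> :: "'g::{topological_group_add, t2_space} \<Rightarrow> ('a \<Rightarrow> complex) set \<Rightarrow> ('a \<Rightarrow> complex) set"
  assumes "1 < p"
    and "locally_compact_space (euclidean :: 'g topology)"
    and "amenable TYPE('g)"
    and "is_representation (Lp p M) \<pi>"
    and "continuous_rep (Lp p M) \<pi>"
    and "bounded_rep (Lp p M) \<pi>"
  shows "\<exists>(N :: ('g, 'a) dilation_point measure) \<pi>' J Q.
    is_representation (Lp p N) \<pi>' \<and>
    continuous_rep (Lp p N) \<pi>' \<and>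
    isometric_rep (Lp p N) \<pi>' \<and>
    (\<forall>t. positive_op p N N (\<pi>' t)) \<and>
    bounded_op (Lp p M) (Lp p N) J \<and>
    bounded_op (Lp p N) (Lp p M) Q \<and>
    op_norm (Lp p M) (Lp p N) J * op_norm (Lp p N) (Lp p M) Q \<le> (rep_norm (Lp p M) \<pi>)\<^sup>2 \<and>
    (\<forall>t. \<forall>F\<in>vecs (Lp p M). \<pi> t F = Q (\<pi>' t (J F)))"
proof -
  note p = assms(1)
  interpret P: plattice p "Lp_fun p M" "Ip p M" by (rule plattice_Lp[OF p])
  define C where "C = rep_norm (Lp p M) \<pi>"
  \<comment> \<open>The action on functions: a chosen representative of the image class. Each law of
    \<pi> becomes an identity almost everywhere through \<open>cls_eq_iff\<close>.\<close>
  define \<sigma> where "\<sigma> t f = rp (\<pi> t (cls p M f))" for t f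
  have bop: "bounded_op (Lp p M) (Lp p M) (\<pi> t)" for t
    using assms(4) by (simp add: is_representation_def)
  then have lin: "linear_op (Lp p M) (Lp p M) (\<pi> t)" for t by (simp add: bounded_op_def)
  have V: "cls p M f \<in> vecs (Lp p M)" if "f \<in> Lp_fun p M" for f using that by (simp add: vecs_Lp)
  have pV: "\<pi> t (cls p M f) \<in> vecs (Lp p M)" if "f \<in> Lp_fun p M" for t f
    using lin V[OF that] by (simp add: linear_op_def)
  have in1: "\<sigma> t f \<in> Lp_fun p M" and c1: "cls p M (\<sigma> t f) = \<pi> t (cls p M f)" if "f \<in> Lp_fun p M" for t f
    unfolding \<sigma>_def using rp_vecs[OF pV[OF that]] by auto
  have le: "op_norm (Lp p M) (Lp p M) (\<pi> t) \<le> C" for t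
    unfolding C_def rep_norm_def using assms(6) by (intro cSUP_upper) (auto simp: bounded_rep_def)
  have nle: "nrm (Lp p M) (\<pi> t (cls p M f)) \<le> C * nrm (Lp p M) (cls p M f)" if f: "f \<in> Lp_fun p M" for t f
    by (rule order_trans[OF nrm_op_le[OF p bop f] mult_right_mono[OF le]]) (simp add: nrm_cls f)
  have C: "0 \<le> C"
  proof -
    have z: "(\<lambda>_. 0) \<in> Lp_fun p M" by (rule P.zero_in)
    have "nrm (Lp p M) (\<pi> 0 (cls p M (\<lambda>_. 0))) \<le> op_norm (Lp p M) (Lp p M) (\<pi> 0)"
      by (rule op_norm_ge[OF bop V[OF z]]) (use z p in \<open>auto simp: nrm_cls vecs_Lp P.zero\<close>)
    then show ?thesis using le[of 0] z by (simp add: nrm_cls c1[symmetric] in1 order_trans[rotated])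
  qed
  obtain m :: "('g \<Rightarrow> real) \<Rightarrow> real" where m: "mean m" by (rule mean_amenable[OF assms(3)])
  interpret mean m by (rule m)
  interpret R: mean_rep m p M \<sigma> C
  proof
    show "1 < p" "0 \<le> C" by (fact p C)+
    fix f t assume f: "f \<in> Lp_fun p M"
    show "\<sigma> t f \<in> Lp_fun p M" by (rule in1[OF f])
    show "AE x in M. \<sigma> t (\<lambda>x. c * f x) x = c * \<sigma> t f x" for c
    proof -
      have "cls p M (\<sigma> t (\<lambda>x. c * f x)) = cls p M (\<lambda>x. c * \<sigma> t f x)"
        using lin V[OF f] by (simp add: c1 f P.scale_in linear_op_def vscale_cls[OF p, symmetric] in1)
      then show ?thesis using f by (simp add: cls_eq_iff in1 P.scale_in)
    qed
    show "AE x in M. \<sigma> (s + t) f x = \<sigma> s (\<sigma> t f) x" for s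
    proof -
      have "cls p M (\<sigma> (s + t) f) = cls p M (\<sigma> s (\<sigma> t f))"
        using assms(4) V[OF f] by (simp add: c1 f in1 is_representation_def)
      then show ?thesis using f by (simp add: cls_eq_iff in1)
    qed
    show "AE x in M. \<sigma> 0 f x = f x"
    proof -
      have "cls p M (\<sigma> 0 f) = cls p M f" using assms(4) V[OF f] by (simp add: c1 f is_representation_def)
      then show ?thesis using f by (simp add: cls_eq_iff in1)
    qed
    show "Ip p M (\<sigma> t f) \<le> C powr p * Ip p M f"
    proof -
      have "Ip p M (\<sigma> t f) powr (1 / p) \<le> C * Ip p M f powr (1 / p)"
        using nle[OF f, of t] by (simp add: c1[OF f, symmetric] nrm_cls in1 f)
      then have "(Ip p M (\<sigma> t f) powr (1 / p)) powr p \<le> (C * Ip p M f powr (1 / p)) powr p"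
        using p by (intro powr_mono2) auto
      then show ?thesis using p C P.nonneg[OF f] P.nonneg[OF in1[OF f]] by (simp add: powr_mult powr_powr)
    qed
    show "((\<lambda>s. Ip p M (\<lambda>x. \<sigma> s f x - \<sigma> t f x)) \<longlongrightarrow> 0) (nhds t)"
    proof -
      have "nrm (Lp p M) (vdiff (Lp p M) (\<pi> s (cls p M f)) (\<pi> t (cls p M f))) = P.nm (\<lambda>x. \<sigma> s f x - \<sigma> t f x)" for s
        using in1[OF f] by (simp add: c1[OF f, symmetric] vdiff_cls[OF p] nrm_cls P.diff_in P.nm_def)
      moreover have "((\<lambda>s. nrm (Lp p M) (vdiff (Lp p M) (\<pi> s (cls p M f)) (\<pi> t (cls p M f)))) \<longlongrightarrow> 0) (at t)"
        using assms(5) V[OF f] by (simp add: continuous_rep_def)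
      ultimately have "((\<lambda>s. Ip p M (\<lambda>x. \<sigma> s f x - \<sigma> t f x)) \<longlongrightarrow> 0) (at t)"
        using P.nm_tendsto_0_iff[of "\<lambda>s x. \<sigma> s f x - \<sigma> t f x" "at t"] P.diff_in[OF in1[OF f] in1[OF f]] by simp
      \<comment> \<open>At \<open>s = t\<close> the expression is 0, so the limit over the punctured
        neighbourhood is also the limit over the full one.\<close>
      then show ?thesis by (simp add: tendsto_nhds_iff P.zero)
    qed
    fix g assume g: "g \<in> Lp_fun p M"
    show "AE x in M. \<sigma> t (\<lambda>x. f x + g x) x = \<sigma> t f x + \<sigma> t g x"
    proof -
      have "cls p M (\<sigma> t (\<lambda>x. f x + g x)) = cls p M (\<lambda>x. \<sigma> t f x + \<sigma> t g x)"
        using lin V[OF f] V[OF g] by (simp add: c1 f g P.add_in linear_op_def vadd_cls[OF p, symmetric] in1)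
      then show ?thesis using f g by (simp add: cls_eq_iff in1 P.add_in)
    qed
  qed
  obtain enc :: "((('g \<times> 'a) \<times> nat) \<Rightarrow> real) \<Rightarrow> (('g \<times> 'a) \<times> nat) set set \<Rightarrow> ('g, 'a) dilation_point"
    where enc: "\<forall>e e' P P'. enc e P = enc e' P' \<longrightarrow> e = e' \<and> P = P'"
    by (rule exE[OF encoding_exists])
  note rep = Kakutani_representation[where enc = enc, OF R.W.clattice_CV]
  obtain N :: "('g, 'a) dilation_point measure" and K where K:
    "(\<forall>f u. K f u \<longrightarrow> f \<in> Lp_fun p N \<and> u \<in> R.W.CV \<and> Ip p N f = R.W.C\<Phi> u) \<and>
    (\<forall>f\<in>Lp_fun p N. \<exists>u. K f u) \<and> (\<forall>u\<in>R.W.CV. \<exists>f. K f u) \<and>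
    (\<forall>f h u v c d. K f u \<longrightarrow> K h v \<longrightarrow> K (\<lambda>z. c * f z + d * h z) (\<lambda>x. c * u x + d * v x)) \<and>
    (\<forall>f u. K f u \<longrightarrow> K (\<lambda>z. complex_of_real (cmod (f z))) (\<lambda>x. complex_of_real (cmod (u x))))"
    by (rule exE[OF rep], rule enc[rule_format], assumption, erule exE, rule that)
  interpret D: dilation m p M \<sigma> C N K
    by unfold_locales (simp_all only: K)
  show ?thesis
  proof (intro exI conjI allI ballI)
    show "is_representation (Lp p N) (\<lambda>t. opf p N (D.\<tau> t))" by (rule D.representation_\<tau>)
    show "continuous_rep (Lp p N) (\<lambda>t. opf p N (D.\<tau> t))" by (rule D.continuous_\<tau>)
    show "isometric_rep (Lp p N) (\<lambda>t. opf p N (D.\<tau> t))" by (rule D.isometric_\<tau>)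
    show "positive_op p N N (opf p N (D.\<tau> t))" for t by (rule D.positive_\<tau>)
    show "bounded_op (Lp p M) (Lp p N) (opf p N D.Jk)" by (rule Lp_operator.bounded_opf[OF D.Lp_operator_Jk])
    show "bounded_op (Lp p N) (Lp p M) (opf p M D.Qk)" by (rule Lp_operator.bounded_opf[OF D.Lp_operator_Qk])
    show "op_norm (Lp p M) (Lp p N) (opf p N D.Jk) * op_norm (Lp p N) (Lp p M) (opf p M D.Qk) \<le> (rep_norm (Lp p M) \<pi>)\<^sup>2"
      using D.op_norms by (simp add: C_def)
    fix t F assume F: "F \<in> vecs (Lp p M)"
    then obtain f where f: "f \<in> Lp_fun p M" "F = cls p M f" by (auto simp: vecs_Lp)
    then show "\<pi> t F = opf p M D.Qk (opf p N (D.\<tau> t) (opf p N D.Jk F))"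
      using D.dilation_opf[OF f(1), of t] c1[OF f(1)] by simp
  qed
qed

end
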